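(* For every $i\ge1$: (1) if $\mathsf{TF}\Sigma^p_i\subseteq\mathsf{FP}^{\mathsf{TF}\Sigma^p_{i-1}}$, then $\mathsf{T}^i_{\mathsf{PV}}\equiv\mathsf{T}^{i+1}_{\mathsf{PV}}$; (2) if $\mathsf{T}^i_{\mathsf{PV}}\equiv\mathsf{T}^{i+1}_{\mathsf{PV}}$, then $\mathsf{TF}\Sigma^p_i\subseteq\mathsf{FP}^{\Sigma^p_{i-1}}$. In particular, $\mathsf{TFNP}=\mathsf{FP}$ if and only if $\mathsf{T}^1_{\mathsf{PV}}\equiv\mathsf{T}^2_{\mathsf{PV}}$.
   Context: $\mathcal{L}_{\mathsf{PV}}$ has constants $0,1$, equality, and a function symbol for each polynomial-time computable $f:\mathbb{N}^k\to\mathbb{N}$. $\Sigma^b_j$ are the strict classes of bounded formulas with $j$ alternating blocks of bounded quantifiers (quantifier-free at level $0$; closure under $\wedge,\vee$, bounded $\exists$ for $\Sigma^b_j$, bounded $\forall$ for $\Pi^b_j$, negation exchanging them). $\mathsf{T}^i_{\mathsf{PV}}$ is the theory of all $\forall\Sigma^b_{i-1}$-sentences true in $\mathbb{N}$; $\mathcal{T}\equiv\mathcal{T}'$ means the two theories prove the same sentences. For $i\ge1$, a relation $R\subseteq\{0,1\}^*\times\{0,1\}^*$ is in $\mathsf{TF}\Sigma^p_i$ if there is a polynomial $p$ such that every $x$ has some $y$ of length $\le p(|x|)$ with $R(x,y)$, and $R\in\Pi^p_{i-1}$ (defined by $\forall z_1\exists z_2\cdots$ with $i-1$ alternating polynomially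 bounded quantifiers over a polynomial-time predicate); $\mathsf{TF}\Sigma^p_1=\mathsf{TFNP}$, and $\mathsf{TF}\Sigma^p_0$ is identified with $\mathsf{FP}$. Such a class is viewed as a class of search problems (given $x$, find $y$ with $R(x,y)$); an inclusion $\mathsf{TF}\Sigma^p_i\subseteq\mathcal{C}$ means that the search problem of every $R\in\mathsf{TF}\Sigma^p_i$ is solvable in $\mathcal{C}$. $\mathsf{FP}^{\Sigma^p_{i-1}}$ is polynomial time with a $\Sigma^p_{i-1}$ oracle, and $\mathsf{FP}^{\mathsf{TF}\Sigma^p_{i-1}}$ is polynomial time with oracle access to (solutions of) search problems in $\mathsf{TF}\Sigma^p_{i-1}$. *)

theory Defs
  imports Main "HOL-Computational_Algebra.Polynomial"
begin

section \<open>Polynomial time\<close>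

text \<open>
  Machines are structured programs over finitely many stacks of bits (registers), with unit cost
  per elementary step. Two stacks are one Turing tape, so these programs and multitape Turing
  machines simulate each other with constant-factor overhead; polynomial time is unaffected, and
  programs compose. In \<open>Case r c\<^sub>0 c\<^sub>1 c\<^sub>2\<close> the branches are for an empty register, top bit \<open>True\<close>,
  and top bit \<open>False\<close>; \<open>Loop r c\<close> repeats \<open>c\<close> while register \<open>r\<close> is nonempty; \<open>Query r\<close> replaces
  the content of \<open>r\<close> by the oracle's answer to it, at a cost covering both strings.
\<close>

datatype prog =
    Skip
  | Push bool nat
  | Pop nat
  | Seq prog prog
  | Case nat prog prog prog
  | Loop nat prog
  | Query nat

type_synonym store = "nat \<Rightarrow> bool list"

text \<open>\<open>exec g c s t s'\<close>: with oracle \<open>g\<close>, program \<open>c\<close> started in \<open>s\<close> halts in \<open>s'\<close> after \<open>t\<close> steps.\<close>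

inductive exec ::
  "(bool list \<Rightarrow> bool list) \<Rightarrow> prog \<Rightarrow> store \<Rightarrow> nat \<Rightarrow> store \<Rightarrow> bool"
  for g :: "bool list \<Rightarrow> bool list"
where
  Skip: "exec g Skip s 1 s"
| Push: "exec g (Push b r) s 1 (s(r := b # s r))"
| Pop: "exec g (Pop r) s 1 (s(r := tl (s r)))"
| Seq: "\<lbrakk>exec g c s t s'; exec g d s' u s''\<rbrakk> \<Longrightarrow> exec g (Seq c d) s (t + u) s''"
| Case_empty: "\<lbrakk>s r = []; exec g c0 s t s'\<rbrakk> \<Longrightarrow> exec g (Case r c0 c1 c2) s (Suc t) s'"
| Case_True: "\<lbrakk>s r = True # w; exec g c1 s t s'\<rbrakk> \<Longrightarrow> exec g (Case r c0 c1 c2) s (Suc t) s'"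
| Case_False: "\<lbrakk>s r = False # w; exec g c2 s t s'\<rbrakk> \<Longrightarrow> exec g (Case r c0 c1 c2) s (Suc t) s'"
| Loop_stop: "s r = [] \<Longrightarrow> exec g (Loop r c) s 1 s"
| Loop_step: "\<lbrakk>s r \<noteq> []; exec g c s t s'; exec g (Loop r c) s' u s''\<rbrakk>
    \<Longrightarrow> exec g (Loop r c) s (Suc (t + u)) s''"
| Query: "exec g (Query r) s (Suc (length (s r) + length (g (s r)))) (s(r := g (s r)))"

primrec query_free :: "prog \<Rightarrow> bool" where
  "query_free Skip = True"
| "query_free (Push b r) = True"
| "query_free (Pop r) = True"
| "query_free (Seq c d) = (query_free c \<and> query_free d)"
| "query_free (Case r c0 c1 c2) = (query_free c0 \<and> query_free c1 \<and> query_free c2)"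
| "query_free (Loop r c) = query_free c"
| "query_free (Query r) = False"

definition load :: "bool list list \<Rightarrow> store" where
  "load xs r = (if r < length xs then xs ! r else [])"

definition runs ::
  "(bool list \<Rightarrow> bool list) \<Rightarrow> prog \<Rightarrow> nat poly \<Rightarrow> bool list list \<Rightarrow> bool list \<Rightarrow> bool"
where
  "runs g c p xs y \<longleftrightarrow>
    (\<exists>t s. exec g c (load xs) t s \<and> t \<le> poly p (sum_list (map length xs)) \<and> s 0 = y)"

text \<open>In the next definition the oracle is irrelevant, as no query is made.\<close>

definition polytime :: "nat \<Rightarrow> (bool list list \<Rightarrow> bool list) \<Rightarrow> bool" where
  "polytime k f \<longleftrightarrow>
    (\<exists>c p. query_free c \<and> (\<forall>xs. length xs = k \<longrightarrow> runs (\<lambda>_. []) c p xs (f xs)))"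

definition polytime_pred :: "nat \<Rightarrow> (bool list list \<Rightarrow> bool) \<Rightarrow> bool" where
  "polytime_pred k P \<longleftrightarrow> polytime k (\<lambda>xs. [P xs])"

definition FP :: "(bool list \<Rightarrow> bool list) set" where
  "FP = {f. polytime 1 (\<lambda>xs. f (xs ! 0))}"

definition FP_rel :: "(bool list \<Rightarrow> bool list) \<Rightarrow> (bool list \<Rightarrow> bool list) set" where
  "FP_rel g = {f. \<exists>c p. \<forall>x. runs g c p [x] (f x)}"


section \<open>The polynomial hierarchy and search problems\<close>

text \<open>Blocks \<open>\<exists>z\<^sub>1 \<forall>z\<^sub>2 \<dots>\<close> and \<open>\<forall>z\<^sub>1 \<exists>z\<^sub>2 \<dots>\<close> of \<open>j\<close> alternating quantifiers over strings of
  length at most \<open>m\<close>, applied to a predicate of the parameters followed by \<open>z\<^sub>1, z\<^sub>2, \<dots>\<close>.\<close>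

fun ex_alt :: "nat \<Rightarrow> nat \<Rightarrow> (bool list list \<Rightarrow> bool) \<Rightarrow> bool list list \<Rightarrow> bool"
and all_alt :: "nat \<Rightarrow> nat \<Rightarrow> (bool list list \<Rightarrow> bool) \<Rightarrow> bool list list \<Rightarrow> bool"
where
  "ex_alt m 0 P xs = P xs"
| "ex_alt m (Suc j) P xs = (\<exists>z. length z \<le> m \<and> all_alt m j P (xs @ [z]))"
| "all_alt m 0 P xs = P xs"
| "all_alt m (Suc j) P xs = (\<forall>z. length z \<le> m \<longrightarrow> ex_alt m j P (xs @ [z]))"

definition SigmaP :: "nat \<Rightarrow> bool list set set" where
  "SigmaP j = {A. \<exists>P q. polytime_pred (j + 1) P \<and>
    (\<forall>x. x \<in> A \<longleftrightarrow> ex_alt (poly q (length x)) j P [x])}"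

type_synonym search_problem = "bool list \<Rightarrow> bool list \<Rightarrow> bool"

definition PiP :: "nat \<Rightarrow> search_problem set" where
  "PiP j = {R. \<exists>P q. polytime_pred (j + 2) P \<and>
    (\<forall>x y. R x y \<longleftrightarrow> all_alt (poly q (length x + length y)) j P [x, y])}"

definition total_within :: "nat poly \<Rightarrow> search_problem \<Rightarrow> bool" where
  "total_within p R \<longleftrightarrow> (\<forall>x. \<exists>y. length y \<le> poly p (length x) \<and> R x y)"

definition graph_of :: "(bool list \<Rightarrow> bool list) \<Rightarrow> search_problem" where
  "graph_of f = (\<lambda>x y. y = f x)"

fun TFSigma :: "nat \<Rightarrow> search_problem set" where
  "TFSigma 0 = graph_of ` FP"
| "TFSigma (Suc j) = {R. R \<in> PiP j \<and> (\<exists>p. total_within p R)}"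

abbreviation TFNP :: "search_problem set" where
  "TFNP \<equiv> TFSigma 1"

text \<open>A class of search problems used as an upper bound is represented by the set of all search
  problems solvable in it.\<close>

definition solvable :: "(bool list \<Rightarrow> bool list) set \<Rightarrow> search_problem set" where
  "solvable F = {R. \<exists>f\<in>F. \<forall>x. R x (f x)}"

definition FP_SigmaP :: "nat \<Rightarrow> search_problem set" where
  "FP_SigmaP j = (\<Union>A\<in>SigmaP j. solvable (FP_rel (\<lambda>q. [q \<in> A])))"

text \<open>An oracle for a search problem \<open>Q\<close> answers each query by some solution within a polynomial
  length bound \<open>b\<close> for which \<open>Q\<close> is total. One machine with one time bound has to succeed for
  every such choice of answers; its output may depend on that choice.\<close>

definition FP_TFSigma :: "nat \<Rightarrow> search_problem set" where
  "FP_TFSigma j = {R. \<exists>Q\<in>TFSigma j. \<exists>b. total_within b Q \<and> (\<exists>c p.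
    \<forall>g. (\<forall>q. length (g q) \<le> poly b (length q) \<and> Q q (g q)) \<longrightarrow>
      (\<forall>x. \<exists>y. runs g c p [x] y \<and> R x y))}"


section \<open>The language of PV\<close>

text \<open>Binary notation, least significant bit first, without superfluous zeros.\<close>

fun bin :: "nat \<Rightarrow> bool list" where
  "bin n = (if n = 0 then [] else odd n # bin (n div 2))"

declare bin.simps [simp del]

text \<open>A function \<open>\<nat>\<^sup>k \<rightarrow> \<nat>\<close> is a function on lists that is \<open>0\<close> outside lists of length \<open>k\<close>, so
  that each such function is represented by exactly one function symbol.\<close>

definition PV_fun :: "nat \<Rightarrow> (nat list \<Rightarrow> nat) \<Rightarrow> bool" where
  "PV_fun k f \<longleftrightarrow> (\<forall>ns. length ns \<noteq> k \<longrightarrow> f ns = 0) \<and>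
    (\<exists>c p. query_free c \<and>
      (\<forall>ns. length ns = k \<longrightarrow> runs (\<lambda>_. []) c p (map bin ns) (bin (f ns))))"

text \<open>De Bruijn indices throughout.\<close>

datatype tm =
    Var nat
  | Zero
  | One
  | App nat "nat list \<Rightarrow> nat" "tm list"

datatype fm =
    Eq tm tm
  | Neg fm
  | Conj fm fm
  | Disj fm fm
  | Exists fm
  | Forall fm

fun wf_tm :: "tm \<Rightarrow> bool" where
  "wf_tm (Var n) = True"
| "wf_tm Zero = True"
| "wf_tm One = True"
| "wf_tm (App k f ts) = (PV_fun k f \<and> length ts = k \<and> (\<forall>t\<in>set ts. wf_tm t))"

primrec wf_fm :: "fm \<Rightarrow> bool" where
  "wf_fm (Eq t u) = (wf_tm t \<and> wf_tm u)"
| "wf_fm (Neg \<phi>) = wf_fm \<phi>"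
| "wf_fm (Conj \<phi> \<psi>) = (wf_fm \<phi> \<and> wf_fm \<psi>)"
| "wf_fm (Disj \<phi> \<psi>) = (wf_fm \<phi> \<and> wf_fm \<psi>)"
| "wf_fm (Exists \<phi>) = wf_fm \<phi>"
| "wf_fm (Forall \<phi>) = wf_fm \<phi>"

fun fv_tm :: "tm \<Rightarrow> nat set" where
  "fv_tm (Var n) = {n}"
| "fv_tm Zero = {}"
| "fv_tm One = {}"
| "fv_tm (App k f ts) = (\<Union>t\<in>set ts. fv_tm t)"

primrec fv_fm :: "fm \<Rightarrow> nat set" where
  "fv_fm (Eq t u) = fv_tm t \<union> fv_tm u"
| "fv_fm (Neg \<phi>) = fv_fm \<phi>"
| "fv_fm (Conj \<phi> \<psi>) = fv_fm \<phi> \<union> fv_fm \<psi>"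
| "fv_fm (Disj \<phi> \<psi>) = fv_fm \<phi> \<union> fv_fm \<psi>"
| "fv_fm (Exists \<phi>) = {n. Suc n \<in> fv_fm \<phi>}"
| "fv_fm (Forall \<phi>) = {n. Suc n \<in> fv_fm \<phi>}"

definition sentence :: "fm \<Rightarrow> bool" where
  "sentence \<phi> \<longleftrightarrow> wf_fm \<phi> \<and> fv_fm \<phi> = {}"

fun eval_tm :: "(nat \<Rightarrow> nat) \<Rightarrow> tm \<Rightarrow> nat" where
  "eval_tm e (Var n) = e n"
| "eval_tm e Zero = 0"
| "eval_tm e One = 1"
| "eval_tm e (App k f ts) = f (map (eval_tm e) ts)"

primrec sat :: "(nat \<Rightarrow> nat) \<Rightarrow> fm \<Rightarrow> bool" where
  "sat e (Eq t u) \<longleftrightarrow> eval_tm e t = eval_tm e u"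
| "sat e (Neg \<phi>) \<longleftrightarrow> \<not> sat e \<phi>"
| "sat e (Conj \<phi> \<psi>) \<longleftrightarrow> sat e \<phi> \<and> sat e \<psi>"
| "sat e (Disj \<phi> \<psi>) \<longleftrightarrow> sat e \<phi> \<or> sat e \<psi>"
| "sat e (Exists \<phi>) \<longleftrightarrow> (\<exists>n. sat (case_nat n e) \<phi>)"
| "sat e (Forall \<phi>) \<longleftrightarrow> (\<forall>n. sat (case_nat n e) \<phi>)"

definition true_in_N :: "fm \<Rightarrow> bool" where
  "true_in_N \<phi> \<longleftrightarrow> (\<forall>e. sat e \<phi>)"


section \<open>Provability\<close>

fun subst_tm :: "(nat \<Rightarrow> tm) \<Rightarrow> tm \<Rightarrow> tm" where
  "subst_tm \<sigma> (Var n) = \<sigma> n"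
| "subst_tm \<sigma> Zero = Zero"
| "subst_tm \<sigma> One = One"
| "subst_tm \<sigma> (App k f ts) = App k f (map (subst_tm \<sigma>) ts)"

abbreviation lift_tm :: "tm \<Rightarrow> tm" where
  "lift_tm \<equiv> subst_tm (\<lambda>n. Var (Suc n))"

definition lift_subst :: "(nat \<Rightarrow> tm) \<Rightarrow> nat \<Rightarrow> tm" where
  "lift_subst \<sigma> = case_nat (Var 0) (\<lambda>n. lift_tm (\<sigma> n))"

primrec subst_fm :: "(nat \<Rightarrow> tm) \<Rightarrow> fm \<Rightarrow> fm" where
  "subst_fm \<sigma> (Eq t u) = Eq (subst_tm \<sigma> t) (subst_tm \<sigma> u)"
| "subst_fm \<sigma> (Neg \<phi>) = Neg (subst_fm \<sigma> \<phi>)"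
| "subst_fm \<sigma> (Conj \<phi> \<psi>) = Conj (subst_fm \<sigma> \<phi>) (subst_fm \<sigma> \<psi>)"
| "subst_fm \<sigma> (Disj \<phi> \<psi>) = Disj (subst_fm \<sigma> \<phi>) (subst_fm \<sigma> \<psi>)"
| "subst_fm \<sigma> (Exists \<phi>) = Exists (subst_fm (lift_subst \<sigma>) \<phi>)"
| "subst_fm \<sigma> (Forall \<phi>) = Forall (subst_fm (lift_subst \<sigma>) \<phi>)"

abbreviation lift_fm :: "fm \<Rightarrow> fm" where
  "lift_fm \<equiv> subst_fm (\<lambda>n. Var (Suc n))"

abbreviation inst :: "fm \<Rightarrow> tm \<Rightarrow> fm" where
  "inst \<phi> t \<equiv> subst_fm (case_nat t Var) \<phi>"

text \<open>Natural deduction for classical first-order logic with equality. The well-formedness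
  premises confine derivations from well-formed hypotheses to formulas of the language.\<close>

inductive proves :: "fm set \<Rightarrow> fm \<Rightarrow> bool" (infix \<open>\<turnstile>\<close> 50) where
  Hyp: "\<lbrakk>\<phi> \<in> \<Gamma>; wf_fm \<phi>\<rbrakk> \<Longrightarrow> \<Gamma> \<turnstile> \<phi>"
| NegI: "\<lbrakk>wf_fm \<phi>; insert \<phi> \<Gamma> \<turnstile> \<psi>; insert \<phi> \<Gamma> \<turnstile> Neg \<psi>\<rbrakk> \<Longrightarrow> \<Gamma> \<turnstile> Neg \<phi>"
| RAA: "\<lbrakk>wf_fm \<phi>; insert (Neg \<phi>) \<Gamma> \<turnstile> \<psi>; insert (Neg \<phi>) \<Gamma> \<turnstile> Neg \<psi>\<rbrakk> \<Longrightarrow> \<Gamma> \<turnstile> \<phi>"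
| ConjI: "\<lbrakk>\<Gamma> \<turnstile> \<phi>; \<Gamma> \<turnstile> \<psi>\<rbrakk> \<Longrightarrow> \<Gamma> \<turnstile> Conj \<phi> \<psi>"
| ConjE1: "\<Gamma> \<turnstile> Conj \<phi> \<psi> \<Longrightarrow> \<Gamma> \<turnstile> \<phi>"
| ConjE2: "\<Gamma> \<turnstile> Conj \<phi> \<psi> \<Longrightarrow> \<Gamma> \<turnstile> \<psi>"
| DisjI1: "\<lbrakk>\<Gamma> \<turnstile> \<phi>; wf_fm \<psi>\<rbrakk> \<Longrightarrow> \<Gamma> \<turnstile> Disj \<phi> \<psi>"
| DisjI2: "\<lbrakk>\<Gamma> \<turnstile> \<psi>; wf_fm \<phi>\<rbrakk> \<Longrightarrow> \<Gamma> \<turnstile> Disj \<phi> \<psi>"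
| DisjE: "\<lbrakk>\<Gamma> \<turnstile> Disj \<phi> \<psi>; insert \<phi> \<Gamma> \<turnstile> \<chi>; insert \<psi> \<Gamma> \<turnstile> \<chi>\<rbrakk> \<Longrightarrow> \<Gamma> \<turnstile> \<chi>"
| ExistsI: "\<lbrakk>wf_tm t; wf_fm \<phi>; \<Gamma> \<turnstile> inst \<phi> t\<rbrakk> \<Longrightarrow> \<Gamma> \<turnstile> Exists \<phi>"
| ExistsE: "\<lbrakk>\<Gamma> \<turnstile> Exists \<phi>; insert \<phi> (lift_fm ` \<Gamma>) \<turnstile> lift_fm \<psi>\<rbrakk> \<Longrightarrow> \<Gamma> \<turnstile> \<psi>"
| ForallI: "lift_fm ` \<Gamma> \<turnstile> \<phi> \<Longrightarrow> \<Gamma> \<turnstile> Forall \<phi>"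
| ForallE: "\<lbrakk>\<Gamma> \<turnstile> Forall \<phi>; wf_tm t\<rbrakk> \<Longrightarrow> \<Gamma> \<turnstile> inst \<phi> t"
| EqI: "wf_tm t \<Longrightarrow> \<Gamma> \<turnstile> Eq t t"
| EqE: "\<lbrakk>\<Gamma> \<turnstile> Eq t u; wf_fm \<phi>; \<Gamma> \<turnstile> inst \<phi> t\<rbrakk> \<Longrightarrow> \<Gamma> \<turnstile> inst \<phi> u"

definition equiv_theories :: "fm set \<Rightarrow> fm set \<Rightarrow> bool" (infix \<open>\<equiv>\<^sub>T\<close> 50) where
  "T \<equiv>\<^sub>T T' \<longleftrightarrow> (\<forall>\<phi>. sentence \<phi> \<longrightarrow> (T \<turnstile> \<phi> \<longleftrightarrow> T' \<turnstile> \<phi>))"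


section \<open>Bounded formulas and the theories\<close>

definition leq_fun :: "nat list \<Rightarrow> nat" where
  "leq_fun ns = (if length ns = 2 \<and> ns ! 0 \<le> ns ! 1 then 1 else 0)"

definition Le :: "tm \<Rightarrow> tm \<Rightarrow> fm" where
  "Le t u = Eq (App 2 leq_fun [t, u]) One"

text \<open>The bounding term is lifted, so it does not contain the quantified variable.\<close>

definition BExists :: "tm \<Rightarrow> fm \<Rightarrow> fm" where
  "BExists t \<phi> = Exists (Conj (Le (Var 0) (lift_tm t)) \<phi>)"

definition BForall :: "tm \<Rightarrow> fm \<Rightarrow> fm" where
  "BForall t \<phi> = Forall (Disj (Neg (Le (Var 0) (lift_tm t))) \<phi>)"

primrec quantifier_free :: "fm \<Rightarrow> bool" where
  "quantifier_free (Eq t u) = True"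
| "quantifier_free (Neg \<phi>) = quantifier_free \<phi>"
| "quantifier_free (Conj \<phi> \<psi>) = (quantifier_free \<phi> \<and> quantifier_free \<psi>)"
| "quantifier_free (Disj \<phi> \<psi>) = (quantifier_free \<phi> \<and> quantifier_free \<psi>)"
| "quantifier_free (Exists \<phi>) = False"
| "quantifier_free (Forall \<phi>) = False"

text \<open>The classes are strict: sharply bounded quantifiers get no special treatment.\<close>

inductive SigmaB :: "nat \<Rightarrow> fm \<Rightarrow> bool" and PiB :: "nat \<Rightarrow> fm \<Rightarrow> bool" where
  SigmaB_0: "quantifier_free \<phi> \<Longrightarrow> SigmaB 0 \<phi>"
| PiB_0: "quantifier_free \<phi> \<Longrightarrow> PiB 0 \<phi>"
| SigmaB_SigmaB: "SigmaB j \<phi> \<Longrightarrow> SigmaB (Suc j) \<phi>"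
| SigmaB_PiB: "PiB j \<phi> \<Longrightarrow> SigmaB (Suc j) \<phi>"
| PiB_SigmaB: "SigmaB j \<phi> \<Longrightarrow> PiB (Suc j) \<phi>"
| PiB_PiB: "PiB j \<phi> \<Longrightarrow> PiB (Suc j) \<phi>"
| SigmaB_Conj: "\<lbrakk>SigmaB j \<phi>; SigmaB j \<psi>\<rbrakk> \<Longrightarrow> SigmaB j (Conj \<phi> \<psi>)"
| SigmaB_Disj: "\<lbrakk>SigmaB j \<phi>; SigmaB j \<psi>\<rbrakk> \<Longrightarrow> SigmaB j (Disj \<phi> \<psi>)"
| PiB_Conj: "\<lbrakk>PiB j \<phi>; PiB j \<psi>\<rbrakk> \<Longrightarrow> PiB j (Conj \<phi> \<psi>)"
| PiB_Disj: "\<lbrakk>PiB j \<phi>; PiB j \<psi>\<rbrakk> \<Longrightarrow> PiB j (Disj \<phi> \<psi>)"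
| SigmaB_Neg: "PiB j \<phi> \<Longrightarrow> SigmaB j (Neg \<phi>)"
| PiB_Neg: "SigmaB j \<phi> \<Longrightarrow> PiB j (Neg \<phi>)"
| SigmaB_BExists: "SigmaB (Suc j) \<phi> \<Longrightarrow> SigmaB (Suc j) (BExists t \<phi>)"
| PiB_BForall: "PiB (Suc j) \<phi> \<Longrightarrow> PiB (Suc j) (BForall t \<phi>)"

definition T_PV :: "nat \<Rightarrow> fm set" where
  "T_PV i = {\<chi>. \<exists>n \<phi>. \<chi> = (Forall ^^ n) \<phi> \<and> SigmaB (i - 1) \<phi> \<and> sentence \<chi> \<and> true_in_N \<chi>}"

end

theory Submission
  imports Defs
begin

text \<open>
  Let \<open>j = i - 1\<close>.

  For (1), a true \<open>\<forall>\<Sigma>\<^sub>i\<close> sentence is the totality of a search problem in \<open>TFSigma i\<close>: collapse its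
  outermost existential quantifiers to one witness. If \<open>j = 0\<close>, the solving function is a term and
  the instance is an axiom of \<open>T_PV 1\<close>. Otherwise consider a table of oracle answers from which the
  solving machine can be simulated without oracle. That a correct table exists is a true
  \<open>\<forall>\<Sigma>\<^sub>j\<close> sentence, and that every correct table yields a solution is a true \<open>\<Pi>\<^sub>j\<close> formula, which is
  provable by stripping its outermost universal quantifiers.

  For (2), suppose that no function in \<open>FP\<close> with a \<open>\<Sigma>\<^sub>j\<close> oracle solves \<open>R\<close>. Since solutions can be
  combined by cases, the sets \<open>{x. \<not> R x (f x)}\<close> generate a proper filter; extend it to an ultrafilter
  \<open>U\<close>. These functions have Skolem functions for \<open>\<Sigma>\<^sub>j\<close> formulas by binary search, so the ultrapower
  of the standard model modulo \<open>U\<close>, restricted to them, is a model of \<open>T_PV i\<close>. In it, the identity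
  function is an input of \<open>R\<close> without solution, so \<open>T_PV i\<close> does not prove that \<open>R\<close> is total.
\<close>

section \<open>Programs, running times and closure properties of polynomial time\<close>

section \<open>Polynomial bounds\<close>

text \<open>The two parts use different oracles because of what a run must certify. A table of
  answers to a search problem in \<open>TFSigma j\<close> with j > 0 is verified by checking
  solutions, which is Pi_(j-1), so its existence is a Sigma_j statement. Answers to a Sigma_j oracle
  include negative ones, whose correctness is Pi_j, and the existence of a table would lie one level
  too high. Conversely, the ultrapower needs Skolem functions for Sigma_j formulas, and finding
  their values takes a Sigma_j oracle. For i = 1 both kinds of oracle collapse to FP, hence the
  equivalence. A search problem may have many solutions, so a correct table is not tied to one given
  oracle: it is completed to some oracle, and the machine must succeed with that one as well. The
  theories have all true sentences of a given form as axioms, so a model takes the place of a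
  proof-theoretic witnessing argument. Machines work on strings while formulas speak about numbers.
  A formula that quantifies over strings codes x by \<open>val (x @ [True])\<close> and decodes n by
  \<open>butlast (bin n)\<close>.\<close>

lemma poly_nat_mono: "m \<le> n \<Longrightarrow> poly (p :: nat poly) m \<le> poly p n"
  by (induction p) (auto intro!: add_mono mult_mono)

text \<open>Running times are dominated by polynomials rather than being polynomials, so that
  introduction rules can follow the shape of an arbitrary time expression.\<close>

definition polyb :: "(nat \<Rightarrow> nat) \<Rightarrow> bool" where
  "polyb T \<longleftrightarrow> (\<exists>p. \<forall>n. T n \<le> poly p n)"

lemma polyb_poly [intro]: "polyb (poly p)"
  unfolding polyb_def by auto

lemma polyb_const [intro]: "polyb (\<lambda>_. c)"
  unfolding polyb_def by (rule exI[of _ "[:c:]"]) simp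

lemma polyb_id [intro]: "polyb (\<lambda>n. n)"
  unfolding polyb_def by (rule exI[of _ "[:0, 1:]"]) simp

lemma polyb_add [intro]: "polyb S \<Longrightarrow> polyb T \<Longrightarrow> polyb (\<lambda>n. S n + T n)"
  unfolding polyb_def
proof (elim exE)
  fix p q assume "\<forall>n. S n \<le> poly p n" "\<forall>n. T n \<le> poly q n"
  then show "\<exists>r. \<forall>n. S n + T n \<le> poly r n"
    by (intro exI[of _ "p + q"]) (simp add: add_mono)
qed

lemma polyb_mult [intro]: "polyb S \<Longrightarrow> polyb T \<Longrightarrow> polyb (\<lambda>n. S n * T n)"
  unfolding polyb_def
proof (elim exE)
  fix p q assume "\<forall>n. S n \<le> poly p n" "\<forall>n. T n \<le> poly q n"
  then show "\<exists>r. \<forall>n. S n * T n \<le> poly r n"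
    by (intro exI[of _ "p * q"]) (simp add: mult_mono)
qed

lemma polyb_Suc [intro]: "polyb T \<Longrightarrow> polyb (\<lambda>n. Suc (T n))"
  using polyb_add[OF polyb_const[of 1]] by simp

lemma polyb_compose: "polyb T \<Longrightarrow> polyb S \<Longrightarrow> polyb (\<lambda>n. T (S n))"
  unfolding polyb_def
proof (elim exE)
  fix p q assume *: "\<forall>n. T n \<le> poly p n" "\<forall>n. S n \<le> poly q n"
  have "T (S n) \<le> poly (pcompose p q) n" for n
    using * poly_nat_mono[of "S n" "poly q n" p] order_trans
    by (fastforce simp: poly_pcompose)
  then show "\<exists>r. \<forall>n. T (S n) \<le> poly r n" by blast
qed

lemma polyb_polyE:
  assumes "polyb T" obtains p where "\<And>n. T n \<le> poly p n"
  using assms unfolding polyb_def by blast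


section \<open>Running programs\<close>

abbreviation sz :: "bool list list \<Rightarrow> nat" where
  "sz xs \<equiv> sum_list (map length xs)"

lemma length_nth_le_sz: "i < length xs \<Longrightarrow> length (xs ! i) \<le> sz xs"
  by (metis elem_le_sum_list length_map nth_map)

text \<open>Exact step counts are relaxed to upper bounds, which can be added and enlarged
  freely.\<close>

definition halts ::
  "(bool list \<Rightarrow> bool list) \<Rightarrow> prog \<Rightarrow> store \<Rightarrow> nat \<Rightarrow> store \<Rightarrow> bool"
where
  "halts g c s T s' \<longleftrightarrow> (\<exists>t\<le>T. exec g c s t s')"

lemma haltsI: "exec g c s t s' \<Longrightarrow> t \<le> T \<Longrightarrow> halts g c s T s'"
  unfolding halts_def by blast

lemma halts_mono: "halts g c s T s' \<Longrightarrow> T \<le> U \<Longrightarrow> halts g c s U s'"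
  unfolding halts_def by (meson order_trans)

lemma halts_Seq:
  "halts g c s T s' \<Longrightarrow> halts g d s' U s'' \<Longrightarrow> halts g (Seq c d) s (T + U) s''"
  unfolding halts_def by (meson add_mono exec.Seq)

lemma halts_Skip: "halts g Skip s 1 s"
  unfolding halts_def using exec.Skip by blast

lemma halts_Push: "halts g (Push b r) s 1 (s(r := b # s r))"
  unfolding halts_def using exec.Push by blast

lemma halts_Pop: "halts g (Pop r) s 1 (s(r := tl (s r)))"
  unfolding halts_def using exec.Pop by blast

text \<open>The run is supplied as an explicit sequence of stores, one per round; this plays the
  role of invariant and variant at once. Each round costs its body and one test, and the final test
  costs one more.\<close>

lemma halts_Loop:
  assumes "\<And>i. i < m \<Longrightarrow> st i r \<noteq> []" "\<And>i. i < m \<Longrightarrow> halts g c (st i) B (st (Suc i))"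
    and "st m r = []"
  shows "halts g (Loop r c) (st 0) (m * (B + 1) + 1) (st m)"
  using assms
proof (induction m arbitrary: st)
  case 0
  then show ?case unfolding halts_def using exec.Loop_stop by fastforce
next
  case (Suc m)
  have "halts g (Loop r c) (st (Suc 0)) (m * (B + 1) + 1) (st (Suc m))"
    using Suc.IH[of "\<lambda>i. st (Suc i)"] Suc.prems by auto
  then obtain u where u: "u \<le> m * (B + 1) + 1" "exec g (Loop r c) (st (Suc 0)) u (st (Suc m))"
    unfolding halts_def by blast
  obtain t where t: "t \<le> B" "exec g c (st 0) t (st (Suc 0))"
    using Suc.prems(2)[of 0] unfolding halts_def by blast
  have "exec g (Loop r c) (st 0) (Suc (t + u)) (st (Suc m))"
    using exec.Loop_step[OF _ t(2) u(2)] Suc.prems(1)[of 0] by blast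
  then show ?case
    by (rule haltsI) (use t u in auto)
qed

lemma exec_query_free: "exec g c s t s' \<Longrightarrow> query_free c \<Longrightarrow> exec g' c s t s'"
  by (induction rule: exec.induct) (auto simp del: One_nat_def intro: exec.intros)

text \<open>A step adds at most one bit, except for a query, which is charged for the length of its
  answer. Hence every time bound is also a bound on output and storage.\<close>

lemma exec_length: "exec g c s t s' \<Longrightarrow> length (s' r) \<le> length (s r) + t"
  by (induction rule: exec.induct) auto

primrec width :: "prog \<Rightarrow> nat" where
  "width Skip = 0"
| "width (Push b r) = Suc r"
| "width (Pop r) = Suc r"
| "width (Seq c d) = max (width c) (width d)"
| "width (Case r c0 c1 c2) = max (Suc r) (max (width c0) (max (width c1) (width c2)))"
| "width (Loop r c) = max (Suc r) (width c)"
| "width (Query r) = Suc r"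

abbreviation merge :: "nat \<Rightarrow> store \<Rightarrow> store \<Rightarrow> store" where
  "merge M s u \<equiv> (\<lambda>r. if r < M then s r else u r)"

text \<open>A program touches only registers below its \<open>width\<close>. This is what allows it
  to run as a subroutine inside a larger store.\<close>

lemma exec_frame: "exec g c s t s' \<Longrightarrow> width c \<le> M \<Longrightarrow> exec g c (merge M s u) t (merge M s' u)"
proof (induction rule: exec.induct)
  case (Push b r s)
  have *: "merge M (s(r := b # s r)) u = (merge M s u)(r := b # merge M s u r)"
    using Push by auto
  show ?case unfolding * by (rule exec.Push)
next
  case (Pop r s)
  have *: "merge M (s(r := tl (s r))) u = (merge M s u)(r := tl (merge M s u r))"
    using Pop by auto
  show ?case unfolding * by (rule exec.Pop)
next
  case (Query r s)
  have *: "merge M (s(r := g (s r))) u = (merge M s u)(r := g (merge M s u r))"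
    and **: "s r = merge M s u r"
    using Query by auto
  show ?case unfolding * by (subst (1 2) **) (rule exec.Query)
next
  case (Skip s)
  show ?case by (rule exec.Skip)
next
  case (Seq c s t s' d v s'')
  then show ?case by (simp add: exec.Seq)
next
  case (Case_empty s r c0 t s' c1 c2)
  then show ?case by (simp add: exec.Case_empty)
next
  case (Case_True s r w c1 t s' c0 c2)
  then show ?case by (simp add: exec.Case_True)
next
  case (Case_False s r w c2 t s' c0 c1)
  then show ?case by (simp add: exec.Case_False)
next
  case (Loop_stop s r c)
  then show ?case by (simp add: exec.Loop_stop del: One_nat_def)
next
  case (Loop_step s r c t s' v s'')
  then show ?case using exec.Loop_step[of "merge M s u" r] by simp
qed


section \<open>Moving and copying registers\<close>

definition clr :: "nat \<Rightarrow> prog" where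
  "clr r = Loop r (Pop r)"

text \<open>Popping from one stack and pushing on another reverses the content; order is restored by
  a second move through a scratch register.\<close>

definition mv :: "nat \<Rightarrow> nat \<Rightarrow> prog" where
  "mv a b = Loop a (Case a Skip (Seq (Pop a) (Push True b)) (Seq (Pop a) (Push False b)))"

definition mv2 :: "nat \<Rightarrow> nat \<Rightarrow> nat \<Rightarrow> prog" where
  "mv2 a b c = Loop a (Case a Skip (Seq (Pop a) (Seq (Push True b) (Push True c)))
     (Seq (Pop a) (Seq (Push False b) (Push False c))))"

definition cp :: "nat \<Rightarrow> nat \<Rightarrow> nat \<Rightarrow> prog" where
  "cp a tmp b = Seq (mv a tmp) (mv2 tmp a b)"

lemma query_free_moves [simp]:
  "query_free (clr r)" "query_free (mv a b)" "query_free (mv2 a b c)" "query_free (cp a tmp b)"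
  by (auto simp: clr_def mv_def mv2_def cp_def)

lemma halts_clr: "halts g (clr r) s (2 * length (s r) + 1) (s(r := []))"
proof -
  let ?st = "\<lambda>i. s(r := drop i (s r))"
  have "halts g (Loop r (Pop r)) (?st 0) (length (s r) * (1 + 1) + 1) (?st (length (s r)))"
  proof (rule halts_Loop)
    fix i assume "i < length (s r)"
    then show "?st i r \<noteq> []" by simp
    have *: "?st (Suc i) = (?st i)(r := tl (?st i r))" by (auto simp: drop_Suc drop_tl)
    show "halts g (Pop r) (?st i) 1 (?st (Suc i))" by (subst *) (rule halts_Pop)
  qed simp
  then show ?thesis by (simp add: clr_def mult_2)
qed

lemma halts_Case_step:
  assumes "s r = b # w" "b \<Longrightarrow> halts g c1 s T s'" "\<not> b \<Longrightarrow> halts g c2 s T s'"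
  shows "halts g (Case r c0 c1 c2) s (Suc T) s'"
  using assms by (cases b) (fastforce simp: halts_def intro: exec.Case_True exec.Case_False)+

lemma halts_Case_empty:
  "s r = [] \<Longrightarrow> halts g c0 s T s' \<Longrightarrow> halts g (Case r c0 c1 c2) s (Suc T) s'"
  by (fastforce simp: halts_def intro: exec.Case_empty)

lemma rev_take_Suc: "i < length xs \<Longrightarrow> rev (take (Suc i) xs) = xs ! i # rev (take i xs)"
  by (simp add: take_Suc_conv_app_nth)

lemma halts_mv:
  assumes "a \<noteq> b"
  shows "halts g (mv a b) s (4 * length (s a) + 1) (s(a := [], b := rev (s a) @ s b))"
proof -
  let ?st = "\<lambda>i. s(a := drop i (s a), b := rev (take i (s a)) @ s b)"
  have "halts g (mv a b) (?st 0) (length (s a) * (3 + 1) + 1) (?st (length (s a)))"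
    unfolding mv_def
  proof (rule halts_Loop)
    fix i assume i: "i < length (s a)"
    then show "?st i a \<noteq> []" using assms by simp
    have 1: "?st i a = s a ! i # drop (Suc i) (s a)"
      using i assms by (simp add: Cons_nth_drop_Suc)
    have "halts g (Seq (Pop a) (Push (s a ! i) b)) (?st i) (1 + 1) (?st (Suc i))"
    proof (rule halts_Seq[OF halts_Pop])
      have *: "?st (Suc i) = ((?st i)(a := tl (?st i a)))
        (b := s a ! i # ((?st i)(a := tl (?st i a))) b)"
        using i assms by (auto simp: drop_Suc drop_tl rev_take_Suc)
      show "halts g (Push (s a ! i) b) ((?st i)(a := tl (?st i a))) 1 (?st (Suc i))"
        by (subst *) (rule halts_Push)
    qed
    then have 2: "halts g (Seq (Pop a) (Push (s a ! i) b)) (?st i) 2 (?st (Suc i))"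
      by (simp add: numeral_2_eq_2)
    have "halts g (Case a Skip (Seq (Pop a) (Push True b)) (Seq (Pop a) (Push False b)))
         (?st i) (Suc 2) (?st (Suc i))"
      by (rule halts_Case_step[where s = "?st i" and r = a and b = "s a ! i", OF 1]) (use 2 in auto)
    then show "halts g (Case a Skip (Seq (Pop a) (Push True b)) (Seq (Pop a) (Push False b)))
         (?st i) 3 (?st (Suc i))" by simp
  qed (use assms in simp)
  then show ?thesis by (simp add: mult.commute)
qed

lemma halts_mv2:
  assumes "a \<noteq> b" "a \<noteq> c" "b \<noteq> c"
  shows "halts g (mv2 a b c) s (5 * length (s a) + 1)
    (s(a := [], b := rev (s a) @ s b, c := rev (s a) @ s c))"
proof -
  let ?st = "\<lambda>i. s(a := drop i (s a), b := rev (take i (s a)) @ s b, c := rev (take i (s a)) @ s c)"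
  have "halts g (mv2 a b c) (?st 0) (length (s a) * (4 + 1) + 1) (?st (length (s a)))"
    unfolding mv2_def
  proof (rule halts_Loop)
    fix i assume i: "i < length (s a)"
    then show "?st i a \<noteq> []" using assms by simp
    have 1: "?st i a = s a ! i # drop (Suc i) (s a)"
      using i assms by (simp add: Cons_nth_drop_Suc)
    let ?s1 = "(?st i)(a := tl (?st i a))"
    let ?s2 = "?s1(b := s a ! i # ?s1 b)"
    have "halts g (Seq (Pop a) (Seq (Push (s a ! i) b) (Push (s a ! i) c))) (?st i) (1 + (1 + 1)) (?st (Suc i))"
    proof (rule halts_Seq[OF halts_Pop], rule halts_Seq[OF halts_Push])
      have *: "?st (Suc i) = ?s2(c := s a ! i # ?s2 c)"
        using i assms by (auto simp: drop_Suc drop_tl rev_take_Suc)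
      show "halts g (Push (s a ! i) c) ?s2 1 (?st (Suc i))"
        by (subst *) (rule halts_Push)
    qed
    then have 2: "halts g (Seq (Pop a) (Seq (Push (s a ! i) b) (Push (s a ! i) c))) (?st i) 3 (?st (Suc i))"
      by (simp add: numeral_3_eq_3)
    have "halts g (Case a Skip (Seq (Pop a) (Seq (Push True b) (Push True c)))
     (Seq (Pop a) (Seq (Push False b) (Push False c)))) (?st i) (Suc 3) (?st (Suc i))"
      by (rule halts_Case_step[where s = "?st i" and r = a and b = "s a ! i", OF 1]) (use 2 in auto)
    then show "halts g (Case a Skip (Seq (Pop a) (Seq (Push True b) (Push True c)))
     (Seq (Pop a) (Seq (Push False b) (Push False c)))) (?st i) 4 (?st (Suc i))" by simp
  qed (use assms in simp)
  then show ?thesis by (simp add: mult.commute)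
qed

lemma halts_cp:
  assumes "a \<noteq> tmp" "tmp \<noteq> b" "a \<noteq> b" "s tmp = []" "s b = []"
  shows "halts g (cp a tmp b) s (9 * length (s a) + 2) (s(b := s a))"
proof -
  have 1: "halts g (mv a tmp) s (4 * length (s a) + 1) (s(a := [], tmp := rev (s a)))"
    using halts_mv[OF assms(1), of g s] assms(4) by simp
  let ?s = "s(a := [], tmp := rev (s a))"
  have 2: "?s(tmp := [], a := rev (?s tmp) @ ?s a, b := rev (?s tmp) @ ?s b) = s(b := s a)"
    using assms by auto
  have "halts g (mv2 tmp a b) ?s (5 * length (s a) + 1) (s(b := s a))"
    using halts_mv2[of tmp a b g ?s] assms 2 by auto
  from halts_Seq[OF 1 this] show ?thesis unfolding cp_def by simp
qed

primrec clears :: "nat \<Rightarrow> prog" where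
  "clears 0 = Skip"
| "clears (Suc k) = Seq (clears k) (clr k)"

lemma query_free_clears [simp]: "query_free (clears k)"
  by (induction k) auto

lemma halts_clears:
  assumes "\<And>r. r < k \<Longrightarrow> length (s r) \<le> L"
  shows "halts g (clears k) s (k * (2 * L + 1) + 1) (merge k (\<lambda>_. []) s)"
  using assms
proof (induction k)
  case 0
  then show ?case using halts_Skip by simp
next
  case (Suc k)
  have "halts g (clr k) (merge k (\<lambda>_. []) s) (2 * length (s k) + 1) (merge (Suc k) (\<lambda>_. []) s)"
  proof -
    have "(merge k (\<lambda>_. []) s)(k := []) = merge (Suc k) (\<lambda>_. []) s" by auto
    then show ?thesis using halts_clr[of g k "merge k (\<lambda>_. []) s"] by simp
  qed
  then have "halts g (clr k) (merge k (\<lambda>_. []) s) (2 * L + 1) (merge (Suc k) (\<lambda>_. []) s)"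
    by (rule halts_mono) (use Suc.prems[of k] in simp)
  from halts_Seq[OF Suc.IH this] Suc.prems show ?case by (simp add: add.commute add.left_commute)
qed

primrec copies :: "nat \<Rightarrow> nat \<Rightarrow> nat \<Rightarrow> prog" where
  "copies S tmp 0 = Skip"
| "copies S tmp (Suc k) = Seq (copies S tmp k) (cp (S + k) tmp k)"

lemma query_free_copies [simp]: "query_free (copies S tmp k)"
  by (induction k) auto

lemma halts_copies:
  assumes "\<And>r. r < k \<Longrightarrow> s r = []" "s tmp = []" "k \<le> tmp" "tmp < S" "\<And>i. i < k \<Longrightarrow> length (s (S + i)) \<le> L"
  shows "halts g (copies S tmp k) s (k * (9 * L + 2) + 1) (merge k (\<lambda>r. s (S + r)) s)"
  using assms
proof (induction k)
  case 0
  then show ?case using halts_Skip by simp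
next
  case (Suc k)
  let ?s = "merge k (\<lambda>r. s (S + r)) s"
  have "?s(k := ?s (S + k)) = merge (Suc k) (\<lambda>r. s (S + r)) s"
    using Suc.prems by auto
  then have "halts g (cp (S + k) tmp k) ?s (9 * length (s (S + k)) + 2) (merge (Suc k) (\<lambda>r. s (S + r)) s)"
    using halts_cp[of "S + k" tmp k ?s g] Suc.prems by simp
  then have "halts g (cp (S + k) tmp k) ?s (9 * L + 2) (merge (Suc k) (\<lambda>r. s (S + r)) s)"
    by (rule halts_mono) (use Suc.prems(5)[of k] in simp)
  from halts_Seq[OF Suc.IH this] Suc.prems show ?case by (simp add: add.commute add.left_commute)
qed

primrec xfer :: "nat \<Rightarrow> nat \<Rightarrow> nat \<Rightarrow> nat \<Rightarrow> prog" where
  "xfer tmp a b 0 = Skip"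
| "xfer tmp a b (Suc k) = Seq (xfer tmp a b k)
     (Seq (clr (b + k)) (Seq (mv (a + k) tmp) (mv tmp (b + k))))"

lemma query_free_xfer [simp]: "query_free (xfer tmp a b k)"
  by (induction k) auto

abbreviation moved :: "nat \<Rightarrow> nat \<Rightarrow> nat \<Rightarrow> store \<Rightarrow> store" where
  "moved a b k s \<equiv> (\<lambda>r. if b \<le> r \<and> r < b + k then s (a + (r - b))
     else if a \<le> r \<and> r < a + k then [] else s r)"

lemma halts_xfer:
  assumes "a + k \<le> b \<or> b + k \<le> a" "s tmp = []" "tmp < a \<or> a + k \<le> tmp" "tmp < b \<or> b + k \<le> tmp"
    and "\<And>i. i < k \<Longrightarrow> length (s (a + i)) \<le> L" "\<And>i. i < k \<Longrightarrow> length (s (b + i)) \<le> L"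
  shows "halts g (xfer tmp a b k) s (k * (10 * L + 3) + 1) (moved a b k s)"
  using assms
proof (induction k)
  case 0
  have "moved a b 0 s = s" by (rule ext) auto
  then show ?case using halts_Skip by simp
next
  case (Suc k)
  have IH: "halts g (xfer tmp a b k) s (k * (10 * L + 3) + 1) (moved a b k s)"
    by (rule Suc.IH) (use Suc.prems in auto)
  let ?s1 = "moved a b k s"
  let ?s2 = "?s1(b + k := [])"
  let ?s3 = "?s2(a + k := [], tmp := rev (?s2 (a + k)) @ ?s2 tmp)"
  let ?s4 = "?s3(tmp := [], b + k := rev (?s3 tmp) @ ?s3 (b + k))"
  have d: "tmp \<noteq> a + k" "tmp \<noteq> b + k" "a + k \<noteq> b + k" "?s2 tmp = []" "?s2 (a + k) = s (a + k)"
    "?s3 (b + k) = []" "?s1 (b + k) = s (b + k)"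
    using Suc.prems(1-4) by auto
  have 1: "halts g (clr (b + k)) ?s1 (2 * L + 1) ?s2"
    by (rule halts_mono[OF halts_clr]) (use d Suc.prems(6)[of k] in auto)
  have 2: "halts g (mv (a + k) tmp) ?s2 (4 * L + 1) ?s3"
    by (rule halts_mono[OF halts_mv]) (use d Suc.prems(5)[of k] in auto)
  have 3: "halts g (mv tmp (b + k)) ?s3 (4 * L + 1) ?s4"
    by (rule halts_mono[OF halts_mv]) (use d Suc.prems(5)[of k] in auto)
  have "halts g (xfer tmp a b (Suc k)) s
    (k * (10 * L + 3) + 1 + (2 * L + 1 + (4 * L + 1 + (4 * L + 1)))) ?s4"
    unfolding xfer.simps by (rule halts_Seq[OF IH halts_Seq[OF 1 halts_Seq[OF 2 3]]])
  moreover have "?s4 = moved a b (Suc k) s"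
  proof
    fix r
    consider "r = tmp" | "r = a + k" | "r = b + k" | "r \<noteq> tmp" "r \<noteq> a + k" "r \<noteq> b + k" by blast
    then show "?s4 r = moved a b (Suc k) s r"
    proof cases
      case 1
      then have "\<not> (b \<le> r \<and> r < b + Suc k)" "\<not> (a \<le> r \<and> r < a + Suc k)"
        using Suc.prems(3,4) by auto
      then show ?thesis using 1 d Suc.prems(2) by auto
    next
      case 2
      then have "\<not> (b \<le> r \<and> r < b + Suc k)" using Suc.prems(1) by auto
      then show ?thesis using 2 d by auto
    next
      case 3
      then show ?thesis using d by simp
    next
      case 4
      then have "b \<le> r \<and> r < b + Suc k \<longleftrightarrow> b \<le> r \<and> r < b + k" "a \<le> r \<and> r < a + Suc k \<longleftrightarrow> a \<le> r \<and> r < a + k"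
        by auto
      then show ?thesis using 4 by (simp only: fun_upd_apply if_False)
    qed
  qed
  moreover have "k * (10 * L + 3) + 1 + (2 * L + 1 + (4 * L + 1 + (4 * L + 1))) = Suc k * (10 * L + 3) + 1"
    by simp
  ultimately show ?case by metis
qed


section \<open>Closure of polynomial time under composition and bounded iteration\<close>

definition call :: "nat \<Rightarrow> prog \<Rightarrow> nat \<Rightarrow> nat \<Rightarrow> prog" where
  "call M c k out =
    Seq (copies (Suc M) M k) (Seq c (Seq (mv 0 M) (Seq (mv M out) (clears M))))"

definition call_time :: "nat \<Rightarrow> nat \<Rightarrow> nat \<Rightarrow> nat \<Rightarrow> nat" where
  "call_time M k n T =
    k * (9 * n + 2) + 1 + (T + (4 * (n + T) + 1 + (4 * (n + T) + 1 + (M * (2 * (n + T) + 1) + 1))))"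

lemma halts_call:
  assumes M: "width c \<le> M" "k \<le> M" "0 < M" "M < out"
    and s: "\<And>r. r \<le> M \<Longrightarrow> s r = []" "s out = []"
    and xs: "length xs = k" "\<And>i. i < k \<Longrightarrow> s (Suc M + i) = xs ! i"
    and ex: "exec g c (load xs) t s'" "t \<le> T"
  shows "halts g (call M c k out) s (call_time M k (sz xs) T) (s(out := s' 0))"
proof -
  let ?n = "sz xs"
  let ?s1 = "merge M (load xs) s" and ?s2 = "merge M s' s"
  let ?s3 = "?s2(0 := [], M := rev (?s2 0) @ ?s2 M)"
  let ?s4 = "?s3(M := [], out := rev (?s3 M) @ ?s3 out)"
  have len: "length (s' r) \<le> ?n + T" for r
  proof -
    have "length (s' r) \<le> length (load xs r) + t" by (rule exec_length[OF ex(1)])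
    moreover have "length (load xs r) \<le> ?n"
      using length_nth_le_sz[of r xs] by (auto simp: load_def)
    ultimately show ?thesis using ex(2) by linarith
  qed
  have "merge k (\<lambda>r. s (Suc M + r)) s = ?s1"
    using M s xs by (auto simp: load_def)
  then have 1: "halts g (copies (Suc M) M k) s (k * (9 * ?n + 2) + 1) ?s1"
    using halts_copies[of k s M "Suc M" ?n g] M s xs length_nth_le_sz[of _ xs] by auto
  have 2: "halts g c ?s1 T ?s2"
    using exec_frame[OF ex(1) M(1)] ex(2) by (rule haltsI)
  have 3: "halts g (mv 0 M) ?s2 (4 * (?n + T) + 1) ?s3"
    by (rule halts_mono[OF halts_mv]) (use M len[of 0] in auto)
  have 4: "halts g (mv M out) ?s3 (4 * (?n + T) + 1) ?s4"
    by (rule halts_mono[OF halts_mv]) (use M s len[of 0] in auto)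
  have "length (?s4 r) \<le> ?n + T" if "r < M" for r
    using that M len[of r] by auto
  then have 5: "halts g (clears M) ?s4 (M * (2 * (?n + T) + 1) + 1) (merge M (\<lambda>_. []) ?s4)"
    by (rule halts_clears)
  have 6: "merge M (\<lambda>_. []) ?s4 = s(out := s' 0)"
    using M s by auto
  show ?thesis
    unfolding call_def call_time_def
    using halts_Seq[OF 1 halts_Seq[OF 2 halts_Seq[OF 3 halts_Seq[OF 4 5]]]] unfolding 6 .
qed

lemma polyb_call_time: "polyb T \<Longrightarrow> polyb (\<lambda>n. call_time M k n (T n))"
  unfolding call_time_def by (intro polyb_add polyb_mult polyb_const polyb_id)

definition comp_at :: "nat \<Rightarrow> nat \<Rightarrow> (bool list list \<Rightarrow> bool list) \<Rightarrow> bool" where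
  "comp_at M k f \<longleftrightarrow> (\<exists>c p. query_free c \<and> width c \<le> M \<and>
    (\<forall>xs. length xs = k \<longrightarrow> (\<exists>t s. (\<forall>g. exec g c (load xs) t s) \<and> t \<le> poly p (sz xs) \<and> s 0 = f xs)))"

lemma comp_at_mono: "comp_at M k f \<Longrightarrow> M \<le> M' \<Longrightarrow> comp_at M' k f"
  unfolding comp_at_def by (meson order_trans)

lemma polytime_comp_at: "polytime k f \<longleftrightarrow> (\<exists>M. comp_at M k f)"
proof
  assume "polytime k f"
  then obtain c p where "query_free c" "\<forall>xs. length xs = k \<longrightarrow> runs (\<lambda>_. []) c p xs (f xs)"
    unfolding polytime_def by blast
  then have "comp_at (width c) k f"
    unfolding comp_at_def runs_def by (meson exec_query_free order_refl)
  then show "\<exists>M. comp_at M k f" ..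
next
  assume "\<exists>M. comp_at M k f"
  then show "polytime k f"
    unfolding comp_at_def polytime_def runs_def by meson
qed

lemma comp_at_common:
  assumes "\<And>f. f \<in> set fs \<Longrightarrow> polytime k f"
  shows "\<exists>M\<ge>M0. \<forall>f\<in>set fs. comp_at M k f"
  using assms
proof (induction fs)
  case (Cons f fs)
  then obtain M where "M \<ge> M0" "\<forall>f\<in>set fs. comp_at M k f" by auto
  moreover obtain N where "comp_at N k f"
    using Cons.prems[of f] polytime_comp_at[of k f] by auto
  ultimately show ?case
    by (intro exI[of _ "max M N"]) (auto intro: comp_at_mono)
qed auto

lemma polytime_length:
  assumes "polytime k f"
  obtains p where "\<And>xs. length xs = k \<Longrightarrow> length (f xs) \<le> poly p (sz xs)"
proof -
  obtain c p where *: "\<forall>xs. length xs = k \<longrightarrow> runs (\<lambda>_. []) c p xs (f xs)"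
    using assms unfolding polytime_def by blast
  show thesis
  proof
    fix xs :: "bool list list"
    assume len: "length xs = k"
    then obtain t s where ts: "exec (\<lambda>_. []) c (load xs) t s" "t \<le> poly p (sz xs)" "s 0 = f xs"
      using * unfolding runs_def by blast
    have "length (load xs 0) \<le> sz xs"
      using length_nth_le_sz[of 0 xs] by (auto simp: load_def)
    then show "length (f xs) \<le> poly ([:0, 1:] + p) (sz xs)"
      using exec_length[OF ts(1), of 0] ts by simp
  qed
qed

lemma polytime_cong: "(\<And>xs. length xs = k \<Longrightarrow> f xs = g xs) \<Longrightarrow> polytime k f \<longleftrightarrow> polytime k g"
  unfolding polytime_def by auto

lemma polytimeI:
  assumes "query_free c" "polyb T"
    and "\<And>xs. length xs = k \<Longrightarrow> \<exists>s. halts (\<lambda>_. []) c (load xs) (T (sz xs)) s \<and> s 0 = f xs"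
  shows "polytime k f"
proof -
  obtain p where "\<And>n. T n \<le> poly p n" using polyb_polyE[OF assms(2)] by blast
  then show ?thesis
    using assms unfolding polytime_def runs_def halts_def by (meson order_trans)
qed

lemma ex_call:
  assumes f: "comp_at M k f" and M: "k \<le> M" "0 < M" "M < out"
  shows "\<exists>C p. query_free C \<and> (\<forall>g s xs. (\<forall>r\<le>M. s r = []) \<longrightarrow> s out = [] \<longrightarrow> length xs = k \<longrightarrow>
    (\<forall>i<k. s (Suc M + i) = xs ! i) \<longrightarrow> halts g C s (poly p (sz xs)) (s(out := f xs)))"
proof -
  obtain c p where c: "query_free c" "width c \<le> M"
    "\<And>xs. length xs = k \<Longrightarrow> \<exists>t s. (\<forall>g. exec g c (load xs) t s) \<and> t \<le> poly p (sz xs) \<and> s 0 = f xs"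
    using f unfolding comp_at_def by blast
  obtain q where q: "\<And>n. call_time M k n (poly p n) \<le> poly q n"
    using polyb_call_time[OF polyb_poly] polyb_polyE by metis
  show ?thesis
  proof (intro exI[of _ "call M c k out"] exI[of _ q] conjI allI impI)
    show "query_free (call M c k out)" using c by (simp add: call_def)
    fix g s and xs :: "bool list list"
    assume s: "\<forall>r\<le>M. s r = []" "s out = []" and xs: "length xs = k" "\<forall>i<k. s (Suc M + i) = xs ! i"
    obtain t s' where t: "exec g c (load xs) t s'" "t \<le> poly p (sz xs)" "s' 0 = f xs"
      using c(3)[OF xs(1)] by blast
    have "halts g (call M c k out) s (call_time M k (sz xs) (poly p (sz xs))) (s(out := s' 0))"
      by (rule halts_call) (use c s xs t M in auto)
    then show "halts g (call M c k out) s (poly q (sz xs)) (s(out := f xs))"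
      using q t(3) halts_mono by metis
  qed
qed

lemma ex_calls:
  assumes M: "k \<le> M" "0 < M" "M < out" and "\<forall>f\<in>set fs. comp_at M k f"
    and out: "M + k < out"
  shows "\<exists>C p. query_free C \<and> (\<forall>g s xs. (\<forall>r\<le>M. s r = []) \<longrightarrow> (\<forall>i<length fs. s (out + i) = []) \<longrightarrow>
    length xs = k \<longrightarrow> (\<forall>i<k. s (Suc M + i) = xs ! i) \<longrightarrow>
    halts g C s (poly p (sz xs)) (\<lambda>r. if out \<le> r \<and> r < out + length fs then (fs ! (r - out)) xs else s r))"
  using assms(4)
proof (induction fs rule: rev_induct)
  case Nil
  have *: "(\<lambda>r. if out \<le> r \<and> r < out + length [] then ([] ! (r - out)) xs else s r) = s"
    for s :: store and xs :: "bool list list" by (rule ext) auto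
  show ?case unfolding *
    by (rule exI[of _ Skip], rule exI[of _ "[:1:]"]) (auto simp del: One_nat_def intro: halts_Skip)
next
  case (snoc f fs)
  have "\<forall>f\<in>set fs. comp_at M k f" using snoc.prems by simp
  from snoc.IH[OF this] obtain C p where C: "query_free C"
    "\<And>g s xs. (\<forall>r\<le>M. s r = []) \<Longrightarrow> (\<forall>i<length fs. s (out + i) = []) \<Longrightarrow>
    length xs = k \<Longrightarrow> (\<forall>i<k. s (Suc M + i) = xs ! i) \<Longrightarrow>
    halts g C s (poly p (sz xs)) (\<lambda>r. if out \<le> r \<and> r < out + length fs then (fs ! (r - out)) xs else s r)"
    by blast
  have "comp_at M k f" using snoc.prems by simp
  from ex_call[OF this M(1,2) trans_less_add1[OF M(3)], of "length fs"]
  have "\<exists>C p. query_free C \<and> (\<forall>g s xs. (\<forall>r\<le>M. s r = []) \<longrightarrow> s (out + length fs) = [] \<longrightarrow> length xs = k \<longrightarrow>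
    (\<forall>i<k. s (Suc M + i) = xs ! i) \<longrightarrow> halts g C s (poly p (sz xs)) (s(out + length fs := f xs)))" .
  then obtain D q where D: "query_free D"
    "\<And>g s xs. (\<forall>r\<le>M. s r = []) \<Longrightarrow> s (out + length fs) = [] \<Longrightarrow> length xs = k \<Longrightarrow>
    (\<forall>i<k. s (Suc M + i) = xs ! i) \<Longrightarrow> halts g D s (poly q (sz xs)) (s(out + length fs := f xs))"
    by blast
  show ?case
  proof (intro exI[of _ "Seq C D"] exI[of _ "p + q"] conjI allI impI)
    show "query_free (Seq C D)" using C(1) D(1) by simp
    fix g s and xs :: "bool list list"
    assume s: "\<forall>r\<le>M. s r = []" "\<forall>i<length (fs @ [f]). s (out + i) = []"
      and xs: "length xs = k" "\<forall>i<k. s (Suc M + i) = xs ! i"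
    let ?s = "\<lambda>r. if out \<le> r \<and> r < out + length fs then (fs ! (r - out)) xs else s r"
    have 1: "halts g C s (poly p (sz xs)) ?s"
      by (rule C(2)) (use s xs in auto)
    have 2: "halts g D ?s (poly q (sz xs)) (?s(out + length fs := f xs))"
      by (rule D(2)) (use s xs M out in auto)
    have 3: "?s(out + length fs := f xs) =
      (\<lambda>r. if out \<le> r \<and> r < out + length (fs @ [f]) then ((fs @ [f]) ! (r - out)) xs else s r)"
      by (rule ext) (auto simp: nth_append)
    show "halts g (Seq C D) s (poly (p + q) (sz xs))
      (\<lambda>r. if out \<le> r \<and> r < out + length (fs @ [f]) then ((fs @ [f]) ! (r - out)) xs else s r)"
      using halts_Seq[OF 1 2] unfolding 3 by simp
  qed
qed

lemma ex_callsE: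
  assumes "k \<le> M" "0 < M" "M < out" "\<forall>f\<in>set fs. comp_at M k f" "M + k < out" "length fs = m"
  obtains C p where "query_free C"
    "\<And>g s xs. (\<forall>r\<le>M. s r = []) \<Longrightarrow> (\<forall>i<m. s (out + i) = []) \<Longrightarrow>
    length xs = k \<Longrightarrow> (\<forall>i<k. s (Suc M + i) = xs ! i) \<Longrightarrow>
    halts g C s (poly p (sz xs)) (\<lambda>r. if out \<le> r \<and> r < out + m then (fs ! (r - out)) xs else s r)"
  using ex_calls[OF assms(1-5)] unfolding assms(6) by blast

lemma sz_map_bound:
  assumes "\<And>g. g \<in> set gs \<Longrightarrow> polytime k g"
  obtains p where "\<And>xs. length xs = k \<Longrightarrow> sz (map (\<lambda>g. g xs) gs) \<le> poly p (sz xs)"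
proof -
  have "\<exists>p. \<forall>xs. length xs = k \<longrightarrow> sz (map (\<lambda>g. g xs) gs) \<le> poly p (sz xs)"
    using assms
  proof (induction gs)
    case Nil
    then show ?case by auto
  next
    case (Cons g gs)
    then obtain p where p: "\<And>xs. length xs = k \<Longrightarrow> sz (map (\<lambda>g. g xs) gs) \<le> poly p (sz xs)"
      by auto
    obtain q where q: "\<And>xs. length xs = k \<Longrightarrow> length (g xs) \<le> poly q (sz xs)"
      using polytime_length Cons.prems by (metis list.set_intros(1))
    show ?case
      by (rule exI[of _ "q + p"]) (use p q in \<open>auto intro: add_mono\<close>)
  qed
  then show thesis using that by blast
qed

text \<open>The outer program \<open>d\<close> has to be correct only on the tuples produced by
  \<open>gs\<close>. The program of a function symbol needs this form, since it is specified on
  canonical binary notations alone.\<close>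

lemma polytime_comp_gen:
  assumes d: "query_free d" "\<And>xs. length xs = k \<Longrightarrow> runs (\<lambda>_. []) d q (map (\<lambda>g. g xs) gs) (F xs)"
    and g: "\<And>g. g \<in> set gs \<Longrightarrow> polytime k g"
  shows "polytime k F"
proof -
  let ?m = "length gs"
  obtain M where M: "M \<ge> Suc (width d + k + ?m)" "\<forall>g\<in>set gs. comp_at M k g"
    using comp_at_common[OF g] by blast
  then have dM: "width d \<le> M" by simp
  let ?out = "Suc M + k"
  obtain C p where C: "query_free C"
    "\<And>g s xs. (\<forall>r\<le>M. s r = []) \<Longrightarrow> (\<forall>i<?m. s (?out + i) = []) \<Longrightarrow>
    length xs = k \<Longrightarrow> (\<forall>i<k. s (Suc M + i) = xs ! i) \<Longrightarrow>
    halts g C s (poly p (sz xs)) (\<lambda>r. if ?out \<le> r \<and> r < ?out + ?m then (gs ! (r - ?out)) xs else s r)"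
    by (rule ex_callsE[OF _ _ _ M(2), of ?out]) (use M in auto)
  obtain b where b: "\<And>xs. length xs = k \<Longrightarrow> sz (map (\<lambda>g. g xs) gs) \<le> poly b (sz xs)"
    using sz_map_bound[OF g] by blast
  let ?T = "\<lambda>n. k * (10 * n + 3) + 1 + (poly p n + (?m * (10 * poly b n + 3) + 1 + poly q (poly b n)))"
  show ?thesis
  proof (rule polytimeI)
    show "query_free (Seq (xfer M 0 (Suc M) k) (Seq C (Seq (xfer M ?out 0 ?m) d)))"
      using C(1) d(1) by simp
    show "polyb ?T"
      by (intro polyb_add polyb_mult polyb_const polyb_id polyb_poly polyb_compose[OF polyb_poly])
    fix xs :: "bool list list" assume xs: "length xs = k"
    let ?g = "\<lambda>_. [] :: bool list"
    let ?vs = "map (\<lambda>g. g xs) gs"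
    let ?s1 = "\<lambda>r. if Suc M \<le> r \<and> r < Suc M + k then xs ! (r - Suc M) else []"
    let ?s2 = "\<lambda>r. if ?out \<le> r \<and> r < ?out + ?m then (gs ! (r - ?out)) xs else ?s1 r"
    have "moved 0 (Suc M) k (load xs) = ?s1"
      using M xs by (intro ext) (auto simp: load_def)
    then have 1: "halts ?g (xfer M 0 (Suc M) k) (load xs) (k * (10 * sz xs + 3) + 1) ?s1"
      using halts_xfer[of 0 k "Suc M" "load xs" M "sz xs" ?g] M xs length_nth_le_sz[of _ xs]
      by (auto simp: load_def)
    have 2: "halts ?g C ?s1 (poly p (sz xs)) ?s2"
      by (rule C(2)) (use M xs in auto)
    let ?s3 = "moved ?out 0 ?m ?s2"
    have 3: "halts ?g (xfer M ?out 0 ?m) ?s2 (?m * (10 * poly b (sz xs) + 3) + 1) ?s3"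
    proof (rule halts_xfer)
      fix i assume "i < ?m"
      then have "length (?vs ! i) \<le> sz ?vs" using length_nth_le_sz[of i ?vs] by simp
      then show "length (?s2 (?out + i)) \<le> poly b (sz xs)"
        using \<open>i < ?m\<close> b[OF xs] by simp
      show "length (?s2 (0 + i)) \<le> poly b (sz xs)" using \<open>i < ?m\<close> M by simp
    qed (use M in auto)
    \<comment> \<open>Below \<open>M\<close> the store is exactly the input store of
      \<open>d\<close>; by the frame property the leftovers above \<open>M\<close> do no
      harm.\<close>
    have 4: "?s3 = merge M (load ?vs) ?s3"
      using M by (auto simp: load_def)
    obtain t s where t: "exec ?g d (load ?vs) t s" "t \<le> poly q (sz ?vs)" "s 0 = F xs"
      using d(2)[OF xs] unfolding runs_def by auto
    have "exec ?g d ?s3 t (merge M s ?s3)"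
      using exec_frame[OF t(1) dM, of ?s3] 4 by argo
    then have 5: "halts ?g d ?s3 (poly q (poly b (sz xs))) (merge M s ?s3)"
      by (rule haltsI) (use t(2) poly_nat_mono[OF b[OF xs], of q] in linarith)
    show "\<exists>s. halts ?g (Seq (xfer M 0 (Suc M) k) (Seq C (Seq (xfer M ?out 0 ?m) d))) (load xs) (?T (sz xs)) s
      \<and> s 0 = F xs"
    proof (intro exI conjI)
      show "halts ?g (Seq (xfer M 0 (Suc M) k) (Seq C (Seq (xfer M ?out 0 ?m) d))) (load xs) (?T (sz xs)) (merge M s ?s3)"
        by (rule halts_Seq[OF 1 halts_Seq[OF 2 halts_Seq[OF 3 5]]])
      show "merge M s ?s3 0 = F xs" using t(3) M by simp
    qed
  qed
qed

lemma polytime_comp: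
  assumes f: "polytime (length gs) f" and g: "\<And>g. g \<in> set gs \<Longrightarrow> polytime k g"
  shows "polytime k (\<lambda>xs. f (map (\<lambda>g. g xs) gs))"
proof -
  obtain d q where d: "query_free d" "\<forall>xs. length xs = length gs \<longrightarrow> runs (\<lambda>_. []) d q xs (f xs)"
    using f unfolding polytime_def by blast
  show ?thesis
    by (rule polytime_comp_gen[where d = d and q = q and gs = gs]) (use d g in simp_all)
qed

text \<open>Bounded recursion in the style of Cobham: the length of the last argument is the number
  of rounds, and the assumed bound on all intermediate tuples keeps every round polynomial.\<close>

lemma polytime_iter:
  assumes len: "\<And>ys. length ys = k \<Longrightarrow> length (F ys) = k"
    and pt: "\<And>i. i < k \<Longrightarrow> polytime k (\<lambda>ys. F ys ! i)"
    and bound: "\<And>xs i. length xs = Suc k \<Longrightarrow> i \<le> length (xs ! k) \<Longrightarrow> sz ((F ^^ i) (take k xs)) \<le> poly q (sz xs)"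
    and j: "j < k"
  shows "polytime (Suc k) (\<lambda>xs. ((F ^^ length (xs ! k)) (take k xs)) ! j)"
proof -
  let ?fs = "map (\<lambda>i ys. F ys ! i) [0..<k]"
  obtain M where M: "M \<ge> Suc (Suc k)" "\<forall>g\<in>set ?fs. comp_at M k g"
  proof -
    have "polytime k g" if "g \<in> set ?fs" for g using that pt by auto
    from comp_at_common[OF this] show thesis using that by blast
  qed
  \<comment> \<open>The counter follows the \<open>k\<close> state registers, so the initial
    transfer of all arguments also loads the counter. New components are collected at
    \<open>?out\<close> first, because each of them depends on all the old ones.\<close>
  let ?cnt = "Suc M + k" and ?out = "Suc (Suc M + k)"
  obtain C p where C: "query_free C"
    "\<And>g s xs. (\<forall>r\<le>M. s r = []) \<Longrightarrow> (\<forall>i<k. s (?out + i) = []) \<Longrightarrow>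
    length xs = k \<Longrightarrow> (\<forall>i<k. s (Suc M + i) = xs ! i) \<Longrightarrow>
    halts g C s (poly p (sz xs)) (\<lambda>r. if ?out \<le> r \<and> r < ?out + k then (?fs ! (r - ?out)) xs else s r)"
    by (rule ex_callsE[OF _ _ _ M(2), of ?out]) (use M in auto)
  let ?body = "Seq (Pop ?cnt) (Seq C (xfer M ?out (Suc M) k))"
  let ?prog = "Seq (xfer M 0 (Suc M) (Suc k)) (Seq (Loop ?cnt ?body) (xfer M (Suc M + j) 0 1))"
  let ?B = "\<lambda>n. 1 + (poly p (poly q n) + (k * (10 * poly q n + 3) + 1))"
  let ?T = "\<lambda>n. Suc k * (10 * n + 3) + 1 + ((n * (?B n + 1) + 1) + (1 * (10 * poly q n + 3) + 1))"
  show ?thesis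
  proof (rule polytimeI)
    show "query_free ?prog" using C(1) by simp
    show "polyb ?T"
      by (intro polyb_add polyb_mult polyb_const polyb_id polyb_poly polyb_compose[OF polyb_poly])
    fix xs :: "bool list list" assume xs: "length xs = Suc k"
    let ?g = "\<lambda>_. [] :: bool list" and ?n = "sz xs"
    let ?Q = "poly q ?n" and ?m = "length (xs ! k)"
    define v where "v i = (F ^^ i) (take k xs)" for i
    have v_len: "length (v i) = k" for i
      unfolding v_def using len xs by (induction i) auto
    have v_sz: "sz (v i) \<le> ?Q" if "i \<le> ?m" for i
      unfolding v_def using bound[OF xs that] .
    have v_nth: "length (v i ! l) \<le> ?Q" if "i \<le> ?m" "l < k" for i l
      using length_nth_le_sz[of l "v i"] v_len v_sz[OF that(1)] that by simp
    define st where "st i = (\<lambda>r. if Suc M \<le> r \<and> r < Suc M + k then v i ! (r - Suc M)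
       else if r = ?cnt then drop i (xs ! k) else [])" for i
    have "moved 0 (Suc M) (Suc k) (load xs) = st 0"
      using M xs by (intro ext) (auto simp: load_def st_def v_def less_Suc_eq)
    then have 1: "halts ?g (xfer M 0 (Suc M) (Suc k)) (load xs) (Suc k * (10 * ?n + 3) + 1) (st 0)"
      using halts_xfer[of 0 "Suc k" "Suc M" "load xs" M ?n ?g] M xs length_nth_le_sz[of _ xs]
      by (auto simp: load_def)
    have step: "halts ?g ?body (st i) (?B ?n) (st (Suc i))" if i: "i < ?m" for i
    proof -
      let ?s1 = "(st i)(?cnt := tl (st i ?cnt))"
      let ?s2 = "\<lambda>r. if ?out \<le> r \<and> r < ?out + k then (?fs ! (r - ?out)) (v i) else ?s1 r"
      have b1: "halts ?g (Pop ?cnt) (st i) 1 ?s1" by (rule halts_Pop)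
      have "halts ?g C ?s1 (poly p (sz (v i))) ?s2"
        by (rule C(2)) (use M v_len in \<open>auto simp: st_def\<close>)
      then have b2: "halts ?g C ?s1 (poly p ?Q) ?s2"
        by (rule halts_mono) (use v_sz[of i] i poly_nat_mono in auto)
      have s2_out: "?s2 (?out + l) = v (Suc i) ! l" if "l < k" for l
        using that by (simp add: v_def)
      have b3: "halts ?g (xfer M ?out (Suc M) k) ?s2 (k * (10 * ?Q + 3) + 1) (moved ?out (Suc M) k ?s2)"
      proof (rule halts_xfer)
        fix l assume l: "l < k"
        show "length (?s2 (?out + l)) \<le> ?Q" unfolding s2_out[OF l] by (rule v_nth) (use i l in auto)
        have "?s2 (Suc M + l) = v i ! l" using l by (simp add: st_def)
        then show "length (?s2 (Suc M + l)) \<le> ?Q" using v_nth[of i l] i l by simp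
      qed (use M in \<open>auto simp: st_def\<close>)
      have "moved ?out (Suc M) k ?s2 = st (Suc i)"
      proof
        fix r
        show "moved ?out (Suc M) k ?s2 r = st (Suc i) r"
        proof (cases "Suc M \<le> r \<and> r < Suc M + k")
          case True
          then have "r - Suc M < k" by linarith
          then show ?thesis using True s2_out[of "r - Suc M"] by (simp add: st_def)
        next
          case False
          then show ?thesis by (auto simp: st_def drop_Suc drop_tl)
        qed
      qed
      then show ?thesis using halts_Seq[OF b1 halts_Seq[OF b2 b3]] by metis
    qed
    have "halts ?g (Loop ?cnt ?body) (st 0) (?m * (?B ?n + 1) + 1) (st ?m)"
      by (rule halts_Loop) (use step in \<open>auto simp: st_def\<close>)
    then have 2: "halts ?g (Loop ?cnt ?body) (st 0) (?n * (?B ?n + 1) + 1) (st ?m)"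
      by (rule halts_mono) (use length_nth_le_sz[of k xs] xs in \<open>auto intro!: add_mono mult_mono\<close>)
    have 3: "halts ?g (xfer M (Suc M + j) 0 1) (st ?m) (1 * (10 * ?Q + 3) + 1) (moved (Suc M + j) 0 1 (st ?m))"
      by (rule halts_xfer) (use M j v_nth[of ?m j] in \<open>auto simp: st_def\<close>)
    show "\<exists>s. halts ?g ?prog (load xs) (?T ?n) s \<and> s 0 = (F ^^ ?m) (take k xs) ! j"
    proof (intro exI conjI)
      show "halts ?g ?prog (load xs) (?T ?n) (moved (Suc M + j) 0 1 (st ?m))"
        by (rule halts_Seq[OF 1 halts_Seq[OF 2 3]])
      show "moved (Suc M + j) 0 1 (st ?m) 0 = (F ^^ ?m) (take k xs) ! j"
        using j by (simp add: st_def v_def)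
    qed
  qed
qed


section \<open>Polynomial-time functions on strings and on binary numbers\<close>

section \<open>A library of polynomial-time functions on strings\<close>

named_theorems pt

lemma polytime_nth [pt]:
  assumes "i < k" shows "polytime k (\<lambda>xs. xs ! i)"
proof (cases "i = 0")
  case True
  show ?thesis
  proof (rule polytimeI[of Skip "\<lambda>_. 1"])
    fix xs :: "bool list list" assume "length xs = k"
    then show "\<exists>s. halts (\<lambda>_. []) Skip (load xs) 1 s \<and> s 0 = xs ! i"
      using halts_Skip assms True by (intro exI[of _ "load xs"]) (auto simp: load_def)
  qed auto
next
  case False
  let ?T = "\<lambda>n. (2 * n + 1) + ((4 * n + 1) + (4 * n + 1))"
  show ?thesis
  proof (rule polytimeI[of "Seq (clr 0) (Seq (mv i k) (mv k 0))" ?T])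
    show "polyb ?T" by (intro polyb_add polyb_mult polyb_const polyb_id)
    fix xs :: "bool list list" assume xs: "length xs = k"
    let ?s1 = "(load xs)(0 := [])"
    let ?s2 = "?s1(i := [], k := rev (?s1 i) @ ?s1 k)"
    let ?s3 = "?s2(k := [], 0 := rev (?s2 k) @ ?s2 0)"
    have len: "length (load xs r) \<le> sz xs" for r
      using length_nth_le_sz[of r xs] by (auto simp: load_def)
    have k: "load xs k = []" using xs by (simp add: load_def)
    have 1: "halts (\<lambda>_. []) (clr 0) (load xs) (2 * sz xs + 1) ?s1"
      by (rule halts_mono[OF halts_clr]) (use len[of 0] in simp)
    have 2: "halts (\<lambda>_. []) (mv i k) ?s1 (4 * sz xs + 1) ?s2"
      by (rule halts_mono[OF halts_mv]) (use assms len[of i] in auto)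
    have 3: "halts (\<lambda>_. []) (mv k 0) ?s2 (4 * sz xs + 1) ?s3"
      by (rule halts_mono[OF halts_mv]) (use assms len[of i] k False in auto)
    show "\<exists>s. halts (\<lambda>_. []) (Seq (clr 0) (Seq (mv i k) (mv k 0))) (load xs) (?T (sz xs)) s \<and> s 0 = xs ! i"
    proof (intro exI conjI)
      show "halts (\<lambda>_. []) (Seq (clr 0) (Seq (mv i k) (mv k 0))) (load xs) (?T (sz xs)) ?s3"
        by (rule halts_Seq[OF 1 halts_Seq[OF 2 3]])
      show "?s3 0 = xs ! i" using assms False k xs by (simp add: load_def)
    qed
  qed simp
qed

lemma polytime_nil: "polytime k (\<lambda>_. [])"
proof (rule polytimeI[of "clr 0" "\<lambda>n. 2 * n + 1"])
  show "polyb (\<lambda>n. 2 * n + 1)" by (intro polyb_add polyb_mult polyb_const polyb_id)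
  fix xs :: "bool list list"
  have "length (load xs 0) \<le> sz xs" using length_nth_le_sz[of 0 xs] by (auto simp: load_def)
  then have "halts (\<lambda>_. []) (clr 0) (load xs) (2 * sz xs + 1) ((load xs)(0 := []))"
    by (intro halts_mono[OF halts_clr]) simp
  then show "\<exists>s. halts (\<lambda>_. []) (clr 0) (load xs) (2 * sz xs + 1) s \<and> s 0 = []" by fastforce
qed simp

lemma polytime_1_Cons: "polytime 1 (\<lambda>xs. b # xs ! 0)"
proof (rule polytimeI[of "Push b 0" "\<lambda>n. 1"])
  fix xs :: "bool list list" assume xs: "length xs = 1"
  have "halts (\<lambda>_. []) (Push b 0) (load xs) 1 ((load xs)(0 := b # load xs 0))" by (rule halts_Push)
  then show "\<exists>s. halts (\<lambda>_. []) (Push b 0) (load xs) 1 s \<and> s 0 = b # xs ! 0"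
    using xs by (intro exI[of _ "(load xs)(0 := b # load xs 0)"]) (simp add: load_def)
qed auto

lemma polytime_1_tl: "polytime 1 (\<lambda>xs. tl (xs ! 0))"
proof (rule polytimeI[of "Pop 0" "\<lambda>n. 1"])
  fix xs :: "bool list list" assume xs: "length xs = 1"
  have "halts (\<lambda>_. []) (Pop 0) (load xs) 1 ((load xs)(0 := tl (load xs 0)))" by (rule halts_Pop)
  then show "\<exists>s. halts (\<lambda>_. []) (Pop 0) (load xs) 1 s \<and> s 0 = tl (xs ! 0)"
    using xs by (intro exI[of _ "(load xs)(0 := tl (load xs 0))"]) (simp add: load_def)
qed auto

fun bcase :: "bool list \<Rightarrow> 'a \<Rightarrow> 'a \<Rightarrow> 'a \<Rightarrow> 'a" where
  "bcase [] a b c = a"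
| "bcase (True # _) a b c = b"
| "bcase (False # _) a b c = c"

lemma bcase_alt: "bcase x a b c = (if x = [] then a else if hd x then b else c)"
  by (cases "(x, a, b, c)" rule: bcase.cases) auto

lemma polytime_4_bcase: "polytime 4 (\<lambda>xs. bcase (xs ! 0) (xs ! 1) (xs ! 2) (xs ! 3))"
proof -
  let ?sel = "\<lambda>i. Seq (clr 0) (Seq (mv i 4) (mv 4 0))"
  let ?c = "Case 0 (?sel 1) (?sel 2) (?sel 3)"
  let ?T0 = "\<lambda>n. (2 * n + 1) + ((4 * n + 1) + (4 * n + 1))"
  show ?thesis
  proof (rule polytimeI[of ?c "\<lambda>n. Suc (?T0 n)"])
    show "polyb (\<lambda>n. Suc (?T0 n))" by (intro polyb_Suc polyb_add polyb_mult polyb_const polyb_id)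
    fix xs :: "bool list list" assume xs: "length xs = 4"
    let ?st = "\<lambda>i. (load xs)(0 := [], i := [], 4 := [], 0 := load xs i)"
    have sel: "halts (\<lambda>_. []) (?sel i) (load xs) (?T0 (sz xs)) (?st i)" if i: "0 < i" "i < 4" for i
    proof -
      let ?s1 = "(load xs)(0 := [])"
      let ?s2 = "?s1(i := [], 4 := rev (?s1 i) @ ?s1 4)"
      let ?s3 = "?s2(4 := [], 0 := rev (?s2 4) @ ?s2 0)"
      have len: "length (load xs r) \<le> sz xs" for r
        using length_nth_le_sz[of r xs] by (auto simp: load_def)
      have k: "load xs 4 = []" using xs by (simp add: load_def)
      have 1: "halts (\<lambda>_. []) (clr 0) (load xs) (2 * sz xs + 1) ?s1"
        by (rule halts_mono[OF halts_clr]) (use len[of 0] in simp)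
      have 2: "halts (\<lambda>_. []) (mv i 4) ?s1 (4 * sz xs + 1) ?s2"
        by (rule halts_mono[OF halts_mv]) (use i len[of i] in auto)
      have 3: "halts (\<lambda>_. []) (mv 4 0) ?s2 (4 * sz xs + 1) ?s3"
        by (rule halts_mono[OF halts_mv]) (use i len[of i] k in auto)
      have 4: "?s3 = ?st i" using i k by (intro ext) auto
      show ?thesis using halts_Seq[OF 1 halts_Seq[OF 2 3]] unfolding 4 .
    qed
    have st: "?st i 0 = xs ! i" if "0 < i" "i < 4" for i using that xs by (simp add: load_def)
    have x0: "load xs 0 = xs ! 0" using xs by (simp add: load_def)
    show "\<exists>s. halts (\<lambda>_. []) ?c (load xs) (Suc (?T0 (sz xs))) s
      \<and> s 0 = bcase (xs ! 0) (xs ! 1) (xs ! 2) (xs ! 3)"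
    proof (cases "xs ! 0")
      case Nil
      have "halts (\<lambda>_. []) ?c (load xs) (Suc (?T0 (sz xs))) (?st 1)"
        by (rule halts_Case_empty) (use x0 Nil sel[of 1] in auto)
      then show ?thesis using st[of 1] Nil by (intro exI[of _ "?st 1"]) simp
    next
      case (Cons b w)
      then have "halts (\<lambda>_. []) ?c (load xs) (Suc (?T0 (sz xs))) (?st (if b then 2 else 3))"
        using halts_Case_step[of "load xs" 0 b w "\<lambda>_. []" "?sel 2" "?T0 (sz xs)" "?st (if b then 2 else 3)" "?sel 3" "?sel 1"]
          x0 sel[of 2] sel[of 3] by auto
      then show ?thesis using st[of 2] st[of 3] Cons
        by (intro exI[of _ "?st (if b then 2 else 3)"]) (cases b; simp)
    qed
  qed simp
qed

lemma polytime_comp1: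
  assumes "polytime 1 (\<lambda>xs. h (xs ! 0))" "polytime k f"
  shows "polytime k (\<lambda>xs. h (f xs))"
proof -
  have "polytime k (\<lambda>xs. (\<lambda>ys. h (ys ! 0)) (map (\<lambda>g. g xs) [f]))"
    by (rule polytime_comp) (use assms in auto)
  then show ?thesis by simp
qed

lemma polytime_comp2:
  assumes "polytime 2 (\<lambda>xs. h (xs ! 0) (xs ! 1))" "polytime k f" "polytime k g"
  shows "polytime k (\<lambda>xs. h (f xs) (g xs))"
proof -
  have "polytime k (\<lambda>xs. (\<lambda>ys. h (ys ! 0) (ys ! 1)) (map (\<lambda>g. g xs) [f, g]))"
    by (rule polytime_comp) (use assms in \<open>auto simp: numeral_2_eq_2\<close>)
  then show ?thesis by simp
qed

lemma polytime_comp4: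
  assumes "polytime 4 (\<lambda>xs. h (xs ! 0) (xs ! 1) (xs ! 2) (xs ! 3))"
    "polytime k f1" "polytime k f2" "polytime k f3" "polytime k f4"
  shows "polytime k (\<lambda>xs. h (f1 xs) (f2 xs) (f3 xs) (f4 xs))"
proof -
  have "polytime k (\<lambda>xs. (\<lambda>ys. h (ys ! 0) (ys ! 1) (ys ! 2) (ys ! 3)) (map (\<lambda>g. g xs) [f1, f2, f3, f4]))"
    by (rule polytime_comp) (use assms in \<open>auto simp: eval_nat_numeral\<close>)
  then show ?thesis by (simp add: eval_nat_numeral)
qed

lemmas polytime_Cons [pt] = polytime_comp1[OF polytime_1_Cons]
lemmas polytime_tl [pt] = polytime_comp1[of tl, OF polytime_1_tl]
lemmas polytime_bcase [pt] = polytime_comp4[OF polytime_4_bcase]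

lemma polytime_const [pt]: "polytime k (\<lambda>_. w)"
  by (induction w) (auto intro: polytime_nil polytime_Cons)

lemma polytime_subst:
  assumes "polytime m f" "length gs = m" "\<And>g. g \<in> set gs \<Longrightarrow> polytime k g"
    and "\<And>xs. length xs = k \<Longrightarrow> map (\<lambda>g. g xs) gs = h xs"
  shows "polytime k (\<lambda>xs. f (h xs))"
  by (subst polytime_cong[of _ _ "\<lambda>xs. f (map (\<lambda>g. g xs) gs)"])
    (use assms in \<open>auto intro: polytime_comp\<close>)


subsection \<open>Predicates\<close>

lemma polytime_pred_polytime: "polytime_pred k P \<Longrightarrow> polytime k (\<lambda>xs. [P xs])"
  unfolding polytime_pred_def .

lemma polytime_if [pt]:
  assumes "polytime_pred k P" "polytime k f" "polytime k g"
  shows "polytime k (\<lambda>xs. if P xs then f xs else g xs)"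
proof -
  have "polytime k (\<lambda>xs. bcase [P xs] [] (f xs) (g xs))"
    using assms unfolding polytime_pred_def by (intro pt)
  then show ?thesis
    by (rule polytime_cong[THEN iffD1, rotated]) (simp add: bcase_alt)
qed

lemma polytime_pred_const [pt]: "polytime_pred k (\<lambda>_. b)"
  unfolding polytime_pred_def by (intro pt)

lemma polytime_pred_cong:
  "(\<And>xs. length xs = k \<Longrightarrow> P xs \<longleftrightarrow> Q xs) \<Longrightarrow> polytime_pred k P \<longleftrightarrow> polytime_pred k Q"
  unfolding polytime_pred_def by (rule polytime_cong) simp

lemma polytime_pred_if:
  assumes "polytime_pred k P" "polytime_pred k Q" "polytime_pred k R"
  shows "polytime_pred k (\<lambda>xs. if P xs then Q xs else R xs)"
proof -
  have "polytime k (\<lambda>xs. if P xs then [Q xs] else [R xs])"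
    by (rule polytime_if) (use assms in \<open>simp_all add: polytime_pred_def\<close>)
  then show ?thesis unfolding polytime_pred_def
    by (rule polytime_cong[THEN iffD1, rotated]) simp
qed

lemma polytime_pred_not [pt]:
  assumes "polytime_pred k P" shows "polytime_pred k (\<lambda>xs. \<not> P xs)"
  using polytime_pred_if[OF assms polytime_pred_const[of k False] polytime_pred_const[of k True]]
  by (rule polytime_pred_cong[THEN iffD1, rotated]) simp

lemma polytime_pred_conj [pt]:
  assumes "polytime_pred k P" "polytime_pred k Q" shows "polytime_pred k (\<lambda>xs. P xs \<and> Q xs)"
  using polytime_pred_if[OF assms polytime_pred_const[of k False]]
  by (rule polytime_pred_cong[THEN iffD1, rotated]) simp

lemma polytime_pred_disj [pt]:
  assumes "polytime_pred k P" "polytime_pred k Q" shows "polytime_pred k (\<lambda>xs. P xs \<or> Q xs)"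
  using polytime_pred_not[OF polytime_pred_conj[OF assms[THEN polytime_pred_not]]]
  by (rule polytime_pred_cong[THEN iffD1, rotated]) blast

lemma polytime_pred_Nil [pt]:
  assumes "polytime k f" shows "polytime_pred k (\<lambda>xs. f xs = [])"
proof -
  have "polytime k (\<lambda>xs. bcase (f xs) [True] [False] [False])"
    by (intro pt assms)
  then show ?thesis unfolding polytime_pred_def
    by (rule polytime_cong[THEN iffD1, rotated]) (simp add: bcase_alt)
qed

lemma polytime_pred_comp:
  assumes "polytime_pred m P" "length gs = m" "\<And>g. g \<in> set gs \<Longrightarrow> polytime k g"
    and "\<And>xs. length xs = k \<Longrightarrow> map (\<lambda>g. g xs) gs = h xs"
  shows "polytime_pred k (\<lambda>xs. P (h xs))"
  using polytime_subst[of m "\<lambda>xs. [P xs]"] assms unfolding polytime_pred_def by blast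


subsection \<open>Iteration\<close>

abbreviation step :: "(bool list list \<Rightarrow> bool list) list \<Rightarrow> bool list list \<Rightarrow> bool list list" where
  "step hs \<equiv> (\<lambda>ys. map (\<lambda>h. h ys) hs)"

lemma polytime_iter_gen:
  assumes hs: "length hs = k" "\<And>h. h \<in> set hs \<Longrightarrow> polytime k h"
    and bound: "\<And>ys n i. length ys = k \<Longrightarrow> i \<le> n \<Longrightarrow> sz ((step hs ^^ i) ys) \<le> poly q (sz ys + n)"
    and fs: "length fs = k" "\<And>f. f \<in> set fs \<Longrightarrow> polytime m f"
    and n: "polytime m n" and j: "j < k"
  shows "polytime m (\<lambda>xs. ((step hs ^^ length (n xs)) (map (\<lambda>f. f xs) fs)) ! j)"
proof -
  have *: "polytime (Suc k) (\<lambda>xs. ((step hs ^^ length (xs ! k)) (take k xs)) ! j)"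
  proof (rule polytime_iter)
    fix xs :: "bool list list" and i
    assume xs: "length xs = Suc k" "i \<le> length (xs ! k)"
    have "sz ((step hs ^^ i) (take k xs)) \<le> poly q (sz (take k xs) + length (xs ! k))"
      by (rule bound) (use xs in auto)
    moreover have "sz xs = sz (take k xs @ [xs ! k])"
      using xs(1) by (metis lessI order_refl take_Suc_conv_app_nth take_all)
    ultimately show "sz ((step hs ^^ i) (take k xs)) \<le> poly q (sz xs)"
      by (simp del: take_Suc)
  next
    fix i assume i: "i < k"
    have "polytime k (hs ! i)" using hs i by simp
    then show "polytime k (\<lambda>ys. step hs ys ! i)" using i hs(1) by simp
  qed (use hs j in auto)
  have c0: "polytime (length (fs @ [n])) (\<lambda>xs. ((step hs ^^ length (xs ! k)) (take k xs)) ! j)"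
    using * fs(1) by simp
  have "polytime m (\<lambda>xs. ((step hs ^^ length (map (\<lambda>g. g xs) (fs @ [n]) ! k)) (take k (map (\<lambda>g. g xs) (fs @ [n])))) ! j)"
    by (rule polytime_comp[OF c0]) (use fs n in auto)
  then show ?thesis using fs(1) by (simp add: nth_append)
qed

text \<open>If one round adds at most a constant to the total size, then n rounds add at most n
  times that constant. Most iterations below are of this kind.\<close>

lemma polytime_iter_add:
  assumes hs: "length hs = k" "\<And>h. h \<in> set hs \<Longrightarrow> polytime k h"
    and bound: "\<And>ys. length ys = k \<Longrightarrow> sz (step hs ys) \<le> sz ys + c"
    and fs: "length fs = k" "\<And>f. f \<in> set fs \<Longrightarrow> polytime m f"
    and n: "polytime m n" and j: "j < k"
  shows "polytime m (\<lambda>xs. ((step hs ^^ length (n xs)) (map (\<lambda>f. f xs) fs)) ! j)"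
proof (rule polytime_iter_gen[where q = "[:0, 1 + c:]", OF hs _ fs n j])
  fix ys :: "bool list list" and n i assume ys: "length ys = k" and i: "i \<le> (n :: nat)"
  have "sz ((step hs ^^ i) ys) \<le> sz ys + i * c \<and> length ((step hs ^^ i) ys) = k"
  proof (induction i)
    case (Suc i)
    then show ?case using bound[of "(step hs ^^ i) ys"] hs(1) by simp
  qed (use ys in simp)
  moreover have "i * c \<le> (sz ys + n) * c" using i by (intro mult_right_mono) auto
  ultimately show "sz ((step hs ^^ i) ys) \<le> poly [:0, 1 + c:] (sz ys + n)"
    by (simp add: algebra_simps)
qed

lemma length_2_E:
  assumes "length ys = 2" obtains a b where "ys = [a, b]"
  using assms by (auto simp: numeral_2_eq_2 length_Suc_conv)

lemma polytime_revapp: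
  assumes "polytime k f" "polytime k g" shows "polytime k (\<lambda>xs. rev (f xs) @ g xs)"
proof -
  let ?hs = "[\<lambda>ys. tl (ys ! 0), \<lambda>ys. bcase (ys ! 0) (ys ! 1) (True # ys ! 1) (False # ys ! 1)]"
  have it: "(step ?hs ^^ i) [u, v] = [drop i u, rev (take i u) @ v]" for i u v
  proof (induction i)
    case (Suc i)
    then show ?case
    proof (cases "drop i u")
      case (Cons a w)
      then have "i < length u" "u ! i = a" by (metis drop_eq_Nil list.distinct(1) not_le) (rule nth_via_drop[OF Cons])
      then show ?thesis using Suc Cons by (simp add: take_Suc_conv_app_nth drop_Suc drop_tl bcase_alt)
    qed (simp add: drop_Suc drop_tl)
  qed simp
  have "polytime k (\<lambda>xs. ((step ?hs ^^ length (f xs)) (map (\<lambda>f. f xs) [f, g])) ! 1)"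
  proof (rule polytime_iter_add[where c = 1 and k = 2])
    fix ys :: "bool list list" assume "length ys = 2"
    then show "sz (step ?hs ys) \<le> sz ys + 1"
      by (elim length_2_E) (auto simp: bcase_alt)
  qed (use assms in \<open>auto intro!: pt\<close>)
  then show ?thesis by (simp add: it[simplified])
qed

lemma polytime_rev [pt]: "polytime k f \<Longrightarrow> polytime k (\<lambda>xs. rev (f xs))"
  using polytime_revapp[OF _ polytime_nil] by simp

lemma polytime_append [pt]: "polytime k f \<Longrightarrow> polytime k g \<Longrightarrow> polytime k (\<lambda>xs. f xs @ g xs)"
  using polytime_revapp[OF polytime_rev] by simp


lemma polytime_trues [pt]:
  assumes "polytime k f" shows "polytime k (\<lambda>xs. replicate (length (f xs)) True)"
proof -
  let ?hs = "[\<lambda>ys. True # ys ! 0]"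
  have it: "(step ?hs ^^ i) [[]] = [replicate i True]" for i
    by (induction i) auto
  have "polytime k (\<lambda>xs. ((step ?hs ^^ length (f xs)) (map (\<lambda>f. f xs) [\<lambda>_. []])) ! 0)"
    by (rule polytime_iter_add[where c = 1 and k = 1])
      (use assms in \<open>auto intro!: pt simp: length_Suc_conv\<close>)
  then show ?thesis by (simp add: it[simplified])
qed

lemma polytime_drop [pt]:
  assumes "polytime k n" "polytime k f" shows "polytime k (\<lambda>xs. drop (length (n xs)) (f xs))"
proof -
  let ?hs = "[\<lambda>ys. tl (ys ! 0)]"
  have it: "(step ?hs ^^ i) [u] = [drop i u]" for i u
    by (induction i) (auto simp: drop_Suc drop_tl)
  have "polytime k (\<lambda>xs. ((step ?hs ^^ length (n xs)) (map (\<lambda>f. f xs) [f])) ! 0)"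
    by (rule polytime_iter_add[where c = 0 and k = 1])
      (use assms in \<open>auto intro!: pt simp: length_Suc_conv\<close>)
  then show ?thesis by (simp add: it[simplified])
qed

lemma polytime_take [pt]:
  assumes "polytime k n" "polytime k f" shows "polytime k (\<lambda>xs. take (length (n xs)) (f xs))"
proof -
  have "take n u = rev (drop (length (drop n u)) (rev u))" for n and u :: "bool list"
    by (cases "n \<le> length u") (auto simp: rev_drop)
  then show ?thesis using assms by (simp only:) (intro pt)
qed

lemma polytime_butlast [pt]: "polytime k f \<Longrightarrow> polytime k (\<lambda>xs. butlast (f xs))"
proof -
  assume f: "polytime k f"
  have "butlast u = rev (tl (rev u))" for u :: "bool list"
    by (cases u rule: rev_cases) auto
  then show ?thesis using f by (simp only:) (intro pt)
qed

lemma polytime_pred_le [pt]: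
  assumes "polytime k f" "polytime k g" shows "polytime_pred k (\<lambda>xs. length (f xs) \<le> length (g xs))"
  using polytime_pred_Nil[OF polytime_drop[OF assms(2,1)]]
  by (rule polytime_pred_cong[THEN iffD1, rotated]) simp

lemma polytime_pred_less [pt]:
  assumes "polytime k f" "polytime k g" shows "polytime_pred k (\<lambda>xs. length (f xs) < length (g xs))"
  using polytime_pred_not[OF polytime_pred_le[OF assms(2,1)]]
  by (rule polytime_pred_cong[THEN iffD1, rotated]) auto

lemma polytime_mult [pt]:
  assumes "polytime k f" "polytime k g"
  shows "polytime k (\<lambda>xs. replicate (length (f xs) * length (g xs)) True)"
proof -
  let ?hs = "[\<lambda>ys. ys ! 1 @ ys ! 0, \<lambda>ys. ys ! 1]"
  have it: "(step ?hs ^^ i) [u, v] = [concat (replicate i v) @ u, v]" for i u v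
    by (induction i) auto
  have "polytime k (\<lambda>xs. ((step ?hs ^^ length (f xs))
    (map (\<lambda>f. f xs) [\<lambda>_. [], \<lambda>xs. replicate (length (g xs)) True])) ! 0)"
  \<comment> \<open>Here a round adds the length of \<open>v\<close>, which depends on the input, so
    the bound is quadratic: the starting size plus a product of two quantities below size plus
    rounds.\<close>
  proof (rule polytime_iter_gen[where k = 2 and q = "[:0, 1, 1:]"])
    fix ys :: "bool list list" and n i assume ys: "length ys = 2" and i: "i \<le> (n :: nat)"
    obtain u v where uv: "ys = [u, v]" using length_2_E[OF ys] .
    have "i * length v \<le> (sz ys + n) * (sz ys + n)" using i uv by (intro mult_mono) auto
    then show "sz ((step ?hs ^^ i) ys) \<le> poly [:0, 1, 1:] (sz ys + n)"
      unfolding uv it by (simp add: length_concat sum_list_replicate algebra_simps)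
  qed (use assms in \<open>auto intro!: pt\<close>)
  moreover have "concat (replicate i (replicate m True)) = replicate (i * m) True" for i m
    by (induction i) (auto simp: replicate_add)
  ultimately show ?thesis by (simp add: it[simplified])
qed

text \<open>Horner's scheme in unary. Such strings serve as loop counters and as length
  bounds.\<close>

lemma polytime_clock [pt]:
  assumes "polytime k f" shows "polytime k (\<lambda>xs. replicate (poly q (length (f xs))) True)"
proof (induction q)
  case (pCons a q)
  have "polytime k (\<lambda>xs. replicate a True @
    replicate (length (f xs) * length (replicate (poly q (length (f xs))) True)) True)"
    by (intro pt assms pCons.IH)
  then show ?case by (simp add: replicate_add)
qed (simp add: polytime_nil)

lemma polytime_concat: "polytime k concat"
proof -
  have "i \<le> k \<Longrightarrow> polytime k (\<lambda>xs. concat (take i xs))" for i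
  proof (induction i)
    case (Suc i)
    then have "polytime k (\<lambda>xs. concat (take i xs) @ xs ! i)"
      by (intro polytime_append polytime_nth) auto
    then show ?case
      by (rule polytime_cong[THEN iffD1, rotated]) (use Suc.prems in \<open>simp add: take_Suc_conv_app_nth\<close>)
  qed (simp add: polytime_nil)
  from this[of k] show ?thesis
    by (rule polytime_cong[THEN iffD1, rotated]) auto
qed

lemma polytime_sz_clock [pt]: "polytime k (\<lambda>xs. replicate (poly q (sz xs)) True)"
  using polytime_clock[OF polytime_concat, of k q] by (simp add: length_concat)


subsection \<open>Pairs, lists and equality\<close>

text \<open>A self-delimiting code: \<open>True\<close> announces a further bit of the first string,
  \<open>False\<close> ends it. A pair is never empty, so the empty string can mark the end of a
  list of pairs.\<close>

fun pair :: "bool list \<Rightarrow> bool list \<Rightarrow> bool list" where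
  "pair [] y = False # y"
| "pair (b # x) y = True # b # pair x y"

fun pfst :: "bool list \<Rightarrow> bool list" where
  "pfst (True # b # p) = b # pfst p"
| "pfst p = []"

fun psnd :: "bool list \<Rightarrow> bool list" where
  "psnd (True # b # p) = psnd p"
| "psnd (True # []) = []"
| "psnd (False # p) = p"
| "psnd [] = []"

lemma pfst_pair [simp]: "pfst (pair x y) = x"
  by (induction x) auto

lemma psnd_pair [simp]: "psnd (pair x y) = y"
  by (induction x) auto

lemma pair_not_Nil [simp]: "pair x y \<noteq> []"
  by (cases x) auto

lemma length_pair [simp]: "length (pair x y) = Suc (2 * length x + length y)"
  by (induction x) auto

lemma length_pfst: "length (pfst p) \<le> length p"
  by (induction p rule: pfst.induct) auto

lemma length_psnd: "length (psnd p) \<le> length p - 1"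
  by (induction p rule: psnd.induct) auto

lemma polytime_pair [pt]:
  assumes "polytime k f" "polytime k g" shows "polytime k (\<lambda>xs. pair (f xs) (g xs))"
proof -
  let ?hs = "[\<lambda>ys. tl (ys ! 0),
    \<lambda>ys. bcase (ys ! 0) (ys ! 1) (True # True # ys ! 1) (True # False # ys ! 1)]"
  have snoc: "pair (u @ [b]) v = concat (map (\<lambda>b. [True, b]) u) @ True # b # False # v" for u b v
    by (induction u) auto
  have pair: "pair u v = concat (map (\<lambda>b. [True, b]) u) @ False # v" for u v
    by (induction u) auto
  have it: "(step ?hs ^^ length u) [u, v] = [[], concat (map (\<lambda>b. [True, b]) (rev u)) @ v]" for u v
  proof (induction u arbitrary: v)
    case (Cons b u)
    have "(step ?hs ^^ length (b # u)) [b # u, v] = (step ?hs ^^ length u) (step ?hs [b # u, v])"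
      by (simp only: length_Cons funpow_Suc_right comp_def)
    also have "step ?hs [b # u, v] = [u, True # b # v]" by (simp add: bcase_alt)
    finally show ?case using Cons[of "True # b # v"] by simp
  qed simp
  have "polytime k (\<lambda>xs. ((step ?hs ^^ length (rev (f xs)))
      (map (\<lambda>f. f xs) [\<lambda>xs. rev (f xs), \<lambda>xs. False # g xs])) ! 1)"
  proof (rule polytime_iter_add[where c = 2 and k = 2])
    fix ys :: "bool list list" assume "length ys = 2"
    then show "sz (step ?hs ys) \<le> sz ys + 2"
      by (elim length_2_E) (auto simp: bcase_alt)
  qed (use assms in \<open>auto intro!: pt\<close>)
  moreover have "(step ?hs ^^ length (rev u)) [rev u, False # v] ! 1 = pair u v" for u v
    using it[of "rev u" "False # v"] by (simp add: pair del: length_rev)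
  ultimately show ?thesis by simp
qed

text \<open>One round of decoding. It rests at the end marker, so surplus rounds are
  harmless.\<close>

fun pstep :: "bool list \<Rightarrow> bool list" where
  "pstep (True # p) = tl p"
| "pstep p = p"

lemma pstep_alt: "pstep p = bcase p p (tl (tl p)) p"
  by (cases p rule: pstep.cases) auto

lemma polytime_psnd [pt]:
  assumes "polytime k f" shows "polytime k (\<lambda>xs. psnd (f xs))"
proof -
  let ?hs = "[\<lambda>ys. pstep (ys ! 0)]"
  have fix_False: "(step ?hs ^^ n) [False # p] = [False # p]" "(step ?hs ^^ n) [[]] = [[]]" for n p
    by (induction n) auto
  have it: "length p \<le> n \<Longrightarrow> tl ((step ?hs ^^ n) [p] ! 0) = psnd p" for n p
  proof (induction p arbitrary: n rule: psnd.induct)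
    case (1 b p)
    then obtain m where "n = Suc m" "length p \<le> m" by (cases n) auto
    then show ?case using "1.IH"[of m] by (simp only: funpow_Suc_right comp_def) simp
  next
    case 2
    then obtain m where "n = Suc m" by (cases n) auto
    then show ?case using fix_False by (simp only: funpow_Suc_right comp_def) simp
  qed (use fix_False in simp_all)
  have "polytime k (\<lambda>xs. tl (((step ?hs ^^ length (f xs)) (map (\<lambda>f. f xs) [f])) ! 0))"
  proof (intro polytime_tl polytime_iter_add[where c = 0 and k = 1])
    show "h \<in> set ?hs \<Longrightarrow> polytime 1 h" for h
      unfolding pstep_alt by (auto intro!: pt)
    fix ys :: "bool list list" assume "length ys = 1"
    then obtain p where "ys = [p]" by (auto simp: length_Suc_conv)
    then show "sz (step ?hs ys) \<le> sz ys + 0" by (simp add: pstep_alt bcase_alt)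
  qed (use assms in auto)
  then show ?thesis using it by simp
qed

lemma polytime_pfst [pt]:
  assumes "polytime k f" shows "polytime k (\<lambda>xs. pfst (f xs))"
proof -
  let ?hs = "[\<lambda>ys. pstep (ys ! 0), \<lambda>ys. bcase (ys ! 0) (ys ! 1)
    (bcase (tl (ys ! 0)) (ys ! 1) (True # ys ! 1) (False # ys ! 1)) (ys ! 1)]"
  have fix_False: "(step ?hs ^^ n) [False # p, v] = [False # p, v]" "(step ?hs ^^ n) [[], v] = [[], v]" for n p v
    by (induction n) auto
  have it: "length p \<le> n \<Longrightarrow> (step ?hs ^^ n) [p, v] ! 1 = rev (pfst p) @ v" for n p v
  proof (induction p arbitrary: n v rule: pfst.induct)
    case (1 b p)
    then obtain m where "n = Suc m" "length p \<le> m" by (cases n) auto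
    then show ?case using "1.IH"[of m "b # v"]
      by (simp only: funpow_Suc_right comp_def) (cases b; simp)
  next
    case ("2_3" b)
    then obtain m where "n = Suc m" by (cases n) auto
    then show ?case using fix_False by (simp only: funpow_Suc_right comp_def) (cases b; simp)
  qed (use fix_False in simp_all)
  have "polytime k (\<lambda>xs. rev (((step ?hs ^^ length (f xs)) (map (\<lambda>f. f xs) [f, \<lambda>_. []])) ! 1))"
  proof (intro polytime_rev polytime_iter_add[where c = 1 and k = 2])
    show "h \<in> set ?hs \<Longrightarrow> polytime 2 h" for h
      unfolding pstep_alt by (auto intro!: pt)
    fix ys :: "bool list list" assume "length ys = 2"
    then show "sz (step ?hs ys) \<le> sz ys + 1"
      by (elim length_2_E) (auto simp add: pstep_alt bcase_alt)
  qed (use assms in \<open>auto intro: pt\<close>)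
  then show ?thesis using it by simp
qed

text \<open>Equal leading bits are removed from both strings at once, and the first mismatch freezes
  the state. The strings agree iff both are used up.\<close>

lemma polytime_pred_eq [pt]:
  assumes "polytime k f" "polytime k g" shows "polytime_pred k (\<lambda>xs. f xs = g xs)"
proof -
  let ?P = "\<lambda>u v :: bool list. (u = [] \<or> v = []) \<or> hd u \<noteq> hd v"
  let ?t = "\<lambda>u v w :: bool list. bcase u w (bcase v w (tl w) w) (bcase v w w (tl w))"
  let ?hs = "[\<lambda>ys. ?t (ys ! 0) (ys ! 1) (ys ! 0), \<lambda>ys. ?t (ys ! 0) (ys ! 1) (ys ! 1)]"
  have fixp: "(step ?hs ^^ n) [u, v] = [u, v]" if "?P u v" for n u v
    using that by (induction n) (auto simp: bcase_alt)
  have it: "length u \<le> n \<Longrightarrow> (step ?hs ^^ n) [u, v] = [[], []] \<longleftrightarrow> u = v" for n u v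
  proof (induction u arbitrary: v n)
    case (Cons a u)
    then obtain m where m: "n = Suc m" "length u \<le> m" by (cases n) auto
    show ?case
    proof (cases "?P (a # u) v")
      case True
      then show ?thesis using fixp[OF True] by auto
    next
      case False
      then obtain v' where v: "v = a # v'" by (cases v) auto
      have "step ?hs [a # u, v] = [u, v']" using v by (simp add: bcase_alt)
      then show ?thesis using Cons.IH[OF m(2), of v'] v m(1)
        by (simp only: funpow_Suc_right comp_def) simp
    qed
  qed (use fixp in auto)
  have c: "polytime k (\<lambda>xs. ((step ?hs ^^ length (f xs)) (map (\<lambda>f. f xs) [f, g])) ! j)" if "j < 2" for j
  proof (rule polytime_iter_add[where c = 0 and k = 2])
    fix ys :: "bool list list" assume "length ys = 2"
    then show "sz (step ?hs ys) \<le> sz ys + 0"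
      by (elim length_2_E) (auto simp add: bcase_alt)
  qed (use assms that in \<open>auto intro!: pt\<close>)
  have len: "length ((step ?hs ^^ n) [u, v]) = 2" for n u v
    by (induction n) auto
  have *: "(step ?hs ^^ n) [u, v] = [[], []] \<longleftrightarrow> (step ?hs ^^ n) [u, v] ! 0 = [] \<and> (step ?hs ^^ n) [u, v] ! 1 = []"
    for n u v
    using len[of n u v] by (elim length_2_E) simp
  show ?thesis
    by (rule polytime_pred_cong[THEN iffD1, OF _ polytime_pred_conj[OF polytime_pred_Nil[OF c[of 0]] polytime_pred_Nil[OF c[of 1]]]])
      (use it * in auto)
qed


subsection \<open>Binary numbers\<close>

primrec val :: "bool list \<Rightarrow> nat" where
  "val [] = 0"
| "val (b # x) = of_bool b + 2 * val x"

lemma bin_0 [simp]: "bin 0 = []"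
  by (simp add: bin.simps)

lemma bin_eq_Nil [simp]: "bin n = [] \<longleftrightarrow> n = 0"
  by (simp add: bin.simps)

lemma bin_1 [simp]: "bin (Suc 0) = [True]"
  by (simp add: bin.simps)

lemma val_bin [simp]: "val (bin n) = n"
proof (induction n rule: bin.induct)
  case (1 n)
  then show ?case by (cases "n = 0") (simp_all add: bin.simps[of n] odd_two_times_div_two_succ)
qed

lemma bin_double: "bin (of_bool b + 2 * n) = (if b \<or> n \<noteq> 0 then b # bin n else [])"
  by (subst bin.simps) auto

lemma val_eq_0: "val x = 0 \<longleftrightarrow> (\<forall>b\<in>set x. \<not> b)"
  by (induction x) auto

lemma bin_val: "bin (val x) = rev (dropWhile Not (rev x))"
proof (induction x)
  case (Cons b x)
  show ?case
  proof (cases "val x = 0")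
    case True
    then have "\<forall>b\<in>set x. \<not> b" by (simp add: val_eq_0)
    then have "dropWhile Not (rev x @ [b]) = dropWhile Not [b]" by (intro dropWhile_append2) auto
    then show ?thesis using True bin_double[of b "val x"] by simp
  next
    case False
    then have "\<exists>b\<in>set (rev x). \<not> \<not> b" by (simp add: val_eq_0)
    then have "dropWhile Not (rev x @ [b]) = dropWhile Not (rev x) @ [b]" by auto
    then show ?thesis using False Cons by (simp add: bin_double del: dropWhile_append1)
  qed
qed simp

text \<open>With \<open>True\<close> as its most significant bit a string is a canonical notation.
  This gives the bijection between strings and positive numbers by which formulas quantify over
  strings; its inverse is \<open>butlast\<close> after \<open>bin\<close>.\<close>

lemma bin_val_snoc [simp]: "bin (val (x @ [True])) = x @ [True]"
  by (simp add: bin_val)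

lemma length_bin_val: "length (bin (val x)) \<le> length x"
  by (simp add: bin_val) (metis length_dropWhile_le length_rev)

lemma val_trues: "Suc (val (replicate m True)) = 2 ^ m"
  by (induction m) auto

lemma length_bin_le: "length (bin n) \<le> m \<longleftrightarrow> n < 2 ^ m"
proof (induction m arbitrary: n)
  case (Suc m)
  have "length (bin n) = (if n = 0 then 0 else Suc (length (bin (n div 2))))"
    by (subst bin.simps) simp
  then show ?case using Suc.IH[of "n div 2"] by (cases "n = 0") auto
qed simp

text \<open>The number written with m ones is the largest of length m. Thus a bound on length
  becomes a bound by a term.\<close>

lemma le_val_trues: "n \<le> val (replicate m True) \<longleftrightarrow> length (bin n) \<le> m"
  unfolding length_bin_le val_trues[symmetric] by auto

lemma length_bin_mono: "m \<le> n \<Longrightarrow> length (bin m) \<le> length (bin n)"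
  by (metis length_bin_le order_le_less_trans order_refl)

lemma dropWhile_iter: "((\<lambda>u. bcase u u u (tl u)) ^^ n) u = dropWhile Not u" if "length u \<le> n"
  using that
proof (induction u arbitrary: n)
  case Nil
  then show ?case by (induction n) auto
next
  case (Cons b u)
  have *: "((\<lambda>u. bcase u u u (tl u)) ^^ n) (True # u) = True # u" for n
    by (induction n) auto
  obtain m where "n = Suc m" "length u \<le> m" using Cons.prems by (cases n) auto
  then show ?case using Cons.IH[of m] * 
    by (simp only: funpow_Suc_right comp_def) (cases b; simp)
qed

lemma polytime_norm [pt]:
  assumes "polytime k f" shows "polytime k (\<lambda>xs. bin (val (f xs)))"
proof -
  let ?h = "\<lambda>u :: bool list. bcase u u u (tl u)"
  let ?hs = "[\<lambda>ys. ?h (ys ! 0)]"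
  have it: "(step ?hs ^^ n) [u] = [(?h ^^ n) u]" for n u
    by (induction n) auto
  have "polytime k (\<lambda>xs. rev (((step ?hs ^^ length (rev (f xs))) (map (\<lambda>f. f xs) [\<lambda>xs. rev (f xs)])) ! 0))"
  proof (intro polytime_rev polytime_iter_add[where c = 0 and k = 1])
    fix ys :: "bool list list" assume "length ys = 1"
    then obtain p where "ys = [p]" by (auto simp: length_Suc_conv)
    then show "sz (step ?hs ys) \<le> sz ys + 0" by (simp add: bcase_alt)
  qed (use assms in \<open>auto intro!: pt\<close>)
  then show ?thesis using it by (simp add: dropWhile_iter bin_val)
qed

lemma length_3_E:
  assumes "length ys = 3" obtains a b c where "ys = [a, b, c]"
  using assms by (auto simp: numeral_3_eq_3 length_Suc_conv)

text \<open>Bits are compared from the least significant one upwards, and each difference overrides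
  the verdict so far, which is kept in the third component. A string that has run out counts as
  continued by zeros.\<close>

lemma polytime_pred_val_le [pt]:
  assumes "polytime k f" "polytime k g" shows "polytime_pred k (\<lambda>xs. val (f xs) \<le> val (g xs))"
proof -
  let ?cmp = "\<lambda>u v r. bcase u (bcase v r [True] r) (bcase v [False] r [False]) (bcase v r [True] r)"
  let ?hs = "[\<lambda>ys. tl (ys ! 0), \<lambda>ys. tl (ys ! 1), \<lambda>ys. ?cmp (ys ! 0) (ys ! 1) (ys ! 2)]"
  have it: "length u \<le> n \<Longrightarrow> length v \<le> n \<Longrightarrow>
    (step ?hs ^^ n) [u, v, [b]] ! 2 = [if val u = val v then b else val u < val v]" for n u v b
  proof (induction n arbitrary: u v b)
    case (Suc n)
    have bit: "val w = of_bool (bcase w False True False) + 2 * val (tl w)" for w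
      by (cases w) (auto simp: bcase_alt)
    have *: "?cmp u v [b] = [if bcase u False True False = bcase v False True False then b
      else bcase v False True False]"
      by (simp add: bcase_alt)
    have "step ?hs [u, v, [b]] = [tl u, tl v, ?cmp u v [b]]" by simp
    then have "(step ?hs ^^ Suc n) [u, v, [b]] = (step ?hs ^^ n) [tl u, tl v, ?cmp u v [b]]"
      by (simp only: funpow_Suc_right comp_def)
    also have "\<dots> ! 2 = [if val (tl u) = val (tl v) then
      (if bcase u False True False = bcase v False True False then b else bcase v False True False)
      else val (tl u) < val (tl v)]"
      unfolding * by (rule Suc.IH) (use Suc.prems in auto)
    also have "\<dots> = [if val u = val v then b else val u < val v]"
      by (cases "bcase u False True False"; cases "bcase v False True False")
        (auto simp: bit[of u] bit[of v]; presburger)+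
    finally show ?case .
  qed simp
  have "polytime k (\<lambda>xs. ((step ?hs ^^ length (f xs @ g xs)) (map (\<lambda>f. f xs) [f, g, \<lambda>_. [True]])) ! 2)"
  proof (rule polytime_iter_add[where c = 1 and k = 3])
    fix ys :: "bool list list" assume "length ys = 3"
    then show "sz (step ?hs ys) \<le> sz ys + 1"
      by (elim length_3_E) (auto simp: bcase_alt numeral_2_eq_2)
  qed (use assms in \<open>auto intro!: pt\<close>)
  then have "polytime k (\<lambda>xs. (step ?hs ^^ length (f xs @ g xs)) [f xs, g xs, [True]] ! 2)"
    by (simp only: list.map)
  moreover have "(step ?hs ^^ length (u @ v)) [u, v, [True]] ! 2 = [val u \<le> val v]" for u v
    by (subst it) auto
  ultimately show ?thesis unfolding polytime_pred_def by simp
qed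


subsection \<open>Function symbols\<close>

lemma PV_funI:
  assumes "polytime k F" "\<And>ns. length ns = k \<Longrightarrow> F (map bin ns) = bin (f ns)"
    and "\<And>ns. length ns \<noteq> k \<Longrightarrow> f ns = 0"
  shows "PV_fun k f"
  using assms unfolding PV_fun_def polytime_def by (metis length_map)

text \<open>Reading the output by \<open>val\<close> makes every string function numerical, whether
  or not its outputs are canonical notations.\<close>

definition pvf :: "nat \<Rightarrow> (bool list list \<Rightarrow> bool list) \<Rightarrow> nat list \<Rightarrow> nat" where
  "pvf k F ns = (if length ns = k then val (F (map bin ns)) else 0)"

lemma PV_fun_pvf: "polytime k F \<Longrightarrow> PV_fun k (pvf k F)"
  by (rule PV_funI[where F = "\<lambda>xs. bin (val (F xs))"]) (auto simp: pvf_def intro: pt)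

lemma pvf_eq: "length ns = k \<Longrightarrow> pvf k F ns = val (F (map bin ns))"
  by (simp add: pvf_def)

lemma PV_fun_leq: "PV_fun 2 leq_fun"
  by (rule PV_funI[where F = "\<lambda>xs. if val (xs ! 0) \<le> val (xs ! 1) then [True] else []"])
    (auto simp: leq_fun_def intro!: pt)

lemma polytime_PV_fun:
  assumes "PV_fun k f" "length gs = k" "\<And>g. g \<in> set gs \<Longrightarrow> polytime m (\<lambda>xs. bin (g xs))"
  shows "polytime m (\<lambda>xs. bin (f (map (\<lambda>g. g xs) gs)))"
proof -
  obtain c p where c: "query_free c" "\<And>ns. length ns = k \<Longrightarrow> runs (\<lambda>_. []) c p (map bin ns) (bin (f ns))"
    using assms(1) unfolding PV_fun_def by blast
  show ?thesis
  proof (rule polytime_comp_gen[where d = c and q = p and gs = "map (\<lambda>g xs. bin (g xs)) gs"])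
    fix xs :: "bool list list"
    show "runs (\<lambda>_. []) c p (map (\<lambda>g. g xs) (map (\<lambda>g xs. bin (g xs)) gs)) (bin (f (map (\<lambda>g. g xs) gs)))"
      using c(2)[of "map (\<lambda>g. g xs) gs"] assms(2) by (simp add: comp_def)
  qed (use c assms(3) in auto)
qed

abbreviation env :: "bool list list \<Rightarrow> nat \<Rightarrow> nat" where
  "env xs \<equiv> (\<lambda>i. val (xs ! i))"

lemma case_nat_env: "case_nat (val z) (env xs) = env (z # xs)"
  by (rule ext) (simp split: nat.split)

lemma polytime_term:
  assumes "wf_tm t" "fv_tm t \<subseteq> {..<k}"
  shows "polytime k (\<lambda>xs. bin (eval_tm (env xs) t))"
  using assms
proof (induction t)
  case (App m f ts)
  have "polytime k (\<lambda>xs. bin (f (map (\<lambda>g. g xs) (map (\<lambda>t xs. eval_tm (env xs) t) ts))))"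
  proof (rule polytime_PV_fun)
    fix g assume "g \<in> set (map (\<lambda>t xs. eval_tm (env xs) t) ts)"
    then show "polytime k (\<lambda>xs. bin (g xs))" using App by auto
  qed (use App.prems in auto)
  then show ?case by (simp add: comp_def)
qed (auto intro!: pt)


section \<open>Closure properties of the polynomial hierarchy\<close>

section \<open>Relations of the polynomial hierarchy\<close>

text \<open>\<open>Sig j k B\<close> says that the \<open>k\<close>-ary relation \<open>B\<close> is \<open>\<Sigma>\<^sub>j\<close>. The quantified string is put in
  front of the parameters, matching de Bruijn indices, and its bound may depend on all of them.
  Membership in \<open>\<Pi>\<^sub>j\<close> is expressed by applying \<open>Sig\<close> to the complement.\<close>

fun Sig :: "nat \<Rightarrow> nat \<Rightarrow> (bool list list \<Rightarrow> bool) \<Rightarrow> bool" where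
  "Sig 0 k B = polytime_pred k B"
| "Sig (Suc j) k B = (\<exists>C q. Sig j (Suc k) C \<and>
    (\<forall>xs. length xs = k \<longrightarrow> (B xs \<longleftrightarrow> (\<exists>z. length z \<le> poly q (sz xs) \<and> \<not> C (z # xs)))))"

lemma SigI:
  assumes "Sig j (Suc k) C"
    and "\<And>xs. length xs = k \<Longrightarrow> B xs \<longleftrightarrow> (\<exists>z. length z \<le> poly q (sz xs) \<and> \<not> C (z # xs))"
  shows "Sig (Suc j) k B"
  using assms by auto

lemma Sig_cong: "(\<And>xs. length xs = k \<Longrightarrow> B xs \<longleftrightarrow> B' xs) \<Longrightarrow> Sig j k B \<longleftrightarrow> Sig j k B'"
proof (cases j)
  case 0
  assume "\<And>xs. length xs = k \<Longrightarrow> B xs \<longleftrightarrow> B' xs"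
  then show ?thesis using 0 polytime_pred_cong[of k B B'] by simp
qed simp

lemma map_nth_Suc: "length ys = Suc k \<Longrightarrow> map (\<lambda>i. ys ! Suc i) [0..<k] = tl ys"
  by (rule nth_equalityI) (auto simp: nth_tl)

lemma polytime_tl_args [pt]: "polytime k f \<Longrightarrow> polytime (Suc k) (\<lambda>ys. f (tl ys))"
  by (rule polytime_subst[where gs = "map (\<lambda>i ys. ys ! Suc i) [0..<k]"])
    (auto simp: map_nth_Suc comp_def intro: pt)

lemma polytime_pred_tl_args [pt]: "polytime_pred k P \<Longrightarrow> polytime_pred (Suc k) (\<lambda>ys. P (tl ys))"
  unfolding polytime_pred_def by (rule polytime_tl_args)

lemma polytime_pred_short [pt]:
  assumes "polytime k f" "polytime k g"
  shows "polytime_pred k (\<lambda>xs. length (f xs) \<le> poly q (length (g xs)))"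
  using polytime_pred_le[OF assms(1) polytime_clock[OF assms(2)]] by simp

text \<open>A polynomial-time condition is pushed through all quantifiers into the matrix.
  Conjunction and disjunction are treated together because each level complements the relation below
  it.\<close>

lemma Sig_pred:
  assumes "Sig j k B" "polytime_pred k P"
  shows "Sig j k (\<lambda>xs. P xs \<and> B xs)" "Sig j k (\<lambda>xs. P xs \<or> B xs)"
proof -
  have "Sig j k (\<lambda>xs. P xs \<and> B xs) \<and> Sig j k (\<lambda>xs. P xs \<or> B xs)"
    using assms
  proof (induction j arbitrary: k B P)
    case 0
    then show ?case by (auto intro: pt)
  next
    case (Suc j)
    obtain C q where C: "Sig j (Suc k) C"
      "\<And>xs. length xs = k \<Longrightarrow> B xs \<longleftrightarrow> (\<exists>z. length z \<le> poly q (sz xs) \<and> \<not> C (z # xs))"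
      using Suc.prems(1) by auto
    have P: "polytime_pred (Suc k) (\<lambda>ys. \<not> P (tl ys))" using Suc.prems by (intro pt)
    have "Sig (Suc j) k (\<lambda>xs. P xs \<and> B xs)"
      by (rule SigI[where C = "\<lambda>ys. \<not> P (tl ys) \<or> C ys" and q = q])
        (use Suc.IH[OF C(1) P] C(2) in auto)
    \<comment> \<open>When only \<open>P\<close> holds, the empty string is a dummy witness.\<close>
    moreover have "Sig (Suc j) k (\<lambda>xs. P xs \<or> B xs)"
      by (rule SigI[where C = "\<lambda>ys. \<not> P (tl ys) \<and> C ys" and q = q])
        (use Suc.IH[OF C(1) P] C(2) in \<open>auto intro: exI[of _ "[]"]\<close>)
    ultimately show ?case by blast
  qed
  then show "Sig j k (\<lambda>xs. P xs \<and> B xs)" "Sig j k (\<lambda>xs. P xs \<or> B xs)" by auto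
qed

lemma polytime_concat_map:
  "(\<And>g. g \<in> set gs \<Longrightarrow> polytime k g) \<Longrightarrow> polytime k (\<lambda>xs. concat (map (\<lambda>g. g xs) gs))"
  by (rule polytime_comp[OF polytime_concat])

text \<open>After substitution the bound refers to the size of the new arguments. The quantifier
  gets a larger bound in the size of the parameters, and the exact one is checked in the
  matrix.\<close>

lemma Sig_subst:
  assumes "Sig j m B" "length gs = m" "\<And>g. g \<in> set gs \<Longrightarrow> polytime k g"
  shows "Sig j k (\<lambda>xs. B (map (\<lambda>g. g xs) gs))"
  using assms
proof (induction j arbitrary: k m B gs)
  case 0
  then show ?case by (auto intro: polytime_pred_comp[of m B gs k])
next
  case (Suc j)
  obtain C q where C: "Sig j (Suc m) C"
    "\<And>xs. length xs = m \<Longrightarrow> B xs \<longleftrightarrow> (\<exists>z. length z \<le> poly q (sz xs) \<and> \<not> C (z # xs))"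
    using Suc.prems(1) by auto
  let ?gs = "(\<lambda>ys. ys ! 0) # map (\<lambda>g ys. g (tl ys)) gs"
  let ?L = "\<lambda>ys. length (ys ! 0) \<le> poly q (length (concat (map (\<lambda>g. g (tl ys)) gs)))"
  obtain b where b: "\<And>xs. length xs = k \<Longrightarrow> sz (map (\<lambda>g. g xs) gs) \<le> poly b (sz xs)"
    using sz_map_bound[of gs k] Suc.prems(3) by blast
  have "polytime (Suc k) (\<lambda>ys. concat (map (\<lambda>g. g (tl ys)) gs))"
    using polytime_tl_args[OF polytime_concat_map[OF Suc.prems(3)]] by simp
  then have L: "polytime_pred (Suc k) (\<lambda>ys. \<not> ?L ys)"
    by (intro polytime_pred_not polytime_pred_short polytime_nth) auto
  have "Sig j (Suc k) (\<lambda>ys. C (map (\<lambda>g. g ys) ?gs))"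
    by (rule Suc.IH[OF C(1)]) (use Suc.prems in \<open>auto intro: pt\<close>)
  from Sig_pred(2)[OF this L] show ?case
  proof (rule SigI[where q = "pcompose q b"])
    fix xs :: "bool list list" assume xs: "length xs = k"
    have "z \<in> {z. length z \<le> poly q (sz (map (\<lambda>g. g xs) gs))} \<Longrightarrow> length z \<le> poly (pcompose q b) (sz xs)" for z
      using poly_nat_mono[OF b[OF xs], of q] by (auto simp: poly_pcompose)
    then show "B (map (\<lambda>g. g xs) gs) \<longleftrightarrow> (\<exists>z. length z \<le> poly (pcompose q b) (sz xs) \<and>
      \<not> (\<not> ?L (z # xs) \<or> C (map (\<lambda>g. g (z # xs)) ?gs)))"
      using C(2)[of "map (\<lambda>g. g xs) gs"] Suc.prems(2) by (auto simp: length_concat comp_def)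
  qed
qed

lemma Sig_substI:
  assumes "Sig j m B" "length gs = m" "\<And>g. g \<in> set gs \<Longrightarrow> polytime k g"
    and "\<And>xs. length xs = k \<Longrightarrow> map (\<lambda>g. g xs) gs = h xs"
  shows "Sig j k (\<lambda>xs. B (h xs))"
proof -
  have "B (map (\<lambda>g. g xs) gs) \<longleftrightarrow> B (h xs)" if "length xs = k" for xs
    unfolding assms(4)[OF that] ..
  from Sig_cong[of k "\<lambda>xs. B (map (\<lambda>g. g xs) gs)" "\<lambda>xs. B (h xs)" j, OF this]
  show ?thesis using Sig_subst[OF assms(1-3)] by blast
qed

lemma Sig_tl: "Sig j k B \<Longrightarrow> Sig j (Suc k) (\<lambda>ys. B (tl ys))"
  by (rule Sig_substI[where gs = "map (\<lambda>i ys. ys ! Suc i) [0..<k]"])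
    (auto simp: map_nth_Suc comp_def intro: pt)

text \<open>The quantifier is a dummy: with bound 0 it ranges over the empty string alone, and the
  complement built into \<open>Sig\<close> supplies the negation.\<close>

lemma Sig_neg: "Sig j k B \<Longrightarrow> Sig (Suc j) k (\<lambda>xs. \<not> B xs)"
  by (rule SigI[where C = "\<lambda>ys. B (tl ys)" and q = 0]) (auto intro: Sig_tl)

lemma Sig_Suc: "Sig j k B \<Longrightarrow> Sig (Suc j) k B"
proof (induction j arbitrary: k B)
  case 0
  then have "Sig 0 k (\<lambda>xs. \<not> B xs)" by (auto intro: pt)
  from Sig_neg[OF this] show ?case by simp
next
  case (Suc j)
  obtain C q where C: "Sig j (Suc k) C"
    "\<And>xs. length xs = k \<Longrightarrow> B xs \<longleftrightarrow> (\<exists>z. length z \<le> poly q (sz xs) \<and> \<not> C (z # xs))"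
    using Suc.prems by auto
  show ?case by (rule SigI[OF Suc.IH[OF C(1)] C(2)])
qed

lemma Sig_le: "i \<le> j \<Longrightarrow> Sig i k B \<Longrightarrow> Sig j k B"
  by (induction rule: dec_induct) (auto intro: Sig_Suc simp del: Sig.simps)

text \<open>The quantified string may code several strings; \<open>fs\<close> decodes them in front
  of the unchanged parameters.\<close>

lemma Sig_head:
  assumes "Sig j (length fs + k) C" "\<And>f. f \<in> set fs \<Longrightarrow> polytime (Suc k) f"
  shows "Sig j (Suc k) (\<lambda>ys. C (map (\<lambda>f. f ys) fs @ tl ys))"
  by (rule Sig_substI[OF assms(1), where gs = "fs @ map (\<lambda>i ys. ys ! Suc i) [0..<k]"])
    (use assms(2) in \<open>auto simp: map_nth_Suc comp_def intro: pt\<close>)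

lemma polytime_pred_sz [pt]:
  assumes "polytime (Suc k) f"
  shows "polytime_pred (Suc k) (\<lambda>ys. length (f ys) \<le> poly q (sz (tl ys)))"
  using polytime_pred_le[OF assms polytime_tl_args[OF polytime_sz_clock[of k q]]] by simp

text \<open>The two leading quantifiers merge into one over pairs, the bounds on the components
  moving into the matrix. Conjunction and disjunction change places at each level, hence the joint
  induction.\<close>

lemma Sig_conj_disj:
  assumes "Sig j k B1" "Sig j k B2"
  shows "Sig j k (\<lambda>xs. B1 xs \<and> B2 xs)" "Sig j k (\<lambda>xs. B1 xs \<or> B2 xs)"
proof -
  have "Sig j k (\<lambda>xs. B1 xs \<and> B2 xs) \<and> Sig j k (\<lambda>xs. B1 xs \<or> B2 xs)"
    using assms
  proof (induction j arbitrary: k B1 B2)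
    case 0
    then show ?case by (auto intro: pt)
  next
    case (Suc j)
    obtain C1 q1 where C1: "Sig j (Suc k) C1"
      "\<And>xs. length xs = k \<Longrightarrow> B1 xs \<longleftrightarrow> (\<exists>z. length z \<le> poly q1 (sz xs) \<and> \<not> C1 (z # xs))"
      using Suc.prems(1) by auto
    obtain C2 q2 where C2: "Sig j (Suc k) C2"
      "\<And>xs. length xs = k \<Longrightarrow> B2 xs \<longleftrightarrow> (\<exists>z. length z \<le> poly q2 (sz xs) \<and> \<not> C2 (z # xs))"
      using Suc.prems(2) by auto
    let ?L1 = "\<lambda>ys. length (pfst (ys ! 0)) \<le> poly q1 (sz (tl ys))"
    let ?L2 = "\<lambda>ys. length (psnd (ys ! 0)) \<le> poly q2 (sz (tl ys))"
    let ?C1 = "\<lambda>ys. C1 (map (\<lambda>f. f ys) [\<lambda>ys. pfst (ys ! 0)] @ tl ys)"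
    let ?C2 = "\<lambda>ys. C2 (map (\<lambda>f. f ys) [\<lambda>ys. psnd (ys ! 0)] @ tl ys)"
    \<comment> \<open>A pair has length 1 + 2|u| + |v|.\<close>
    let ?q = "1 + 2 * q1 + q2"
    have L1: "polytime_pred (Suc k) (\<lambda>ys. \<not> ?L1 ys)" and L2: "polytime_pred (Suc k) (\<lambda>ys. \<not> ?L2 ys)"
      by (intro pt; simp)+
    have S1: "Sig j (Suc k) ?C1" by (rule Sig_head) (use C1 in \<open>auto intro: pt\<close>)
    have S2: "Sig j (Suc k) ?C2" by (rule Sig_head) (use C2 in \<open>auto intro: pt\<close>)
    note D1 = Sig_pred(2)[OF S1 L1] and D2 = Sig_pred(2)[OF S2 L2]
    have pair_in: "length (pair u v) \<le> poly ?q n" if "length u \<le> poly q1 n" "length v \<le> poly q2 n" for u v n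
      using that by simp
    have "Sig (Suc j) k (\<lambda>xs. B1 xs \<and> B2 xs)"
    proof (rule SigI[where q = ?q])
      show "Sig j (Suc k) (\<lambda>ys. (\<not> ?L1 ys \<or> ?C1 ys) \<or> (\<not> ?L2 ys \<or> ?C2 ys))"
        using Suc.IH[OF D1 D2] by blast
      fix xs :: "bool list list" assume xs: "length xs = k"
      show "(B1 xs \<and> B2 xs) \<longleftrightarrow> (\<exists>z. length z \<le> poly ?q (sz xs) \<and> \<not> ((\<not> ?L1 (z # xs) \<or> ?C1 (z # xs)) \<or>
         (\<not> ?L2 (z # xs) \<or> ?C2 (z # xs))))"
      proof
        assume "B1 xs \<and> B2 xs"
        then obtain u v where "length u \<le> poly q1 (sz xs)" "\<not> C1 (u # xs)" "length v \<le> poly q2 (sz xs)" "\<not> C2 (v # xs)"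
          using C1(2)[OF xs] C2(2)[OF xs] by blast
        then show "\<exists>z. length z \<le> poly ?q (sz xs) \<and> \<not> ((\<not> ?L1 (z # xs) \<or> ?C1 (z # xs)) \<or>
         (\<not> ?L2 (z # xs) \<or> ?C2 (z # xs)))"
          using pair_in by (intro exI[of _ "pair u v"]) simp
      qed (use C1(2)[OF xs] C2(2)[OF xs] in auto)
    qed
    moreover have "Sig (Suc j) k (\<lambda>xs. B1 xs \<or> B2 xs)"
    proof (rule SigI[where q = ?q])
      show "Sig j (Suc k) (\<lambda>ys. (\<not> ?L1 ys \<or> ?C1 ys) \<and> (\<not> ?L2 ys \<or> ?C2 ys))"
        using Suc.IH[OF D1 D2] by blast
      fix xs :: "bool list list" assume xs: "length xs = k"
      show "(B1 xs \<or> B2 xs) \<longleftrightarrow> (\<exists>z. length z \<le> poly ?q (sz xs) \<and> \<not> ((\<not> ?L1 (z # xs) \<or> ?C1 (z # xs)) \<and>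
         (\<not> ?L2 (z # xs) \<or> ?C2 (z # xs))))"
      proof
        assume "B1 xs \<or> B2 xs"
        then show "\<exists>z. length z \<le> poly ?q (sz xs) \<and> \<not> ((\<not> ?L1 (z # xs) \<or> ?C1 (z # xs)) \<and>
         (\<not> ?L2 (z # xs) \<or> ?C2 (z # xs)))"
        proof
          assume "B1 xs"
          then obtain u where "length u \<le> poly q1 (sz xs)" "\<not> C1 (u # xs)" using C1(2)[OF xs] by blast
          then show ?thesis using pair_in[of u "sz xs" "[]"] by (intro exI[of _ "pair u []"]) simp
        next
          assume "B2 xs"
          then obtain v where "length v \<le> poly q2 (sz xs)" "\<not> C2 (v # xs)" using C2(2)[OF xs] by blast
          then show ?thesis using pair_in[of "[]" "sz xs" v] by (intro exI[of _ "pair [] v"]) simp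
        qed
      qed (use C1(2)[OF xs] C2(2)[OF xs] in auto)
    qed
    ultimately show ?case by blast
  qed
  then show "Sig j k (\<lambda>xs. B1 xs \<and> B2 xs)" "Sig j k (\<lambda>xs. B1 xs \<or> B2 xs)" by auto
qed

text \<open>Adjacent existential quantifiers contract to one over pairs, so no level is
  lost.\<close>

lemma Sig_bex:
  assumes "Sig (Suc j) (Suc k) B"
  shows "Sig (Suc j) k (\<lambda>xs. \<exists>u. length u \<le> poly r (sz xs) \<and> B (u # xs))"
proof -
  obtain C q where C: "Sig j (Suc (Suc k)) C"
    "\<And>xs. length xs = Suc k \<Longrightarrow> B xs \<longleftrightarrow> (\<exists>z. length z \<le> poly q (sz xs) \<and> \<not> C (z # xs))"
    using assms by auto
  let ?L1 = "\<lambda>ys. length (pfst (ys ! 0)) \<le> poly r (sz (tl ys))"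
  let ?L2 = "\<lambda>ys. length (psnd (ys ! 0)) \<le> poly q (length (pfst (ys ! 0) @ concat (tl ys)))"
  let ?C = "\<lambda>ys. C (map (\<lambda>f. f ys) [\<lambda>ys. psnd (ys ! 0), \<lambda>ys. pfst (ys ! 0)] @ tl ys)"
  \<comment> \<open>The bound on the second component depends on the first: it is \<open>q\<close>
    of |u| plus the size of the parameters, where |u| is bounded by \<open>r\<close>.\<close>
  let ?q = "1 + 2 * r + pcompose q (r + [:0, 1:])"
  have "polytime_pred (Suc k) (\<lambda>ys. ?L1 ys \<and> ?L2 ys)"
    by (intro pt polytime_tl_args[OF polytime_concat]; simp)
  then have L: "polytime_pred (Suc k) (\<lambda>ys. \<not> (?L1 ys \<and> ?L2 ys))" by (rule polytime_pred_not)
  have S: "Sig j (Suc k) ?C" by (rule Sig_head) (use C in \<open>auto intro: pt\<close>)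
  show ?thesis
  proof (rule SigI[OF Sig_pred(2)[OF S L], where q = ?q])
    fix xs :: "bool list list" assume xs: "length xs = k"
    show "(\<exists>u. length u \<le> poly r (sz xs) \<and> B (u # xs)) \<longleftrightarrow>
      (\<exists>z. length z \<le> poly ?q (sz xs) \<and> \<not> (\<not> (?L1 (z # xs) \<and> ?L2 (z # xs)) \<or> ?C (z # xs)))"
      (is "?l \<longleftrightarrow> ?r")
    proof
      assume ?l
      then obtain u z where u: "length u \<le> poly r (sz xs)" "length z \<le> poly q (length u + sz xs)" "\<not> C (z # u # xs)"
        using C(2)[of "_ # xs"] xs by auto
      have "poly q (length u + sz xs) \<le> poly q (poly r (sz xs) + sz xs)"
        using u(1) by (intro poly_nat_mono) simp
      then have "length (pair u z) \<le> poly ?q (sz xs)"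
        using u by (simp add: poly_pcompose)
      then show ?r using u by (intro exI[of _ "pair u z"]) (simp add: length_concat)
    next
      assume ?r
      then show ?l using C(2)[of "_ # xs"] xs by (auto simp: length_concat)
    qed
  qed
qed


subsection \<open>Prenex form with a uniform bound\<close>

text \<open>De Morgan for whole blocks. The two sides may arrange the parameters differently, as
  \<open>a\<close> and as \<open>b\<close>, and a fixed condition \<open>c\<close> may be pulled out
  of all quantifiers because their domains are nonempty.\<close>

lemma ex_all_alt_dual:
  assumes "\<And>ws. length ws = j \<Longrightarrow> P' (a @ ws) \<longleftrightarrow> c \<and> \<not> P (b @ ws)"
  shows "all_alt m j P' a \<longleftrightarrow> c \<and> \<not> ex_alt m j P b" "ex_alt m j P' a \<longleftrightarrow> c \<and> \<not> all_alt m j P b"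
proof -
  have "(all_alt m j P' a \<longleftrightarrow> c \<and> \<not> ex_alt m j P b) \<and> (ex_alt m j P' a \<longleftrightarrow> c \<and> \<not> all_alt m j P b)"
    using assms
  proof (induction j arbitrary: a b)
    case 0
    then show ?case using 0[of "[]"] by simp
  next
    case (Suc j)
    have "P' ((a @ [z]) @ ws) \<longleftrightarrow> c \<and> \<not> P ((b @ [z]) @ ws)" if "length ws = j" for z ws
      using Suc.prems[of "z # ws"] that by simp
    then have IH: "(all_alt m j P' (a @ [z]) \<longleftrightarrow> c \<and> \<not> ex_alt m j P (b @ [z])) \<and>
      (ex_alt m j P' (a @ [z]) \<longleftrightarrow> c \<and> \<not> all_alt m j P (b @ [z]))" for z
      by (intro Suc.IH) blast
    have "length ([] :: bool list) \<le> m" by simp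
    then show ?case unfolding all_alt.simps ex_alt.simps using IH by blast
  qed
  then show "all_alt m j P' a \<longleftrightarrow> c \<and> \<not> ex_alt m j P b" "ex_alt m j P' a \<longleftrightarrow> c \<and> \<not> all_alt m j P b"
    by auto
qed

lemma polytime_pred_args:
  assumes "polytime_pred m P" "\<And>i. i < m \<Longrightarrow> \<sigma> i < n"
  shows "polytime_pred n (\<lambda>ys. P (map (\<lambda>i. ys ! \<sigma> i) [0..<m]))"
  by (rule polytime_pred_comp[OF assms(1), where gs = "map (\<lambda>i ys. ys ! \<sigma> i) [0..<m]"])
    (use assms(2) in \<open>auto intro: pt\<close>)

text \<open>The bounds in \<open>Sig\<close> depend on strings quantified earlier, whereas a block
  has one bound. Every sufficiently large \<open>m\<close> will do, since the exact bounds are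
  checked in the matrix.\<close>

lemma Sig_ex_alt:
  assumes "Sig j k B"
  shows "\<exists>P q. polytime_pred (k + j) P \<and>
    (\<forall>xs m. length xs = k \<longrightarrow> poly q (sz xs) \<le> m \<longrightarrow> (B xs \<longleftrightarrow> ex_alt m j P xs))"
  using assms
proof (induction j arbitrary: k B)
  case (Suc j)
  obtain C q where C: "Sig j (Suc k) C"
    "\<And>xs. length xs = k \<Longrightarrow> B xs \<longleftrightarrow> (\<exists>z. length z \<le> poly q (sz xs) \<and> \<not> C (z # xs))"
    using Suc.prems by auto
  obtain P r where P: "polytime_pred (Suc k + j) P"
    "\<And>xs m. length xs = Suc k \<Longrightarrow> poly r (sz xs) \<le> m \<Longrightarrow> C xs \<longleftrightarrow> ex_alt m j P xs"
    using Suc.IH[OF C(1)] by blast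
  \<comment> \<open>A block appends the quantified string after the \<open>k\<close> parameters,
    \<open>Sig\<close> expects it in front of them.\<close>
  let ?\<sigma> = "\<lambda>i. if i = 0 then k else if i \<le> k then i - 1 else i"
  let ?Q = "\<lambda>ys. \<not> P (map (\<lambda>i. ys ! ?\<sigma> i) [0..<Suc k + j])"
  let ?L = "\<lambda>ys. length (ys ! k) \<le> poly q (length (concat (map (\<lambda>g. g ys) (map (\<lambda>i ys. ys ! i) [0..<k]))))"
  \<comment> \<open>Large enough for \<open>z\<close> itself and for the strings quantified below
    it, whose parameters include \<open>z\<close>.\<close>
  let ?q = "q + pcompose r (q + [:0, 1:])"
  have "polytime_pred (k + Suc j) ?Q"
    by (rule polytime_pred_not, rule polytime_pred_args[OF P(1)]) auto
  moreover have "polytime_pred (k + Suc j) ?L"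
    by (intro pt polytime_concat_map) (auto intro: pt)
  ultimately have Q: "polytime_pred (k + Suc j) (\<lambda>ys. ?L ys \<and> ?Q ys)" by (intro polytime_pred_conj)
  show ?case
  proof (intro exI[of _ "\<lambda>ys. ?L ys \<and> ?Q ys"] exI[of _ ?q] conjI Q allI impI)
    fix xs :: "bool list list" and m
    assume xs: "length xs = k" and m: "poly ?q (sz xs) \<le> m"
    have qm: "poly q (sz xs) \<le> m" using m by simp
    have L: "?L (xs @ [z] @ ws) \<longleftrightarrow> length z \<le> poly q (sz xs)" for z ws
    proof -
      have "map (\<lambda>i. (xs @ [z] @ ws) ! i) [0..<k] = xs"
        using xs by (intro nth_equalityI) (auto simp: nth_append)
      then show ?thesis using xs by (simp add: comp_def length_concat nth_append)
    qed
    have Q: "map (\<lambda>i. (xs @ [z] @ ws) ! ?\<sigma> i) [0..<Suc k + j] = z # xs @ ws" if "length ws = j" for z ws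
    proof (rule nth_equalityI)
      fix i assume "i < length (map (\<lambda>i. (xs @ [z] @ ws) ! ?\<sigma> i) [0..<Suc k + j])"
      then have i: "i < Suc k + j" by simp
      consider "i = 0" | i' where "i = Suc i'" "i' < k" | i' where "i = Suc i'" "k \<le> i'"
        by (cases i) force+
      then have *: "(xs @ [z] @ ws) ! ?\<sigma> i = (z # xs @ ws) ! i"
        using xs by cases (simp_all add: nth_append Suc_diff_le)
      have "map (\<lambda>i. (xs @ [z] @ ws) ! ?\<sigma> i) [0..<Suc k + j] ! i = (xs @ [z] @ ws) ! ?\<sigma> i"
        using i by (simp del: upt_Suc)
      then show "map (\<lambda>i. (xs @ [z] @ ws) ! ?\<sigma> i) [0..<Suc k + j] ! i = (z # xs @ ws) ! i"
        using * by (rule trans)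
    qed (use xs that in simp)
    have alt: "all_alt m j (\<lambda>ys. ?L ys \<and> ?Q ys) (xs @ [z]) \<longleftrightarrow>
      length z \<le> poly q (sz xs) \<and> \<not> ex_alt m j P (z # xs)" for z
    proof (rule ex_all_alt_dual(1))
      fix ws :: "bool list list" assume "length ws = j"
      then show "(?L ((xs @ [z]) @ ws) \<and> ?Q ((xs @ [z]) @ ws)) \<longleftrightarrow>
        length z \<le> poly q (sz xs) \<and> \<not> P ((z # xs) @ ws)"
        using L[of z ws] Q[of ws z] by (simp only: append_assoc) simp
    qed
    have "C (z # xs) \<longleftrightarrow> ex_alt m j P (z # xs)" if "length z \<le> poly q (sz xs)" for z
    proof (rule P(2))
      have "poly r (sz (z # xs)) \<le> poly r (poly q (sz xs) + sz xs)"
        using that by (intro poly_nat_mono) simp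
      then show "poly r (sz (z # xs)) \<le> m" using m by (simp add: poly_pcompose)
    qed (use xs in simp)
    then show "B xs \<longleftrightarrow> ex_alt m (Suc j) (\<lambda>ys. ?L ys \<and> ?Q ys) xs"
      unfolding ex_alt.simps alt C(2)[OF xs] using qm by (meson order_trans)
  qed
qed auto

text \<open>All quantifiers of a block share the bound computed from the original parameters. Giving
  it as the length of a string function lets the induction carry it past the strings put in
  front.\<close>

lemma ex_alt_Sig:
  assumes "polytime_pred (k + j) P" "polytime k b"
  shows "Sig j k (\<lambda>xs. ex_alt (length (b xs)) j P xs)"
  using assms
proof (induction j arbitrary: k P b)
  case (Suc j)
  let ?\<sigma> = "\<lambda>i. if i < k then Suc i else if i = k then 0 else i"
  let ?P = "\<lambda>ys. \<not> P (map (\<lambda>i. ys ! ?\<sigma> i) [0..<k + Suc j])"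
  let ?C = "\<lambda>ys. ex_alt (length (b (tl ys))) j ?P ys"
  have "polytime_pred (Suc k + j) ?P"
    by (rule polytime_pred_not, rule polytime_pred_args[OF Suc.prems(1)]) auto
  then have S: "Sig j (Suc k) ?C"
    by (rule Suc.IH) (intro pt Suc.prems)
  have L: "polytime_pred (Suc k) (\<lambda>ys. \<not> length (ys ! 0) \<le> length (b (tl ys)))"
    by (intro pt Suc.prems) simp
  obtain q where q: "\<And>xs. length xs = k \<Longrightarrow> length (b xs) \<le> poly q (sz xs)"
    using polytime_length[OF Suc.prems(2)] by blast
  show ?case
  proof (rule SigI[OF Sig_pred(2)[OF S L], where q = q])
    fix xs :: "bool list list" assume xs: "length xs = k"
    have "map (\<lambda>i. ((z # xs) @ ws) ! ?\<sigma> i) [0..<k + Suc j] = (xs @ [z]) @ ws" if "length ws = j" for z ws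
    proof (rule nth_equalityI)
      fix i assume "i < length (map (\<lambda>i. ((z # xs) @ ws) ! ?\<sigma> i) [0..<k + Suc j])"
      then have i: "i < k + Suc j" by simp
      consider "i < k" | "i = k" | i' where "i = Suc i'" "k \<le> i'"
        by (cases i) force+
      then have *: "((z # xs) @ ws) ! ?\<sigma> i = ((xs @ [z]) @ ws) ! i"
        using xs by cases (simp_all add: nth_append Suc_diff_le)
      have "map (\<lambda>i. ((z # xs) @ ws) ! ?\<sigma> i) [0..<k + Suc j] ! i = ((z # xs) @ ws) ! ?\<sigma> i"
        using i by (simp del: upt_Suc)
      then show "map (\<lambda>i. ((z # xs) @ ws) ! ?\<sigma> i) [0..<k + Suc j] ! i = ((xs @ [z]) @ ws) ! i"
        using * by (rule trans)
    qed (use xs that in simp)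
    then have "ex_alt m j ?P (z # xs) \<longleftrightarrow> True \<and> \<not> all_alt m j P (xs @ [z])" for m z
      by (intro ex_all_alt_dual(2)) (simp only: simp_thms)
    then show "ex_alt (length (b xs)) (Suc j) P xs \<longleftrightarrow> (\<exists>z. length z \<le> poly q (sz xs) \<and>
      \<not> (\<not> length ((z # xs) ! 0) \<le> length (b (tl (z # xs))) \<or> ?C (z # xs)))"
      using q[OF xs] by (auto intro: order_trans)
  qed
qed simp


lemma PiP_iff_Sig: "R \<in> PiP j \<longleftrightarrow> Sig j 2 (\<lambda>xs. \<not> R (xs ! 0) (xs ! 1))"
proof
  assume "R \<in> PiP j"
  then obtain P q where P: "polytime_pred (j + 2) P"
    "\<And>x y. R x y \<longleftrightarrow> all_alt (poly q (length x + length y)) j P [x, y]"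
    unfolding PiP_def by blast
  have "polytime_pred (2 + j) (\<lambda>ys. \<not> P ys)" using P(1) by (intro pt) (simp add: add.commute)
  from ex_alt_Sig[OF this polytime_sz_clock[of 2 q]]
  show "Sig j 2 (\<lambda>xs. \<not> R (xs ! 0) (xs ! 1))"
  proof (rule Sig_cong[THEN iffD1, rotated])
    fix xs :: "bool list list" assume "length xs = 2"
    then obtain x y where xs: "xs = [x, y]" by (rule length_2_E)
    have "ex_alt m j (\<lambda>ys. \<not> P ys) [x, y] \<longleftrightarrow> True \<and> \<not> all_alt m j P [x, y]" for m
      by (rule ex_all_alt_dual(2)) simp
    then show "ex_alt (length (replicate (poly q (sz xs)) True)) j (\<lambda>ys. \<not> P ys) xs \<longleftrightarrow> \<not> R (xs ! 0) (xs ! 1)"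
      using P(2)[of x y] by (simp add: xs)
  qed
next
  assume "Sig j 2 (\<lambda>xs. \<not> R (xs ! 0) (xs ! 1))"
  from Sig_ex_alt[OF this] obtain P q where P: "polytime_pred (2 + j) P"
    "\<And>xs m. length xs = 2 \<Longrightarrow> poly q (sz xs) \<le> m \<Longrightarrow> (\<not> R (xs ! 0) (xs ! 1)) \<longleftrightarrow> ex_alt m j P xs"
    by blast
  have "polytime_pred (j + 2) (\<lambda>ys. \<not> P ys)" using P(1) by (intro pt) (simp add: add.commute)
  moreover have "R x y \<longleftrightarrow> all_alt (poly q (length x + length y)) j (\<lambda>ys. \<not> P ys) [x, y]" for x y
  proof -
    have "all_alt m j (\<lambda>ys. \<not> P ys) [x, y] \<longleftrightarrow> True \<and> \<not> ex_alt m j P [x, y]" for m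
      by (rule ex_all_alt_dual(1)) simp
    moreover have "(\<not> R x y) \<longleftrightarrow> ex_alt (poly q (length x + length y)) j P [x, y]"
      using P(2)[of "[x, y]" "poly q (length x + length y)"] by simp
    ultimately show ?thesis by blast
  qed
  ultimately show "R \<in> PiP j" unfolding PiP_def by blast
qed

lemma SigmaP_if_Sig:
  assumes "Sig j 1 (\<lambda>xs. xs ! 0 \<in> A)" shows "A \<in> SigmaP j"
proof -
  from Sig_ex_alt[OF assms] obtain P q where P: "polytime_pred (1 + j) P"
    "\<And>xs m. length xs = 1 \<Longrightarrow> poly q (sz xs) \<le> m \<Longrightarrow> xs ! 0 \<in> A \<longleftrightarrow> ex_alt m j P xs"
    by blast
  have "x \<in> A \<longleftrightarrow> ex_alt (poly q (length x)) j P [x]" for x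
    using P(2)[of "[x]" "poly q (length x)"] by simp
  then show ?thesis using P(1) unfolding SigmaP_def by (auto simp: add.commute)
qed


section \<open>Bounded formulas and the relations they define\<close>

section \<open>Substitution and bounded formulas\<close>

lemma eval_tm_cong: "(\<And>n. n \<in> fv_tm t \<Longrightarrow> e n = e' n) \<Longrightarrow> eval_tm e t = eval_tm e' t"
proof (induction t)
  case (App k f ts)
  then have "map (eval_tm e) ts = map (eval_tm e') ts" by auto
  then show ?case by (simp only: eval_tm.simps)
qed auto

lemma sat_cong: "(\<And>n. n \<in> fv_fm \<phi> \<Longrightarrow> e n = e' n) \<Longrightarrow> sat e \<phi> \<longleftrightarrow> sat e' \<phi>"
proof (induction \<phi> arbitrary: e e')
  case (Eq t u)
  then show ?case using eval_tm_cong[of t e e'] eval_tm_cong[of u e e'] by auto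
next
  case (Neg \<phi>)
  then show ?case by (metis fv_fm.simps(2) sat.simps(2))
next
  case (Conj \<phi>1 \<phi>2)
  then show ?case by (metis UnCI fv_fm.simps(3) sat.simps(3))
next
  case (Disj \<phi>1 \<phi>2)
  then show ?case by (metis UnCI fv_fm.simps(4) sat.simps(4))
next
  case (Exists \<phi>)
  have "sat (case_nat n e) \<phi> \<longleftrightarrow> sat (case_nat n e') \<phi>" for n
    by (rule Exists.IH) (use Exists.prems in \<open>auto split: nat.split\<close>)
  then show ?case by simp
next
  case (Forall \<phi>)
  have "sat (case_nat n e) \<phi> \<longleftrightarrow> sat (case_nat n e') \<phi>" for n
    by (rule Forall.IH) (use Forall.prems in \<open>auto split: nat.split\<close>)
  then show ?case by simp
qed

lemma eval_tm_subst [simp]: "eval_tm e (subst_tm \<sigma> t) = eval_tm (\<lambda>n. eval_tm e (\<sigma> n)) t"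
  by (induction t) (auto simp: comp_def cong: map_cong)

lemma eval_lift_subst:
  "(\<lambda>i. eval_tm (case_nat n e) (lift_subst \<sigma> i)) = case_nat n (\<lambda>i. eval_tm e (\<sigma> i))"
  by (rule ext) (simp add: lift_subst_def split: nat.split)

lemma sat_subst [simp]: "sat e (subst_fm \<sigma> \<phi>) \<longleftrightarrow> sat (\<lambda>n. eval_tm e (\<sigma> n)) \<phi>"
  by (induction \<phi> arbitrary: e \<sigma>) (simp_all add: eval_lift_subst)

lemma subst_tm_comp: "subst_tm \<sigma> (subst_tm \<tau> t) = subst_tm (\<lambda>n. subst_tm \<sigma> (\<tau> n)) t"
  by (induction t) auto

lemma lift_subst_comp:
  "(\<lambda>n. subst_tm (lift_subst \<sigma>) (lift_subst \<tau> n)) = lift_subst (\<lambda>n. subst_tm \<sigma> (\<tau> n))"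
  by (rule ext) (simp add: lift_subst_def subst_tm_comp split: nat.split)

lemma subst_fm_comp: "subst_fm \<sigma> (subst_fm \<tau> \<phi>) = subst_fm (\<lambda>n. subst_tm \<sigma> (\<tau> n)) \<phi>"
  by (induction \<phi> arbitrary: \<sigma> \<tau>) (simp_all add: subst_tm_comp lift_subst_comp)

lemma subst_tm_cong: "(\<And>n. n \<in> fv_tm t \<Longrightarrow> \<sigma> n = \<tau> n) \<Longrightarrow> subst_tm \<sigma> t = subst_tm \<tau> t"
  by (induction t) auto

lemma subst_fm_cong: "(\<And>n. n \<in> fv_fm \<phi> \<Longrightarrow> \<sigma> n = \<tau> n) \<Longrightarrow> subst_fm \<sigma> \<phi> = subst_fm \<tau> \<phi>"
proof (induction \<phi> arbitrary: \<sigma> \<tau>)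
  case (Eq t u)
  then show ?case using subst_tm_cong[of t \<sigma> \<tau>] subst_tm_cong[of u \<sigma> \<tau>] by auto
next
  case (Exists \<phi>)
  have "subst_fm (lift_subst \<sigma>) \<phi> = subst_fm (lift_subst \<tau>) \<phi>"
    by (rule Exists.IH) (use Exists.prems in \<open>auto simp: lift_subst_def split: nat.split\<close>)
  then show ?case by simp
next
  case (Forall \<phi>)
  have "subst_fm (lift_subst \<sigma>) \<phi> = subst_fm (lift_subst \<tau>) \<phi>"
    by (rule Forall.IH) (use Forall.prems in \<open>auto simp: lift_subst_def split: nat.split\<close>)
  then show ?case by simp
next
  case (Neg \<phi>)
  show ?case using Neg.IH[of \<sigma> \<tau>] Neg.prems by simp
next
  case (Conj \<phi>1 \<phi>2)
  show ?case using Conj.IH(1)[of \<sigma> \<tau>] Conj.IH(2)[of \<sigma> \<tau>] Conj.prems by simp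
next
  case (Disj \<phi>1 \<phi>2)
  show ?case using Disj.IH(1)[of \<sigma> \<tau>] Disj.IH(2)[of \<sigma> \<tau>] Disj.prems by simp
qed

lemma subst_tm_Var [simp]: "subst_tm Var t = t"
  by (induction t) (auto simp: map_idI)

lemma lift_subst_Var [simp]: "lift_subst Var = Var"
  by (rule ext) (simp add: lift_subst_def split: nat.split)

lemma subst_fm_Var [simp]: "subst_fm Var \<phi> = \<phi>"
  by (induction \<phi>) auto

lemma wf_subst_tm: "wf_tm t \<Longrightarrow> (\<And>n. wf_tm (\<sigma> n)) \<Longrightarrow> wf_tm (subst_tm \<sigma> t)"
  by (induction t) auto

lemma wf_lift_subst: "(\<And>n. wf_tm (\<sigma> n)) \<Longrightarrow> wf_tm (lift_subst \<sigma> n)"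
  by (auto simp: lift_subst_def intro: wf_subst_tm split: nat.split)

lemma wf_subst_fm: "wf_fm \<phi> \<Longrightarrow> (\<And>n. wf_tm (\<sigma> n)) \<Longrightarrow> wf_fm (subst_fm \<sigma> \<phi>)"
  by (induction \<phi> arbitrary: \<sigma>) (auto simp: wf_subst_tm wf_lift_subst)

lemma fv_subst_tm: "fv_tm (subst_tm \<sigma> t) = (\<Union>n\<in>fv_tm t. fv_tm (\<sigma> n))"
  by (induction t) auto

lemma fv_lift_tm [simp]: "fv_tm (lift_tm t) = Suc ` fv_tm t"
  by (auto simp: fv_subst_tm)

lemma fv_lift_subst: "i \<in> fv_tm (lift_subst \<sigma> n) \<longleftrightarrow>
  (case n of 0 \<Rightarrow> i = 0 | Suc m \<Rightarrow> \<exists>j\<in>fv_tm (\<sigma> m). i = Suc j)"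
  by (auto simp: lift_subst_def split: nat.split)

lemma fv_subst_fm: "fv_fm (subst_fm \<sigma> \<phi>) = (\<Union>n\<in>fv_fm \<phi>. fv_tm (\<sigma> n))"
proof (induction \<phi> arbitrary: \<sigma>)
  case (Exists \<phi>)
  then show ?case
    by (auto simp: fv_lift_subst split: nat.splits) (metis gr0_implies_Suc)
next
  case (Forall \<phi>)
  then show ?case
    by (auto simp: fv_lift_subst split: nat.splits) (metis gr0_implies_Suc)
qed (auto simp: fv_subst_tm)

lemma finite_fv_tm: "finite (fv_tm t)"
  by (induction t) auto

lemma finite_fv_fm: "finite (fv_fm \<phi>)"
proof (induction \<phi>)
  case (Exists \<phi>)
  have "{n. Suc n \<in> fv_fm \<phi>} = Suc -` fv_fm \<phi>" by auto
  then show ?case using Exists by (simp add: finite_vimageI)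
next
  case (Forall \<phi>)
  have "{n. Suc n \<in> fv_fm \<phi>} = Suc -` fv_fm \<phi>" by auto
  then show ?case using Forall by (simp add: finite_vimageI)
qed (auto simp: finite_fv_tm)

lemma subst_sentence: "fv_fm \<chi> = {} \<Longrightarrow> subst_fm \<sigma> \<chi> = \<chi>"
  using subst_fm_cong[of \<chi> \<sigma> Var] by simp

lemma sat_Le [simp]: "sat e (Le t u) \<longleftrightarrow> eval_tm e t \<le> eval_tm e u"
  by (simp add: Le_def leq_fun_def)

lemma wf_Le [simp]: "wf_fm (Le t u) \<longleftrightarrow> wf_tm t \<and> wf_tm u"
  by (auto simp: Le_def PV_fun_leq)

lemma fv_Le [simp]: "fv_fm (Le t u) = fv_tm t \<union> fv_tm u"
  by (auto simp: Le_def)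

lemma wf_lift_tm [simp]: "wf_tm (lift_tm t) \<longleftrightarrow> wf_tm t"
  by (induction t) auto

lemma sat_BExists [simp]:
  "sat e (BExists t \<phi>) \<longleftrightarrow> (\<exists>n\<le>eval_tm e t. sat (case_nat n e) \<phi>)"
  by (auto simp: BExists_def)

lemma sat_BForall [simp]:
  "sat e (BForall t \<phi>) \<longleftrightarrow> (\<forall>n\<le>eval_tm e t. sat (case_nat n e) \<phi>)"
  by (auto simp: BForall_def)

lemma wf_BExists [simp]: "wf_fm (BExists t \<phi>) \<longleftrightarrow> wf_tm t \<and> wf_fm \<phi>"
  by (auto simp: BExists_def)

lemma wf_BForall [simp]: "wf_fm (BForall t \<phi>) \<longleftrightarrow> wf_tm t \<and> wf_fm \<phi>"
  by (auto simp: BForall_def)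

lemma fv_BExists [simp]: "fv_fm (BExists t \<phi>) = fv_tm t \<union> {n. Suc n \<in> fv_fm \<phi>}"
  by (auto simp: BExists_def)

lemma fv_BForall [simp]: "fv_fm (BForall t \<phi>) = fv_tm t \<union> {n. Suc n \<in> fv_fm \<phi>}"
  by (auto simp: BForall_def)

lemma lift_subst_lift: "subst_tm (lift_subst \<sigma>) (lift_tm t) = lift_tm (subst_tm \<sigma> t)"
  by (simp add: subst_tm_comp lift_subst_def)

lemma lift_subst_0 [simp]: "lift_subst \<sigma> 0 = Var 0"
  by (simp add: lift_subst_def)

lemma subst_BExists [simp]:
  "subst_fm \<sigma> (BExists t \<phi>) = BExists (subst_tm \<sigma> t) (subst_fm (lift_subst \<sigma>) \<phi>)"
  by (simp add: BExists_def Le_def lift_subst_lift)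

lemma subst_BForall [simp]:
  "subst_fm \<sigma> (BForall t \<phi>) = BForall (subst_tm \<sigma> t) (subst_fm (lift_subst \<sigma>) \<phi>)"
  by (simp add: BForall_def Le_def lift_subst_lift)

lemma quantifier_free_subst [simp]: "quantifier_free (subst_fm \<sigma> \<phi>) \<longleftrightarrow> quantifier_free \<phi>"
  by (induction \<phi> arbitrary: \<sigma>) auto

lemma SigmaB_PiB_subst:
  "SigmaB j \<phi> \<Longrightarrow> SigmaB j (subst_fm \<sigma> \<phi>)" "PiB j \<psi> \<Longrightarrow> PiB j (subst_fm \<sigma> \<psi>)"
  by (induction j \<phi> and j \<psi> arbitrary: \<sigma> and \<sigma> rule: SigmaB_PiB.inducts)
    (auto intro: SigmaB_PiB.intros)

lemma SigmaB_PiB_0: "SigmaB j \<phi> \<Longrightarrow> j = 0 \<Longrightarrow> quantifier_free \<phi>" "PiB j \<psi> \<Longrightarrow> j = 0 \<Longrightarrow> quantifier_free \<psi>"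
  by (induction j \<phi> and j \<psi> rule: SigmaB_PiB.inducts) auto

lemma SigmaB_le: "i \<le> j \<Longrightarrow> SigmaB i \<phi> \<Longrightarrow> SigmaB j \<phi>"
  by (induction rule: dec_induct) (auto intro: SigmaB_PiB.intros)

lemma PiB_le: "i \<le> j \<Longrightarrow> PiB i \<phi> \<Longrightarrow> PiB j \<phi>"
  by (induction rule: dec_induct) (auto intro: SigmaB_PiB.intros)


subsection \<open>Bounded formulas define the relations of the hierarchy\<close>

lemma bin_inject [simp]: "bin m = bin n \<longleftrightarrow> m = n"
  by (metis val_bin)

lemma polytime_quantifier_free:
  "quantifier_free \<phi> \<Longrightarrow> wf_fm \<phi> \<Longrightarrow> fv_fm \<phi> \<subseteq> {..<k} \<Longrightarrow> polytime_pred k (\<lambda>xs. sat (env xs) \<phi>)"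
proof (induction \<phi>)
  case (Eq t u)
  have "polytime_pred k (\<lambda>xs. bin (eval_tm (env xs) t) = bin (eval_tm (env xs) u))"
    by (intro polytime_pred_eq polytime_term) (use Eq in auto)
  then show ?case by simp
qed (auto intro!: pt)

lemma Sig_bounded_ex:
  assumes t: "wf_tm t" "fv_tm t \<subseteq> {..<k}" and S: "Sig (Suc j) (Suc k) (\<lambda>xs. P (env xs))"
  shows "Sig (Suc j) k (\<lambda>xs. \<exists>n\<le>eval_tm (env xs) t. P (case_nat n (env xs)))"
proof -
  note T = polytime_term[OF t]
  obtain r where r: "\<And>xs. length xs = k \<Longrightarrow> length (bin (eval_tm (env xs) t)) \<le> poly r (sz xs)"
    using polytime_length[OF T] by blast
  have "polytime_pred (Suc k) (\<lambda>ys. val (ys ! 0) \<le> val (bin (eval_tm (env (tl ys)) t)))"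
    by (intro polytime_pred_val_le polytime_nth polytime_tl_args[OF T]) simp
  from Sig_bex[OF Sig_pred(1)[OF S this], of r]
  show ?thesis
  proof (rule Sig_cong[THEN iffD1, rotated])
    fix xs :: "bool list list" assume xs: "length xs = k"
    show "(\<exists>u. length u \<le> poly r (sz xs) \<and> val ((u # xs) ! 0) \<le> val (bin (eval_tm (env (tl (u # xs))) t)) \<and>
        P (env (u # xs))) \<longleftrightarrow> (\<exists>n\<le>eval_tm (env xs) t. P (case_nat n (env xs)))"
    proof
      assume "\<exists>n\<le>eval_tm (env xs) t. P (case_nat n (env xs))"
      then obtain n where n: "n \<le> eval_tm (env xs) t" "P (case_nat n (env xs))" by blast
      have "length (bin n) \<le> poly r (sz xs)"
        using length_bin_mono[OF n(1)] r[OF xs] by linarith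
      moreover have "P (env (bin n # xs))" using n(2) case_nat_env[of "bin n" xs] by simp
      ultimately show "\<exists>u. length u \<le> poly r (sz xs) \<and>
          val ((u # xs) ! 0) \<le> val (bin (eval_tm (env (tl (u # xs))) t)) \<and> P (env (u # xs))"
        using n(1) by (intro exI[of _ "bin n"]) simp
    qed (auto simp flip: case_nat_env)
  qed
qed

lemma Sig_formula:
  "SigmaB j \<phi> \<Longrightarrow> wf_fm \<phi> \<Longrightarrow> fv_fm \<phi> \<subseteq> {..<k} \<Longrightarrow> Sig j k (\<lambda>xs. sat (env xs) \<phi>)"
  "PiB j \<psi> \<Longrightarrow> wf_fm \<psi> \<Longrightarrow> fv_fm \<psi> \<subseteq> {..<k} \<Longrightarrow> Sig j k (\<lambda>xs. \<not> sat (env xs) \<psi>)"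
proof (induction j \<phi> and j \<psi> arbitrary: k and k rule: SigmaB_PiB.inducts)
  case (SigmaB_0 \<phi>)
  then show ?case using polytime_quantifier_free by simp
next
  case (PiB_0 \<phi>)
  then show ?case using polytime_quantifier_free polytime_pred_not by simp
next
  case (SigmaB_SigmaB j \<phi>)
  then show ?case by (intro Sig_Suc) auto
next
  case (SigmaB_PiB j \<phi>)
  then show ?case using Sig_neg[OF SigmaB_PiB.IH] by simp
next
  case (PiB_SigmaB j \<phi>)
  then show ?case by (intro Sig_neg) auto
next
  case (PiB_PiB j \<phi>)
  then show ?case by (intro Sig_Suc) auto
next
  case (SigmaB_Conj j \<phi> \<psi>)
  then show ?case using Sig_conj_disj(1)[OF SigmaB_Conj.IH(1,2)] by simp
next
  case (SigmaB_Disj j \<phi> \<psi>)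
  then show ?case using Sig_conj_disj(2)[OF SigmaB_Disj.IH(1,2)] by simp
next
  case (PiB_Conj j \<phi> \<psi>)
  then show ?case using Sig_conj_disj(2)[OF PiB_Conj.IH(1,2)] by simp
next
  case (PiB_Disj j \<phi> \<psi>)
  then show ?case using Sig_conj_disj(1)[OF PiB_Disj.IH(1,2)] by simp
next
  case (SigmaB_Neg j \<phi>)
  then show ?case by simp
next
  case (PiB_Neg j \<phi>)
  then show ?case by simp
next
  case (SigmaB_BExists j \<phi> t)
  have "fv_fm \<phi> \<subseteq> {..<Suc k}"
    using SigmaB_BExists.prems by (auto simp: subset_iff less_Suc_eq_0_disj) (metis not0_implies_Suc)
  then show ?case
    using Sig_bounded_ex[of t k j "\<lambda>e. sat e \<phi>"] SigmaB_BExists by simp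
next
  case (PiB_BForall j \<phi> t)
  have "fv_fm \<phi> \<subseteq> {..<Suc k}"
    using PiB_BForall.prems by (auto simp: subset_iff less_Suc_eq_0_disj) (metis not0_implies_Suc)
  then show ?case
    using Sig_bounded_ex[of t k j "\<lambda>e. \<not> sat e \<phi>"] PiB_BForall by simp
qed

abbreviation args :: "nat \<Rightarrow> (nat \<Rightarrow> nat) \<Rightarrow> bool list list" where
  "args k e \<equiv> map (\<lambda>i. bin (e i)) [0..<k]"

definition pv_term :: "nat \<Rightarrow> (bool list list \<Rightarrow> bool list) \<Rightarrow> tm" where
  "pv_term k F = App k (pvf k F) (map Var [0..<k])"

lemma eval_pv_term [simp]: "eval_tm e (pv_term k F) = val (F (args k e))"
  by (simp add: pv_term_def pvf_eq comp_def)

lemma wf_pv_term [simp]: "polytime k F \<Longrightarrow> wf_tm (pv_term k F)"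
  by (auto simp: pv_term_def PV_fun_pvf)

lemma fv_pv_term [simp]: "fv_tm (pv_term k F) = {..<k}"
  by (auto simp: pv_term_def)

lemma args_Suc: "args (Suc k) (case_nat n e) = bin n # args k e"
  by (simp add: map_upt_Suc del: upt_Suc)

text \<open>A quantified string \<open>z\<close> is replaced by the number
  \<open>val (z @ [True])\<close>. Every number decodes to some string, 0 to the empty one, so the
  numerical quantifier ranges over the same strings.\<close>

lemma formula_Sig:
  assumes "Sig j k B"
  shows "\<exists>\<phi>. SigmaB j \<phi> \<and> wf_fm \<phi> \<and> fv_fm \<phi> \<subseteq> {..<k} \<and> (\<forall>e. sat e \<phi> \<longleftrightarrow> B (args k e))"
  using assms
proof (induction j arbitrary: k B)
  case 0
  then have "polytime k (\<lambda>xs. [B xs])" by (simp add: polytime_pred_def)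
  then show ?case
    by (intro exI[of _ "Eq (pv_term k (\<lambda>xs. [B xs])) One"]) (auto intro: SigmaB_PiB.intros)
next
  case (Suc j)
  obtain C q where C: "Sig j (Suc k) C"
    "\<And>xs. length xs = k \<Longrightarrow> B xs \<longleftrightarrow> (\<exists>z. length z \<le> poly q (sz xs) \<and> \<not> C (z # xs))"
    using Suc.prems by auto
  have "Sig j (Suc k) (\<lambda>ys. C (map (\<lambda>f. f ys) [\<lambda>ys. butlast (ys ! 0)] @ tl ys))"
    by (rule Sig_head) (use C in \<open>auto intro: pt\<close>)
  from Suc.IH[OF this] obtain \<phi> where \<phi>: "SigmaB j \<phi>" "wf_fm \<phi>" "fv_fm \<phi> \<subseteq> {..<Suc k}"
    "\<And>e. sat e \<phi> \<longleftrightarrow> C (butlast (args (Suc k) e ! 0) # tl (args (Suc k) e))"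
    by auto
  \<comment> \<open>The code of a string has one bit more than the string, hence one more digit in
    the bound.\<close>
  let ?t = "pv_term k (\<lambda>xs. True # replicate (poly q (sz xs)) True)"
  show ?case
  proof (intro exI[of _ "BExists ?t (Neg \<phi>)"] conjI allI)
    show "SigmaB (Suc j) (BExists ?t (Neg \<phi>))"
      using \<phi>(1) by (intro SigmaB_PiB.SigmaB_BExists SigmaB_PiB.SigmaB_PiB SigmaB_PiB.PiB_Neg)
    have "polytime k (\<lambda>xs. True # replicate (poly q (sz xs)) True)" by (intro pt)
    then show "wf_fm (BExists ?t (Neg \<phi>))" using \<phi>(2) by simp
    show "fv_fm (BExists ?t (Neg \<phi>)) \<subseteq> {..<k}" using \<phi>(3) by auto
    fix e
    let ?xs = "args k e"
    have le: "n \<le> eval_tm e ?t \<longleftrightarrow> length (bin n) \<le> Suc (poly q (sz ?xs))" for n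
      using le_val_trues[of n "Suc (poly q (sz ?xs))"] by simp
    have "sat e (BExists ?t (Neg \<phi>)) \<longleftrightarrow> (\<exists>n. length (bin n) \<le> Suc (poly q (sz ?xs)) \<and> \<not> C (butlast (bin n) # ?xs))"
      unfolding sat_BExists sat.simps \<phi>(4) args_Suc le by simp
    also have "\<dots> \<longleftrightarrow> (\<exists>z. length z \<le> poly q (sz ?xs) \<and> \<not> C (z # ?xs))"
    proof
      assume "\<exists>z. length z \<le> poly q (sz ?xs) \<and> \<not> C (z # ?xs)"
      then obtain z where z: "length z \<le> poly q (sz ?xs)" "\<not> C (z # ?xs)" by blast
      then show "\<exists>n. length (bin n) \<le> Suc (poly q (sz ?xs)) \<and> \<not> C (butlast (bin n) # ?xs)"
        by (intro exI[of _ "val (z @ [True])"]) simp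
    qed (metis diff_le_self length_butlast diff_Suc_1 diff_le_mono)
    also have "\<dots> \<longleftrightarrow> B ?xs" using C(2)[of ?xs] by simp
    finally show "sat e (BExists ?t (Neg \<phi>)) \<longleftrightarrow> B ?xs" .
  qed
qed


section \<open>Provability in theories of true sentences\<close>

section \<open>Derivations\<close>

lemma proves_weaken: "\<Gamma> \<turnstile> \<phi> \<Longrightarrow> \<Gamma> \<subseteq> \<Delta> \<Longrightarrow> \<Delta> \<turnstile> \<phi>"
proof (induction arbitrary: \<Delta> rule: proves.induct)
  case (Hyp \<phi> \<Gamma>)
  then show ?case by (blast intro: proves.Hyp)
next
  case (NegI \<phi> \<Gamma> \<psi>)
  show ?case
    by (rule proves.NegI[OF NegI.hyps(1) NegI.IH]) (use NegI.prems in auto)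
next
  case (RAA \<phi> \<Gamma> \<psi>)
  show ?case
    by (rule proves.RAA[OF RAA.hyps(1) RAA.IH]) (use RAA.prems in auto)
next
  case (DisjE \<Gamma> \<phi> \<psi> \<chi>)
  show ?case
    by (rule proves.DisjE[OF DisjE.IH]) (use DisjE.prems in auto)
next
  case (ExistsE \<Gamma> \<phi> \<psi>)
  show ?case
    by (rule proves.ExistsE[OF ExistsE.IH]) (use ExistsE.prems in auto)
next
  case (ForallI \<Gamma> \<phi>)
  show ?case
    by (rule proves.ForallI[OF ForallI.IH]) (use ForallI.prems in auto)
next
  case (EqE \<Gamma> t u \<phi>)
  show ?case
    by (rule proves.EqE[OF EqE.IH(1) EqE.hyps(2) EqE.IH(2)]) (use EqE.prems in auto)
qed (blast intro: proves.intros)+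

abbreviation Fal :: fm where
  "Fal \<equiv> Neg (Eq Zero Zero)"

lemma proves_contra:
  assumes "\<Gamma> \<turnstile> \<phi>" "\<Gamma> \<turnstile> Neg \<phi>" shows "\<Gamma> \<turnstile> Fal"
  by (rule proves.NegI[where \<psi> = \<phi>]) (auto intro: proves_weaken[OF assms(1)] proves_weaken[OF assms(2)])

lemma Fal_contra: "\<Gamma> \<turnstile> Eq Zero Zero"
  by (simp add: proves.EqI)

lemma Neg_if_Fal: "wf_fm \<phi> \<Longrightarrow> insert \<phi> \<Gamma> \<turnstile> Fal \<Longrightarrow> \<Gamma> \<turnstile> Neg \<phi>"
  using proves.NegI Fal_contra by blast

lemma proves_if_Fal: "wf_fm \<phi> \<Longrightarrow> insert (Neg \<phi>) \<Gamma> \<turnstile> Fal \<Longrightarrow> \<Gamma> \<turnstile> \<phi>"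
  using proves.RAA Fal_contra by blast

lemma Fal_cut: "\<Gamma> \<turnstile> \<phi> \<Longrightarrow> wf_fm \<phi> \<Longrightarrow> insert \<phi> \<Gamma> \<turnstile> Fal \<Longrightarrow> \<Gamma> \<turnstile> Fal"
  using Neg_if_Fal proves_contra by blast

lemma hyp1: "wf_fm \<phi> \<Longrightarrow> insert \<phi> \<Gamma> \<turnstile> \<phi>"
  by (simp add: proves.Hyp)

text \<open>The lemmas of this form turn natural deduction into a refutation calculus, in which a
  hypothesis is decomposed and \<open>Fal\<close> is the goal throughout. As \<open>Fal\<close> is
  closed, it is unaffected by lifting.\<close>

lemma left_Conj:
  assumes "wf_fm (Conj \<phi> \<psi>)" "insert \<phi> (insert \<psi> \<Gamma>) \<turnstile> Fal"
  shows "insert (Conj \<phi> \<psi>) \<Gamma> \<turnstile> Fal"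
proof -
  let ?\<Gamma> = "insert (Conj \<phi> \<psi>) \<Gamma>"
  have c: "?\<Gamma> \<turnstile> Conj \<phi> \<psi>" by (rule hyp1[OF assms(1)])
  have "insert \<phi> (insert \<psi> ?\<Gamma>) \<turnstile> Fal" by (rule proves_weaken[OF assms(2)]) auto
  moreover have "insert \<psi> ?\<Gamma> \<turnstile> \<phi>" by (rule proves_weaken[OF proves.ConjE1[OF c]]) auto
  ultimately have "insert \<psi> ?\<Gamma> \<turnstile> Fal" using Fal_cut assms(1) by simp
  then show ?thesis using Fal_cut[OF proves.ConjE2[OF c]] assms(1) by simp
qed

lemma left_Disj:
  assumes "wf_fm (Disj \<phi> \<psi>)" "insert \<phi> \<Gamma> \<turnstile> Fal" "insert \<psi> \<Gamma> \<turnstile> Fal"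
  shows "insert (Disj \<phi> \<psi>) \<Gamma> \<turnstile> Fal"
  by (rule proves.DisjE[OF hyp1[OF assms(1)]])
    (auto intro: proves_weaken[OF assms(2)] proves_weaken[OF assms(3)])

lemma left_Exists:
  assumes "wf_fm (Exists \<phi>)" "insert \<phi> (lift_fm ` \<Gamma>) \<turnstile> Fal"
  shows "insert (Exists \<phi>) \<Gamma> \<turnstile> Fal"
  by (rule proves.ExistsE[OF hyp1[OF assms(1)]]) (auto intro: proves_weaken[OF assms(2)])

lemma left_Neg_Conj:
  assumes "wf_fm (Conj \<phi> \<psi>)" "insert (Neg \<phi>) \<Gamma> \<turnstile> Fal" "insert (Neg \<psi>) \<Gamma> \<turnstile> Fal"
  shows "insert (Neg (Conj \<phi> \<psi>)) \<Gamma> \<turnstile> Fal"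
proof (rule proves_contra)
  have "\<Gamma> \<turnstile> Conj \<phi> \<psi>"
    using assms by (intro proves.ConjI; intro proves_if_Fal[OF _ assms(2)] proves_if_Fal[OF _ assms(3)]) auto
  then show "insert (Neg (Conj \<phi> \<psi>)) \<Gamma> \<turnstile> Conj \<phi> \<psi>" by (rule proves_weaken) auto
  show "insert (Neg (Conj \<phi> \<psi>)) \<Gamma> \<turnstile> Neg (Conj \<phi> \<psi>)" using assms(1) by (intro hyp1) simp
qed

lemma Neg_Disj:
  assumes "\<Gamma> \<turnstile> Neg (Disj \<phi> \<psi>)" "wf_fm \<phi>" "wf_fm \<psi>"
  shows "\<Gamma> \<turnstile> Neg \<phi>" "\<Gamma> \<turnstile> Neg \<psi>"
proof -
  show "\<Gamma> \<turnstile> Neg \<phi>"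
    by (rule proves.NegI[OF assms(2), of _ "Disj \<phi> \<psi>"])
      (use assms in \<open>auto intro: proves.DisjI1 hyp1 proves_weaken[OF assms(1)]\<close>)
  show "\<Gamma> \<turnstile> Neg \<psi>"
    by (rule proves.NegI[OF assms(3), of _ "Disj \<phi> \<psi>"])
      (use assms in \<open>auto intro: proves.DisjI2 hyp1 proves_weaken[OF assms(1)]\<close>)
qed

lemma left_Neg_Disj:
  assumes "wf_fm (Disj \<phi> \<psi>)" "insert (Neg \<phi>) (insert (Neg \<psi>) \<Gamma>) \<turnstile> Fal"
  shows "insert (Neg (Disj \<phi> \<psi>)) \<Gamma> \<turnstile> Fal"
proof -
  let ?\<Gamma> = "insert (Neg (Disj \<phi> \<psi>)) \<Gamma>"
  have c: "?\<Gamma> \<turnstile> Neg (Disj \<phi> \<psi>)" using assms(1) by (intro hyp1) simp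
  have n: "?\<Gamma> \<turnstile> Neg \<phi>" "?\<Gamma> \<turnstile> Neg \<psi>" using Neg_Disj[OF c] assms(1) by auto
  have "insert (Neg \<phi>) (insert (Neg \<psi>) ?\<Gamma>) \<turnstile> Fal" by (rule proves_weaken[OF assms(2)]) auto
  moreover have "insert (Neg \<psi>) ?\<Gamma> \<turnstile> Neg \<phi>" by (rule proves_weaken[OF n(1)]) auto
  ultimately have "insert (Neg \<psi>) ?\<Gamma> \<turnstile> Fal" using Fal_cut assms(1) by simp
  then show ?thesis using Fal_cut[OF n(2)] assms(1) by simp
qed

lemma Neg_NegD:
  assumes "\<Gamma> \<turnstile> Neg (Neg \<phi>)" "wf_fm \<phi>" shows "\<Gamma> \<turnstile> \<phi>"
  by (rule proves.RAA[OF assms(2), of _ "Neg \<phi>"])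
    (use assms in \<open>auto intro: hyp1 proves_weaken[OF assms(1)]\<close>)

lemma left_Neg_Neg:
  assumes "wf_fm \<phi>" "insert \<phi> \<Gamma> \<turnstile> Fal"
  shows "insert (Neg (Neg \<phi>)) \<Gamma> \<turnstile> Fal"
proof (rule Fal_cut)
  show "insert (Neg (Neg \<phi>)) \<Gamma> \<turnstile> \<phi>" using assms(1) by (intro Neg_NegD[OF hyp1]) auto
  show "insert \<phi> (insert (Neg (Neg \<phi>)) \<Gamma>) \<turnstile> Fal" by (rule proves_weaken[OF assms(2)]) auto
qed (rule assms)

lemma left_Neg_Forall:
  assumes "wf_fm (Forall \<phi>)" "insert (Neg \<phi>) (lift_fm ` \<Gamma>) \<turnstile> Fal"
  shows "insert (Neg (Forall \<phi>)) \<Gamma> \<turnstile> Fal"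
proof (rule proves_contra)
  have "lift_fm ` \<Gamma> \<turnstile> \<phi>" using assms by (intro proves_if_Fal[OF _ assms(2)]) auto
  then have "\<Gamma> \<turnstile> Forall \<phi>" by (rule proves.ForallI)
  then show "insert (Neg (Forall \<phi>)) \<Gamma> \<turnstile> Forall \<phi>" by (rule proves_weaken) auto
  show "insert (Neg (Forall \<phi>)) \<Gamma> \<turnstile> Neg (Forall \<phi>)" using assms(1) by (intro hyp1) simp
qed

text \<open>Derived formulas replace axioms inside a derivation. The quantifier rules lift all
  hypotheses, so both theories have to be invariant under lifting, while \<open>\<Delta>\<close>
  collects the hypotheses that are later discharged.\<close>

lemma proves_cut_set:
  assumes "\<Gamma> \<turnstile> \<phi>" "\<Gamma> \<subseteq> T' \<union> \<Delta>"
    and "\<And>\<chi>. \<chi> \<in> T' \<Longrightarrow> T \<turnstile> \<chi>" "lift_fm ` T = T" "lift_fm ` T' = T'"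
  shows "T \<union> \<Delta> \<turnstile> \<phi>"
  using assms(1,2)
proof (induction arbitrary: \<Delta> rule: proves.induct)
  case (Hyp \<phi> \<Gamma>)
  then consider "\<phi> \<in> T'" | "\<phi> \<in> \<Delta>" by blast
  then show ?case
  proof cases
    case 1
    then show ?thesis using proves_weaken[OF assms(3)] by blast
  qed (use Hyp in \<open>auto intro: proves.Hyp\<close>)
next
  case (NegI \<phi> \<Gamma> \<psi>)
  have "insert \<phi> \<Gamma> \<subseteq> T' \<union> insert \<phi> \<Delta>" using NegI.prems by auto
  from NegI.IH(1)[OF this] NegI.IH(2)[OF this] show ?case using proves.NegI[OF NegI.hyps(1)] by simp
next
  case (RAA \<phi> \<Gamma> \<psi>)
  have "insert (Neg \<phi>) \<Gamma> \<subseteq> T' \<union> insert (Neg \<phi>) \<Delta>" using RAA.prems by auto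
  from RAA.IH(1)[OF this] RAA.IH(2)[OF this] show ?case using proves.RAA[OF RAA.hyps(1)] by simp
next
  case (DisjE \<Gamma> \<phi> \<psi> \<chi>)
  have "insert \<phi> \<Gamma> \<subseteq> T' \<union> insert \<phi> \<Delta>" "insert \<psi> \<Gamma> \<subseteq> T' \<union> insert \<psi> \<Delta>" using DisjE.prems by auto
  from DisjE.IH(1)[OF DisjE.prems] DisjE.IH(2)[OF this(1)] DisjE.IH(3)[OF this(2)]
  show ?case using proves.DisjE by simp
next
  case (ExistsE \<Gamma> \<phi> \<psi>)
  have "insert \<phi> (lift_fm ` \<Gamma>) \<subseteq> T' \<union> insert \<phi> (lift_fm ` \<Delta>)"
    using image_mono[OF ExistsE.prems, of lift_fm] assms(5) by (auto simp: image_Un)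
  from ExistsE.IH(2)[OF this] have "insert \<phi> (lift_fm ` (T \<union> \<Delta>)) \<turnstile> lift_fm \<psi>"
    using assms(4) by (simp add: image_Un)
  then show ?case using proves.ExistsE[OF ExistsE.IH(1)[OF ExistsE.prems]] by blast
next
  case (ForallI \<Gamma> \<phi>)
  have "lift_fm ` \<Gamma> \<subseteq> T' \<union> lift_fm ` \<Delta>"
    using image_mono[OF ForallI.prems, of lift_fm] assms(5) by (auto simp: image_Un)
  from ForallI.IH[OF this] have "lift_fm ` (T \<union> \<Delta>) \<turnstile> \<phi>"
    using assms(4) by (simp add: image_Un)
  then show ?case by (rule proves.ForallI)
qed (blast intro: proves.intros)+


section \<open>Deriving true formulas in the theories\<close>

lemma lift_T_PV [simp]: "lift_fm ` T_PV i = T_PV i"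
proof -
  have "lift_fm \<chi> = \<chi>" if "\<chi> \<in> T_PV i" for \<chi>
    using that by (auto simp: T_PV_def sentence_def intro: subst_sentence)
  then show ?thesis by (simp add: image_cong[where g = id])
qed

lemma fv_Foralls: "fv_fm ((Forall ^^ n) \<phi>) = {i. i + n \<in> fv_fm \<phi>}"
  by (induction n) auto

lemma wf_Foralls [simp]: "wf_fm ((Forall ^^ n) \<phi>) \<longleftrightarrow> wf_fm \<phi>"
  by (induction n) auto

text \<open>A variable i left free by the prefix is variable n + i of the matrix. With the
  substitution shifted accordingly, eliminating one quantifier reproduces the same form for the
  shorter prefix.\<close>

lemma Foralls_elim:
  assumes "\<Gamma> \<turnstile> subst_fm (\<lambda>i. \<rho> (n + i)) ((Forall ^^ n) \<phi>)" "\<And>i. wf_tm (\<rho> i)"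
  shows "\<Gamma> \<turnstile> subst_fm \<rho> \<phi>"
  using assms(1)
proof (induction n)
  case (Suc n)
  then have "\<Gamma> \<turnstile> Forall (subst_fm (lift_subst (\<lambda>i. \<rho> (Suc n + i))) ((Forall ^^ n) \<phi>))" by simp
  from proves.ForallE[OF this assms(2)[of n]]
  have "\<Gamma> \<turnstile> subst_fm (\<lambda>i. subst_tm (case_nat (\<rho> n) Var) (lift_subst (\<lambda>i. \<rho> (Suc n + i)) i)) ((Forall ^^ n) \<phi>)"
    by (simp add: subst_fm_comp)
  moreover have "(\<lambda>i. subst_tm (case_nat (\<rho> n) Var) (lift_subst (\<lambda>i. \<rho> (Suc n + i)) i)) = (\<lambda>i. \<rho> (n + i))"
    by (rule ext) (simp add: lift_subst_def subst_tm_comp split: nat.split)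
  ultimately show ?case using Suc.IH by simp
qed simp

lemma Foralls_intro: "T \<turnstile> \<phi> \<Longrightarrow> lift_fm ` T = T \<Longrightarrow> T \<turnstile> (Forall ^^ n) \<phi>"
  by (induction n) (auto intro: proves.ForallI)

lemma sat_Foralls: "(\<forall>e. sat e ((Forall ^^ n) \<phi>)) \<longleftrightarrow> (\<forall>e. sat e \<phi>)"
proof (induction n)
  case (Suc n)
  have "(\<forall>e m. sat (case_nat m e) \<psi>) \<longleftrightarrow> (\<forall>e. sat e \<psi>)" for \<psi>
  proof safe
    fix e assume "\<forall>e m. sat (case_nat m e) \<psi>"
    then have "sat (case_nat (e 0) (\<lambda>i. e (Suc i))) \<psi>" by blast
    moreover have "case_nat (e 0) (\<lambda>i. e (Suc i)) = e" by (rule ext) (simp split: nat.split)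
    ultimately show "sat e \<psi>" by simp
  qed auto
  then show ?case using Suc by simp
qed simp

lemma T_PV_closure:
  assumes "SigmaB j \<phi>" "wf_fm \<phi>" "\<And>e. sat e \<phi>" "fv_fm \<phi> \<subseteq> {..<n}"
  shows "(Forall ^^ n) \<phi> \<in> T_PV (Suc j)"
proof -
  have "sentence ((Forall ^^ n) \<phi>)" using assms by (auto simp: sentence_def fv_Foralls)
  moreover have "true_in_N ((Forall ^^ n) \<phi>)" using assms(3) sat_Foralls unfolding true_in_N_def by blast
  ultimately show ?thesis using assms(1) unfolding T_PV_def by auto
qed

lemma fv_bounded: obtains n where "fv_fm \<phi> \<subseteq> {..<n}"
  using finite_fv_fm[of \<phi>] by (metis finite_nat_iff_bounded)

lemma T_PV_SigmaB:
  assumes "SigmaB j \<phi>" "wf_fm \<phi>" "\<And>e. sat e \<phi>" "\<And>i. wf_tm (\<rho> i)"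
  shows "T_PV (Suc j) \<turnstile> subst_fm \<rho> \<phi>"
proof -
  obtain n where n: "fv_fm \<phi> \<subseteq> {..<n}" by (rule fv_bounded)
  have "subst_fm (\<lambda>i. \<rho> (n + i)) ((Forall ^^ n) \<phi>) = (Forall ^^ n) \<phi>"
    by (rule subst_sentence) (use n in \<open>auto simp: fv_Foralls\<close>)
  moreover have "T_PV (Suc j) \<turnstile> (Forall ^^ n) \<phi>"
    by (rule proves.Hyp[OF T_PV_closure[OF assms(1-3) n]]) (use assms(2) in simp)
  ultimately show ?thesis using Foralls_elim[of "T_PV (Suc j)" \<rho> n \<phi>] assms(4) by simp
qed

text \<open>Binary connectives weigh 2: pushing a negation inwards turns it into two, and the total
  must still decrease.\<close>

primrec fsize :: "fm \<Rightarrow> nat" where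
  "fsize (Eq t u) = 1"
| "fsize (Neg \<phi>) = Suc (fsize \<phi>)"
| "fsize (Conj \<phi> \<psi>) = 2 + fsize \<phi> + fsize \<psi>"
| "fsize (Disj \<phi> \<psi>) = 2 + fsize \<phi> + fsize \<psi>"
| "fsize (Exists \<phi>) = Suc (fsize \<phi>)"
| "fsize (Forall \<phi>) = Suc (fsize \<phi>)"

lemma fsize_subst [simp]: "fsize (subst_fm \<sigma> \<phi>) = fsize \<phi>"
  by (induction \<phi> arbitrary: \<sigma>) auto

text \<open>The level \<open>m\<close> is variable because the induction passes through the
  cumulativity rules. Whatever comes from a lower level falls under the first alternative, where
  decomposition stops.\<close>

lemma SigmaB_PiB_inversion:
  "SigmaB m \<phi> \<Longrightarrow> m \<le> Suc j \<Longrightarrow> PiB j \<phi>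
    \<or> (\<exists>\<alpha> \<beta>. \<phi> = Conj \<alpha> \<beta> \<and> SigmaB (Suc j) \<alpha> \<and> SigmaB (Suc j) \<beta>)
    \<or> (\<exists>\<alpha> \<beta>. \<phi> = Disj \<alpha> \<beta> \<and> SigmaB (Suc j) \<alpha> \<and> SigmaB (Suc j) \<beta>)
    \<or> (\<exists>t \<alpha>. \<phi> = BExists t \<alpha> \<and> SigmaB (Suc j) \<alpha>)
    \<or> (\<exists>\<alpha>. \<phi> = Neg \<alpha> \<and> PiB (Suc j) \<alpha>)"
  "PiB m \<psi> \<Longrightarrow> m \<le> Suc j \<Longrightarrow> SigmaB j \<psi>
    \<or> (\<exists>\<alpha> \<beta>. \<psi> = Conj \<alpha> \<beta> \<and> PiB (Suc j) \<alpha> \<and> PiB (Suc j) \<beta>)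
    \<or> (\<exists>\<alpha> \<beta>. \<psi> = Disj \<alpha> \<beta> \<and> PiB (Suc j) \<alpha> \<and> PiB (Suc j) \<beta>)
    \<or> (\<exists>t \<alpha>. \<psi> = BForall t \<alpha> \<and> PiB (Suc j) \<alpha>)
    \<or> (\<exists>\<alpha>. \<psi> = Neg \<alpha> \<and> SigmaB (Suc j) \<alpha>)"
proof (induction m \<phi> and m \<psi> rule: SigmaB_PiB.inducts)
  case (SigmaB_0 \<phi>)
  then show ?case using PiB_le[of 0 j] SigmaB_PiB.PiB_0 by blast
next
  case (PiB_0 \<phi>)
  then show ?case using SigmaB_le[of 0 j] SigmaB_PiB.SigmaB_0 by blast
next
  case (SigmaB_SigmaB m \<phi>)
  then show ?case by simp
next
  case (SigmaB_PiB m \<phi>)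
  then show ?case using PiB_le[of m j] by simp
next
  case (PiB_SigmaB m \<phi>)
  then show ?case using SigmaB_le[of m j] by simp
next
  case (PiB_PiB m \<phi>)
  then show ?case by simp
next
  case (SigmaB_Conj m \<phi> \<psi>)
  then show ?case using SigmaB_le[of m "Suc j"] by simp
next
  case (SigmaB_Disj m \<phi> \<psi>)
  then show ?case using SigmaB_le[of m "Suc j"] by simp
next
  case (PiB_Conj m \<phi> \<psi>)
  then show ?case using PiB_le[of m "Suc j"] by simp
next
  case (PiB_Disj m \<phi> \<psi>)
  then show ?case using PiB_le[of m "Suc j"] by simp
next
  case (SigmaB_Neg m \<phi>)
  then show ?case using PiB_le[of m "Suc j"] by simp
next
  case (PiB_Neg m \<phi>)
  then show ?case using SigmaB_le[of m "Suc j"] by simp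
next
  case (SigmaB_BExists m \<phi> t)
  then show ?case using SigmaB_le[of "Suc m" "Suc j"] by blast
next
  case (PiB_BForall m \<phi> t)
  then show ?case using PiB_le[of "Suc m" "Suc j"] by blast
qed

text \<open>Negated formulas are analysed one step further, so that all components are Sigma
  formulas of the same level again and a recursion on \<open>fsize\<close> can continue with
  them.\<close>

lemma SigmaB_cases:
  assumes "SigmaB (Suc j) \<phi>"
  obtains (leaf) "PiB j \<phi>"
  | (Conj) \<alpha> \<beta> where "\<phi> = Conj \<alpha> \<beta>" "SigmaB (Suc j) \<alpha>" "SigmaB (Suc j) \<beta>"
  | (Disj) \<alpha> \<beta> where "\<phi> = Disj \<alpha> \<beta>" "SigmaB (Suc j) \<alpha>" "SigmaB (Suc j) \<beta>"
  | (BExists) t \<alpha> where "\<phi> = BExists t \<alpha>" "SigmaB (Suc j) \<alpha>"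
  | (Neg_Conj) \<alpha> \<beta> where "\<phi> = Neg (Conj \<alpha> \<beta>)" "SigmaB (Suc j) (Neg \<alpha>)" "SigmaB (Suc j) (Neg \<beta>)"
  | (Neg_Disj) \<alpha> \<beta> where "\<phi> = Neg (Disj \<alpha> \<beta>)" "SigmaB (Suc j) (Neg \<alpha>)" "SigmaB (Suc j) (Neg \<beta>)"
  | (Neg_Neg) \<alpha> where "\<phi> = Neg (Neg \<alpha>)" "SigmaB (Suc j) \<alpha>"
  | (Neg_BForall) t \<alpha> where "\<phi> = Neg (BForall t \<alpha>)" "SigmaB (Suc j) (Neg \<alpha>)"
proof -
  note inv = SigmaB_PiB_inversion(1)[OF assms order_refl]
  show thesis
  proof (cases "\<exists>\<psi>. \<phi> = Neg \<psi> \<and> PiB (Suc j) \<psi>")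
    case True
    then obtain \<psi> where \<psi>: "\<phi> = Neg \<psi>" "PiB (Suc j) \<psi>" by blast
    have N: "SigmaB (Suc j) (Neg \<alpha>)" if "PiB (Suc j) \<alpha>" for \<alpha>
      using that by (rule SigmaB_PiB.SigmaB_Neg)
    from SigmaB_PiB_inversion(2)[OF \<psi>(2) order_refl] show thesis
    proof (elim disjE exE conjE)
      assume "SigmaB j \<psi>"
      then show thesis using \<psi>(1) leaf SigmaB_PiB.PiB_Neg by simp
    next
      fix \<alpha> \<beta> assume "\<psi> = Conj \<alpha> \<beta>" "PiB (Suc j) \<alpha>" "PiB (Suc j) \<beta>"
      then show thesis using \<psi>(1) by (intro Neg_Conj[of \<alpha> \<beta>] N) simp_all
    next
      fix \<alpha> \<beta> assume "\<psi> = Disj \<alpha> \<beta>" "PiB (Suc j) \<alpha>" "PiB (Suc j) \<beta>"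
      then show thesis using \<psi>(1) by (intro Neg_Disj[of \<alpha> \<beta>] N) simp_all
    next
      fix t \<alpha> assume "\<psi> = BForall t \<alpha>" "PiB (Suc j) \<alpha>"
      then show thesis using \<psi>(1) by (intro Neg_BForall[of t \<alpha>] N) simp_all
    next
      fix \<alpha> assume "\<psi> = Neg \<alpha>" "SigmaB (Suc j) \<alpha>"
      then show thesis using \<psi>(1) by (intro Neg_Neg[of \<alpha>]) simp_all
    qed
  next
    case False
    with inv show thesis using leaf Conj Disj BExists by blast
  qed
qed

lemma SigmaB_quantifier_free: "quantifier_free \<phi> \<Longrightarrow> SigmaB j \<phi>"
  using SigmaB_le[of 0 j] SigmaB_PiB.SigmaB_0 by blast

lemma PiB_quantifier_free: "quantifier_free \<phi> \<Longrightarrow> PiB j \<phi>"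
  using PiB_le[of 0 j] SigmaB_PiB.PiB_0 by blast

lemma SigmaB_Le: "SigmaB j (Le t u)" "PiB j (Le t u)"
  by (auto simp: Le_def intro: SigmaB_quantifier_free PiB_quantifier_free)

text \<open>Decomposing the formulas of an unsatisfiable set, with fresh variables for the outermost
  existential quantifiers, leaves \<open>\<Pi>\<^sub>j\<close> formulas, which are collected in the conjunction \<open>\<lambda>\<close>. The
  refutation of such a conjunction is an axiom.\<close>

lemma unsat_refutable:
  assumes "\<And>\<phi>. \<phi> \<in> set \<Delta> \<Longrightarrow> SigmaB (Suc j) \<phi>" "\<And>\<phi>. \<phi> \<in> set \<Delta> \<Longrightarrow> wf_fm \<phi>" "PiB j \<kappa>" "wf_fm \<kappa>"
    and "\<And>e. sat e \<kappa> \<Longrightarrow> (\<And>\<phi>. \<phi> \<in> set \<Delta> \<Longrightarrow> sat e \<phi>) \<Longrightarrow> False"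
  shows "insert \<kappa> (T_PV (Suc j) \<union> set \<Delta>) \<turnstile> Fal"
  using assms
proof (induction "sum_list (map fsize \<Delta>)" arbitrary: \<Delta> \<kappa> rule: less_induct)
  case less
  show ?case
  proof (cases \<Delta>)
    case Nil
    then have "sat e (Neg \<kappa>)" for e using less.prems(5)[of e] by auto
    then have "T_PV (Suc j) \<turnstile> subst_fm Var (Neg \<kappa>)"
      using less.prems by (intro T_PV_SigmaB) (auto intro: SigmaB_PiB.SigmaB_Neg)
    then have "T_PV (Suc j) \<turnstile> Neg \<kappa>" by simp
    then have "insert \<kappa> (T_PV (Suc j) \<union> set \<Delta>) \<turnstile> Neg \<kappa>" by (rule proves_weaken) auto
    with hyp1[OF less.prems(4)] show ?thesis by (rule proves_contra)
  next
    case (Cons \<phi> \<Delta>')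
    let ?\<Gamma> = "insert \<kappa> (T_PV (Suc j) \<union> set \<Delta>')"
    have eq: "insert \<kappa> (T_PV (Suc j) \<union> set \<Delta>) = insert \<phi> ?\<Gamma>" using Cons by auto
    have wf: "wf_fm \<phi>" using less.prems(2) Cons by simp
    have sig: "SigmaB (Suc j) \<phi>" using less.prems(1) Cons by simp
    have IH: "insert \<kappa>' (T_PV (Suc j) \<union> set \<Theta>) \<turnstile> Fal"
      if "sum_list (map fsize \<Theta>) < fsize \<phi> + sum_list (map fsize \<Delta>')"
        "\<And>\<phi>. \<phi> \<in> set \<Theta> \<Longrightarrow> SigmaB (Suc j) \<phi>" "\<And>\<phi>. \<phi> \<in> set \<Theta> \<Longrightarrow> wf_fm \<phi>" "PiB j \<kappa>'" "wf_fm \<kappa>'"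
        "\<And>e. sat e \<kappa>' \<Longrightarrow> (\<And>\<phi>. \<phi> \<in> set \<Theta> \<Longrightarrow> sat e \<phi>) \<Longrightarrow> False" for \<Theta> \<kappa>'
      by (rule less.hyps) (use that Cons in auto)
    have unsat: "False" if "sat e \<kappa>" "sat e \<phi>" "\<And>\<psi>. \<psi> \<in> set \<Delta>' \<Longrightarrow> sat e \<psi>" for e
      using less.prems(5)[of e] that Cons by auto
    have rest: "\<And>\<psi>. \<psi> \<in> set \<Delta>' \<Longrightarrow> SigmaB (Suc j) \<psi>" "\<And>\<psi>. \<psi> \<in> set \<Delta>' \<Longrightarrow> wf_fm \<psi>"
      using less.prems(1,2) Cons by auto
    have one: "insert \<alpha> ?\<Gamma> \<turnstile> Fal"
      if "fsize \<alpha> < fsize \<phi>" "SigmaB (Suc j) \<alpha>" "wf_fm \<alpha>" "\<And>e. sat e \<alpha> \<Longrightarrow> sat e \<phi>" for \<alpha>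
    proof -
      have "insert \<kappa> (T_PV (Suc j) \<union> set (\<alpha> # \<Delta>')) \<turnstile> Fal"
        by (rule IH) (use that rest less.prems(3,4) in \<open>auto dest!: unsat\<close>)
      then show ?thesis by (rule proves_weaken) auto
    qed
    have two: "insert \<alpha> (insert \<beta> ?\<Gamma>) \<turnstile> Fal"
      if "fsize \<alpha> + fsize \<beta> < fsize \<phi>" "SigmaB (Suc j) \<alpha>" "SigmaB (Suc j) \<beta>" "wf_fm \<alpha>" "wf_fm \<beta>"
        "\<And>e. sat e \<alpha> \<Longrightarrow> sat e \<beta> \<Longrightarrow> sat e \<phi>" for \<alpha> \<beta>
    proof -
      have "insert \<kappa> (T_PV (Suc j) \<union> set (\<alpha> # \<beta> # \<Delta>')) \<turnstile> Fal"
        by (rule IH) (use that rest less.prems(3,4) in \<open>auto dest!: unsat\<close>)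
      then show ?thesis by (rule proves_weaken) auto
    qed
    \<comment> \<open>The witness of an existential quantifier becomes variable 0, and all other
      hypotheses are lifted past it. Truth of the lifted set at \<open>e\<close> is truth of the old
      one at the tail of \<open>e\<close>.\<close>
    have fresh: "insert \<alpha> (lift_fm ` ?\<Gamma>) \<turnstile> Fal"
      if "fsize \<alpha> < fsize \<phi>" "SigmaB (Suc j) \<alpha>" "wf_fm \<alpha>" "\<And>e m. sat (case_nat m e) \<alpha> \<Longrightarrow> sat e \<phi>" for \<alpha>
    proof -
      have "insert (lift_fm \<kappa>) (T_PV (Suc j) \<union> set (\<alpha> # map lift_fm \<Delta>')) \<turnstile> Fal"
      proof (rule IH)
        fix e
        assume e: "sat e (lift_fm \<kappa>)" "\<And>\<psi>. \<psi> \<in> set (\<alpha> # map lift_fm \<Delta>') \<Longrightarrow> sat e \<psi>"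
        let ?e = "\<lambda>i. e (Suc i)"
        have "case_nat (e 0) ?e = e" by (rule ext) (simp split: nat.split)
        then have "sat ?e \<phi>" using that(4)[of "e 0" ?e] e(2)[of \<alpha>] by simp
        moreover have "sat ?e \<psi>" if "\<psi> \<in> set \<Delta>'" for \<psi> using e(2)[of "lift_fm \<psi>"] that by simp
        ultimately show False using unsat[of ?e] e(1) by simp
      next
        have "map fsize (map lift_fm \<Delta>') = map fsize \<Delta>'" by simp
        then show "sum_list (map fsize (\<alpha> # map lift_fm \<Delta>')) < fsize \<phi> + sum_list (map fsize \<Delta>')"
          using that(1) by (simp del: map_map)
      qed (use that rest less.prems(3,4) in \<open>auto intro: SigmaB_PiB_subst wf_subst_fm\<close>)
      then show ?thesis
        by (rule proves_weaken) (auto simp: image_Un)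
    qed
    show ?thesis unfolding eq using sig
    proof (cases rule: SigmaB_cases)
      \<comment> \<open>The formula moves from the list into the conjunction, which makes the list
        smaller.\<close>
      case leaf
      have "insert (Conj \<kappa> \<phi>) (T_PV (Suc j) \<union> set \<Delta>') \<turnstile> Fal"
      proof (rule IH)
        have "0 < fsize \<phi>" by (cases \<phi>) auto
        then show "sum_list (map fsize \<Delta>') < fsize \<phi> + sum_list (map fsize \<Delta>')" by simp
      qed (use leaf wf rest less.prems(3,4) in \<open>auto intro: SigmaB_PiB.PiB_Conj dest: unsat\<close>)
      then have "insert (Conj \<kappa> \<phi>) (insert \<phi> ?\<Gamma>) \<turnstile> Fal" by (rule proves_weaken) auto
      moreover have "insert \<phi> ?\<Gamma> \<turnstile> Conj \<kappa> \<phi>"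
        using wf less.prems(4) by (intro proves.ConjI proves.Hyp) auto
      ultimately show "insert \<phi> ?\<Gamma> \<turnstile> Fal"
        using Fal_cut wf less.prems(4) by simp
    next
      case (Conj \<alpha> \<beta>)
      then show "insert \<phi> ?\<Gamma> \<turnstile> Fal" using left_Conj[of \<alpha> \<beta> ?\<Gamma>] two[of \<alpha> \<beta>] wf by simp
    next
      case (Disj \<alpha> \<beta>)
      then show "insert \<phi> ?\<Gamma> \<turnstile> Fal" using left_Disj[of \<alpha> \<beta> ?\<Gamma>] one[of \<alpha>] one[of \<beta>] wf by simp
    next
      case (BExists t \<alpha>)
      let ?\<beta> = "Conj (Le (Var 0) (lift_tm t)) \<alpha>"
      have "insert ?\<beta> (lift_fm ` ?\<Gamma>) \<turnstile> Fal"
        by (rule fresh) (use BExists wf in \<open>auto simp: BExists_def intro: SigmaB_PiB.SigmaB_Conj SigmaB_Le\<close>)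
      then show "insert \<phi> ?\<Gamma> \<turnstile> Fal"
        using left_Exists[of ?\<beta> ?\<Gamma>] wf BExists(1) by (simp add: BExists_def)
    next
      case (Neg_Conj \<alpha> \<beta>)
      then show "insert \<phi> ?\<Gamma> \<turnstile> Fal" using left_Neg_Conj[of \<alpha> \<beta> ?\<Gamma>] one[of "Neg \<alpha>"] one[of "Neg \<beta>"] wf by simp
    next
      case (Neg_Disj \<alpha> \<beta>)
      then show "insert \<phi> ?\<Gamma> \<turnstile> Fal" using left_Neg_Disj[of \<alpha> \<beta> ?\<Gamma>] two[of "Neg \<alpha>" "Neg \<beta>"] wf by simp
    next
      case (Neg_Neg \<alpha>)
      then show "insert \<phi> ?\<Gamma> \<turnstile> Fal" using left_Neg_Neg[of \<alpha> ?\<Gamma>] one[of \<alpha>] wf by simp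
    next
      case (Neg_BForall t \<alpha>)
      let ?\<beta> = "Disj (Neg (Le (Var 0) (lift_tm t))) \<alpha>"
      have b: "Conj (Le (Var 0) (lift_tm t)) (Neg \<alpha>) \<in> Collect (SigmaB (Suc j))"
        using Neg_BForall by (auto intro: SigmaB_PiB.SigmaB_Conj SigmaB_Le)
      let ?\<gamma> = "Conj (Le (Var 0) (lift_tm t)) (Neg \<alpha>)"
      have g: "insert ?\<gamma> (lift_fm ` ?\<Gamma>) \<turnstile> Fal"
        by (rule fresh) (use b Neg_BForall wf in \<open>auto simp: BForall_def\<close>)
      have "insert (Neg ?\<beta>) (lift_fm ` ?\<Gamma>) \<turnstile> Fal"
      proof (rule Fal_cut)
        have w: "wf_fm (Neg ?\<beta>)" "wf_fm \<alpha>" "wf_fm (Le (Var 0) (lift_tm t))" using wf Neg_BForall by auto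
        have h: "insert (Neg ?\<beta>) (lift_fm ` ?\<Gamma>) \<turnstile> Neg ?\<beta>" by (rule hyp1[OF w(1)])
        show "insert (Neg ?\<beta>) (lift_fm ` ?\<Gamma>) \<turnstile> ?\<gamma>"
          using w by (intro proves.ConjI Neg_NegD[OF Neg_Disj(1)[OF h]] Neg_Disj(2)[OF h]) auto
        show "wf_fm ?\<gamma>" using w by simp
        show "insert ?\<gamma> (insert (Neg ?\<beta>) (lift_fm ` ?\<Gamma>)) \<turnstile> Fal" by (rule proves_weaken[OF g]) auto
      qed
      then show "insert \<phi> ?\<Gamma> \<turnstile> Fal"
        using left_Neg_Forall[of ?\<beta> ?\<Gamma>] wf Neg_BForall(1) by (simp add: BForall_def)
    qed
  qed
qed

lemma T_PV_PiB:
  assumes "PiB (Suc j) \<psi>" "wf_fm \<psi>" "\<And>e. sat e \<psi>"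
  shows "T_PV (Suc j) \<turnstile> \<psi>"
proof -
  \<comment> \<open>The empty conjunction.\<close>
  let ?\<kappa> = "Eq Zero Zero"
  have "insert ?\<kappa> (T_PV (Suc j) \<union> set [Neg \<psi>]) \<turnstile> Fal"
    by (rule unsat_refutable) (use assms in \<open>auto intro: PiB_quantifier_free SigmaB_PiB.SigmaB_Neg\<close>)
  then have "insert ?\<kappa> (insert (Neg \<psi>) (T_PV (Suc j))) \<turnstile> Fal" by simp
  then have "insert (Neg \<psi>) (T_PV (Suc j)) \<turnstile> Fal"
    using Fal_cut[OF Fal_contra] by simp
  then show ?thesis by (rule proves_if_Fal[OF assms(2)])
qed

lemma T_PV_le: "T_PV (Suc j) \<subseteq> T_PV (Suc (Suc j))"
  unfolding T_PV_def using SigmaB_PiB.SigmaB_SigmaB by auto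


section \<open>Collapsing outermost existential quantifiers to one witness\<close>

section \<open>Witnessing outermost existential quantifiers by a single number\<close>

definition fst_tm :: tm where
  "fst_tm = pv_term 1 (\<lambda>xs. pfst (butlast (xs ! 0)))"

definition snd_tm :: tm where
  "snd_tm = pv_term 1 (\<lambda>xs. psnd (butlast (xs ! 0)))"

definition npair :: "nat \<Rightarrow> nat \<Rightarrow> nat" where
  "npair m n = val (pair (bin m) (bin n) @ [True])"

lemma wf_fst_snd_tm [simp]: "wf_tm fst_tm" "wf_tm snd_tm"
  unfolding fst_tm_def snd_tm_def by (auto intro!: wf_pv_term pt)

lemma fv_fst_snd_tm [simp]: "fv_tm fst_tm = {0}" "fv_tm snd_tm = {0}"
  unfolding fst_tm_def snd_tm_def by auto

lemma eval_fst_snd_npair [simp]: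
  "eval_tm (case_nat (npair m n) e) fst_tm = m" "eval_tm (case_nat (npair m n) e) snd_tm = n"
  unfolding fst_tm_def snd_tm_def npair_def by simp_all

lemma length_bin_npair: "length (bin (npair m n)) = 2 + 2 * length (bin m) + length (bin n)"
  by (simp add: npair_def)

lemma subst_case_nat: "subst_fm \<rho> (subst_fm (case_nat a b) \<phi>) =
  subst_fm (case_nat (subst_tm \<rho> a) (\<lambda>n. subst_tm \<rho> (b n))) \<phi>"
proof -
  have "(\<lambda>n. subst_tm \<rho> (case_nat a b n)) = case_nat (subst_tm \<rho> a) (\<lambda>n. subst_tm \<rho> (b n))"
    by (rule ext) (simp split: nat.split)
  then show ?thesis by (simp add: subst_fm_comp)
qed

lemma sat_case_nat: "sat e (subst_fm (case_nat a b) \<phi>) \<longleftrightarrow>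
  sat (case_nat (eval_tm e a) (\<lambda>n. eval_tm e (b n))) \<phi>"
proof -
  have "(\<lambda>n. eval_tm e (case_nat a b n)) = case_nat (eval_tm e a) (\<lambda>n. eval_tm e (b n))"
    by (rule ext) (simp split: nat.split)
  then show ?thesis by simp
qed

lemma wf_case_nat: "wf_tm a \<Longrightarrow> (\<And>n. wf_tm (b n)) \<Longrightarrow> wf_tm (case_nat a b n)"
  by (simp split: nat.split)

text \<open>Variable 0 of \<open>W\<close> codes all outermost existential witnesses of
  \<open>\<phi>\<close>, whose own variables shift by one. The syntactic clause speaks of all
  substitutions because the construction passes under quantifiers. The semantic clause asks for
  witnesses of polynomial length, as the totality of a search problem does.\<close>

definition witness_for :: "nat \<Rightarrow> fm \<Rightarrow> fm \<Rightarrow> bool" where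
  "witness_for j \<phi> W \<longleftrightarrow> PiB j W \<and> wf_fm W \<and> fv_fm W \<subseteq> insert 0 (Suc ` fv_fm \<phi>) \<and>
    (\<forall>\<Gamma> \<sigma> s. (\<forall>n. wf_tm (\<sigma> n)) \<longrightarrow> wf_tm s \<longrightarrow>
      \<Gamma> \<turnstile> subst_fm (case_nat s \<sigma>) W \<longrightarrow> \<Gamma> \<turnstile> subst_fm \<sigma> \<phi>) \<and>
    (\<forall>k. fv_fm \<phi> \<subseteq> {..<k} \<longrightarrow> (\<exists>q. \<forall>e. sat e \<phi> \<longrightarrow>
      (\<exists>w. length (bin w) \<le> poly q (sz (args k e)) \<and> sat (case_nat w e) W)))"

lemma witness_forD:
  assumes "witness_for j \<phi> W"
  shows "PiB j W" "wf_fm W" "fv_fm W \<subseteq> insert 0 (Suc ` fv_fm \<phi>)"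
    and "\<And>\<Gamma> \<sigma> s. (\<And>n. wf_tm (\<sigma> n)) \<Longrightarrow> wf_tm s \<Longrightarrow> \<Gamma> \<turnstile> subst_fm (case_nat s \<sigma>) W \<Longrightarrow> \<Gamma> \<turnstile> subst_fm \<sigma> \<phi>"
    and "\<And>k. fv_fm \<phi> \<subseteq> {..<k} \<Longrightarrow> \<exists>q. \<forall>e. sat e \<phi> \<longrightarrow>
      (\<exists>w. length (bin w) \<le> poly q (sz (args k e)) \<and> sat (case_nat w e) W)"
  using assms unfolding witness_for_def by blast+

lemma witness_for_leaf:
  assumes "PiB j \<phi>" "wf_fm \<phi>"
  shows "witness_for j \<phi> (lift_fm \<phi>)"
  unfolding witness_for_def
proof (intro conjI allI impI)
  fix k
  show "\<exists>q. \<forall>e. sat e \<phi> \<longrightarrow>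
      (\<exists>w. length (bin w) \<le> poly q (sz (args k e)) \<and> sat (case_nat w e) (lift_fm \<phi>))"
    by (intro exI[of _ 0]) (auto intro!: exI[of _ "0 :: nat"])
qed (use assms in \<open>auto simp: subst_fm_comp fv_subst_fm intro: SigmaB_PiB_subst wf_subst_fm\<close>)

text \<open>For replacing a negated formula by its De Morgan dual: truth is carried from
  \<open>\<phi>\<close> to \<open>\<psi>\<close>, derivability from \<open>\<psi>\<close> back to
  \<open>\<phi>\<close>.\<close>

lemma witness_for_transfer:
  assumes "witness_for j \<psi> W" "fv_fm \<psi> = fv_fm \<phi>" "\<And>e. sat e \<phi> \<Longrightarrow> sat e \<psi>"
    and "\<And>\<Gamma> \<sigma>. (\<And>n. wf_tm (\<sigma> n)) \<Longrightarrow> \<Gamma> \<turnstile> subst_fm \<sigma> \<psi> \<Longrightarrow> \<Gamma> \<turnstile> subst_fm \<sigma> \<phi>"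
  shows "witness_for j \<phi> W"
  unfolding witness_for_def
proof (intro conjI allI impI)
  fix k assume "fv_fm \<phi> \<subseteq> {..<k}"
  then have "fv_fm \<psi> \<subseteq> {..<k}" unfolding assms(2) .
  from witness_forD(5)[OF assms(1) this] obtain q where "\<forall>e. sat e \<psi> \<longrightarrow>
      (\<exists>w. length (bin w) \<le> poly q (sz (args k e)) \<and> sat (case_nat w e) W)" ..
  then show "\<exists>q. \<forall>e. sat e \<phi> \<longrightarrow>
      (\<exists>w. length (bin w) \<le> poly q (sz (args k e)) \<and> sat (case_nat w e) W)"
    using assms(3) by (intro exI[of _ q]) blast
next
  fix \<Gamma> \<sigma> s
  assume "\<forall>n. wf_tm (\<sigma> n)" "wf_tm s" "\<Gamma> \<turnstile> subst_fm (case_nat s \<sigma>) W"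
  then show "\<Gamma> \<turnstile> subst_fm \<sigma> \<phi>"
    using witness_forD(4)[OF assms(1), of \<sigma> s \<Gamma>] assms(4)[of \<sigma> \<Gamma>] by blast
qed (use witness_forD(1-3)[OF assms(1)] assms(2) in \<open>simp_all\<close>)

abbreviation at_tm :: "tm \<Rightarrow> fm \<Rightarrow> fm" where
  "at_tm a W \<equiv> subst_fm (case_nat a (\<lambda>n. Var (Suc n))) W"

lemma fv_at_tm: "fv_fm W \<subseteq> insert 0 (Suc ` A) \<Longrightarrow> fv_tm a = {0} \<Longrightarrow> fv_fm (at_tm a W) \<subseteq> insert 0 (Suc ` A)"
proof
  fix i assume W: "fv_fm W \<subseteq> insert 0 (Suc ` A)" "fv_tm a = {0}" and "i \<in> fv_fm (at_tm a W)"
  then obtain n where n: "n \<in> fv_fm W" "i \<in> fv_tm (case_nat a (\<lambda>n. Var (Suc n)) n)"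
    by (auto simp: fv_subst_fm)
  then have "i = 0 \<or> i = n" using W(2) by (cases n) auto
  then show "i \<in> insert 0 (Suc ` A)" using n(1) W(1) by auto
qed

lemma subst_at_tm: "subst_fm (case_nat s \<sigma>) (at_tm a W) = subst_fm (case_nat (subst_tm (case_nat s \<sigma>) a) \<sigma>) W"
  by (simp add: subst_case_nat)

lemma sat_at_tm: "sat (case_nat w e) (at_tm a W) \<longleftrightarrow> sat (case_nat (eval_tm (case_nat w e) a) e) W"
  by (simp add: sat_case_nat del: sat_subst)

text \<open>The two components of a coded pair serve the two subformulas. For a disjunction only one
  component has to be right; the other is filled with 0.\<close>

lemma witness_for_Conj_Disj:
  assumes A: "witness_for j \<alpha> V" and B: "witness_for j \<beta> W" and wf: "wf_fm \<alpha>" "wf_fm \<beta>"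
  shows "witness_for j (Conj \<alpha> \<beta>) (Conj (at_tm fst_tm V) (at_tm snd_tm W))" (is ?C)
    and "witness_for j (Disj \<alpha> \<beta>) (Disj (at_tm fst_tm V) (at_tm snd_tm W))" (is ?D)
proof -
  note A = witness_forD[OF A] and B = witness_forD[OF B]
  have syn: "PiB j (at_tm fst_tm V)" "PiB j (at_tm snd_tm W)" "wf_fm (at_tm fst_tm V)" "wf_fm (at_tm snd_tm W)"
    using A(1,2) B(1,2) by (auto intro!: SigmaB_PiB_subst wf_subst_fm wf_case_nat)
  have "fv_fm V \<subseteq> insert 0 (Suc ` fv_fm (Conj \<alpha> \<beta>))" "fv_fm W \<subseteq> insert 0 (Suc ` fv_fm (Conj \<alpha> \<beta>))"
    using A(3) B(3) by auto
  then have fv: "fv_fm (at_tm fst_tm V) \<subseteq> insert 0 (Suc ` fv_fm (Conj \<alpha> \<beta>))"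
    "fv_fm (at_tm snd_tm W) \<subseteq> insert 0 (Suc ` fv_fm (Conj \<alpha> \<beta>))"
    by (simp_all add: fv_at_tm)
  have der: "\<Gamma> \<turnstile> subst_fm (case_nat s \<sigma>) (at_tm fst_tm V) \<Longrightarrow> \<Gamma> \<turnstile> subst_fm \<sigma> \<alpha>"
    "\<Gamma> \<turnstile> subst_fm (case_nat s \<sigma>) (at_tm snd_tm W) \<Longrightarrow> \<Gamma> \<turnstile> subst_fm \<sigma> \<beta>"
    if "\<And>n. wf_tm (\<sigma> n)" "wf_tm s" for \<Gamma> \<sigma> s
  proof -
    have wf: "wf_tm (subst_tm (case_nat s \<sigma>) a)" if "wf_tm a" for a
      by (rule wf_subst_tm[OF that]) (use \<open>\<And>n. wf_tm (\<sigma> n)\<close> \<open>wf_tm s\<close> in \<open>auto intro: wf_case_nat\<close>)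
    show "\<Gamma> \<turnstile> subst_fm (case_nat s \<sigma>) (at_tm fst_tm V) \<Longrightarrow> \<Gamma> \<turnstile> subst_fm \<sigma> \<alpha>"
      unfolding subst_at_tm by (rule A(4)[OF that(1) wf]) auto
    show "\<Gamma> \<turnstile> subst_fm (case_nat s \<sigma>) (at_tm snd_tm W) \<Longrightarrow> \<Gamma> \<turnstile> subst_fm \<sigma> \<beta>"
      unfolding subst_at_tm by (rule B(4)[OF that(1) wf]) auto
  qed
  have bnd: "\<exists>q. \<forall>e. (sat e \<alpha> \<longrightarrow> (\<exists>w. length (bin w) \<le> poly q (sz (args k e)) \<and> sat (case_nat w e) V)) \<and>
    (sat e \<beta> \<longrightarrow> (\<exists>w. length (bin w) \<le> poly q (sz (args k e)) \<and> sat (case_nat w e) W))"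
    if "fv_fm \<alpha> \<union> fv_fm \<beta> \<subseteq> {..<k}" for k
  proof -
    obtain q1 q2 where
      "\<forall>e. sat e \<alpha> \<longrightarrow> (\<exists>w. length (bin w) \<le> poly q1 (sz (args k e)) \<and> sat (case_nat w e) V)"
      "\<forall>e. sat e \<beta> \<longrightarrow> (\<exists>w. length (bin w) \<le> poly q2 (sz (args k e)) \<and> sat (case_nat w e) W)"
      using A(5)[of k] B(5)[of k] \<open>fv_fm \<alpha> \<union> fv_fm \<beta> \<subseteq> {..<k}\<close> by auto
    then show ?thesis
      by (intro exI[of _ "q1 + q2"]) (simp, meson trans_le_add1 trans_le_add2)
  qed
  show ?C
    unfolding witness_for_def
  proof (intro conjI allI impI)
    fix \<Gamma> \<sigma> s assume h: "\<forall>n. wf_tm (\<sigma> n)" "wf_tm s"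
      "\<Gamma> \<turnstile> subst_fm (case_nat s \<sigma>) (Conj (at_tm fst_tm V) (at_tm snd_tm W))"
    then have "\<Gamma> \<turnstile> Conj (subst_fm (case_nat s \<sigma>) (at_tm fst_tm V)) (subst_fm (case_nat s \<sigma>) (at_tm snd_tm W))"
      by simp
    from der[OF _ h(2), of \<sigma> \<Gamma>] proves.ConjE1[OF this] proves.ConjE2[OF this] h(1)
    show "\<Gamma> \<turnstile> subst_fm \<sigma> (Conj \<alpha> \<beta>)" by (simp add: proves.ConjI)
  next
    fix k assume "fv_fm (Conj \<alpha> \<beta>) \<subseteq> {..<k}"
    then obtain q where q: "\<And>e. sat e \<alpha> \<Longrightarrow> \<exists>w. length (bin w) \<le> poly q (sz (args k e)) \<and> sat (case_nat w e) V"
      "\<And>e. sat e \<beta> \<Longrightarrow> \<exists>w. length (bin w) \<le> poly q (sz (args k e)) \<and> sat (case_nat w e) W"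
      using bnd[of k] by (metis fv_fm.simps(3))
    show "\<exists>q. \<forall>e. sat e (Conj \<alpha> \<beta>) \<longrightarrow> (\<exists>w. length (bin w) \<le> poly q (sz (args k e)) \<and>
      sat (case_nat w e) (Conj (at_tm fst_tm V) (at_tm snd_tm W)))"
    \<comment> \<open>The code of a pair has length 2 + 2|m| + |n|.\<close>
    proof (intro exI[of _ "2 + 3 * q"] allI impI)
      fix e assume "sat e (Conj \<alpha> \<beta>)"
      then obtain m n where mn: "length (bin m) \<le> poly q (sz (args k e))" "sat (case_nat m e) V"
        "length (bin n) \<le> poly q (sz (args k e))" "sat (case_nat n e) W"
        using q[of e] by auto
      show "\<exists>w. length (bin w) \<le> poly (2 + 3 * q) (sz (args k e)) \<and>
        sat (case_nat w e) (Conj (at_tm fst_tm V) (at_tm snd_tm W))"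
        using mn by (intro exI[of _ "npair m n"]) (simp add: length_bin_npair sat_at_tm del: sat_subst)
    qed
  qed (use syn fv in \<open>auto intro: SigmaB_PiB.PiB_Conj\<close>)
  show ?D
    unfolding witness_for_def
  proof (intro conjI allI impI)
    fix \<Gamma> \<sigma> s assume h: "\<forall>n. wf_tm (\<sigma> n)" "wf_tm s"
      "\<Gamma> \<turnstile> subst_fm (case_nat s \<sigma>) (Disj (at_tm fst_tm V) (at_tm snd_tm W))"
    let ?V = "subst_fm (case_nat s \<sigma>) (at_tm fst_tm V)" and ?W = "subst_fm (case_nat s \<sigma>) (at_tm snd_tm W)"
    have d: "\<Gamma> \<turnstile> Disj ?V ?W" using h(3) by simp
    have w: "wf_fm ?V" "wf_fm ?W" "wf_fm (subst_fm \<sigma> \<alpha>)" "wf_fm (subst_fm \<sigma> \<beta>)"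
      using h(1,2) syn(3,4) wf by (auto intro!: wf_subst_fm wf_case_nat simp del: subst_fm.simps)
    have "insert ?V \<Gamma> \<turnstile> subst_fm \<sigma> \<alpha>" "insert ?W \<Gamma> \<turnstile> subst_fm \<sigma> \<beta>"
      using der[OF _ h(2), of \<sigma>] h(1) hyp1 w by blast+
    then show "\<Gamma> \<turnstile> subst_fm \<sigma> (Disj \<alpha> \<beta>)"
      using proves.DisjE[OF d] proves.DisjI1 proves.DisjI2 w by simp
  next
    fix k assume "fv_fm (Disj \<alpha> \<beta>) \<subseteq> {..<k}"
    then obtain q where q: "\<And>e. sat e \<alpha> \<Longrightarrow> \<exists>w. length (bin w) \<le> poly q (sz (args k e)) \<and> sat (case_nat w e) V"
      "\<And>e. sat e \<beta> \<Longrightarrow> \<exists>w. length (bin w) \<le> poly q (sz (args k e)) \<and> sat (case_nat w e) W"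
      using bnd[of k] by (metis fv_fm.simps(4))
    show "\<exists>q. \<forall>e. sat e (Disj \<alpha> \<beta>) \<longrightarrow> (\<exists>w. length (bin w) \<le> poly q (sz (args k e)) \<and>
      sat (case_nat w e) (Disj (at_tm fst_tm V) (at_tm snd_tm W)))"
    proof (intro exI[of _ "2 + 3 * q"] allI impI)
      fix e assume "sat e (Disj \<alpha> \<beta>)"
      then consider m where "length (bin m) \<le> poly q (sz (args k e))" "sat (case_nat m e) V"
        | n where "length (bin n) \<le> poly q (sz (args k e))" "sat (case_nat n e) W"
        using q[of e] by auto
      then show "\<exists>w. length (bin w) \<le> poly (2 + 3 * q) (sz (args k e)) \<and>
        sat (case_nat w e) (Disj (at_tm fst_tm V) (at_tm snd_tm W))"
      proof cases
        case (1 m)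
        then show ?thesis
          by (intro exI[of _ "npair m 0"]) (simp add: length_bin_npair sat_at_tm del: sat_subst)
      next
        case (2 n)
        then show ?thesis
          by (intro exI[of _ "npair 0 n"]) (simp add: length_bin_npair sat_at_tm del: sat_subst)
      qed
    qed
  qed (use syn fv in \<open>auto intro: SigmaB_PiB.PiB_Disj\<close>)
qed

text \<open>The first component is the quantified number, the second a witness for the body, in
  which the first component occurs as a parameter.\<close>

lemma witness_for_BExists:
  assumes A: "witness_for j \<alpha> V" and wf: "wf_tm t" "wf_fm \<alpha>"
  shows "witness_for j (BExists t \<alpha>) (Conj (Le fst_tm (lift_tm t))
    (subst_fm (case_nat snd_tm (case_nat fst_tm (\<lambda>n. Var (Suc n)))) V))"
    (is "witness_for j _ (Conj ?L ?W)")
proof -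
  note A = witness_forD[OF A]
  have syn: "PiB j ?W" "wf_fm ?W" "PiB j ?L" "wf_fm ?L"
    using A(1,2) wf by (auto intro!: SigmaB_PiB_subst wf_subst_fm wf_case_nat SigmaB_Le)
  have subst_W: "subst_fm (case_nat s \<sigma>) ?W = subst_fm (case_nat (subst_tm (case_nat s \<sigma>) snd_tm)
    (case_nat (subst_tm (case_nat s \<sigma>) fst_tm) \<sigma>)) V" for s \<sigma>
  proof -
    have "(\<lambda>n. subst_tm (case_nat s \<sigma>) (case_nat fst_tm (\<lambda>n. Var (Suc n)) n)) =
      case_nat (subst_tm (case_nat s \<sigma>) fst_tm) \<sigma>"
      by (rule ext) (simp split: nat.split)
    then show ?thesis by (simp add: subst_case_nat)
  qed
  have sat_W: "sat (case_nat w e) ?W \<longleftrightarrow> sat (case_nat (eval_tm (case_nat w e) snd_tm)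
    (case_nat (eval_tm (case_nat w e) fst_tm) e)) V" for w e
  proof -
    have "(\<lambda>n. eval_tm (case_nat w e) (case_nat fst_tm (\<lambda>n. Var (Suc n)) n)) =
      case_nat (eval_tm (case_nat w e) fst_tm) e"
      by (rule ext) (simp split: nat.split)
    then show ?thesis by (simp add: sat_case_nat del: sat_subst)
  qed
  show ?thesis
    unfolding witness_for_def
  proof (intro conjI allI impI)
    have "fv_fm ?W \<subseteq> insert 0 (Suc ` {n. Suc n \<in> fv_fm \<alpha>})"
    proof
      fix i assume "i \<in> fv_fm ?W"
      then obtain n where n: "n \<in> fv_fm V" "i \<in> fv_tm (case_nat snd_tm (case_nat fst_tm (\<lambda>n. Var (Suc n))) n)"
        by (auto simp: fv_subst_fm)
      then consider "i = 0" | m where "n = Suc (Suc m)" "i = Suc m"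
        by (auto split: nat.splits)
      then show "i \<in> insert 0 (Suc ` {n. Suc n \<in> fv_fm \<alpha>})"
        using n(1) A(3) by cases auto
    qed
    then show "fv_fm (Conj ?L ?W) \<subseteq> insert 0 (Suc ` fv_fm (BExists t \<alpha>))" by auto
  next
    fix \<Gamma> \<sigma> s assume h: "\<forall>n. wf_tm (\<sigma> n)" "wf_tm s" "\<Gamma> \<turnstile> subst_fm (case_nat s \<sigma>) (Conj ?L ?W)"
    let ?r = "subst_tm (case_nat s \<sigma>) fst_tm"
    have wr: "wf_tm ?r" "wf_tm (subst_tm (case_nat s \<sigma>) snd_tm)"
      using h(1,2) by (auto intro!: wf_subst_tm wf_case_nat)
    have c: "\<Gamma> \<turnstile> Conj (Le ?r (subst_tm \<sigma> t)) (subst_fm (case_nat s \<sigma>) ?W)"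
      using h(3) by (simp add: Le_def subst_tm_comp)
    have "\<Gamma> \<turnstile> subst_fm (case_nat ?r \<sigma>) \<alpha>"
      by (rule A(4)[OF _ wr(2)]) (use proves.ConjE2[OF c] h(1) wr in \<open>auto simp: subst_W intro: wf_case_nat\<close>)
    with proves.ConjE1[OF c] have "\<Gamma> \<turnstile> Conj (Le ?r (subst_tm \<sigma> t)) (subst_fm (case_nat ?r \<sigma>) \<alpha>)"
      by (rule proves.ConjI)
    moreover have "(\<lambda>n. subst_tm (case_nat ?r Var) (lift_subst \<sigma> n)) = case_nat ?r \<sigma>"
      by (rule ext) (simp add: lift_subst_def subst_tm_comp split: nat.split)
    ultimately have "\<Gamma> \<turnstile> inst (Conj (Le (Var 0) (lift_tm (subst_tm \<sigma> t))) (subst_fm (lift_subst \<sigma>) \<alpha>)) ?r"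
      by (simp add: Le_def subst_tm_comp subst_fm_comp)
    from proves.ExistsI[OF wr(1) _ this]
    have "\<Gamma> \<turnstile> BExists (subst_tm \<sigma> t) (subst_fm (lift_subst \<sigma>) \<alpha>)"
      using h(1) wf by (simp add: BExists_def wf_subst_tm wf_subst_fm wf_lift_subst)
    then show "\<Gamma> \<turnstile> subst_fm \<sigma> (BExists t \<alpha>)" by simp
  next
    fix k assume k: "fv_fm (BExists t \<alpha>) \<subseteq> {..<k}"
    then have "fv_fm \<alpha> \<subseteq> {..<Suc k}"
      by (auto simp: subset_iff less_Suc_eq_0_disj) (metis not0_implies_Suc)
    from A(5)[OF this] obtain q where q: "\<And>e. sat e \<alpha> \<Longrightarrow>
        \<exists>w. length (bin w) \<le> poly q (sz (args (Suc k) e)) \<and> sat (case_nat w e) V"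
      by blast
    have kt: "fv_tm t \<subseteq> {..<k}" using k by simp
    obtain r where r: "\<And>xs. length xs = k \<Longrightarrow> length (bin (eval_tm (env xs) t)) \<le> poly r (sz xs)"
      using polytime_length[OF polytime_term[OF wf(1) kt]] by blast
    have rt: "length (bin (eval_tm e t)) \<le> poly r (sz (args k e))" for e
    proof -
      have "eval_tm (env (args k e)) t = eval_tm e t"
        by (rule eval_tm_cong) (use kt in auto)
      then show ?thesis using r[of "args k e"] by simp
    qed
    show "\<exists>q. \<forall>e. sat e (BExists t \<alpha>) \<longrightarrow>
      (\<exists>w. length (bin w) \<le> poly q (sz (args k e)) \<and> sat (case_nat w e) (Conj ?L ?W))"
    \<comment> \<open>The quantified number is bounded through the term by \<open>r\<close>, and the
      inner witness by \<open>q\<close> of that number together with the parameters.\<close>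
    proof (intro exI[of _ "2 + 2 * r + pcompose q (r + [:0, 1:])"] allI impI)
      fix e assume "sat e (BExists t \<alpha>)"
      then obtain m where m: "m \<le> eval_tm e t" "sat (case_nat m e) \<alpha>" by auto
      obtain w where w: "length (bin w) \<le> poly q (sz (args (Suc k) (case_nat m e)))"
        "sat (case_nat w (case_nat m e)) V"
        using q[OF m(2)] by blast
      have m_len: "length (bin m) \<le> poly r (sz (args k e))"
        using length_bin_mono[OF m(1)] rt[of e] by linarith
      have "length (bin w) \<le> poly q (length (bin m) + sz (args k e))"
        using w(1) unfolding args_Suc by simp
      also have "\<dots> \<le> poly q (poly r (sz (args k e)) + sz (args k e))"
        using m_len by (intro poly_nat_mono) simp
      finally have "length (bin (npair m w)) \<le> poly (2 + 2 * r + pcompose q (r + [:0, 1:])) (sz (args k e))"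
        using m_len by (simp add: length_bin_npair poly_pcompose)
      moreover have "sat (case_nat (npair m w) e) (Conj ?L ?W)"
        using m(1) w(2) sat_W by simp
      ultimately show "\<exists>w. length (bin w) \<le> poly (2 + 2 * r + pcompose q (r + [:0, 1:])) (sz (args k e)) \<and>
        sat (case_nat w e) (Conj ?L ?W)" by blast
    qed
  qed (use syn in \<open>auto intro: SigmaB_PiB.PiB_Conj\<close>)
qed

lemma Neg_ConjI:
  assumes "\<Gamma> \<turnstile> Disj (Neg \<alpha>) (Neg \<beta>)" "wf_fm \<alpha>" "wf_fm \<beta>" shows "\<Gamma> \<turnstile> Neg (Conj \<alpha> \<beta>)"
proof (rule proves.DisjE[OF assms(1)])
  let ?C = "Conj \<alpha> \<beta>"
  have c: "insert ?C \<Delta> \<turnstile> ?C" for \<Delta> using assms by (intro hyp1) simp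
  show "insert (Neg \<alpha>) \<Gamma> \<turnstile> Neg ?C"
    by (rule proves.NegI[of _ _ \<alpha>]) (use assms proves.ConjE1[OF c] in \<open>auto intro: proves.Hyp\<close>)
  show "insert (Neg \<beta>) \<Gamma> \<turnstile> Neg ?C"
    by (rule proves.NegI[of _ _ \<beta>]) (use assms proves.ConjE2[OF c] in \<open>auto intro: proves.Hyp\<close>)
qed

lemma Neg_DisjI:
  assumes "\<Gamma> \<turnstile> Neg \<alpha>" "\<Gamma> \<turnstile> Neg \<beta>" "wf_fm \<alpha>" "wf_fm \<beta>" shows "\<Gamma> \<turnstile> Neg (Disj \<alpha> \<beta>)"
proof (rule Neg_if_Fal)
  show "insert (Disj \<alpha> \<beta>) \<Gamma> \<turnstile> Fal"
  proof (rule left_Disj)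
    show "insert \<alpha> \<Gamma> \<turnstile> Fal" by (rule proves_contra[OF hyp1 proves_weaken[OF assms(1)]]) (use assms in auto)
    show "insert \<beta> \<Gamma> \<turnstile> Fal" by (rule proves_contra[OF hyp1 proves_weaken[OF assms(2)]]) (use assms in auto)
  qed (use assms in simp)
qed (use assms in simp)

lemma Neg_NegI:
  assumes "\<Gamma> \<turnstile> \<alpha>" "wf_fm \<alpha>" shows "\<Gamma> \<turnstile> Neg (Neg \<alpha>)"
  by (rule proves.NegI[of _ _ \<alpha>]) (use assms in \<open>auto intro: hyp1 proves_weaken[OF assms(1)]\<close>)

lemma Neg_BForallI:
  assumes "\<Gamma> \<turnstile> BExists t (Neg \<alpha>)" "wf_tm t" "wf_fm \<alpha>" shows "\<Gamma> \<turnstile> Neg (BForall t \<alpha>)"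
proof (rule Neg_if_Fal)
  let ?L = "Le (Var 0) (lift_tm t)"
  let ?E = "Conj ?L (Neg \<alpha>)" and ?D = "Disj (Neg ?L) \<alpha>"
  let ?\<Delta> = "insert ?E (lift_fm ` (insert (BForall t \<alpha>) \<Gamma>))"
  have "lift_fm (BForall t \<alpha>) = Forall (subst_fm (lift_subst (\<lambda>n. Var (Suc n))) ?D)"
    by (simp add: BForall_def)
  then have "?\<Delta> \<turnstile> Forall (subst_fm (lift_subst (\<lambda>n. Var (Suc n))) ?D)"
    using assms by (intro proves.Hyp) (auto intro!: wf_subst_fm wf_lift_subst simp del: subst_fm.simps)
  \<comment> \<open>Instantiation at the witness of the existential hypothesis, which is variable 0
    after lifting.\<close>
  from proves.ForallE[OF this, of "Var 0"]
  have "?\<Delta> \<turnstile> subst_fm (\<lambda>n. subst_tm (case_nat (Var 0) Var) (lift_subst (\<lambda>n. Var (Suc n)) n)) ?D"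
    by (simp add: subst_fm_comp subst_tm_comp)
  moreover have "(\<lambda>n. subst_tm (case_nat (Var 0) Var) (lift_subst (\<lambda>n. Var (Suc n)) n)) = Var"
    by (rule ext) (simp add: lift_subst_def split: nat.split)
  ultimately have D: "?\<Delta> \<turnstile> ?D" by simp
  have E: "?\<Delta> \<turnstile> ?E" using assms by (intro hyp1) simp
  have "?\<Delta> \<turnstile> Neg ?D"
    by (rule Neg_DisjI[OF Neg_NegI[OF proves.ConjE1[OF E]] proves.ConjE2[OF E]]) (use assms in auto)
  then have "?\<Delta> \<turnstile> lift_fm Fal" using proves_contra[OF D] by simp
  moreover have "insert (BForall t \<alpha>) \<Gamma> \<turnstile> Exists ?E"
    using proves_weaken[OF assms(1), of "insert (BForall t \<alpha>) \<Gamma>"] by (auto simp: BExists_def)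
  ultimately show "insert (BForall t \<alpha>) \<Gamma> \<turnstile> Fal" using proves.ExistsE by blast
qed (use assms in simp)

lemma ex_witness:
  assumes "SigmaB (Suc j) \<phi>" "wf_fm \<phi>"
  shows "\<exists>W. witness_for j \<phi> W"
  using assms
proof (induction "fsize \<phi>" arbitrary: \<phi> rule: less_induct)
  case less
  from less.prems(1) show ?case
  proof (cases rule: SigmaB_cases)
    case leaf
    then show ?thesis using witness_for_leaf less.prems(2) by blast
  next
    case (Conj \<alpha> \<beta>)
    then show ?thesis using less.hyps[of \<alpha>] less.hyps[of \<beta>] less.prems(2) witness_for_Conj_Disj(1)[of j \<alpha> _ \<beta>] by force
  next
    case (Disj \<alpha> \<beta>)
    then show ?thesis using less.hyps[of \<alpha>] less.hyps[of \<beta>] less.prems(2) witness_for_Conj_Disj(2)[of j \<alpha> _ \<beta>] by force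
  next
    case (BExists t \<alpha>)
    have "fsize \<alpha> < fsize \<phi>" using BExists by (simp add: BExists_def)
    then show ?thesis using less.hyps[of \<alpha>] less.prems(2) BExists witness_for_BExists[of j \<alpha> _ t] by force
  next
    case (Neg_Conj \<alpha> \<beta>)
    then obtain V W where "witness_for j (Neg \<alpha>) V" "witness_for j (Neg \<beta>) W"
      using less.hyps[of "Neg \<alpha>"] less.hyps[of "Neg \<beta>"] less.prems(2) by force
    from witness_for_Conj_Disj(2)[OF this] have "witness_for j (Disj (Neg \<alpha>) (Neg \<beta>))
      (Disj (at_tm fst_tm V) (at_tm snd_tm W))"
      using less.prems(2) Neg_Conj by simp
    then have "witness_for j \<phi> (Disj (at_tm fst_tm V) (at_tm snd_tm W))"
      by (rule witness_for_transfer) (use Neg_Conj less.prems(2) in \<open>auto intro: Neg_ConjI wf_subst_fm\<close>)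
    then show ?thesis by blast
  next
    case (Neg_Disj \<alpha> \<beta>)
    then obtain V W where "witness_for j (Neg \<alpha>) V" "witness_for j (Neg \<beta>) W"
      using less.hyps[of "Neg \<alpha>"] less.hyps[of "Neg \<beta>"] less.prems(2) by force
    from witness_for_Conj_Disj(1)[OF this] have "witness_for j (Conj (Neg \<alpha>) (Neg \<beta>))
      (Conj (at_tm fst_tm V) (at_tm snd_tm W))"
      using less.prems(2) Neg_Disj by simp
    then have "witness_for j \<phi> (Conj (at_tm fst_tm V) (at_tm snd_tm W))"
      by (rule witness_for_transfer) (use Neg_Disj less.prems(2) in
        \<open>auto intro!: Neg_DisjI intro: wf_subst_fm proves.ConjE1 proves.ConjE2\<close>)
    then show ?thesis by blast
  next
    case (Neg_Neg \<alpha>)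
    then obtain W where "witness_for j \<alpha> W" using less.hyps[of \<alpha>] less.prems(2) by force
    then have "witness_for j \<phi> W"
      by (rule witness_for_transfer) (use Neg_Neg less.prems(2) in \<open>auto intro: Neg_NegI wf_subst_fm\<close>)
    then show ?thesis by blast
  next
    case (Neg_BForall t \<alpha>)
    have "fsize (Neg \<alpha>) < fsize \<phi>" using Neg_BForall by (simp add: BForall_def)
    then obtain W where "witness_for j (Neg \<alpha>) W" using less.hyps[of "Neg \<alpha>"] less.prems(2) Neg_BForall by force
    from witness_for_BExists[OF this, of t] obtain W' where "witness_for j (BExists t (Neg \<alpha>)) W'"
      using less.prems(2) Neg_BForall by auto
    then have "witness_for j \<phi> W'"
      by (rule witness_for_transfer) (use Neg_BForall less.prems(2) in
        \<open>auto intro: Neg_BForallI wf_subst_fm wf_subst_tm wf_lift_subst\<close>)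
    then show ?thesis by blast
  qed
qed


section \<open>Oracle computations as clocked simulations and tables of answers\<close>

section \<open>Clocked simulation of oracle programs\<close>

text \<open>The simulated state is the list of the registers below \<open>M\<close>, followed by advice, a clock and
  a failure flag. Loops are cut off after as many rounds as the clock is long, and answers are cut
  to that length; this makes the simulation polynomial on all inputs while changing nothing on runs
  that are short enough. A query is answered by \<open>ans\<close> from the advice, and raises the flag if \<open>ok\<close>
  rejects it.\<close>

primrec sim :: "(bool list \<Rightarrow> bool list \<Rightarrow> bool list) \<Rightarrow> (bool list \<Rightarrow> bool list \<Rightarrow> bool) \<Rightarrow> nat \<Rightarrow>
    prog \<Rightarrow> bool list list \<Rightarrow> bool list list" where
  "sim ans ok M Skip xs = xs"
| "sim ans ok M (Push b r) xs = xs[r := b # xs ! r]"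
| "sim ans ok M (Pop r) xs = xs[r := tl (xs ! r)]"
| "sim ans ok M (Seq c d) xs = sim ans ok M d (sim ans ok M c xs)"
| "sim ans ok M (Case r c0 c1 c2) xs =
    bcase (xs ! r) (sim ans ok M c0 xs) (sim ans ok M c1 xs) (sim ans ok M c2 xs)"
| "sim ans ok M (Loop r c) xs =
    ((\<lambda>ys. if ys ! r = [] then ys else sim ans ok M c ys) ^^ length (xs ! Suc M)) xs"
| "sim ans ok M (Query r) xs =
    xs[r := take (length (xs ! Suc M)) (ans (xs ! r) (xs ! M)),
       Suc (Suc M) := (if ok (xs ! r) (xs ! M) then xs ! Suc (Suc M) else True # xs ! Suc (Suc M))]"

lemma funpow_invariant: "P x \<Longrightarrow> (\<And>y. P y \<Longrightarrow> P (f y)) \<Longrightarrow> P ((f ^^ n) x)"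
  by (induction n) auto

context
  fixes ans :: "bool list \<Rightarrow> bool list \<Rightarrow> bool list" and ok :: "bool list \<Rightarrow> bool list \<Rightarrow> bool"
    and M :: nat
begin

abbreviation (input) "S \<equiv> sim ans ok M"

lemma sim_frame:
  assumes "width c \<le> M" "length xs = Suc (Suc (Suc M))"
  shows "length (S c xs) = Suc (Suc (Suc M)) \<and> S c xs ! M = xs ! M \<and> S c xs ! Suc M = xs ! Suc M \<and>
    (xs ! Suc (Suc M) \<noteq> [] \<longrightarrow> S c xs ! Suc (Suc M) \<noteq> [])"
  using assms
proof (induction c arbitrary: xs)
  case (Seq c d)
  then show ?case by (metis max.bounded_iff sim.simps(4) width.simps(4))
next
  case (Case r c0 c1 c2)
  then show ?case by (auto simp: bcase_alt)
next
  case (Loop r c)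
  let ?P = "\<lambda>ys. length ys = Suc (Suc (Suc M)) \<and> ys ! M = xs ! M \<and> ys ! Suc M = xs ! Suc M \<and>
    (xs ! Suc (Suc M) \<noteq> [] \<longrightarrow> ys ! Suc (Suc M) \<noteq> [])"
  have "?P (((\<lambda>ys. if ys ! r = [] then ys else S c ys) ^^ n) xs)" for n
    by (rule funpow_invariant) (use Loop in auto)
  from this[of "length (xs ! Suc M)"] show ?case unfolding sim.simps .
qed (auto simp: nth_list_update)

lemma sz_list_update: "i < length xs \<Longrightarrow> sz (xs[i := y]) + length (xs ! i) = sz xs + length y"
proof (induction xs arbitrary: i)
  case (Cons x xs)
  then show ?case by (cases i) auto
qed simp

text \<open>The growth is bounded in terms of the clock alone and not of the current size; otherwise
  nested loops would compound it. As the clock never changes, a loop multiplies the growth of its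
  body by the length of the clock.\<close>

lemma sim_growth:
  assumes "width c \<le> M"
  shows "\<exists>p. \<forall>xs. length xs = Suc (Suc (Suc M)) \<longrightarrow> sz (S c xs) \<le> sz xs + poly p (length (xs ! Suc M))"
  using assms
proof (induction c)
  case Skip
  show ?case by (intro exI[of _ 0]) simp
next
  case (Push b r)
  have "sz (S (Push b r) xs) \<le> sz xs + poly 1 (length (xs ! Suc M))"
    if "length xs = Suc (Suc (Suc M))" for xs
    using sz_list_update[of r xs "b # xs ! r"] that Push by simp
  then show ?case by blast
next
  case (Pop r)
  have "sz (S (Pop r) xs) \<le> sz xs + poly 1 (length (xs ! Suc M))"
    if "length xs = Suc (Suc (Suc M))" for xs
    using sz_list_update[of r xs "tl (xs ! r)"] that Pop by simp
  then show ?case by blast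
next
  case (Seq c d)
  then obtain p q where
    "\<And>xs. length xs = Suc (Suc (Suc M)) \<Longrightarrow> sz (S c xs) \<le> sz xs + poly p (length (xs ! Suc M))"
    "\<And>xs. length xs = Suc (Suc (Suc M)) \<Longrightarrow> sz (S d xs) \<le> sz xs + poly q (length (xs ! Suc M))"
    by auto
  note pq = this
  have "sz (S d (S c xs)) \<le> sz xs + poly (p + q) (length (xs ! Suc M))"
    if "length xs = Suc (Suc (Suc M))" for xs
    using pq(1)[OF that] pq(2)[of "S c xs"] sim_frame[of c xs] Seq.prems that by simp
  then show ?case unfolding sim.simps by blast
next
  case (Case r c0 c1 c2)
  then obtain p0 p1 p2 where
    "\<And>xs. length xs = Suc (Suc (Suc M)) \<Longrightarrow> sz (S c0 xs) \<le> sz xs + poly p0 (length (xs ! Suc M))"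
    "\<And>xs. length xs = Suc (Suc (Suc M)) \<Longrightarrow> sz (S c1 xs) \<le> sz xs + poly p1 (length (xs ! Suc M))"
    "\<And>xs. length xs = Suc (Suc (Suc M)) \<Longrightarrow> sz (S c2 xs) \<le> sz xs + poly p2 (length (xs ! Suc M))"
    by auto
  then have "sz (S (Case r c0 c1 c2) xs) \<le> sz xs + poly (p0 + p1 + p2) (length (xs ! Suc M))"
    if "length xs = Suc (Suc (Suc M))" for xs
    using that by (fastforce simp: bcase_alt)
  then show ?case by blast
next
  case (Loop r c)
  then obtain p where
    p: "\<And>xs. length xs = Suc (Suc (Suc M)) \<Longrightarrow> sz (S c xs) \<le> sz xs + poly p (length (xs ! Suc M))"
    by auto
  let ?F = "\<lambda>ys. if ys ! r = [] then ys else S c ys"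
  have "sz (S (Loop r c) xs) \<le> sz xs + poly ([:0, 1:] * p) (length (xs ! Suc M))"
    if xs: "length xs = Suc (Suc (Suc M))" for xs
  proof -
    have "length ((?F ^^ n) xs) = Suc (Suc (Suc M)) \<and> (?F ^^ n) xs ! Suc M = xs ! Suc M \<and>
      sz ((?F ^^ n) xs) \<le> sz xs + n * poly p (length (xs ! Suc M))" for n
    proof (induction n)
      case (Suc n)
      then show ?case using sim_frame[of c "(?F ^^ n) xs"] p[of "(?F ^^ n) xs"] Loop.prems by auto
    qed (use xs in simp)
    then show ?thesis by simp
  qed
  then show ?case by blast
next
  case (Query r)
  have "sz (S (Query r) xs) \<le> sz xs + poly [:1, 1:] (length (xs ! Suc M))"
    if xs: "length xs = Suc (Suc (Suc M))" for xs
  proof -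
    let ?a = "take (length (xs ! Suc M)) (ans (xs ! r) (xs ! M))"
    let ?b = "if ok (xs ! r) (xs ! M) then xs ! Suc (Suc M) else True # xs ! Suc (Suc M)"
    have "sz (xs[r := ?a]) \<le> sz xs + length (xs ! Suc M)"
      using sz_list_update[of r xs ?a] Query.prems xs by simp
    moreover have "sz (xs[r := ?a, Suc (Suc M) := ?b]) \<le> sz (xs[r := ?a]) + 1"
      using sz_list_update[of "Suc (Suc M)" "xs[r := ?a]" ?b] Query.prems xs by auto
    ultimately show ?thesis by simp
  qed
  then show ?case by blast
qed

lemma polytime_list_update:
  assumes "\<And>i. i < k \<Longrightarrow> polytime m (\<lambda>xs. F xs ! i)" "polytime m f" "i < k"
    and "\<And>xs. length xs = m \<Longrightarrow> length (F xs) = k"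
  shows "polytime m (\<lambda>xs. (F xs)[r := f xs] ! i)"
proof (cases "i = r")
  case True
  show ?thesis by (rule polytime_cong[THEN iffD1, OF _ assms(2)]) (use True assms(3,4) in simp)
next
  case False
  then show ?thesis using assms(1)[OF assms(3)] by simp
qed

lemma polytime_sim:
  assumes ans: "polytime 2 (\<lambda>ys. ans (ys ! 0) (ys ! 1))"
    and ok: "polytime_pred 2 (\<lambda>ys. ok (ys ! 0) (ys ! 1))"
    and "width c \<le> M" "i < Suc (Suc (Suc M))"
  shows "polytime (Suc (Suc (Suc M))) (\<lambda>xs. S c xs ! i)"
  using assms(3,4)
proof (induction c arbitrary: i)
  case Skip
  then show ?case by (auto intro: pt)
next
  case (Push b r)
  then show ?case
    unfolding sim.simps by (intro polytime_list_update[where k = "Suc (Suc (Suc M))"]) (auto intro!: pt)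
next
  case (Pop r)
  then show ?case
    unfolding sim.simps by (intro polytime_list_update[where k = "Suc (Suc (Suc M))"]) (auto intro!: pt)
next
  case (Seq c d)
  show ?case
    unfolding sim.simps
  proof (rule polytime_subst[where f = "\<lambda>xs. S d xs ! i" and h = "S c" and m = "Suc (Suc (Suc M))"
        and gs = "map (\<lambda>i xs. S c xs ! i) [0..<Suc (Suc (Suc M))]"])
    show "polytime (Suc (Suc (Suc M))) (\<lambda>xs. S d xs ! i)" using Seq by simp
    show "polytime (Suc (Suc (Suc M))) g" if "g \<in> set (map (\<lambda>i xs. S c xs ! i) [0..<Suc (Suc (Suc M))])" for g
      using that Seq by (auto simp del: upt_Suc)
    show "map (\<lambda>g. g xs) (map (\<lambda>i xs. S c xs ! i) [0..<Suc (Suc (Suc M))]) = S c xs"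
      if "length xs = Suc (Suc (Suc M))" for xs
      using sim_frame[of c xs] that Seq.prems by (intro nth_equalityI) (simp_all del: upt_Suc)
  qed simp
next
  case (Case r c0 c1 c2)
  have "polytime (Suc (Suc (Suc M))) (\<lambda>xs. bcase (xs ! r) (S c0 xs ! i) (S c1 xs ! i) (S c2 xs ! i))"
    using Case by (intro pt) auto
  then show ?case by (rule polytime_cong[THEN iffD1, rotated]) (simp add: bcase_alt)
next
  case (Loop r c)
  let ?k = "Suc (Suc (Suc M))"
  let ?F = "\<lambda>ys. if ys ! r = [] then ys else S c ys"
  obtain p where p: "\<And>xs. length xs = ?k \<Longrightarrow> sz (S c xs) \<le> sz xs + poly p (length (xs ! Suc M))"
    using sim_growth[of c] Loop.prems by auto
  have "polytime (Suc ?k) (\<lambda>xs. ((?F ^^ length (xs ! ?k)) (take ?k xs)) ! i)"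
  \<comment> \<open>Each of at most |clock| rounds adds at most \<open>p\<close> of |clock|, and the
    counter and the clock are part of the input.\<close>
  proof (rule polytime_iter[where q = "[:0, 1:] * (1 + p)"])
    fix ys :: "bool list list" assume "length ys = ?k"
    then show "length (?F ys) = ?k" using sim_frame[of c ys] Loop.prems by simp
  next
    fix l assume "l < ?k"
    then have "polytime ?k (\<lambda>ys. if ys ! r = [] then ys ! l else S c ys ! l)"
      using Loop by (intro pt Loop.IH) auto
    then show "polytime ?k (\<lambda>ys. ?F ys ! l)"
      by (rule polytime_cong[THEN iffD1, rotated]) simp
  next
    fix xs :: "bool list list" and n assume xs: "length xs = Suc ?k" "n \<le> length (xs ! ?k)"
    let ?v = "take ?k xs"
    have "length ((?F ^^ n) ?v) = ?k \<and> (?F ^^ n) ?v ! Suc M = xs ! Suc M \<and>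
      sz ((?F ^^ n) ?v) \<le> sz ?v + n * poly p (length (xs ! Suc M))" for n
    proof (induction n)
      case (Suc n)
      then show ?case using sim_frame[of c "(?F ^^ n) ?v"] p[of "(?F ^^ n) ?v"] Loop.prems by auto
    qed (use xs in simp)
    moreover have "sz ?v \<le> sz xs"
      by (metis append_take_drop_id le_add1 map_append sum_list_append)
    moreover have "n \<le> sz xs" "length (xs ! Suc M) \<le> sz xs"
      using xs length_nth_le_sz[of ?k xs] length_nth_le_sz[of "Suc M" xs] by auto
    then have "n * poly p (length (xs ! Suc M)) \<le> sz xs * poly p (sz xs)"
      by (intro mult_mono poly_nat_mono) auto
    ultimately have "sz ((?F ^^ n) ?v) \<le> sz xs + sz xs * poly p (sz xs)"
      by (meson add_mono order_trans)
    then show "sz ((?F ^^ n) ?v) \<le> poly ([:0, 1:] * (1 + p)) (sz xs)"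
      by (simp add: algebra_simps)
  qed (use Loop.prems in simp)
  \<comment> \<open>The clock is duplicated: one copy counts the rounds, the other stays in the
    state for inner loops.\<close>
  then have "polytime ?k (\<lambda>xs. (\<lambda>ys. (?F ^^ length (ys ! ?k)) (take ?k ys) ! i) (xs @ [xs ! Suc M]))"
  proof (rule polytime_subst)
    show "length (map (\<lambda>i ys. ys ! i) [0..<?k] @ [\<lambda>ys. ys ! Suc M]) = Suc ?k" by simp
    fix g assume "g \<in> set (map (\<lambda>i ys. ys ! i) [0..<?k] @ [\<lambda>ys :: bool list list. ys ! Suc M])"
    then show "polytime ?k g" by (auto intro!: pt simp del: upt_Suc)
  next
    fix xs :: "bool list list" assume "length xs = ?k"
    then have "map (\<lambda>i. xs ! i) [0..<?k] = xs" by (metis map_nth)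
    then show "map (\<lambda>g. g xs) (map (\<lambda>i ys. ys ! i) [0..<?k] @ [\<lambda>ys. ys ! Suc M]) = xs @ [xs ! Suc M]"
      by (simp add: comp_def del: upt_Suc)
  qed
  then show ?case
    by (rule polytime_cong[THEN iffD1, rotated]) (simp add: nth_append)
next
  case (Query r)
  have c: "polytime_pred (Suc (Suc (Suc M))) (\<lambda>xs. ok (xs ! r) (xs ! M))"
    by (rule polytime_pred_comp[OF ok, of "[\<lambda>xs. xs ! r, \<lambda>xs. xs ! M]" _ "\<lambda>xs. [xs ! r, xs ! M]", simplified])
      (use Query in \<open>auto intro: pt\<close>)
  have a: "polytime (Suc (Suc (Suc M))) (\<lambda>xs. ans (xs ! r) (xs ! M))"
    by (rule polytime_comp2[OF ans]) (use Query in \<open>auto intro: pt\<close>)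
  have "polytime (Suc (Suc (Suc M))) (\<lambda>xs. xs[r := take (length (xs ! Suc M)) (ans (xs ! r) (xs ! M))] ! l)"
    if "l < Suc (Suc (Suc M))" for l
    by (rule polytime_list_update[where k = "Suc (Suc (Suc M))"]) (use that a in \<open>auto intro!: pt\<close>)
  then show ?case
    unfolding sim.simps
    by (intro polytime_list_update[where k = "Suc (Suc (Suc M))"]) (use Query c a in \<open>auto intro!: pt\<close>)
qed

definition sim_state :: "store \<Rightarrow> bool list \<Rightarrow> bool list \<Rightarrow> bool list \<Rightarrow> bool list list" where
  "sim_state s w clk b = map s [0..<M] @ [w, clk, b]"

lemma sim_state_nth [simp]:
  "length (sim_state s w clk b) = Suc (Suc (Suc M))" "r < M \<Longrightarrow> sim_state s w clk b ! r = s r"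
  "sim_state s w clk b ! M = w" "sim_state s w clk b ! Suc M = clk" "sim_state s w clk b ! Suc (Suc M) = b"
  by (auto simp: sim_state_def nth_append)

lemma sim_state_update: "r < M \<Longrightarrow> (sim_state s w clk b)[r := x] = sim_state (s(r := x)) w clk b"
  by (rule nth_equalityI) (auto simp: sim_state_def nth_append nth_list_update)

lemma sim_state_flag: "(sim_state s w clk b)[Suc (Suc M) := x] = sim_state s w clk x"
  by (rule nth_equalityI) (auto simp: sim_state_def nth_append nth_list_update nth_Cons')

text \<open>As \<open>sim\<close>, but with a number of rounds for the outermost loop of its own: in the induction
  over a run of a loop, it decreases while the clock does not.\<close>

definition sim_rounds :: "nat \<Rightarrow> prog \<Rightarrow> bool list list \<Rightarrow> bool list list" where
  "sim_rounds N c xs = (case c of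
      Loop r d \<Rightarrow> ((\<lambda>ys. if ys ! r = [] then ys else S d ys) ^^ N) xs
    | _ \<Rightarrow> S c xs)"

lemma sim_rounds_sim: "sim_rounds (length (xs ! Suc M)) c xs = S c xs"
  by (cases c) (simp_all add: sim_rounds_def)

lemma sim_rounds_flag:
  assumes "width c \<le> M" "length xs = Suc (Suc (Suc M))" "xs ! Suc (Suc M) \<noteq> []"
  shows "sim_rounds N c xs ! Suc (Suc M) \<noteq> []"
proof (cases "\<exists>r d. c = Loop r d")
  case True
  then obtain r d where c: "c = Loop r d" by blast
  let ?P = "\<lambda>ys. length ys = Suc (Suc (Suc M)) \<and> ys ! Suc (Suc M) \<noteq> []"
  have "?P (((\<lambda>ys. if ys ! r = [] then ys else S d ys) ^^ N) xs)"
    by (rule funpow_invariant) (use assms c sim_frame in auto)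
  then show ?thesis by (simp add: c sim_rounds_def)
next
  case False
  then have "sim_rounds N c xs = S c xs" by (cases c) (auto simp: sim_rounds_def)
  then show ?thesis using sim_frame[OF assms(1,2)] assms(3) by simp
qed

text \<open>Here \<open>qs\<close> stands for the queries of a fixed run with oracle
  \<open>g\<close>, while the advice is quantified inside. So the same list can be used to build a
  table and to judge a table that is given. Advice has to agree with \<open>g\<close> only on the
  queries that \<open>ok\<close> accepts.\<close>

definition sim_correct :: "(bool list \<Rightarrow> bool list) \<Rightarrow> prog \<Rightarrow> store \<Rightarrow> nat \<Rightarrow> store \<Rightarrow> bool list list \<Rightarrow> bool" where
  "sim_correct g c s t s' qs \<longleftrightarrow> (\<forall>w clk N. (\<forall>q. ok q w \<longrightarrow> ans q w = g q) \<longrightarrow> t \<le> length clk \<longrightarrow> t \<le> N \<longrightarrow>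
    ((\<forall>q\<in>set qs. ok q w) \<longrightarrow> sim_rounds N c (sim_state s w clk []) = sim_state s' w clk []) \<and>
    ((\<exists>q\<in>set qs. \<not> ok q w) \<longrightarrow> sim_rounds N c (sim_state s w clk []) ! Suc (Suc M) \<noteq> []))"

lemma sim_correctI:
  assumes "\<And>w clk N. (\<And>q. ok q w \<Longrightarrow> ans q w = g q) \<Longrightarrow> t \<le> length clk \<Longrightarrow> t \<le> N \<Longrightarrow>
    \<forall>q\<in>set qs. ok q w \<Longrightarrow> sim_rounds N c (sim_state s w clk []) = sim_state s' w clk []"
    and "\<And>w clk N. (\<And>q. ok q w \<Longrightarrow> ans q w = g q) \<Longrightarrow> t \<le> length clk \<Longrightarrow> t \<le> N \<Longrightarrow>
    \<exists>q\<in>set qs. \<not> ok q w \<Longrightarrow> sim_rounds N c (sim_state s w clk []) ! Suc (Suc M) \<noteq> []"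
  shows "sim_correct g c s t s' qs"
  using assms unfolding sim_correct_def by blast

lemma sim_correctD:
  assumes "sim_correct g c s t s' qs" "\<And>q. ok q w \<Longrightarrow> ans q w = g q" "t \<le> length clk" "t \<le> N"
  shows "\<forall>q\<in>set qs. ok q w \<Longrightarrow> sim_rounds N c (sim_state s w clk []) = sim_state s' w clk []"
    and "\<exists>q\<in>set qs. \<not> ok q w \<Longrightarrow> sim_rounds N c (sim_state s w clk []) ! Suc (Suc M) \<noteq> []"
  using assms unfolding sim_correct_def by blast+

lemma sim_correctD':
  assumes "sim_correct g c s t s' qs" "\<And>q. ok q w \<Longrightarrow> ans q w = g q" "t \<le> length clk"
  shows "\<forall>q\<in>set qs. ok q w \<Longrightarrow> S c (sim_state s w clk []) = sim_state s' w clk []"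
    and "\<exists>q\<in>set qs. \<not> ok q w \<Longrightarrow> S c (sim_state s w clk []) ! Suc (Suc M) \<noteq> []"
  using sim_correctD[OF assms order_trans[OF assms(3) order_refl]] sim_rounds_sim[of "sim_state s w clk []" c]
  by simp_all

end

lemma sim_correct_Case:
  assumes "sim_correct ans ok M g d s t s' qs"
    and "\<And>w clk N. sim_rounds ans ok M N c (sim_state M s w clk []) = sim ans ok M d (sim_state M s w clk [])"
  shows "sim_correct ans ok M g c s (Suc t) s' qs"
proof (rule sim_correctI)
  fix w clk :: "bool list" and N :: nat
  assume h: "\<And>q. ok q w \<Longrightarrow> ans q w = g q" "Suc t \<le> length clk"
  note D = sim_correctD'[where ans = ans and ok = ok and w = w and clk = clk, OF assms(1) h(1) Suc_leD[OF h(2)]]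
  show "sim_rounds ans ok M N c (sim_state M s w clk []) = sim_state M s' w clk []" if "\<forall>q\<in>set qs. ok q w"
    unfolding assms(2) by (rule D(1)[OF _ that])
  show "sim_rounds ans ok M N c (sim_state M s w clk []) ! Suc (Suc M) \<noteq> []" if "\<exists>q\<in>set qs. \<not> ok q w"
    unfolding assms(2) by (rule D(2)[OF _ that])
qed

text \<open>Simulation and run agree up to the first rejected query; from then on the flag stays
  raised, whatever the simulation does. The bounds on \<open>qs\<close> limit the size of a table
  for the run.\<close>

lemma sim_exec:
  assumes "exec g c s t s'" "width c \<le> M"
  shows "\<exists>qs. length qs \<le> t \<and> (\<forall>q\<in>set qs. length q + length (g q) \<le> t) \<and>
    (\<forall>ans ok. sim_correct ans ok M g c s t s' qs)"
  using assms
proof (induction rule: exec.induct)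
  case (Skip s)
  show ?case by (intro exI[of _ "[]"]) (auto intro!: sim_correctI simp: sim_rounds_def)
next
  case (Push b r s)
  then show ?case
    by (intro exI[of _ "[]"]) (auto intro!: sim_correctI simp: sim_rounds_def sim_state_update fun_upd_def)
next
  case (Pop r s)
  then show ?case
    by (intro exI[of _ "[]"]) (auto intro!: sim_correctI simp: sim_rounds_def sim_state_update fun_upd_def)
next
  case (Seq c s t s' d u s'')
  then obtain qs1 qs2 where
    q1: "length qs1 \<le> t" "\<forall>q\<in>set qs1. length q + length (g q) \<le> t" "\<And>ans ok. sim_correct ans ok M g c s t s' qs1" and
    q2: "length qs2 \<le> u" "\<forall>q\<in>set qs2. length q + length (g q) \<le> u" "\<And>ans ok. sim_correct ans ok M g d s' u s'' qs2"
    by auto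
  have "sim_correct ans ok M g (Seq c d) s (t + u) s'' (qs1 @ qs2)" for ans ok
  proof (rule sim_correctI)
    fix w clk :: "bool list" and N :: nat
    assume h: "\<And>q. ok q w \<Longrightarrow> ans q w = g q" "t + u \<le> length clk"
    note D1 = sim_correctD'[where ans = ans and ok = ok and w = w and clk = clk, OF q1(3) h(1)] and D2 = sim_correctD'[where ans = ans and ok = ok and w = w and clk = clk, OF q2(3) h(1)]
    show "sim_rounds ans ok M N (Seq c d) (sim_state M s w clk []) = sim_state M s'' w clk []"
      if "\<forall>q\<in>set (qs1 @ qs2). ok q w"
      using that D1(1) D2(1) h(2) by (simp add: sim_rounds_def)
    show "sim_rounds ans ok M N (Seq c d) (sim_state M s w clk []) ! Suc (Suc M) \<noteq> []"
      if "\<exists>q\<in>set (qs1 @ qs2). \<not> ok q w"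
    proof (cases "\<exists>q\<in>set qs1. \<not> ok q w")
      case True
      then show ?thesis
        using D1(2) h(2) sim_frame[of c M "sim_state M s w clk []" ans ok]
          sim_frame[of d M "sim ans ok M c (sim_state M s w clk [])" ans ok] Seq.prems
        by (simp add: sim_rounds_def)
    next
      case False
      then show ?thesis using that D1(1) D2(2) h(2) by (auto simp: sim_rounds_def)
    qed
  qed
  then show ?case using q1 q2 by (intro exI[of _ "qs1 @ qs2"]) fastforce
next
  case (Case_empty s r c0 t s' c1 c2)
  then obtain qs where q: "length qs \<le> t" "\<forall>q\<in>set qs. length q + length (g q) \<le> t"
    "\<And>ans ok. sim_correct ans ok M g c0 s t s' qs" by auto
  have "sim_correct ans ok M g (Case r c0 c1 c2) s (Suc t) s' qs" for ans ok
    by (rule sim_correct_Case[OF q(3)]) (use Case_empty in \<open>simp add: sim_rounds_def\<close>)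
  then show ?case using q by (intro exI[of _ qs]) auto
next
  case (Case_True s r v c1 t s' c0 c2)
  then obtain qs where q: "length qs \<le> t" "\<forall>q\<in>set qs. length q + length (g q) \<le> t"
    "\<And>ans ok. sim_correct ans ok M g c1 s t s' qs" by auto
  have "sim_correct ans ok M g (Case r c0 c1 c2) s (Suc t) s' qs" for ans ok
    by (rule sim_correct_Case[OF q(3)]) (use Case_True in \<open>simp add: sim_rounds_def\<close>)
  then show ?case using q by (intro exI[of _ qs]) auto
next
  case (Case_False s r v c2 t s' c0 c1)
  then obtain qs where q: "length qs \<le> t" "\<forall>q\<in>set qs. length q + length (g q) \<le> t"
    "\<And>ans ok. sim_correct ans ok M g c2 s t s' qs" by auto
  have "sim_correct ans ok M g (Case r c0 c1 c2) s (Suc t) s' qs" for ans ok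
    by (rule sim_correct_Case[OF q(3)]) (use Case_False in \<open>simp add: sim_rounds_def\<close>)
  then show ?case using q by (intro exI[of _ qs]) auto
next
  case (Loop_stop s r c)
  have "((\<lambda>ys. if ys ! r = [] then ys else sim ans ok M c ys) ^^ N) (sim_state M s w clk []) = sim_state M s w clk []"
    for ans ok N w clk
    by (induction N) (use Loop_stop in auto)
  then show ?case by (intro exI[of _ "[]"]) (auto intro!: sim_correctI simp: sim_rounds_def)
next
  case (Loop_step s r c t s' u s'')
  then obtain qs1 qs2 where
    q1: "length qs1 \<le> t" "\<forall>q\<in>set qs1. length q + length (g q) \<le> t" "\<And>ans ok. sim_correct ans ok M g c s t s' qs1" and
    q2: "length qs2 \<le> u" "\<forall>q\<in>set qs2. length q + length (g q) \<le> u" "\<And>ans ok. sim_correct ans ok M g (Loop r c) s' u s'' qs2"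
    by auto
  have "sim_correct ans ok M g (Loop r c) s (Suc (t + u)) s'' (qs1 @ qs2)" for ans ok
  proof (rule sim_correctI)
    fix w clk :: "bool list" and N :: nat
    assume h: "\<And>q. ok q w \<Longrightarrow> ans q w = g q" "Suc (t + u) \<le> length clk" "Suc (t + u) \<le> N"
    \<comment> \<open>The step charged for entering the round pays for the round used up.\<close>
    obtain N' where N: "N = Suc N'" "u \<le> N'" using h(3) by (cases N) auto
    let ?s = "sim_state M s w clk []"
    have step: "sim_rounds ans ok M N (Loop r c) ?s = sim_rounds ans ok M N' (Loop r c) (sim ans ok M c ?s)"
      using Loop_step.hyps(1) Loop_step.prems N(1)
      by (simp add: sim_rounds_def funpow_Suc_right del: funpow.simps)
    note D1 = sim_correctD'[where ans = ans and ok = ok and w = w and clk = clk, OF q1(3) h(1)] and D2 = sim_correctD[where ans = ans and ok = ok and w = w and clk = clk and N = N', OF q2(3) h(1)]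
    show "sim_rounds ans ok M N (Loop r c) ?s = sim_state M s'' w clk []" if "\<forall>q\<in>set (qs1 @ qs2). ok q w"
      unfolding step using that D1(1) D2(1) h(2) N(2) by simp
    show "sim_rounds ans ok M N (Loop r c) ?s ! Suc (Suc M) \<noteq> []" if "\<exists>q\<in>set (qs1 @ qs2). \<not> ok q w"
    proof (cases "\<exists>q\<in>set qs1. \<not> ok q w")
      case True
      then show ?thesis unfolding step
        by (intro sim_rounds_flag) (use D1(2) h(2) sim_frame[of c M ?s ans ok] Loop_step.prems in auto)
    next
      case False
      then show ?thesis unfolding step using that D1(1) D2(2) h(2) N(2) by auto
    qed
  qed
  then show ?case using q1 q2 by (intro exI[of _ "qs1 @ qs2"]) fastforce
next
  case (Query r s)
  have "sim_correct ans ok M g (Query r) s (Suc (length (s r) + length (g (s r)))) (s(r := g (s r))) [s r]" for ans ok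
    by (rule sim_correctI)
      (use Query in \<open>auto simp: sim_rounds_def sim_state_update sim_state_flag fun_upd_def\<close>)
  then show ?case by (intro exI[of _ "[s r]"]) (auto simp: fun_upd_def)
qed


subsection \<open>Eliminating polynomial-time oracles\<close>

definition sim_start :: "nat \<Rightarrow> bool list \<Rightarrow> bool list \<Rightarrow> bool list \<Rightarrow> bool list list" where
  "sim_start M x w clk = sim_state M (load [x]) w clk []"

lemma polytime_sim_start:
  assumes ans: "polytime 2 (\<lambda>ys. ans (ys ! 0) (ys ! 1))"
    and ok: "polytime_pred 2 (\<lambda>ys. ok (ys ! 0) (ys ! 1))"
    and M: "width c \<le> M" "0 < M" "i < Suc (Suc (Suc M))"
    and f: "polytime k x" "polytime k w" "polytime k clk"
  shows "polytime k (\<lambda>xs. sim ans ok M c (sim_start M (x xs) (w xs) (clk xs)) ! i)"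
proof (rule polytime_subst[OF polytime_sim[OF ans ok M(1,3)],
      where gs = "map (\<lambda>r xs. if r = 0 then x xs else []) [0..<M] @ [w, clk, \<lambda>_. []]"])
  show "map (\<lambda>g. g xs) (map (\<lambda>r xs. if r = 0 then x xs else []) [0..<M] @ [w, clk, \<lambda>_. []]) =
      sim_start M (x xs) (w xs) (clk xs)" for xs
    by (auto simp: sim_start_def sim_state_def load_def)
next
  fix g assume "g \<in> set (map (\<lambda>r xs. if r = 0 then x xs else []) [0..<M] @ [w, clk, \<lambda>_. []])"
  then have "g \<in> (\<lambda>r xs. if r = 0 then x xs else []) ` set [0..<M] \<or> g \<in> {w, clk, \<lambda>_. []}"
    unfolding set_append set_map by (simp only: Un_iff list.set)
  then show "polytime k g"
  proof (elim disjE imageE insertE emptyE)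
    fix r assume "g = (\<lambda>xs. if r = 0 then x xs else [])"
    then show ?thesis using f polytime_nil by (cases "r = 0") simp_all
  qed (use f polytime_nil in simp_all)
qed simp

text \<open>With a polynomial-time oracle the simulation computes the answers by itself: the advice
  is empty and every query is accepted.\<close>

lemma oracle_elimination:
  assumes f: "f \<in> FP" and runs: "\<And>x. runs f c p [x] (y x)"
  shows "y \<in> FP"
proof -
  let ?M = "Suc (width c)"
  let ?ans = "\<lambda>q w. f q" and ?ok = "\<lambda>q w :: bool list. True"
  let ?clk = "\<lambda>x :: bool list. replicate (poly p (length x)) True"
  have f1: "polytime 1 (\<lambda>xs. f (xs ! 0))" using f unfolding FP_def by simp
  have "polytime 2 (\<lambda>ys. f (ys ! 0))"
    by (rule polytime_comp1[OF f1 polytime_nth]) simp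
  then have "polytime 1 (\<lambda>xs. sim ?ans ?ok ?M c (sim_start ?M (xs ! 0) [] (?clk (xs ! 0))) ! 0)"
    by (intro polytime_sim_start) (auto intro: pt)
  moreover have "sim ?ans ?ok ?M c (sim_start ?M x [] (?clk x)) ! 0 = y x" for x
  proof -
    obtain t s where t: "exec f c (load [x]) t s" "t \<le> poly p (length x)" "s 0 = y x"
      using runs[of x] unfolding runs_def by auto
    obtain qs where "\<And>ans ok. sim_correct ans ok ?M f c (load [x]) t s qs"
      using sim_exec[OF t(1), of ?M] by auto
    from sim_correctD'(1)[OF this, of ?ok "[]" ?ans "?clk x"] t(2)
    have "sim ?ans ?ok ?M c (sim_start ?M x [] (?clk x)) = sim_state ?M s [] (?clk x) []"
      by (simp add: sim_start_def)
    then show ?thesis using t(3) by simp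
  qed
  ultimately show ?thesis unfolding FP_def by simp
qed


section \<open>Tables of oracle answers\<close>

primrec tab :: "bool list list \<Rightarrow> bool list" where
  "tab [] = []"
| "tab (x # xs) = pair x (tab xs)"

text \<open>Every string decodes to exactly \<open>n\<close> entries, since the projections are
  total. Inputs of a search problem thus need no check for being well-formed.\<close>

definition untab :: "nat \<Rightarrow> bool list \<Rightarrow> bool list list" where
  "untab n x = map (\<lambda>i. pfst ((psnd ^^ i) x)) [0..<n]"

lemma psnd_tab: "(psnd ^^ i) (tab xs) = tab (drop i xs)"
proof (induction i arbitrary: xs)
  case (Suc i)
  show ?case
  proof (cases xs)
    case Nil
    then show ?thesis using Suc[of "[]"] by simp
  next
    case (Cons x ys)
    then show ?thesis using Suc[of ys] by (simp only: funpow_Suc_right comp_def tab.simps psnd_pair drop_Suc_Cons)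
  qed
qed simp

lemma untab_tab [simp]: "untab (length xs) (tab xs) = xs"
proof (rule nth_equalityI)
  fix i assume "i < length (untab (length xs) (tab xs))"
  then have "i < length xs" by (simp add: untab_def)
  then show "untab (length xs) (tab xs) ! i = xs ! i"
    by (simp add: untab_def psnd_tab Cons_nth_drop_Suc[symmetric])
qed (simp add: untab_def)

lemma length_untab [simp]: "length (untab n x) = n"
  by (simp add: untab_def)

lemma length_tab_le: "length xs \<le> length (tab xs)"
  by (induction xs) auto

lemma length_tab_bound: "(\<And>x. x \<in> set xs \<Longrightarrow> length x \<le> m) \<Longrightarrow> length (tab xs) \<le> length xs * (2 * m + 1)"
proof (induction xs)
  case (Cons x xs)
  then have "length (tab xs) \<le> length xs * (2 * m + 1)" "length x \<le> m" by auto
  then show ?case by simp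
qed simp

lemma polytime_psnd_iter [pt]:
  assumes "polytime k n" "polytime k f" shows "polytime k (\<lambda>xs. (psnd ^^ length (n xs)) (f xs))"
proof -
  let ?hs = "[\<lambda>ys. psnd (ys ! 0)]"
  have it: "(step ?hs ^^ i) [u] = [(psnd ^^ i) u]" for i u
    by (induction i) auto
  have "polytime k (\<lambda>xs. ((step ?hs ^^ length (n xs)) (map (\<lambda>f. f xs) [f])) ! 0)"
  proof (rule polytime_iter_add[where c = 0 and k = 1])
    fix ys :: "bool list list" assume "length ys = 1"
    then obtain u where "ys = [u]" by (auto simp: length_Suc_conv)
    then show "sz (step ?hs ys) \<le> sz ys + 0" using length_psnd[of u] by simp
  qed (use assms in \<open>auto intro!: pt\<close>)
  then show ?thesis by (simp add: it[simplified])
qed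

lemma polytime_untab_nth [pt]:
  assumes "polytime k f" shows "polytime k (\<lambda>xs. pfst ((psnd ^^ i) (f xs)))"
  using polytime_pfst[OF polytime_psnd_iter[OF polytime_const[of k "replicate i True"] assms]] by simp

lemma polytime_tab: "(\<And>g. g \<in> set gs \<Longrightarrow> polytime k g) \<Longrightarrow> polytime k (\<lambda>xs. tab (map (\<lambda>g. g xs) gs))"
  by (induction gs) (auto intro: pt)

lemma polytime_tab_args [pt]: "polytime k tab"
proof -
  have "polytime k (\<lambda>xs. tab (map (\<lambda>g. g xs) (map (\<lambda>i xs. xs ! i) [0..<k])))"
    by (rule polytime_tab) (auto intro: pt)
  then show ?thesis
    by (rule polytime_cong[THEN iffD1, rotated]) (auto simp: comp_def map_nth)
qed

text \<open>Entries are pairs of a query and its answer. The search rests at the first match or at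
  the end, and \<open>length w\<close> rounds suffice because every entry takes up at least one
  bit.\<close>

definition find_entry :: "bool list \<Rightarrow> bool list \<Rightarrow> bool list" where
  "find_entry q w = ((\<lambda>u. if u = [] \<or> pfst (pfst u) = q then u else psnd u) ^^ length w) w"

definition table_ok :: "bool list \<Rightarrow> bool list \<Rightarrow> bool" where
  "table_ok q w \<longleftrightarrow> find_entry q w \<noteq> [] \<and> pfst (pfst (find_entry q w)) = q"

definition table_ans :: "bool list \<Rightarrow> bool list \<Rightarrow> bool list" where
  "table_ans q w = psnd (pfst (find_entry q w))"

lemma polytime_find_entry: "polytime 2 (\<lambda>ys. find_entry (ys ! 0) (ys ! 1))"
proof -
  let ?h = "\<lambda>q u. if u = [] \<or> pfst (pfst u) = q then u else psnd u"
  let ?hs = "[\<lambda>ys. ys ! 0, \<lambda>ys. ?h (ys ! 0) (ys ! 1)]"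
  have it: "(step ?hs ^^ i) [q, u] = [q, (?h q ^^ i) u]" for i q u
    by (induction i) auto
  have "polytime 2 (\<lambda>ys. ((step ?hs ^^ length (ys ! 1)) (map (\<lambda>f. f ys) [\<lambda>ys. ys ! 0, \<lambda>ys. ys ! 1])) ! 1)"
  proof (rule polytime_iter_add[where c = 0 and k = 2])
    fix ys :: "bool list list" assume "length ys = 2"
    then obtain q u where "ys = [q, u]" by (rule length_2_E)
    then show "sz (step ?hs ys) \<le> sz ys + 0" using length_psnd[of u] by auto
  qed (auto intro!: pt)
  then have "polytime 2 (\<lambda>ys. (step ?hs ^^ length (ys ! 1)) [ys ! 0, ys ! 1] ! 1)"
    by (simp only: list.map)
  then show ?thesis unfolding it find_entry_def by simp
qed

lemma polytime_table:
  "polytime 2 (\<lambda>ys. table_ans (ys ! 0) (ys ! 1))" "polytime_pred 2 (\<lambda>ys. table_ok (ys ! 0) (ys ! 1))"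
  unfolding table_ans_def table_ok_def by (intro pt polytime_find_entry; simp)+

text \<open>Every string counts as a table. The condition concerns all its entries, so it covers
  whichever entry a search may find; iterates beyond the end are empty.\<close>

definition valid_table :: "(bool list \<Rightarrow> bool list \<Rightarrow> bool) \<Rightarrow> bool list \<Rightarrow> bool" where
  "valid_table V w \<longleftrightarrow> (\<forall>i. (psnd ^^ i) w \<noteq> [] \<longrightarrow>
    V (pfst (pfst ((psnd ^^ i) w))) (psnd (pfst ((psnd ^^ i) w))))"

lemma valid_table_ans:
  assumes "valid_table V w" "table_ok q w" shows "V q (table_ans q w)"
proof -
  have "\<exists>i. find_entry q w = (psnd ^^ i) w"
    unfolding find_entry_def
  proof (rule funpow_invariant)
    show "\<exists>i. w = (psnd ^^ i) w" by (rule exI[of _ 0]) simp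
    fix u assume "\<exists>i. u = (psnd ^^ i) w"
    then obtain i where "u = (psnd ^^ i) w" by blast
    then show "\<exists>i. (if u = [] \<or> pfst (pfst u) = q then u else psnd u) = (psnd ^^ i) w"
      by (metis comp_apply funpow.simps(2))
  qed
  then show ?thesis
    using assms unfolding valid_table_def table_ok_def table_ans_def by metis
qed

lemma valid_table_tab:
  assumes "\<And>q. q \<in> set qs \<Longrightarrow> V q (g q)"
  shows "valid_table V (tab (map (\<lambda>q. pair q (g q)) qs))"
  unfolding valid_table_def psnd_tab drop_map
proof (intro allI impI)
  fix i assume "tab (map (\<lambda>q. pair q (g q)) (drop i qs)) \<noteq> []"
  then obtain q rest where "drop i qs = q # rest" by (cases "drop i qs") auto
  moreover from this have "q \<in> set qs" by (metis in_set_dropD list.set_intros(1))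
  ultimately show "V (pfst (pfst (tab (map (\<lambda>q. pair q (g q)) (drop i qs)))))
      (psnd (pfst (tab (map (\<lambda>q. pair q (g q)) (drop i qs)))))"
    using assms by simp
qed

lemma table_ok_tab:
  assumes "q \<in> set qs" shows "table_ok q (tab (map (\<lambda>q. pair q (g q)) qs))"
proof -
  let ?h = "\<lambda>u. if u = [] \<or> pfst (pfst u) = q then u else psnd u"
  let ?t = "\<lambda>qs. tab (map (\<lambda>q. pair q (g q)) qs)"
  have "(?h ^^ n) (?t qs) \<noteq> [] \<and> pfst (pfst ((?h ^^ n) (?t qs))) = q" if "length qs \<le> n" "q \<in> set qs" for n qs
    using that
  proof (induction qs arbitrary: n)
    case (Cons p qs)
    show ?case
    proof (cases "p = q")
      case True
      have "(?h ^^ n) (?t (p # qs)) = ?t (p # qs)" by (induction n) (use True in auto)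
      then show ?thesis using True by simp
    next
      case False
      then obtain m where m: "n = Suc m" "length qs \<le> m" "q \<in> set qs" using Cons.prems by (cases n) auto
      have "?h (?t (p # qs)) = ?t qs" using False by simp
      then have "(?h ^^ n) (?t (p # qs)) = (?h ^^ m) (?t qs)"
        unfolding m(1) funpow_Suc_right comp_def by presburger
      then show ?thesis using Cons.IH[OF m(2,3)] by presburger
    qed
  qed simp
  moreover have "length qs \<le> length (?t qs)" using length_tab_le[of "map (\<lambda>q. pair q (g q)) qs"] by simp
  ultimately show ?thesis using assms unfolding table_ok_def find_entry_def by presburger
qed

text \<open>Quantifying over the positions of a table must not raise the level. At level 0 all
  positions are tested by iteration; at higher levels the quantifier is absorbed by the leading
  existential one. As \<open>Bad []\<close> fails, positions beyond the length of the table never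
  matter.\<close>

lemma Sig_ex_psnd:
  assumes S: "Sig j 1 (\<lambda>us. Bad (us ! 0))" and nil: "\<not> Bad []"
  shows "Sig j 1 (\<lambda>ws. \<exists>i. Bad ((psnd ^^ i) (ws ! 0)))"
proof -
  have short: "(\<exists>i. Bad ((psnd ^^ i) w)) \<longleftrightarrow> (\<exists>i<length w. Bad ((psnd ^^ i) w))" for w
  proof -
    have "length ((psnd ^^ i) w) \<le> length w - i" for i
    proof (induction i)
      case (Suc i)
      then show ?case using length_psnd[of "(psnd ^^ i) w"] by simp
    qed simp
    then have "(psnd ^^ i) w = []" if "length w \<le> i" for i
      using that by (metis diff_is_0_eq le_zero_eq length_0_conv)
    then show ?thesis using nil by (metis not_le)
  qed
  show ?thesis
  proof (cases j)
    case 0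
    let ?hs = "[\<lambda>ys. psnd (ys ! 0), \<lambda>ys. if Bad (ys ! 0) then [True] else ys ! 1]"
    have it: "(step ?hs ^^ n) [w, []] = [(psnd ^^ n) w, if \<exists>i<n. Bad ((psnd ^^ i) w) then [True] else []]" for n w
      by (induction n) (auto simp: less_Suc_eq)
    have bad: "polytime_pred 1 (\<lambda>us. Bad (us ! 0))" using S 0 by simp
    have bad2: "polytime_pred 2 (\<lambda>us. Bad (us ! 0))"
      using polytime_pred_comp[OF bad, of "[\<lambda>ys. ys ! 0]" 2 "\<lambda>ys. [ys ! 0]"] polytime_nth[of 0 2] by simp
    have "polytime 1 (\<lambda>xs. ((step ?hs ^^ length (xs ! 0)) (map (\<lambda>f. f xs) [\<lambda>xs. xs ! 0, \<lambda>_. []])) ! 1)"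
    proof (rule polytime_iter_add[where c = 1 and k = 2])
      fix ys :: "bool list list" assume "length ys = 2"
      then obtain u v where "ys = [u, v]" by (rule length_2_E)
      then show "sz (step ?hs ys) \<le> sz ys + 1" using length_psnd[of u] by auto
    qed (auto intro!: pt bad2)
    then have "polytime 1 (\<lambda>xs. (step ?hs ^^ length (xs ! 0)) [xs ! 0, []] ! 1)" by (simp only: list.map)
    then have "polytime_pred 1 (\<lambda>xs. (step ?hs ^^ length (xs ! 0)) [xs ! 0, []] ! 1 \<noteq> [])"
      by (intro polytime_pred_not polytime_pred_Nil)
    then have "polytime_pred 1 (\<lambda>ws. \<exists>i<length (ws ! 0). Bad ((psnd ^^ i) (ws ! 0)))"
      unfolding it by (rule polytime_pred_cong[THEN iffD1, rotated]) simp
    then show ?thesis unfolding short using 0 by simp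
  next
    case (Suc i)
    have "Sig j 2 (\<lambda>ys. Bad ([(psnd ^^ length (ys ! 0)) (ys ! 1)] ! 0))"
      by (rule Sig_substI[OF S, where gs = "[\<lambda>ys. (psnd ^^ length (ys ! 0)) (ys ! 1)]"]) (auto intro!: pt)
    then have "Sig (Suc i) (Suc 1) (\<lambda>ys. Bad ((psnd ^^ length (ys ! 0)) (ys ! 1)))"
      using Suc by (simp add: numeral_2_eq_2)
    \<comment> \<open>Positions are given in unary, as the length of the quantified string.\<close>
    from Sig_bex[OF this, of "[:0, 1:]"] show ?thesis
      unfolding Suc
    proof (rule Sig_cong[THEN iffD1, rotated])
      fix xs :: "bool list list" assume "length xs = 1"
      then obtain w where w: "xs = [w]" by (auto simp: length_Suc_conv)
      show "(\<exists>u. length u \<le> poly [:0, 1:] (sz xs) \<and> Bad ((psnd ^^ length ((u # xs) ! 0)) ((u # xs) ! 1))) \<longleftrightarrow>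
        (\<exists>i. Bad ((psnd ^^ i) (xs ! 0)))"
      proof
        assume "\<exists>i. Bad ((psnd ^^ i) (xs ! 0))"
        then obtain i where "i < length w" "Bad ((psnd ^^ i) w)" using short w by auto
        then show "\<exists>u. length u \<le> poly [:0, 1:] (sz xs) \<and> Bad ((psnd ^^ length ((u # xs) ! 0)) ((u # xs) ! 1))"
          by (intro exI[of _ "replicate i True"]) (simp add: w)
      qed auto
    qed
  qed
qed


section \<open>From polynomial-time solutions to equivalence of the theories\<close>

section \<open>From solving search problems to provability\<close>

lemma sat_args:
  assumes "fv_fm W \<subseteq> insert 0 (Suc ` {..<k})"
  shows "sat (env (y # args k e)) W \<longleftrightarrow> sat (case_nat (val y) e) W"
proof (rule sat_cong)
  fix n assume "n \<in> fv_fm W"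
  then consider "n = 0" | m where "n = Suc m" "m < k" using assms by auto
  then show "env (y # args k e) n = case_nat (val y) e n" by cases auto
qed

lemma sz_args_env: "length xs = k \<Longrightarrow> sz (args k (env xs)) \<le> sz xs"
proof -
  assume "length xs = k"
  then have "args k (env xs) = map (\<lambda>x. bin (val x)) xs"
    by (intro nth_equalityI) auto
  moreover have "sz (map (\<lambda>x. bin (val x)) xs) \<le> sz xs"
    by (induction xs) (auto intro: add_mono length_bin_val)
  ultimately show ?thesis by simp
qed

lemma length_psnd_iter: "length ((psnd ^^ i) x) \<le> length x"
proof (induction i)
  case (Suc i)
  then show ?case using length_psnd[of "(psnd ^^ i) x"] by simp
qed simp

lemma sz_untab: "sz (untab k x) \<le> k * length x"
proof -
  have "length (pfst ((psnd ^^ i) x)) \<le> length x" for i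
    using length_pfst length_psnd_iter order_trans by metis
  then have "(\<Sum>i\<leftarrow>[0..<k]. length (pfst ((psnd ^^ i) x))) \<le> (\<Sum>i\<leftarrow>[0..<k]. length x)"
    by (intro sum_list_mono) simp
  then show ?thesis by (simp add: untab_def comp_def sum_list_triv)
qed

locale witnessed_formula =
  fixes j k :: nat and \<phi> W :: fm and q :: "nat poly"
  assumes wit: "witness_for j \<phi> W" and wf: "wf_fm \<phi>" and fv: "fv_fm \<phi> \<subseteq> {..<k}"
    and total: "\<And>e. \<exists>w. length (bin w) \<le> poly q (sz (args k e)) \<and> sat (case_nat w e) W"
begin

lemmas W = witness_forD[OF wit]

lemma fv_W: "fv_fm W \<subseteq> insert 0 (Suc ` {..<k})" "fv_fm W \<subseteq> {..<Suc k}"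
  using W(3) fv by auto

definition problem :: search_problem where
  "problem x y \<longleftrightarrow> sat (env (y # untab k x)) W"

lemma problem_TFSigma: "problem \<in> TFSigma (Suc j)"
proof -
  have "Sig j 2 (\<lambda>xs. \<not> sat (env (xs ! 1 # untab k (xs ! 0))) W)"
    by (rule Sig_substI[OF Sig_formula(2)[OF W(1,2) fv_W(2)],
          where gs = "(\<lambda>xs. xs ! 1) # map (\<lambda>i xs. pfst ((psnd ^^ i) (xs ! 0))) [0..<k]"])
      (auto simp: untab_def comp_def intro!: pt)
  then have "problem \<in> PiP j" unfolding PiP_iff_Sig problem_def .
  \<comment> \<open>Each of the \<open>k\<close> parameters decoded from x is at most as long as
    x.\<close>
  moreover have "total_within (pcompose q [:0, k:]) problem"
    unfolding total_within_def
  proof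
    fix x
    let ?xs = "untab k x"
    obtain w where w: "length (bin w) \<le> poly q (sz (args k (env ?xs)))" "sat (case_nat w (env ?xs)) W"
      using total[of "env ?xs"] by blast
    have "poly q (sz (args k (env ?xs))) \<le> poly q (k * length x)"
      using sz_args_env[of ?xs k] sz_untab[of k x] by (intro poly_nat_mono) simp
    then have "length (bin w) \<le> poly (pcompose q [:0, k:]) (length x)"
      using w(1) by (simp add: poly_pcompose mult.commute)
    moreover have "problem x (bin w)"
      using w(2) case_nat_env[of "bin w" ?xs] by (simp add: problem_def)
    ultimately show "\<exists>y. length y \<le> poly (pcompose q [:0, k:]) (length x) \<and> problem x y" by blast
  qed
  ultimately show ?thesis by auto
qed

lemma problem_tab: "problem (tab (args k e)) y \<longleftrightarrow> sat (case_nat (val y) e) W"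
  using untab_tab[of "args k e"] sat_args[OF fv_W(1), of y e] by (simp add: problem_def)

lemma provable_if_FP:
  assumes "f \<in> FP" "\<And>x. problem x (f x)" "j = 0"
  shows "T_PV (Suc j) \<turnstile> \<phi>"
proof -
  let ?s = "pv_term k (\<lambda>xs. f (tab xs))"
  have "polytime 1 (\<lambda>xs. f (xs ! 0))" using assms(1) unfolding FP_def by simp
  from polytime_comp1[OF this polytime_tab_args] have s: "wf_tm ?s" by simp
  have "SigmaB j (subst_fm (case_nat ?s Var) W)"
    using SigmaB_PiB_0(2)[OF W(1) assms(3)] by (intro SigmaB_quantifier_free) simp
  moreover have "wf_fm (subst_fm (case_nat ?s Var) W)"
    using W(2) s by (intro wf_subst_fm wf_case_nat) auto
  moreover have "sat e (subst_fm (case_nat ?s Var) W)" for e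
    unfolding sat_case_nat using assms(2)[of "tab (args k e)"] problem_tab by simp
  ultimately have "T_PV (Suc j) \<turnstile> subst_fm Var (subst_fm (case_nat ?s Var) W)"
    by (rule T_PV_SigmaB) simp
  then have "T_PV (Suc j) \<turnstile> subst_fm (case_nat ?s Var) W" by simp
  from W(4)[OF _ s this] show ?thesis by simp
qed

text \<open>One level up, the solution is computed from a table \<open>w\<close> of oracle answers. That a suitable
  table exists and that every suitable table yields a solution are both provable.\<close>

lemma provable_if_table:
  fixes F :: "bool list list \<Rightarrow> bool list"
  assumes j: "j = Suc i" and \<Theta>: "Sig i (Suc k) (\<lambda>ys. \<not> \<Theta> ys)" and F: "polytime (Suc k) F"
    and ex: "\<And>xs. length xs = k \<Longrightarrow> \<exists>w. length w \<le> poly r (sz xs) \<and> \<Theta> (w # xs)"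
    and sound: "\<And>w xs. length xs = k \<Longrightarrow> \<Theta> (w # xs) \<Longrightarrow> problem (tab xs) (F (w # xs))"
  shows "T_PV (Suc j) \<turnstile> \<phi>"
proof -
  have "Sig i (Suc k) (\<lambda>ys. \<not> \<Theta> (map (\<lambda>f. f ys) [\<lambda>ys. butlast (ys ! 0)] @ tl ys))"
    by (rule Sig_head) (use \<Theta> in \<open>auto intro!: pt\<close>)
  from formula_Sig[OF this] obtain \<theta>' where \<theta>': "SigmaB i \<theta>'" "wf_fm \<theta>'" "fv_fm \<theta>' \<subseteq> {..<Suc k}"
    "\<And>e. sat e \<theta>' \<longleftrightarrow> \<not> \<Theta> (butlast (args (Suc k) e ! 0) # tl (args (Suc k) e))"
    by auto
  define \<theta> where "\<theta> = Neg \<theta>'"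
  have \<theta>: "PiB i \<theta>" "wf_fm \<theta>" "fv_fm \<theta> \<subseteq> {..<Suc k}"
    using \<theta>' by (auto simp: \<theta>_def intro: SigmaB_PiB.PiB_Neg)
  have sat_\<theta>: "sat (case_nat n e) \<theta> \<longleftrightarrow> \<Theta> (butlast (bin n) # args k e)" for n e
    unfolding \<theta>_def sat.simps \<theta>'(4) args_Suc by simp
  let ?t = "pv_term k (\<lambda>xs. True # replicate (poly r (sz xs)) True)"
  have t: "wf_tm ?t" by (intro wf_pv_term pt)
  let ?T = "T_PV (Suc j)"
  \<comment> \<open>A table is polynomially bounded and its correctness is Pi_i, so its existence is
    a true Sigma_j formula.\<close>
  have "?T \<turnstile> subst_fm Var (BExists ?t \<theta>)"
  proof (rule T_PV_SigmaB)
    show "SigmaB j (BExists ?t \<theta>)"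
      unfolding j using \<theta>(1) by (intro SigmaB_PiB.SigmaB_BExists SigmaB_PiB.SigmaB_PiB)
    show "wf_fm (BExists ?t \<theta>)" using t \<theta>(2) by simp
    fix e
    obtain w where w: "length w \<le> poly r (sz (args k e))" "\<Theta> (w # args k e)"
      using ex[of "args k e"] by auto
    have "val (w @ [True]) \<le> eval_tm e ?t"
      using le_val_trues[of "val (w @ [True])" "Suc (poly r (sz (args k e)))"] w(1) by simp
    moreover have "sat (case_nat (val (w @ [True])) e) \<theta>"
      unfolding sat_\<theta> using w(2) by simp
    ultimately show "sat e (BExists ?t \<theta>)" unfolding sat_BExists by blast
  qed simp
  then have S1: "?T \<turnstile> Exists (Conj (Le (Var 0) (lift_tm ?t)) \<theta>)"
    unfolding subst_fm_Var BExists_def .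
  let ?s = "pv_term (Suc k) (\<lambda>ys. F (butlast (ys ! 0) # tl ys))"
  have "polytime (Suc k) (\<lambda>ys. F (butlast (ys ! 0) # tl ys))"
    by (rule polytime_subst[OF F, where gs = "(\<lambda>ys. butlast (ys ! 0)) # map (\<lambda>i ys. ys ! Suc i) [0..<k]"])
      (auto simp: map_nth_Suc comp_def intro!: pt)
  then have s: "wf_tm ?s" by simp
  let ?D = "Disj (Neg \<theta>) (at_tm ?s W)"
  \<comment> \<open>Soundness of all tables is a true Pi_j formula, hence derivable even one level
    lower.\<close>
  have "T_PV (Suc i) \<turnstile> ?D"
  proof (rule T_PV_PiB)
    show "PiB (Suc i) ?D"
    proof (rule SigmaB_PiB.PiB_Disj)
      show "PiB (Suc i) (Neg \<theta>)" using \<theta>(1) by (intro SigmaB_PiB.PiB_SigmaB SigmaB_PiB.SigmaB_Neg)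
      show "PiB (Suc i) (at_tm ?s W)" using W(1) unfolding j by (rule SigmaB_PiB_subst)
    qed
    show wf_D: "wf_fm ?D" using \<theta>(2) W(2) s by (auto intro!: wf_subst_fm wf_case_nat)
    fix e :: "nat \<Rightarrow> nat"
    let ?e = "\<lambda>i. e (Suc i)"
    have e: "case_nat (e 0) ?e = e" by (rule ext) (simp split: nat.split)
    have "sat (case_nat (e 0) ?e) ?D"
    proof (cases "sat (case_nat (e 0) ?e) \<theta>")
      case True
      then have "\<Theta> (butlast (bin (e 0)) # args k ?e)" unfolding sat_\<theta> .
      from sound[OF _ this] have "problem (tab (args k ?e)) (F (butlast (bin (e 0)) # args k ?e))" by simp
      then have "sat (case_nat (val (F (butlast (bin (e 0)) # args k ?e))) ?e) W" unfolding problem_tab .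
      moreover have "eval_tm (case_nat (e 0) ?e) ?s = val (F (butlast (bin (e 0)) # args k ?e))"
        unfolding eval_pv_term args_Suc by simp
      ultimately have "sat (case_nat (e 0) ?e) (at_tm ?s W)" unfolding sat_at_tm by simp
      then show ?thesis by (simp only: sat.simps simp_thms)
    qed simp
    then show "sat e ?D" unfolding e .
  qed
  then have S2: "?T \<turnstile> ?D" unfolding j by (rule proves_weaken[OF _ T_PV_le])
  let ?E = "Conj (Le (Var 0) (lift_tm ?t)) \<theta>"
  have wE: "wf_fm ?E" "wf_fm (at_tm ?s W)" "wf_fm (lift_fm \<phi>)"
    using t s \<theta>(2) W(2) wf by (auto intro!: wf_subst_fm wf_case_nat)
  have "insert ?E ?T \<turnstile> lift_fm \<phi>"
  proof (rule proves.DisjE)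
    show "insert ?E ?T \<turnstile> ?D" by (rule proves_weaken[OF S2]) auto
    have "insert (Neg \<theta>) (insert ?E ?T) \<turnstile> \<theta>"
      by (rule proves.ConjE2, rule proves.Hyp[OF _ wE(1)]) simp
    moreover have "insert (Neg \<theta>) (insert ?E ?T) \<turnstile> Neg \<theta>" using \<theta>(2) by (intro hyp1) simp
    ultimately have "insert (Neg \<theta>) (insert ?E ?T) \<turnstile> Fal" by (rule proves_contra)
    then have "insert (Neg (lift_fm \<phi>)) (insert (Neg \<theta>) (insert ?E ?T)) \<turnstile> Fal"
      by (rule proves_weaken) auto
    then show "insert (Neg \<theta>) (insert ?E ?T) \<turnstile> lift_fm \<phi>" by (rule proves_if_Fal[OF wE(3)])
    show "insert (at_tm ?s W) (insert ?E ?T) \<turnstile> lift_fm \<phi>"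
      by (rule W(4)[OF _ s hyp1[OF wE(2)]]) simp
  qed
  then have "insert ?E (lift_fm ` ?T) \<turnstile> lift_fm \<phi>" by simp
  with S1 show ?thesis by (rule proves.ExistsE)
qed

text \<open>A table is suitable if the simulation raises no flag and all entries are short correct
  answers. Existence: record the queries of a run with any correct oracle. Soundness: complete the
  table to a correct oracle; the machine succeeds with it, and the simulation reproduces its
  run.\<close>

lemma provable_if_TFSigma_oracle:
  assumes j: "j = Suc i" and Q: "Q \<in> PiP i" "total_within b Q"
    and c: "\<And>g x. (\<And>q. length (g q) \<le> poly b (length q) \<and> Q q (g q)) \<Longrightarrow> \<exists>y. runs g c p [x] y \<and> problem x y"
  shows "T_PV (Suc j) \<turnstile> \<phi>"
proof -
  let ?M = "Suc (width c)"
  define V where "V q a \<longleftrightarrow> length a \<le> poly b (length q) \<and> Q q a" for q a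
  let ?clk = "\<lambda>x :: bool list. replicate (poly p (length x)) True"
  let ?sim = "\<lambda>w x. sim table_ans table_ok ?M c (sim_start ?M x w (?clk x))"
  let ?\<Theta> = "\<lambda>ys. ?sim (ys ! 0) (tab (tl ys)) ! Suc (Suc ?M) = [] \<and> valid_table V (ys ! 0)"
  let ?F = "\<lambda>ys. ?sim (ys ! 0) (tab (tl ys)) ! 0"
  \<comment> \<open>A run of t steps asks at most t queries. An entry has length at most 1 + 2t, and
    storing it in the table at most doubles this and adds 1.\<close>
  let ?P = "[:0, 1:] * (2 * (1 + 2 * [:0, 1:]) + 1) :: nat poly"
  have sim: "polytime (Suc k) (\<lambda>ys. ?sim (ys ! 0) (tab (tl ys)) ! l)" if "l < Suc (Suc (Suc ?M))" for l
    by (rule polytime_sim_start[OF polytime_table]) (use that in \<open>auto intro!: pt polytime_tl_args[OF polytime_tab_args]\<close>)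
  have correct: "?sim w x = sim_state ?M s w (?clk x) []"
    if "\<And>ans ok. sim_correct ans ok ?M g c (load [x]) t s qs" "t \<le> poly p (length x)"
      "\<And>q. table_ok q w \<Longrightarrow> table_ans q w = g q" "\<forall>q\<in>set qs. table_ok q w" for g x t s qs w
    using sim_correctD'(1)[where ans = table_ans and ok = table_ok and w = w and clk = "?clk x", OF that(1) that(3)]
      that(2,4) by (simp add: sim_start_def)
  have run: "\<exists>t s qs y. s 0 = y \<and> problem x y \<and> t \<le> poly p (length x) \<and> length qs \<le> t \<and>
      (\<forall>q\<in>set qs. length q + length (g q) \<le> t) \<and> (\<forall>ans ok. sim_correct ans ok ?M g c (load [x]) t s qs)"
    if "\<And>q. V q (g q)" for g x
  proof -
    obtain y where y: "runs g c p [x] y" "problem x y" using c[of g x] \<open>\<And>q. V q (g q)\<close> V_def by blast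
    then obtain t s where t: "exec g c (load [x]) t s" "t \<le> poly p (length x)" "s 0 = y"
      unfolding runs_def by auto
    then show ?thesis using sim_exec[OF t(1), of ?M] y(2) by auto
  qed
  have ex_V: "\<exists>a. V q a" for q using Q(2) unfolding total_within_def V_def by blast
  show ?thesis
  proof (rule provable_if_table[OF j, where \<Theta> = ?\<Theta> and F = ?F])
    let ?Bad = "\<lambda>u. u \<noteq> [] \<and> \<not> V (pfst (pfst u)) (psnd (pfst u))"
    have "Sig i 2 (\<lambda>xs. \<not> Q (xs ! 0) (xs ! 1))" using Q(1) PiP_iff_Sig by blast
    then have "Sig i 1 (\<lambda>us. \<not> Q ([pfst (pfst (us ! 0)), psnd (pfst (us ! 0))] ! 0)
        ([pfst (pfst (us ! 0)), psnd (pfst (us ! 0))] ! 1))"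
      by (rule Sig_substI[where gs = "[\<lambda>us. pfst (pfst (us ! 0)), \<lambda>us. psnd (pfst (us ! 0))]"]) (auto intro!: pt)
    then have nQ: "Sig i 1 (\<lambda>us. \<not> Q (pfst (pfst (us ! 0))) (psnd (pfst (us ! 0))))" by simp
    have l: "polytime_pred 1 (\<lambda>us. \<not> length (psnd (pfst (us ! 0))) \<le> poly b (length (pfst (pfst (us ! 0)))))"
      by (intro pt) auto
    have n: "polytime_pred 1 (\<lambda>us. us ! 0 \<noteq> [])" by (intro pt) auto
    have "Sig i 1 (\<lambda>us. ?Bad (us ! 0))"
      using Sig_pred(1)[OF Sig_pred(2)[OF nQ l] n] by (simp add: V_def de_Morgan_conj)
    from Sig_ex_psnd[OF this] have "Sig i 1 (\<lambda>ws. \<exists>n. ?Bad ((psnd ^^ n) (ws ! 0)))" by simp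
    then have "Sig i (Suc k) (\<lambda>ys. \<exists>n. ?Bad ((psnd ^^ n) ([ys ! 0] ! 0)))"
      by (rule Sig_substI[where gs = "[\<lambda>ys. ys ! 0]"]) (auto intro: pt)
    then have nv: "Sig i (Suc k) (\<lambda>ys. \<not> valid_table V (ys ! 0))" by (simp add: valid_table_def)
    have "polytime_pred (Suc k) (\<lambda>ys. ?sim (ys ! 0) (tab (tl ys)) ! Suc (Suc ?M) \<noteq> [])"
      by (intro polytime_pred_not polytime_pred_Nil sim) simp
    from Sig_pred(2)[OF nv this] show "Sig i (Suc k) (\<lambda>ys. \<not> ?\<Theta> ys)" by (simp add: de_Morgan_conj)
    show "polytime (Suc k) ?F" by (rule sim) simp
  next
    fix xs :: "bool list list" assume xs: "length xs = k"
    obtain g where g: "\<And>q. V q (g q)" using ex_V by metis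
    obtain t s qs y where t: "t \<le> poly p (length (tab xs))" "length qs \<le> t"
      "\<forall>q\<in>set qs. length q + length (g q) \<le> t" "\<And>ans ok. sim_correct ans ok ?M g c (load [tab xs]) t s qs"
      using run[OF g, of "tab xs"] by blast
    let ?w = "tab (map (\<lambda>q. pair q (g q)) qs)"
    \<comment> \<open>With the graph of \<open>g\<close> in place of \<open>V\<close>: lookups in
      the table return the answers of this very oracle.\<close>
    have vt: "valid_table (\<lambda>q a. a = g q) ?w" by (rule valid_table_tab) simp
    have "table_ok q ?w \<Longrightarrow> table_ans q ?w = g q" for q by (rule valid_table_ans[OF vt])
    then have "?sim ?w (tab xs) = sim_state ?M s ?w (?clk (tab xs)) []"
      by (intro correct[OF t(4,1)]) (auto intro: table_ok_tab)
    moreover have "valid_table V ?w" by (rule valid_table_tab) (rule g)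
    moreover have "length ?w \<le> poly (pcompose ?P (pcompose p (2 * [:0, 1:] + [:k:]))) (sz xs)"
    proof -
      have "length x \<le> 1 + 2 * t" if "x \<in> set (map (\<lambda>q. pair q (g q)) qs)" for x
        using that t(3) by fastforce
      then have "length ?w \<le> length (map (\<lambda>q. pair q (g q)) qs) * (2 * (1 + 2 * t) + 1)" by (rule length_tab_bound)
      also have "\<dots> \<le> t * (2 * (1 + 2 * t) + 1)" using t(2) by (intro mult_right_mono) auto
      also have "\<dots> = poly ?P t" by simp
      also have "\<dots> \<le> poly ?P (poly p (2 * sz xs + k))"
      proof (rule poly_nat_mono)
        have "length (tab xs) \<le> 2 * sz xs + k" unfolding xs[symmetric] by (induction xs) auto
        then show "t \<le> poly p (2 * sz xs + k)" using t(1) poly_nat_mono order_trans by blast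
      qed
      also have "poly p (2 * sz xs + k) = poly (pcompose p (2 * [:0, 1:] + [:k:])) (sz xs)"
        by (simp add: poly_pcompose mult_2 add.commute)
      finally show ?thesis by (simp only: poly_pcompose)
    qed
    ultimately show "\<exists>w. length w \<le> poly (pcompose ?P (pcompose p (2 * [:0, 1:] + [:k:]))) (sz xs) \<and> ?\<Theta> (w # xs)"
      by (intro exI[of _ ?w]) simp
  next
    fix w xs assume "length xs = k" "?\<Theta> (w # xs)"
    then have flag: "?sim w (tab xs) ! Suc (Suc ?M) = []" and valid: "valid_table V w" by auto
    \<comment> \<open>Outside the table any correct answer will do.\<close>
    define g where "g q = (if table_ok q w then table_ans q w else (SOME a. V q a))" for q
    have gV: "V q (g q)" for q
      using valid_table_ans[OF valid] someI_ex[OF ex_V] by (simp add: g_def)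
    obtain t s qs y where t: "s 0 = y" "problem (tab xs) y" "t \<le> poly p (length (tab xs))"
      "\<And>ans ok. sim_correct ans ok ?M g c (load [tab xs]) t s qs"
      using run[OF gV, of "tab xs"] by blast
    have g: "table_ok q w \<Longrightarrow> table_ans q w = g q" for q by (simp add: g_def)
    \<comment> \<open>A query missing from the table would have raised the flag.\<close>
    have "\<forall>q\<in>set qs. table_ok q w"
      using sim_correctD'(2)[where ans = table_ans and ok = table_ok and w = w and clk = "?clk (tab xs)", OF t(4) g]
        t(3) flag by (auto simp: sim_start_def)
    from correct[OF t(4,3) g this] t(1,2)
    show "problem (tab xs) (?F (w # xs))" by simp
  qed
qed

end

lemma provable_if_solvable:
  assumes "TFSigma (Suc j) \<subseteq> FP_TFSigma j" "SigmaB (Suc j) \<phi>" "wf_fm \<phi>" "\<And>e. sat e \<phi>"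
  shows "T_PV (Suc j) \<turnstile> \<phi>"
proof -
  obtain W where W: "witness_for j \<phi> W" using ex_witness assms(2,3) by blast
  obtain k where k: "fv_fm \<phi> \<subseteq> {..<k}" by (rule fv_bounded)
  obtain q where "\<And>e. \<exists>w. length (bin w) \<le> poly q (sz (args k e)) \<and> sat (case_nat w e) W"
    using witness_forD(5)[OF W k] assms(4) by blast
  then interpret witnessed_formula j k \<phi> W q using W assms(3) k by unfold_locales
  have "problem \<in> FP_TFSigma j" using assms(1) problem_TFSigma by blast
  then obtain Q b c p where Q: "Q \<in> TFSigma j" "total_within b Q"
    and c: "\<And>g x. (\<And>q. length (g q) \<le> poly b (length q) \<and> Q q (g q)) \<Longrightarrow> \<exists>y. runs g c p [x] y \<and> problem x y"
    unfolding FP_TFSigma_def by blast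
  show ?thesis
  proof (cases j)
    case 0
    then obtain f where f: "f \<in> FP" "Q = graph_of f" using Q(1) by auto
    \<comment> \<open>The only solution is \<open>f q\<close>, so it is the one within the length
      bound, and \<open>f\<close> is a correct oracle.\<close>
    have "length (f q) \<le> poly b (length q) \<and> Q q (f q)" for q
      using Q(2) f(2) unfolding total_within_def graph_of_def by auto
    from c[OF this] obtain y where y: "\<And>x. runs f c p [x] (y x)" "\<And>x. problem x (y x)" by metis
    have "y \<in> FP" by (rule oracle_elimination[OF f(1) y(1)])
    then show ?thesis using y(2) 0 by (rule provable_if_FP)
  next
    case (Suc i)
    then have "Q \<in> PiP i" using Q(1) by simp
    from provable_if_TFSigma_oracle[OF Suc this Q(2) c] show ?thesis .
  qed
qed

theorem equiv_if_solvable: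
  assumes "TFSigma (Suc j) \<subseteq> FP_TFSigma j"
  shows "T_PV (Suc j) \<equiv>\<^sub>T T_PV (Suc (Suc j))"
  unfolding equiv_theories_def
proof (intro allI impI iffI)
  fix \<psi>
  assume "T_PV (Suc j) \<turnstile> \<psi>"
  then show "T_PV (Suc (Suc j)) \<turnstile> \<psi>" by (rule proves_weaken[OF _ T_PV_le])
next
  fix \<psi>
  assume "T_PV (Suc (Suc j)) \<turnstile> \<psi>"
  then have "T_PV (Suc j) \<union> {} \<turnstile> \<psi>"
  proof (rule proves_cut_set)
    fix \<chi> assume "\<chi> \<in> T_PV (Suc (Suc j))"
    then obtain n \<phi> where \<chi>: "\<chi> = (Forall ^^ n) \<phi>" "SigmaB (Suc j) \<phi>" "sentence \<chi>" "true_in_N \<chi>"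
      unfolding T_PV_def by auto
    then have "wf_fm \<phi>" "\<And>e. sat e \<phi>"
      using sat_Foralls[of n \<phi>] by (auto simp: sentence_def true_in_N_def)
    from provable_if_solvable[OF assms \<chi>(2) this] show "T_PV (Suc j) \<turnstile> \<chi>"
      unfolding \<chi>(1) by (rule Foralls_intro) simp
  qed auto
  then show "T_PV (Suc j) \<turnstile> \<psi>" by simp
qed


section \<open>A restricted ultrapower and Los's theorem for bounded formulas\<close>

section \<open>Restricted ultrapowers of the standard model\<close>

definition ultrafilter :: "'x set set \<Rightarrow> bool" where
  "ultrafilter U \<longleftrightarrow> {} \<notin> U \<and> (\<forall>A\<in>U. \<forall>B\<in>U. A \<inter> B \<in> U) \<and> (\<forall>A\<in>U. \<forall>B. A \<subseteq> B \<longrightarrow> B \<in> U) \<and>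
    (\<forall>A. A \<in> U \<or> - A \<in> U)"

text \<open>By Zorn's lemma there is a maximal filter above the given base. It decides every set,
  since an undecided set could be adjoined to it and the result would still be a proper
  filter.\<close>

lemma ex_ultrafilter:
  fixes \<A> :: "'x set set"
  assumes "\<A> \<noteq> {}" "{} \<notin> \<A>" "\<And>A B. A \<in> \<A> \<Longrightarrow> B \<in> \<A> \<Longrightarrow> \<exists>C\<in>\<A>. C \<subseteq> A \<inter> B"
  obtains U where "ultrafilter U" "\<A> \<subseteq> U"
proof -
  define filt :: "'x set set \<Rightarrow> bool" where
    "filt F \<longleftrightarrow> {} \<notin> F \<and> (\<forall>A\<in>F. \<forall>B\<in>F. A \<inter> B \<in> F) \<and> (\<forall>A\<in>F. \<forall>B. A \<subseteq> B \<longrightarrow> B \<in> F)" for F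
  let ?S = "{F. filt F \<and> \<A> \<subseteq> F}"
  define F0 where "F0 = {X. \<exists>A\<in>\<A>. A \<subseteq> X}"
  have "X \<inter> Y \<in> F0" if XY: "X \<in> F0" "Y \<in> F0" for X Y
  proof -
    obtain A B where AB: "A \<in> \<A>" "A \<subseteq> X" "B \<in> \<A>" "B \<subseteq> Y" using XY unfolding F0_def by blast
    then obtain C where "C \<in> \<A>" "C \<subseteq> A \<inter> B" using assms(3) by blast
    then show ?thesis using AB unfolding F0_def by blast
  qed
  moreover have "{} \<notin> F0" using assms(2) unfolding F0_def by simp
  moreover have "Y \<in> F0" if "X \<in> F0" "X \<subseteq> Y" for X Y using that unfolding F0_def by blast
  ultimately have "filt F0" unfolding filt_def by blast
  moreover have "\<A> \<subseteq> F0" unfolding F0_def by blast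
  ultimately have "F0 \<in> ?S" by blast
  then have "?S \<noteq> {}" by blast
  moreover have "\<Union>C \<in> ?S" if C: "C \<noteq> {}" "subset.chain ?S C" for C
  proof -
    have F: "filt F" "\<A> \<subseteq> F" if "F \<in> C" for F using C(2) that unfolding subset.chain_def by auto
    have "A \<inter> B \<in> \<Union>C" if AB: "A \<in> \<Union>C" "B \<in> \<Union>C" for A B
    proof -
      obtain F G where FG: "F \<in> C" "A \<in> F" "G \<in> C" "B \<in> G" using AB by blast
      then have "F \<subseteq> G \<or> G \<subseteq> F" using C(2) unfolding subset.chain_def by blast
      then obtain H where "H \<in> C" "A \<in> H" "B \<in> H" using FG by blast
      then show ?thesis using F(1)[of H] unfolding filt_def by blast
    qed
    moreover have "{} \<notin> \<Union>C" using F(1) unfolding filt_def by blast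
    moreover have "B \<in> \<Union>C" if AB: "A \<in> \<Union>C" "A \<subseteq> B" for A B
    proof -
      obtain F where "F \<in> C" "A \<in> F" using AB(1) by blast
      then have "B \<in> F" using F(1)[of F] AB(2) unfolding filt_def by blast
      then show ?thesis using \<open>F \<in> C\<close> by blast
    qed
    ultimately have "filt (\<Union>C)" unfolding filt_def by (intro conjI ballI allI impI)
    moreover have "\<A> \<subseteq> \<Union>C" using F(2) C(1) by blast
    ultimately show ?thesis by simp
  qed
  ultimately have "\<exists>U\<in>?S. \<forall>F\<in>?S. U \<subseteq> F \<longrightarrow> F = U" by (rule subset_Zorn_nonempty)
  then obtain U where U: "U \<in> ?S" "\<forall>F\<in>?S. U \<subseteq> F \<longrightarrow> F = U" by (rule bexE)
  have fU: "{} \<notin> U" "\<And>A B. A \<in> U \<Longrightarrow> B \<in> U \<Longrightarrow> A \<inter> B \<in> U" "\<And>A B. A \<in> U \<Longrightarrow> A \<subseteq> B \<Longrightarrow> B \<in> U" "\<A> \<subseteq> U"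
    using U(1) unfolding filt_def by auto
  have "A \<in> U \<or> - A \<in> U" for A
  proof (rule ccontr)
    assume n: "\<not> (A \<in> U \<or> - A \<in> U)"
    define F where "F = {X. \<exists>B\<in>U. B \<inter> A \<subseteq> X}"
    have "U \<subseteq> F" unfolding F_def by blast
    have "UNIV \<in> U" using fU(3,4) assms(1) by (metis ex_in_conv subsetD top_greatest)
    then have "A \<in> F" unfolding F_def by blast
    have "{} \<notin> F"
    proof
      assume "{} \<in> F"
      then obtain B where "B \<in> U" "B \<subseteq> - A" unfolding F_def by blast
      then show False using n fU(3) by blast
    qed
    moreover have "X \<inter> Y \<in> F" if XY: "X \<in> F" "Y \<in> F" for X Y
    proof -
      obtain B C where "B \<in> U" "B \<inter> A \<subseteq> X" "C \<in> U" "C \<inter> A \<subseteq> Y" using XY unfolding F_def by blast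
      then have "B \<inter> C \<in> U" "(B \<inter> C) \<inter> A \<subseteq> X \<inter> Y" using fU(2) by blast+
      then show ?thesis unfolding F_def by blast
    qed
    moreover have "Y \<in> F" if "X \<in> F" "X \<subseteq> Y" for X Y using that unfolding F_def by blast
    ultimately have "filt F" unfolding filt_def by (intro conjI ballI allI impI)
    then have "F \<in> ?S" using fU(4) \<open>U \<subseteq> F\<close> by simp
    from U(2)[rule_format, OF this \<open>U \<subseteq> F\<close>] show False using n \<open>A \<in> F\<close> by blast
  qed
  then have "ultrafilter U"
    unfolding ultrafilter_def using fU(1-3) by (intro conjI ballI allI impI)
  then show thesis using that fU(4) by blast
qed

text \<open>The elements of the structure are functions in \<open>D\<close>; equality is \<open>U\<close>-almost everywhere
  equality, which avoids forming a quotient.\<close>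

primrec usat :: "'x set set \<Rightarrow> ('x \<Rightarrow> nat) set \<Rightarrow> (nat \<Rightarrow> 'x \<Rightarrow> nat) \<Rightarrow> fm \<Rightarrow> bool" where
  "usat U D e (Eq t u) \<longleftrightarrow> {x. eval_tm (\<lambda>n. e n x) t = eval_tm (\<lambda>n. e n x) u} \<in> U"
| "usat U D e (Neg \<phi>) \<longleftrightarrow> \<not> usat U D e \<phi>"
| "usat U D e (Conj \<phi> \<psi>) \<longleftrightarrow> usat U D e \<phi> \<and> usat U D e \<psi>"
| "usat U D e (Disj \<phi> \<psi>) \<longleftrightarrow> usat U D e \<phi> \<or> usat U D e \<psi>"
| "usat U D e (Exists \<phi>) \<longleftrightarrow> (\<exists>h\<in>D. usat U D (case_nat h e) \<phi>)"
| "usat U D e (Forall \<phi>) \<longleftrightarrow> (\<forall>h\<in>D. usat U D (case_nat h e) \<phi>)"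

lemma case_nat_at: "(\<lambda>n. case_nat h e n x) = case_nat (h x) (\<lambda>n. e n x)"
  by (rule ext) (simp split: nat.split)

lemma usat_subst: "usat U D e (subst_fm \<sigma> \<phi>) \<longleftrightarrow> usat U D (\<lambda>n x. eval_tm (\<lambda>m. e m x) (\<sigma> n)) \<phi>"
proof (induction \<phi> arbitrary: e \<sigma>)
  case (Exists \<phi>)
  have "(\<lambda>n x. eval_tm (\<lambda>m. case_nat h e m x) (lift_subst \<sigma> n)) =
    case_nat h (\<lambda>n x. eval_tm (\<lambda>m. e m x) (\<sigma> n))" for h
    by (intro ext) (simp add: case_nat_at lift_subst_def split: nat.split)
  then show ?case by (simp add: Exists.IH)
next
  case (Forall \<phi>)
  have "(\<lambda>n x. eval_tm (\<lambda>m. case_nat h e m x) (lift_subst \<sigma> n)) =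
    case_nat h (\<lambda>n x. eval_tm (\<lambda>m. e m x) (\<sigma> n))" for h
    by (intro ext) (simp add: case_nat_at lift_subst_def split: nat.split)
  then show ?case by (simp add: Forall.IH)
qed auto

locale restricted_ultrapower =
  fixes U :: "'x set set" and D :: "('x \<Rightarrow> nat) set"
  assumes ultrafilter: "ultrafilter U"
    and closed: "\<And>k f hs. PV_fun k f \<Longrightarrow> length hs = k \<Longrightarrow> set hs \<subseteq> D \<Longrightarrow> (\<lambda>x. f (map (\<lambda>h. h x) hs)) \<in> D"
    and constants: "(\<lambda>_. 0) \<in> D" "(\<lambda>_. 1) \<in> D"
begin

lemma U_Int: "A \<in> U \<Longrightarrow> B \<in> U \<Longrightarrow> A \<inter> B \<in> U"
  and U_mono: "A \<in> U \<Longrightarrow> A \<subseteq> B \<Longrightarrow> B \<in> U"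
  and U_empty: "{} \<notin> U"
  using ultrafilter unfolding ultrafilter_def by auto

lemma U_Compl: "- A \<in> U \<longleftrightarrow> A \<notin> U"
  using ultrafilter U_Int[of A "- A"] U_empty unfolding ultrafilter_def by auto

lemma U_UNIV: "UNIV \<in> U"
  using U_Compl[of "{}"] U_empty by simp

lemma U_Int_iff: "A \<inter> B \<in> U \<longleftrightarrow> A \<in> U \<and> B \<in> U"
  using U_Int U_mono[of "A \<inter> B"] by blast

lemma U_Collect_not: "{x. \<not> P x} \<in> U \<longleftrightarrow> {x. P x} \<notin> U"
  using U_Compl[of "{x. P x}"] by (simp add: Collect_neg_eq)

lemma U_Collect_conj: "{x. P x \<and> Q x} \<in> U \<longleftrightarrow> {x. P x} \<in> U \<and> {x. Q x} \<in> U"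
  using U_Int_iff[of "{x. P x}" "{x. Q x}"] by (simp add: Collect_conj_eq)

lemma U_Collect_disj: "{x. P x \<or> Q x} \<in> U \<longleftrightarrow> {x. P x} \<in> U \<or> {x. Q x} \<in> U"
  using U_Collect_conj[of "\<lambda>x. \<not> P x" "\<lambda>x. \<not> Q x"] U_Collect_not[of P] U_Collect_not[of Q]
    U_Collect_not[of "\<lambda>x. P x \<or> Q x"] by (simp, blast)

lemma U_Collect_mono: "{x. P x} \<in> U \<Longrightarrow> (\<And>x. P x \<Longrightarrow> Q x) \<Longrightarrow> {x. Q x} \<in> U"
  using U_mono[of "{x. P x}" "{x. Q x}"] by blast

lemma U_ball: "finite F \<Longrightarrow> (\<And>n. n \<in> F \<Longrightarrow> {x. P n x} \<in> U) \<Longrightarrow> {x. \<forall>n\<in>F. P n x} \<in> U"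
proof (induction F rule: finite_induct)
  case empty
  then show ?case using U_UNIV by simp
next
  case (insert n F)
  then show ?case using U_Collect_conj[of "P n" "\<lambda>x. \<forall>n\<in>F. P n x"] by simp
qed

text \<open>Elements that agree almost everywhere are indistinguishable. For an equation, the
  finitely many sets of agreement, one for each free variable, intersect in a set of
  \<open>U\<close>. This is what makes the equality rule sound.\<close>

lemma usat_cong:
  "(\<And>n. n \<in> fv_fm \<phi> \<Longrightarrow> {x. e n x = e' n x} \<in> U) \<Longrightarrow> usat U D e \<phi> \<longleftrightarrow> usat U D e' \<phi>"
proof (induction \<phi> arbitrary: e e')
  case (Eq t u)
  have eq: "{x. \<forall>n\<in>fv_tm t \<union> fv_tm u. e n x = e' n x} \<in> U"
    by (rule U_ball) (use Eq finite_fv_tm in auto)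
  have ev: "eval_tm (\<lambda>n. e n x) t = eval_tm (\<lambda>n. e' n x) t" "eval_tm (\<lambda>n. e n x) u = eval_tm (\<lambda>n. e' n x) u"
    if "\<forall>n\<in>fv_tm t \<union> fv_tm u. e n x = e' n x" for x
    using that by (auto intro!: eval_tm_cong)
  show ?case unfolding usat.simps
  proof
    assume h: "{x. eval_tm (\<lambda>n. e n x) t = eval_tm (\<lambda>n. e n x) u} \<in> U"
    show "{x. eval_tm (\<lambda>n. e' n x) t = eval_tm (\<lambda>n. e' n x) u} \<in> U"
      by (rule U_mono[OF U_Int[OF eq h]]) (use ev in auto)
  next
    assume h: "{x. eval_tm (\<lambda>n. e' n x) t = eval_tm (\<lambda>n. e' n x) u} \<in> U"
    show "{x. eval_tm (\<lambda>n. e n x) t = eval_tm (\<lambda>n. e n x) u} \<in> U"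
      by (rule U_mono[OF U_Int[OF eq h]]) (use ev in auto)
  qed
next
  case (Neg \<phi>)
  show ?case using Neg.IH[of e e'] Neg.prems by simp
next
  case (Conj \<phi>1 \<phi>2)
  show ?case using Conj.IH(1)[of e e'] Conj.IH(2)[of e e'] Conj.prems by simp
next
  case (Disj \<phi>1 \<phi>2)
  show ?case using Disj.IH(1)[of e e'] Disj.IH(2)[of e e'] Disj.prems by simp
next
  case (Exists \<phi>)
  have "usat U D (case_nat h e) \<phi> \<longleftrightarrow> usat U D (case_nat h e') \<phi>" for h
    by (rule Exists.IH) (use Exists.prems U_UNIV in \<open>auto split: nat.split\<close>)
  then show ?case by simp
next
  case (Forall \<phi>)
  have "usat U D (case_nat h e) \<phi> \<longleftrightarrow> usat U D (case_nat h e') \<phi>" for h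
    by (rule Forall.IH) (use Forall.prems U_UNIV in \<open>auto split: nat.split\<close>)
  then show ?case by simp
qed

lemma eval_in_D:
  assumes "\<And>n. e n \<in> D" shows "wf_tm t \<Longrightarrow> (\<lambda>x. eval_tm (\<lambda>n. e n x) t) \<in> D"
proof (induction t)
  case (App k f ts)
  have "(\<lambda>x. f (map (\<lambda>h. h x) (map (\<lambda>t x. eval_tm (\<lambda>n. e n x) t) ts))) \<in> D"
    by (rule closed) (use App in auto)
  then show ?case by (simp add: comp_def)
qed (use assms constants in auto)

lemma usat_inst: "usat U D e (inst \<phi> t) \<longleftrightarrow> usat U D (case_nat (\<lambda>x. eval_tm (\<lambda>n. e n x) t) e) \<phi>"
proof -
  have "(\<lambda>n x. eval_tm (\<lambda>m. e m x) (case_nat t Var n)) = case_nat (\<lambda>x. eval_tm (\<lambda>n. e n x) t) e"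
    by (intro ext) (simp split: nat.split)
  then show ?thesis by (simp add: usat_subst)
qed

lemma usat_lift: "usat U D (case_nat h e) (lift_fm \<phi>) \<longleftrightarrow> usat U D e \<phi>"
  by (simp add: usat_subst)

lemma soundness:
  "\<Gamma> \<turnstile> \<phi> \<Longrightarrow> (\<And>n. e n \<in> D) \<Longrightarrow> (\<And>\<gamma>. \<gamma> \<in> \<Gamma> \<Longrightarrow> usat U D e \<gamma>) \<Longrightarrow> usat U D e \<phi>"
proof (induction arbitrary: e rule: proves.induct)
  case (NegI \<phi> \<Gamma> \<psi>)
  show ?case using NegI.IH[of e] NegI.prems by auto
next
  case (RAA \<phi> \<Gamma> \<psi>)
  show ?case
  proof (rule ccontr)
    assume "\<not> usat U D e \<phi>"
    then have "\<And>\<gamma>. \<gamma> \<in> insert (Neg \<phi>) \<Gamma> \<Longrightarrow> usat U D e \<gamma>" using RAA.prems(2) by auto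
    from RAA.IH(1)[OF RAA.prems(1) this] RAA.IH(2)[OF RAA.prems(1) this] show False by simp
  qed
next
  case (DisjE \<Gamma> \<phi> \<psi> \<chi>)
  show ?case using DisjE.IH(1)[of e] DisjE.IH(2)[of e] DisjE.IH(3)[of e] DisjE.prems by auto
next
  case (ExistsI t \<phi> \<Gamma>)
  have "usat U D e (inst \<phi> t)" using ExistsI by blast
  then show ?case using eval_in_D[of e t] ExistsI.hyps(1) ExistsI.prems(1) unfolding usat_inst by auto
next
  case (ExistsE \<Gamma> \<phi> \<psi>)
  then obtain h where h: "h \<in> D" "usat U D (case_nat h e) \<phi>" by (metis usat.simps(5))
  have "usat U D (case_nat h e) (lift_fm \<psi>)"
  proof (rule ExistsE.IH(2))
    show "case_nat h e n \<in> D" for n using h(1) ExistsE.prems(1) by (simp split: nat.split)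
    show "usat U D (case_nat h e) \<gamma>" if "\<gamma> \<in> insert \<phi> (lift_fm ` \<Gamma>)" for \<gamma>
      using that h(2) ExistsE.prems(2) by (auto simp: usat_lift)
  qed
  then show ?case by (simp add: usat_lift)
next
  case (ForallI \<Gamma> \<phi>)
  have "usat U D (case_nat h e) \<phi>" if "h \<in> D" for h
  proof (rule ForallI.IH)
    show "case_nat h e n \<in> D" for n using that ForallI.prems(1) by (simp split: nat.split)
    show "usat U D (case_nat h e) \<gamma>" if "\<gamma> \<in> lift_fm ` \<Gamma>" for \<gamma>
      using that ForallI.prems(2) by (auto simp: usat_lift)
  qed
  then show ?case by simp
next
  case (ForallE \<Gamma> \<phi> t)
  have "usat U D e (Forall \<phi>)" using ForallE by blast
  then show ?case using eval_in_D[of e t] ForallE.hyps(2) ForallE.prems(1) unfolding usat_inst by auto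
next
  case (EqI t \<Gamma>)
  show ?case using U_UNIV by simp
next
  case (EqE \<Gamma> t u \<phi>)
  have 1: "usat U D e (Eq t u)" "usat U D e (inst \<phi> t)" using EqE by blast+
  have "usat U D (case_nat (\<lambda>x. eval_tm (\<lambda>n. e n x) t) e) \<phi> \<longleftrightarrow> usat U D (case_nat (\<lambda>x. eval_tm (\<lambda>n. e n x) u) e) \<phi>"
    by (rule usat_cong) (use 1(1) U_UNIV in \<open>auto split: nat.split\<close>)
  then show ?case using 1(2) unfolding usat_inst by blast
qed auto

lemma usat_Le: "usat U D e (Le t u) \<longleftrightarrow> {x. eval_tm (\<lambda>n. e n x) t \<le> eval_tm (\<lambda>n. e n x) u} \<in> U"
proof -
  have "{x. eval_tm (\<lambda>n. e n x) (App 2 leq_fun [t, u]) = eval_tm (\<lambda>n. e n x) One} =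
    {x. eval_tm (\<lambda>n. e n x) t \<le> eval_tm (\<lambda>n. e n x) u}"
    by (auto simp: leq_fun_def)
  then show ?thesis by (simp only: Le_def usat.simps)
qed

lemma usat_quantifier_free: "quantifier_free \<phi> \<Longrightarrow> usat U D e \<phi> \<longleftrightarrow> {x. sat (\<lambda>n. e n x) \<phi>} \<in> U"
  by (induction \<phi>) (simp_all add: U_Collect_not U_Collect_conj U_Collect_disj)

end

text \<open>Skolem functions pick witnesses at every point x, below the bound wherever there are
  any. For \<open>j = 0\<close> the condition is vacuous: the formulas have no quantifiers.\<close>

locale skolem_ultrapower = restricted_ultrapower +
  fixes j :: nat
  assumes skolem: "\<And>\<phi> t e. 0 < j \<Longrightarrow> SigmaB j \<phi> \<Longrightarrow> wf_fm \<phi> \<Longrightarrow> wf_tm t \<Longrightarrow> (\<And>n. e n \<in> D) \<Longrightarrow>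
    \<exists>h\<in>D. \<forall>x. (\<exists>n\<le>eval_tm (\<lambda>n. e n x) t. sat (case_nat n (\<lambda>n. e n x)) \<phi>) \<longrightarrow>
      h x \<le> eval_tm (\<lambda>n. e n x) t \<and> sat (case_nat (h x) (\<lambda>n. e n x)) \<phi>"
begin

text \<open>Los's theorem, limited to level \<open>j\<close>. A full ultrapower contains a choice
  function for every existential statement; here only those for Sigma_j formulas are provided, and
  they settle both kinds of bounded quantifiers.\<close>

lemma usat_SigmaB:
  "SigmaB m \<phi> \<Longrightarrow> m \<le> j \<Longrightarrow> wf_fm \<phi> \<Longrightarrow> (\<And>n. e n \<in> D) \<Longrightarrow> usat U D e \<phi> \<longleftrightarrow> {x. sat (\<lambda>n. e n x) \<phi>} \<in> U"
  "PiB m \<psi> \<Longrightarrow> m \<le> j \<Longrightarrow> wf_fm \<psi> \<Longrightarrow> (\<And>n. e n \<in> D) \<Longrightarrow> usat U D e \<psi> \<longleftrightarrow> {x. sat (\<lambda>n. e n x) \<psi>} \<in> U"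
proof (induction m \<phi> and m \<psi> arbitrary: e and e rule: SigmaB_PiB.inducts)
  case (SigmaB_BExists m \<phi> t)
  have wf: "wf_tm t" "wf_fm \<phi>" using SigmaB_BExists.prems(2) by auto
  have IH: "usat U D (case_nat h e) \<phi> \<longleftrightarrow> {x. sat (case_nat (h x) (\<lambda>n. e n x)) \<phi>} \<in> U" if "h \<in> D" for h
    using SigmaB_BExists.IH[of "case_nat h e"] SigmaB_BExists.prems wf that
    by (simp add: case_nat_at split: nat.split)
  have "usat U D e (BExists t \<phi>) \<longleftrightarrow> (\<exists>h\<in>D. {x. h x \<le> eval_tm (\<lambda>n. e n x) t \<and> sat (case_nat (h x) (\<lambda>n. e n x)) \<phi>} \<in> U)"
    unfolding BExists_def using IH by (simp add: usat_Le U_Collect_conj case_nat_at)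
  also have "\<dots> \<longleftrightarrow> {x. \<exists>n\<le>eval_tm (\<lambda>n. e n x) t. sat (case_nat n (\<lambda>n. e n x)) \<phi>} \<in> U"
  proof
    assume "\<exists>h\<in>D. {x. h x \<le> eval_tm (\<lambda>n. e n x) t \<and> sat (case_nat (h x) (\<lambda>n. e n x)) \<phi>} \<in> U"
    then show "{x. \<exists>n\<le>eval_tm (\<lambda>n. e n x) t. sat (case_nat n (\<lambda>n. e n x)) \<phi>} \<in> U"
      by (elim bexE U_Collect_mono) blast
  next
    assume *: "{x. \<exists>n\<le>eval_tm (\<lambda>n. e n x) t. sat (case_nat n (\<lambda>n. e n x)) \<phi>} \<in> U"
    have "SigmaB j \<phi>" using SigmaB_le SigmaB_BExists.hyps SigmaB_BExists.prems(1) by blast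
    then obtain h where h: "h \<in> D" "\<And>x. (\<exists>n\<le>eval_tm (\<lambda>n. e n x) t. sat (case_nat n (\<lambda>n. e n x)) \<phi>) \<Longrightarrow>
      h x \<le> eval_tm (\<lambda>n. e n x) t \<and> sat (case_nat (h x) (\<lambda>n. e n x)) \<phi>"
      using skolem[of \<phi> t e] wf SigmaB_BExists.prems by auto
    have "{x. h x \<le> eval_tm (\<lambda>n. e n x) t \<and> sat (case_nat (h x) (\<lambda>n. e n x)) \<phi>} \<in> U"
      by (rule U_Collect_mono[OF *]) (rule h(2))
    then show "\<exists>h\<in>D. {x. h x \<le> eval_tm (\<lambda>n. e n x) t \<and> sat (case_nat (h x) (\<lambda>n. e n x)) \<phi>} \<in> U"
      using h(1) by blast
  qed
  finally show ?case by simp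
next
  case (PiB_BForall m \<phi> t)
  have wf: "wf_tm t" "wf_fm \<phi>" using PiB_BForall.prems(2) by auto
  have IH: "usat U D (case_nat h e) \<phi> \<longleftrightarrow> {x. sat (case_nat (h x) (\<lambda>n. e n x)) \<phi>} \<in> U" if "h \<in> D" for h
    using PiB_BForall.IH[of "case_nat h e"] PiB_BForall.prems wf that
    by (simp add: case_nat_at split: nat.split)
  have "usat U D e (BForall t \<phi>) \<longleftrightarrow> (\<forall>h\<in>D. {x. h x \<le> eval_tm (\<lambda>n. e n x) t \<and> \<not> sat (case_nat (h x) (\<lambda>n. e n x)) \<phi>} \<notin> U)"
    unfolding BForall_def using IH by (simp add: usat_Le U_Collect_conj U_Collect_not case_nat_at)
  also have "\<dots> \<longleftrightarrow> {x. \<exists>n\<le>eval_tm (\<lambda>n. e n x) t. \<not> sat (case_nat n (\<lambda>n. e n x)) \<phi>} \<notin> U"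
  proof
    assume *: "\<forall>h\<in>D. {x. h x \<le> eval_tm (\<lambda>n. e n x) t \<and> \<not> sat (case_nat (h x) (\<lambda>n. e n x)) \<phi>} \<notin> U"
    have "SigmaB j (Neg \<phi>)"
      using SigmaB_le SigmaB_PiB.SigmaB_Neg PiB_BForall.hyps PiB_BForall.prems(1) by blast
    then obtain h where h: "h \<in> D" "\<And>x. (\<exists>n\<le>eval_tm (\<lambda>n. e n x) t. \<not> sat (case_nat n (\<lambda>n. e n x)) \<phi>) \<Longrightarrow>
      h x \<le> eval_tm (\<lambda>n. e n x) t \<and> \<not> sat (case_nat (h x) (\<lambda>n. e n x)) \<phi>"
      using skolem[of "Neg \<phi>" t e] wf PiB_BForall.prems by auto
    show "{x. \<exists>n\<le>eval_tm (\<lambda>n. e n x) t. \<not> sat (case_nat n (\<lambda>n. e n x)) \<phi>} \<notin> U"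
    proof
      assume "{x. \<exists>n\<le>eval_tm (\<lambda>n. e n x) t. \<not> sat (case_nat n (\<lambda>n. e n x)) \<phi>} \<in> U"
      then have "{x. h x \<le> eval_tm (\<lambda>n. e n x) t \<and> \<not> sat (case_nat (h x) (\<lambda>n. e n x)) \<phi>} \<in> U"
        by (rule U_Collect_mono) (rule h(2))
      then show False using * h(1) by blast
    qed
  next
    assume *: "{x. \<exists>n\<le>eval_tm (\<lambda>n. e n x) t. \<not> sat (case_nat n (\<lambda>n. e n x)) \<phi>} \<notin> U"
    show "\<forall>h\<in>D. {x. h x \<le> eval_tm (\<lambda>n. e n x) t \<and> \<not> sat (case_nat (h x) (\<lambda>n. e n x)) \<phi>} \<notin> U"
    proof (intro ballI notI)
      fix h assume "{x. h x \<le> eval_tm (\<lambda>n. e n x) t \<and> \<not> sat (case_nat (h x) (\<lambda>n. e n x)) \<phi>} \<in> U"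
      then have "{x. \<exists>n\<le>eval_tm (\<lambda>n. e n x) t. \<not> sat (case_nat n (\<lambda>n. e n x)) \<phi>} \<in> U"
        by (rule U_Collect_mono) blast
      then show False using * by blast
    qed
  qed
  also have "\<dots> \<longleftrightarrow> {x. \<forall>n\<le>eval_tm (\<lambda>n. e n x) t. sat (case_nat n (\<lambda>n. e n x)) \<phi>} \<in> U"
    using U_Collect_not[of "\<lambda>x. \<exists>n\<le>eval_tm (\<lambda>n. e n x) t. \<not> sat (case_nat n (\<lambda>n. e n x)) \<phi>"] by simp
  finally show ?case by simp
qed (simp_all add: usat_quantifier_free U_Collect_not U_Collect_conj U_Collect_disj)

text \<open>The matrix of an axiom holds at every point under all assignments, in particular under
  those from \<open>D\<close>; the unbounded universal prefix is therefore preserved by the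
  restriction.\<close>

lemma usat_T_PV:
  assumes "\<chi> \<in> T_PV (Suc j)" "\<And>n. e n \<in> D" shows "usat U D e \<chi>"
proof -
  obtain n \<phi> where \<chi>: "\<chi> = (Forall ^^ n) \<phi>" "SigmaB j \<phi>" "sentence \<chi>" "true_in_N \<chi>"
    using assms(1) unfolding T_PV_def by auto
  then have \<phi>: "wf_fm \<phi>" "\<And>e. sat e \<phi>"
    using sat_Foralls[of n \<phi>] by (auto simp: sentence_def true_in_N_def)
  have "usat U D e \<phi>" if "\<And>n. e n \<in> D" for e
    using usat_SigmaB(1)[OF \<chi>(2) _ \<phi>(1) that] \<phi>(2) U_UNIV by simp
  then have "usat U D e ((Forall ^^ m) \<phi>)" if "\<And>n. e n \<in> D" for m e
    using that
  proof (induction m arbitrary: e)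
    case (Suc m)
    have "case_nat h e n \<in> D" if "h \<in> D" for h n
      using that Suc.prems(2) by (simp split: nat.split)
    then show ?case using Suc by simp
  qed simp
  then show ?thesis using assms(2) \<chi>(1) by blast
qed

lemma usat_provable: "T_PV (Suc j) \<turnstile> \<phi> \<Longrightarrow> (\<And>n. e n \<in> D) \<Longrightarrow> usat U D e \<phi>"
  using soundness usat_T_PV by blast

end


section \<open>Functions computable in polynomial time with a Sigma_j oracle\<close>

section \<open>Functions computed with adaptively queried advice bits\<close>

text \<open>The bit added in round \<open>n\<close> is the answer to a query about the bits found so far. Functions of
  the input and such advice serve as a normal form for \<open>FP\<close> with a \<open>\<Sigma>\<^sub>j\<close> oracle.\<close>

fun advice :: "(bool list \<Rightarrow> bool) \<Rightarrow> nat \<Rightarrow> bool list" where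
  "advice B 0 = []"
| "advice B (Suc n) = B (advice B n) # advice B n"

lemma length_advice [simp]: "length (advice B n) = n"
  by (induction n) auto

definition Adv :: "nat \<Rightarrow> (bool list \<Rightarrow> bool list) set" where
  "Adv j = {w. \<exists>B p. Sig j 2 (\<lambda>ys. B (ys ! 0) (ys ! 1)) \<and> (\<forall>x. w x = advice (\<lambda>v. B v x) (poly p (length x)))}"

definition FS :: "nat \<Rightarrow> (bool list \<Rightarrow> bool list) set" where
  "FS j = {f. \<exists>w\<in>Adv j. \<exists>h. polytime 2 (\<lambda>ys. h (ys ! 0) (ys ! 1)) \<and> (\<forall>x. f x = h x (w x))}"

lemma Adv_Nil: "(\<lambda>_. []) \<in> Adv j"
proof -
  have "Sig j 2 (\<lambda>ys. False)" by (rule Sig_le[of 0 j]) (auto intro: pt)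
  then show ?thesis
    unfolding Adv_def by (intro CollectI exI[of _ "\<lambda>_ _. False"] exI[of _ 0]) simp
qed

lemma length_Adv:
  assumes "w \<in> Adv j" obtains p where "\<And>x. length (w x) = poly p (length x)"
  using assms unfolding Adv_def by auto

lemma FS_I: "w \<in> Adv j \<Longrightarrow> polytime 2 (\<lambda>ys. h (ys ! 0) (ys ! 1)) \<Longrightarrow> (\<And>x. f x = h x (w x)) \<Longrightarrow> f \<in> FS j"
  unfolding FS_def by blast

lemma Sig_args2:
  assumes "Sig j 2 (\<lambda>ys. B (ys ! 0) (ys ! 1))" "polytime k f" "polytime k g"
  shows "Sig j k (\<lambda>xs. B (f xs) (g xs))"
proof -
  have "Sig j k (\<lambda>xs. B ([f xs, g xs] ! 0) ([f xs, g xs] ! 1))"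
    by (rule Sig_substI[OF assms(1), where gs = "[f, g]"]) (use assms(2,3) in auto)
  then show ?thesis by simp
qed

lemma Sig_args3:
  assumes "Sig j 3 (\<lambda>ys. B (ys ! 0) (ys ! 1) (ys ! 2))" "polytime k f" "polytime k g" "polytime k h"
  shows "Sig j k (\<lambda>xs. B (f xs) (g xs) (h xs))"
proof -
  have "Sig j k (\<lambda>xs. B ([f xs, g xs, h xs] ! 0) ([f xs, g xs, h xs] ! 1) ([f xs, g xs, h xs] ! 2))"
    by (rule Sig_substI[OF assms(1), where gs = "[f, g, h]"]) (use assms(2-4) in auto)
  then show ?thesis by (simp add: numeral_2_eq_2)
qed

text \<open>Two phases of queries form a single one. The bits of the first phase stay at the end of
  the advice, and their number is known from the input, so a later query can tell the phases
  apart.\<close>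

lemma Adv_extend:
  assumes w: "w \<in> Adv j" and C: "Sig j 3 (\<lambda>ys. C (ys ! 0) (ys ! 1) (ys ! 2))"
  shows "(\<lambda>x. advice (\<lambda>v. C v x (w x)) (poly q (length x)) @ w x) \<in> Adv j"
proof -
  obtain B p where B: "Sig j 2 (\<lambda>ys. B (ys ! 0) (ys ! 1))"
    "\<And>x. w x = advice (\<lambda>v. B v x) (poly p (length x))"
    using w unfolding Adv_def by blast
  let ?clk = "\<lambda>x :: bool list. replicate (poly p (length x)) True"
  let ?d = "\<lambda>v x. drop (length (?clk x)) v"
  \<comment> \<open>Only the length of \<open>?d v x\<close> matters: it counts the bits of the
    second phase, which stand in front, and the remaining bits are the advice of the first.\<close>
  define E where "E v x \<longleftrightarrow> length v < length (?clk x) \<and> B v x \<or>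
    length (?clk x) \<le> length v \<and> C (take (length (?d v x)) v) x (drop (length (?d v x)) v)" for v x
  have clk: "polytime 2 (\<lambda>ys. ?clk (ys ! 1))" by (intro pt) simp
  have v: "polytime 2 (\<lambda>ys. ys ! 0)" and x: "polytime 2 (\<lambda>ys. ys ! 1)" by (intro pt; simp)+
  have d: "polytime 2 (\<lambda>ys. ?d (ys ! 0) (ys ! 1))" by (rule polytime_drop[OF clk v])
  have "Sig j 2 (\<lambda>ys. E (ys ! 0) (ys ! 1))"
    unfolding E_def
    by (intro Sig_conj_disj(2) Sig_pred(1) B(1) polytime_pred_less polytime_pred_le v clk
        Sig_args3[OF C polytime_take[OF d v] x polytime_drop[OF d v]])
  moreover have "advice (\<lambda>v. C v x (w x)) (poly q (length x)) @ w x = advice (\<lambda>v. E v x) (poly (p + q) (length x))" for x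
  proof -
    let ?p = "poly p (length x)"
    have 1: "n \<le> ?p \<Longrightarrow> advice (\<lambda>v. E v x) n = advice (\<lambda>v. B v x) n" for n
      by (induction n) (auto simp: E_def)
    have 2: "advice (\<lambda>v. E v x) (?p + m) = advice (\<lambda>v. C v x (w x)) m @ w x" for m
    proof (induction m)
      case 0
      then show ?case using 1[of ?p] B(2) by simp
    next
      case (Suc m)
      have "length (w x) = ?p" using B(2) by simp
      then show ?case using Suc by (simp add: E_def)
    qed
    show ?thesis using 2[of "poly q (length x)"] by simp
  qed
  ultimately show ?thesis unfolding Adv_def by blast
qed

text \<open>The advice strings are concatenated, and each function cuts out its own part by length.
  Composition and definition by cases then take place inside polynomial time.\<close>

lemma FS_common:
  assumes "set fs \<subseteq> FS j"
  shows "\<exists>w\<in>Adv j. \<exists>hs. length hs = length fs \<and> (\<forall>h\<in>set hs. polytime 2 (\<lambda>ys. h (ys ! 0) (ys ! 1))) \<and>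
    (\<forall>x. map (\<lambda>f. f x) fs = map (\<lambda>h. h x (w x)) hs)"
  using assms
proof (induction fs)
  case Nil
  show ?case using Adv_Nil by auto
next
  case (Cons f fs)
  then obtain w hs where w: "w \<in> Adv j" "length hs = length fs" "\<forall>h\<in>set hs. polytime 2 (\<lambda>ys. h (ys ! 0) (ys ! 1))"
    "\<And>x. map (\<lambda>f. f x) fs = map (\<lambda>h. h x (w x)) hs"
    by auto
  obtain u g where u: "u \<in> Adv j" "polytime 2 (\<lambda>ys. g (ys ! 0) (ys ! 1))" "\<And>x. f x = g x (u x)"
    using Cons.prems unfolding FS_def by auto
  obtain B p where B: "Sig j 2 (\<lambda>ys. B (ys ! 0) (ys ! 1))" "\<And>x. u x = advice (\<lambda>v. B v x) (poly p (length x))"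
    using u(1) unfolding Adv_def by blast
  have S: "Sig j 3 (\<lambda>ys. B (ys ! 0) (ys ! 1))"
    by (rule Sig_args2[OF B(1)]) (auto intro: pt)
  let ?w = "\<lambda>x. u x @ w x"
  let ?clk = "\<lambda>x :: bool list. replicate (poly p (length x)) True"
  have w': "?w \<in> Adv j"
    using Adv_extend[OF w(1), of "\<lambda>v x _. B v x" p] S B(2) by simp
  let ?g = "\<lambda>x v. g x (take (length (?clk x)) v)"
  let ?h = "\<lambda>h x v. h x (drop (length (?clk x)) v)"
  have args: "polytime 2 (\<lambda>ys. ys ! 0)" "polytime 2 (\<lambda>ys. take (length (?clk (ys ! 0))) (ys ! 1))"
    "polytime 2 (\<lambda>ys. drop (length (?clk (ys ! 0))) (ys ! 1))"
    by (intro pt; simp)+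
  have "polytime 2 (\<lambda>ys. ?g (ys ! 0) (ys ! 1))" by (rule polytime_comp2[OF u(2) args(1,2)])
  moreover have "polytime 2 (\<lambda>ys. ?h h (ys ! 0) (ys ! 1))" if "h \<in> set hs" for h
    by (rule polytime_comp2[OF _ args(1,3)]) (use w(3) that in blast)
  moreover have "length (u x) = poly p (length x)" for x using B(2) by simp
  ultimately show ?case
    using w u(3) by (intro bexI[OF _ w'] exI[of _ "?g # map ?h hs"]) (auto simp: comp_def)
qed

lemma FS_comp:
  assumes "polytime k F" "length fs = k" "set fs \<subseteq> FS j"
  shows "(\<lambda>x. F (map (\<lambda>f. f x) fs)) \<in> FS j"
proof -
  obtain w hs where w: "w \<in> Adv j" "length hs = length fs" "\<forall>h\<in>set hs. polytime 2 (\<lambda>ys. h (ys ! 0) (ys ! 1))"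
    "\<And>x. map (\<lambda>f. f x) fs = map (\<lambda>h. h x (w x)) hs"
    using FS_common[OF assms(3)] by blast
  have "polytime 2 (\<lambda>ys. F (map (\<lambda>g. g ys) (map (\<lambda>h ys. h (ys ! 0) (ys ! 1)) hs)))"
    by (rule polytime_comp) (use assms(1,2) w(2,3) in auto)
  then show ?thesis
    by (intro FS_I[OF w(1), where h = "\<lambda>x v. F (map (\<lambda>h. h x v) hs)"]) (simp_all add: comp_def w(4))
qed

lemma FS_polytime: "polytime 1 (\<lambda>xs. f (xs ! 0)) \<Longrightarrow> f \<in> FS j"
proof -
  assume f: "polytime 1 (\<lambda>xs. f (xs ! 0))"
  have "polytime 2 (\<lambda>ys. f (ys ! 0))" by (rule polytime_comp1[OF f polytime_nth]) simp
  then show ?thesis by (intro FS_I[OF Adv_Nil, where h = "\<lambda>x _. f x"]) auto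
qed

lemma FS_length:
  assumes "f \<in> FS j" obtains p where "\<And>x. length (f x) \<le> poly p (length x)"
proof -
  obtain w h where w: "w \<in> Adv j" "polytime 2 (\<lambda>ys. h (ys ! 0) (ys ! 1))" "\<And>x. f x = h x (w x)"
    using assms unfolding FS_def by blast
  obtain p where p: "\<And>x. length (w x) = poly p (length x)" using length_Adv[OF w(1)] by blast
  obtain q where q: "\<And>ys. length ys = 2 \<Longrightarrow> length (h (ys ! 0) (ys ! 1)) \<le> poly q (sz ys)"
    using polytime_length[OF w(2)] by blast
  show thesis
  proof
    fix x
    have "length (h x (w x)) \<le> poly q (length x + poly p (length x))" using q[of "[x, w x]"] p[of x] by simp
    then show "length (f x) \<le> poly (pcompose q ([:0, 1:] + p)) (length x)"
      using w(3) by (simp add: poly_pcompose)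
  qed
qed

lemma sz_FS:
  assumes "set fs \<subseteq> FS j" obtains p where "\<And>x. sz (map (\<lambda>f. f x) fs) \<le> poly p (length x)"
proof -
  have "\<exists>p. \<forall>x. sz (map (\<lambda>f. f x) fs) \<le> poly p (length x)"
    using assms
  proof (induction fs)
    case (Cons f fs)
    then obtain p where p: "\<forall>x. sz (map (\<lambda>f. f x) fs) \<le> poly p (length x)" by auto
    obtain q where q: "\<And>x. length (f x) \<le> poly q (length x)"
      using FS_length[of f j] Cons.prems by auto
    show ?case by (rule exI[of _ "q + p"]) (use p q in \<open>auto intro: add_mono\<close>)
  qed simp
  then show thesis using that by blast
qed

text \<open>Binary search, starting from the last bit: the advice is always a suffix of a solution.\<close>

lemma advice_search:
  assumes ex: "\<exists>c. length c = L \<and> P c"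
    and C: "\<And>v. C v \<longleftrightarrow> (\<exists>z. Suc (length z + length v) = L \<and> P (z @ True # v))"
  shows "P (advice C L)"
proof -
  have "\<exists>z. length z + n = L \<and> P (z @ advice C n)" if "n \<le> L" for n
    using that
  proof (induction n)
    case 0
    then show ?case using ex by simp
  next
    case (Suc n)
    then obtain z where z: "length z + n = L" "P (z @ advice C n)" by auto
    then obtain y b where y: "z = y @ [b]" using Suc.prems by (cases z rule: rev_cases) auto
    show ?case
    proof (cases "C (advice C n)")
      case True
      then obtain z' where "Suc (length z' + n) = L" "P (z' @ True # advice C n)" using C by auto
      then show ?thesis using True by (intro exI[of _ z']) simp
    next
      case False
      then have "\<not> b" using z y C[of "advice C n"] by (cases b) auto
      then show ?thesis using False z y by (intro exI[of _ y]) simp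
    qed
  qed
  from this[of L] show ?thesis by auto
qed

text \<open>Binary search runs over strings of one fixed length, so a candidate is padded: a marker
  bit \<open>True\<close> ends it and zeros follow. Whether a suffix extends to a solution is again
  a Sigma relation of the same level, as the quantifier over the missing part is absorbed.\<close>

lemma FS_search:
  assumes B: "Sig (Suc i) (Suc k) B" and fs: "length fs = k" "set fs \<subseteq> FS (Suc i)"
  obtains g where "g \<in> FS (Suc i)"
    "\<And>x z. length z \<le> poly q (length x) \<Longrightarrow> B (z # map (\<lambda>f. f x) fs) \<Longrightarrow> B (g x # map (\<lambda>f. f x) fs)"
proof -
  obtain w hs where w: "w \<in> Adv (Suc i)" "length hs = k" "\<forall>h\<in>set hs. polytime 2 (\<lambda>ys. h (ys ! 0) (ys ! 1))"
    "\<And>x. map (\<lambda>f. f x) fs = map (\<lambda>h. h x (w x)) hs"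
    using FS_common[OF fs(2)] fs(1) by auto
  let ?L = "q + 1"
  let ?clk = "\<lambda>x :: bool list. replicate (poly ?L (length x)) True"
  define dec where "dec c = butlast (bin (val c))" for c
  \<comment> \<open>Two inequalities make the total length exact.\<close>
  define C where "C v x u \<longleftrightarrow> (\<exists>z. length z \<le> poly ?L (sz [v, x, u]) \<and>
     ((length (True # z @ v) \<le> length (?clk x) \<and> length (?clk x) \<le> length (True # z @ v)) \<and>
       B (dec (z @ True # v) # map (\<lambda>h. h x u) hs)))" for v x u
  have args: "polytime 4 (\<lambda>ys. ys ! 0)" "polytime 4 (\<lambda>ys. ys ! 1)" "polytime 4 (\<lambda>ys. ys ! 2)" "polytime 4 (\<lambda>ys. ys ! 3)"
    by (intro pt; simp)+
  have S: "Sig (Suc i) 4 (\<lambda>ys. B (dec (ys ! 0 @ True # ys ! 1) # map (\<lambda>h. h (ys ! 2) (ys ! 3)) hs))"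
  proof (rule Sig_substI[OF B, where gs = "(\<lambda>ys. dec (ys ! 0 @ True # ys ! 1)) # map (\<lambda>h ys. h (ys ! 2) (ys ! 3)) hs"])
    fix g assume "g \<in> set ((\<lambda>ys. dec (ys ! 0 @ True # ys ! 1)) # map (\<lambda>h ys. h (ys ! 2) (ys ! 3)) hs)"
    then consider "g = (\<lambda>ys. dec (ys ! 0 @ True # ys ! 1))" | h where "h \<in> set hs" "g = (\<lambda>ys. h (ys ! 2) (ys ! 3))"
      by auto
    then show "polytime 4 g"
    proof cases
      case 1
      then show ?thesis unfolding dec_def by (auto intro!: pt)
    next
      case 2
      then show ?thesis using polytime_comp2[of h, OF _ args(3,4)] w(3) by blast
    qed
  qed (use w(2) in simp_all)
  have l: "polytime_pred 4 (\<lambda>ys. length (True # ys ! 0 @ ys ! 1) \<le> length (?clk (ys ! 2)) \<and>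
      length (?clk (ys ! 2)) \<le> length (True # ys ! 0 @ ys ! 1))"
    by (intro polytime_pred_conj polytime_pred_le polytime_Cons polytime_append polytime_clock args)
  have "Sig (Suc i) (Suc 3) (\<lambda>ys. (length (True # ys ! 0 @ ys ! 1) \<le> length (?clk (ys ! 2)) \<and>
      length (?clk (ys ! 2)) \<le> length (True # ys ! 0 @ ys ! 1)) \<and>
      B (dec (ys ! 0 @ True # ys ! 1) # map (\<lambda>h. h (ys ! 2) (ys ! 3)) hs))"
    using Sig_pred(1)[OF S l] by simp
  from Sig_bex[OF this, of ?L]
  have C_Sig: "Sig (Suc i) 3 (\<lambda>ys. C (ys ! 0) (ys ! 1) (ys ! 2))"
  proof (rule Sig_cong[THEN iffD1, rotated])
    fix ys :: "bool list list" assume "length ys = 3"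
    then obtain v x u where "ys = [v, x, u]" by (rule length_3_E)
    then show "(\<exists>z. length z \<le> poly ?L (sz ys) \<and> (length (True # (z # ys) ! 0 @ (z # ys) ! 1) \<le> length (?clk ((z # ys) ! 2)) \<and>
      length (?clk ((z # ys) ! 2)) \<le> length (True # (z # ys) ! 0 @ (z # ys) ! 1)) \<and>
      B (dec ((z # ys) ! 0 @ True # (z # ys) ! 1) # map (\<lambda>h. h ((z # ys) ! 2) ((z # ys) ! 3)) hs)) \<longleftrightarrow>
      C (ys ! 0) (ys ! 1) (ys ! 2)"
      by (simp only: C_def nth_Cons_0 nth_Cons_Suc numeral_2_eq_2 numeral_3_eq_3 One_nat_def)
  qed
  let ?v = "\<lambda>x. advice (\<lambda>v. C v x (w x)) (poly ?L (length x))"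
  have w': "(\<lambda>x. ?v x @ w x) \<in> Adv (Suc i)" by (rule Adv_extend[OF w(1) C_Sig])
  let ?g = "\<lambda>x. dec (?v x)"
  show thesis
  proof (rule that)
    show "?g \<in> FS (Suc i)"
    proof (rule FS_I[OF w', where h = "\<lambda>x u. dec (take (length (?clk x)) u)"])
      show "polytime 2 (\<lambda>ys. dec (take (length (?clk (ys ! 0))) (ys ! 1)))"
        unfolding dec_def by (intro pt; simp)
    qed simp
    fix x z assume z: "length z \<le> poly q (length x)" "B (z # map (\<lambda>f. f x) fs)"
    let ?P = "\<lambda>c. B (dec c # map (\<lambda>f. f x) fs)"
    let ?l = "poly ?L (length x)"
    have C_eq: "C v x (w x) \<longleftrightarrow> (\<exists>z. Suc (length z + length v) = ?l \<and> ?P (z @ True # v))" for v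
    proof -
      have "?l \<le> poly ?L (sz [v, x, w x])" by (rule poly_nat_mono) simp
      moreover have "length (True # z @ v) \<le> length (?clk x) \<and> length (?clk x) \<le> length (True # z @ v) \<longleftrightarrow>
        Suc (length z + length v) = ?l" for z
        by auto
      ultimately show ?thesis unfolding C_def w(4) by (intro ex_cong1) auto
    qed
    \<comment> \<open>Low-order bits come first, so decoding drops the zeros at the end and then the
      marker.\<close>
    let ?c = "z @ True # replicate (poly q (length x) - length z) False"
    have "dropWhile Not (replicate n False @ True # y) = True # y" for n y by (induction n) auto
    then have "bin (val ?c) = z @ [True]" by (simp add: bin_val)
    then have "length ?c = ?l \<and> ?P ?c" using z by (simp add: dec_def)
    then have ex: "\<exists>c. length c = ?l \<and> ?P c" by blast
    show "B (?g x # map (\<lambda>f. f x) fs)" by (rule advice_search[OF ex C_eq])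
  qed
qed

text \<open>As \<open>R\<close> is Pi_j, a single Sigma_j query decides whether \<open>f1\<close>
  fails; if so, the value of \<open>f2\<close> is taken. The set of failures of the new function
  lies in both given ones, which makes these sets a filter base.\<close>

lemma FS_choose:
  assumes R: "R \<in> PiP j" and f: "f1 \<in> FS j" "f2 \<in> FS j"
  shows "\<exists>f\<in>FS j. \<forall>x. R x (f1 x) \<or> R x (f2 x) \<longrightarrow> R x (f x)"
proof -
  have "set [f1, f2] \<subseteq> FS j" using f by simp
  from FS_common[OF this] obtain w hs where w: "w \<in> Adv j" "length hs = length [f1, f2]" "\<forall>h\<in>set hs. polytime 2 (\<lambda>ys. h (ys ! 0) (ys ! 1))"
    "\<And>x. map (\<lambda>f. f x) [f1, f2] = map (\<lambda>h. h x (w x)) hs"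
    by blast
  obtain h1 h2 where hs: "hs = [h1, h2]"
    using w(2) by (auto simp: length_Suc_conv)
  have h: "polytime 2 (\<lambda>ys. h1 (ys ! 0) (ys ! 1))" "polytime 2 (\<lambda>ys. h2 (ys ! 0) (ys ! 1))"
    "\<And>x. f1 x = h1 x (w x)" "\<And>x. f2 x = h2 x (w x)"
    using w(3,4) hs by auto
  have x: "polytime 3 (\<lambda>ys. ys ! 1)" "polytime 3 (\<lambda>ys. ys ! 2)" by (intro pt; simp)+
  have "Sig j 3 (\<lambda>ys. \<not> R (ys ! 1) (h1 (ys ! 1) (ys ! 2)))"
    using R Sig_args2[of j "\<lambda>x y. \<not> R x y", OF _ x(1) polytime_comp2[OF h(1) x]] unfolding PiP_iff_Sig by simp
  from Adv_extend[OF w(1) this, of 1]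
  have w': "(\<lambda>x. (\<not> R x (h1 x (w x))) # w x) \<in> Adv j" by simp
  let ?f = "\<lambda>x u. bcase u [] (h2 x (tl u)) (h1 x (tl u))"
  have a: "polytime 2 (\<lambda>ys. ys ! 0)" "polytime 2 (\<lambda>ys. ys ! 1)" "polytime 2 (\<lambda>ys. tl (ys ! 1))" by (intro pt; simp)+
  have "polytime 2 (\<lambda>ys. ?f (ys ! 0) (ys ! 1))"
    by (intro polytime_bcase a polytime_nil polytime_comp2[OF h(1) a(1,3)] polytime_comp2[OF h(2) a(1,3)])
  then have "(\<lambda>x. ?f x ((\<not> R x (h1 x (w x))) # w x)) \<in> FS j"
    by (rule FS_I[OF w']) simp
  then show ?thesis
    by (rule bexI[rotated]) (use h(3,4) in \<open>auto simp: bcase_alt\<close>)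
qed


section \<open>Computing advice with an oracle\<close>

text \<open>The oracle set contains the pairs of an input and a partial advice whose next bit is
  \<open>True\<close>. The program asks for one bit per round and then applies the polynomial-time
  function to input and advice.\<close>

lemma FS_FP_rel:
  assumes "f \<in> FS j"
  shows "\<exists>A\<in>SigmaP j. f \<in> FP_rel (\<lambda>q. [q \<in> A])"
proof -
  obtain w h where w: "w \<in> Adv j" and h: "polytime 2 (\<lambda>ys. h (ys ! 0) (ys ! 1))" "\<And>x. f x = h x (w x)"
    using assms unfolding FS_def by blast
  obtain B p where B: "Sig j 2 (\<lambda>ys. B (ys ! 0) (ys ! 1))" "\<And>x. w x = advice (\<lambda>v. B v x) (poly p (length x))"
    using w unfolding Adv_def by blast
  define A where "A = {s. B (psnd s) (pfst s)}"
  have "Sig j 1 (\<lambda>xs. B (psnd (xs ! 0)) (pfst (xs ! 0)))"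
    by (rule Sig_args2[OF B(1)]) (intro pt; simp)+
  then have A: "A \<in> SigmaP j" by (intro SigmaP_if_Sig) (simp add: A_def)
  let ?g = "\<lambda>q. [q \<in> A]"
  let ?clk = "\<lambda>x :: bool list. replicate (poly p (length x)) True"
  have clk: "polytime 1 (\<lambda>xs. ?clk (xs ! 0))" and pair: "polytime 2 (\<lambda>ys. pair (ys ! 0) (ys ! 1))"
    by (intro pt; simp)+
  obtain M1 M2 M3 where Ms: "comp_at M1 1 (\<lambda>xs. ?clk (xs ! 0))" "comp_at M2 2 (\<lambda>ys. pair (ys ! 0) (ys ! 1))"
    "comp_at M3 2 (\<lambda>ys. h (ys ! 0) (ys ! 1))"
    using clk pair h(1) unfolding polytime_comp_at by blast
  define M where "M = M1 + M2 + M3 + 2"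
  have M: "2 \<le> M" "comp_at M 1 (\<lambda>xs. ?clk (xs ! 0))" "comp_at M 2 (\<lambda>ys. pair (ys ! 0) (ys ! 1))"
    "comp_at M 2 (\<lambda>ys. h (ys ! 0) (ys ! 1))"
    unfolding M_def
    using comp_at_mono[OF Ms(1), of "M1 + M2 + M3 + 2"] comp_at_mono[OF Ms(2), of "M1 + M2 + M3 + 2"]
      comp_at_mono[OF Ms(3), of "M1 + M2 + M3 + 2"] by simp_all
  \<comment> \<open>\<open>X\<close> holds the input, \<open>V\<close> the advice so far,
    \<open>N\<close> the remaining rounds in unary, \<open>Z\<close> queries and results. The first
    two lie where the calling convention expects arguments.\<close>
  define X where "X = Suc M"
  define V where "V = Suc X"
  define N where "N = Suc V"
  define Z where "Z = Suc N"
  note regs = X_def V_def N_def Z_def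
  obtain C1 p1 where C1: "\<And>g s xs. (\<forall>r\<le>M. s r = []) \<Longrightarrow> s N = [] \<Longrightarrow> length xs = 1 \<Longrightarrow>
    (\<forall>i<1. s (Suc M + i) = xs ! i) \<Longrightarrow> halts g C1 s (poly p1 (sz xs)) (s(N := ?clk (xs ! 0)))"
  proof -
    have "1 \<le> M" "0 < M" "M < N" using M(1) unfolding regs by auto
    from ex_call[OF M(2) this] show thesis using that by blast
  qed
  have MZ: "2 \<le> M" "0 < M" "M < Z" using M(1) unfolding regs by auto
  from ex_call[OF M(3) MZ] obtain C2 p2 where C2: "\<And>g s xs. (\<forall>r\<le>M. s r = []) \<Longrightarrow> s Z = [] \<Longrightarrow> length xs = 2 \<Longrightarrow>
    (\<forall>i<2. s (Suc M + i) = xs ! i) \<Longrightarrow> halts g C2 s (poly p2 (sz xs)) (s(Z := pair (xs ! 0) (xs ! 1)))"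
    by blast
  from ex_call[OF M(4) MZ] obtain C3 p3 where C3: "\<And>g s xs. (\<forall>r\<le>M. s r = []) \<Longrightarrow> s Z = [] \<Longrightarrow> length xs = 2 \<Longrightarrow>
    (\<forall>i<2. s (Suc M + i) = xs ! i) \<Longrightarrow> halts g C3 s (poly p3 (sz xs)) (s(Z := h (xs ! 0) (xs ! 1)))"
    by blast
  obtain r where r: "\<And>ys. length ys = 2 \<Longrightarrow> length (h (ys ! 0) (ys ! 1)) \<le> poly r (sz ys)"
    using polytime_length[OF h(1)] by blast
  let ?body = "Seq (Pop N) (Seq C2 (Seq (Query Z) (mv Z V)))"
  let ?prog = "Seq (xfer M 0 X 1) (Seq C1 (Seq (Loop N ?body) (Seq C3 (xfer M Z 0 1))))"
  let ?S = "\<lambda>n. n + poly p n"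
  \<comment> \<open>A pop, the pairing, a query of length at most 1 + 2|x| + |v| with a one-bit
    answer, and 5 steps for moving this bit.\<close>
  let ?b = "\<lambda>n. 1 + (poly p2 (?S n) + (Suc (Suc (2 * n + poly p n) + 1) + 5))"
  let ?T = "\<lambda>n. (1 * (10 * n + 3) + 1) + (poly p1 n + ((poly p n * (?b n + 1) + 1) +
    (poly p3 (?S n) + (1 * (10 * (n + poly r (?S n)) + 3) + 1))))"
  have "polyb ?T"
    by (intro polyb_add polyb_mult polyb_const polyb_id polyb_poly polyb_Suc
        polyb_compose[OF polyb_poly, where S = ?S])
  then obtain t where t: "\<And>n. ?T n \<le> poly t n" using polyb_polyE by blast
  have "runs ?g ?prog t [x] (f x)" for x
  proof -
    let ?n = "length x"
    define a where "a = advice (\<lambda>v. B v x)"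
    define st where "st i = (\<lambda>r. if r = X then x else if r = V then a i
      else if r = N then replicate (poly p ?n - i) True else [])" for i
    have low: "st i r = []" if "r \<le> M" for i r using that by (simp add: st_def regs)
    have args: "\<forall>l<2. st i (Suc M + l) = [x, a i] ! l" for i
      by (auto simp: st_def regs less_2_cases_iff)
    have a_len: "length (a i) = i" for i by (simp add: a_def)
    let ?s0 = "\<lambda>r. if r = X then x else []"
    have "moved 0 X 1 (load [x]) = ?s0"
      by (intro ext) (auto simp: load_def regs)
    then have 1: "halts ?g (xfer M 0 X 1) (load [x]) (1 * (10 * ?n + 3) + 1) ?s0"
      using halts_xfer[of 0 1 X "load [x]" M ?n ?g] M(1) by (auto simp: load_def regs)
    have "halts ?g C1 ?s0 (poly p1 (sz [x])) (?s0(N := ?clk ([x] ! 0)))"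
      by (rule C1) (auto simp: regs)
    moreover have "?s0(N := ?clk ([x] ! 0)) = st 0"
      by (intro ext) (auto simp: st_def regs a_def)
    ultimately have 2: "halts ?g C1 ?s0 (poly p1 ?n) (st 0)" by simp
    have body: "halts ?g ?body (st i) (?b ?n) (st (Suc i))" if i: "i < poly p ?n" for i
    proof -
      let ?s1 = "(st i)(N := tl (st i N))"
      let ?s2 = "?s1(Z := pair x (a i))"
      let ?s3 = "?s2(Z := ?g (?s2 Z))"
      let ?s4 = "?s3(Z := [], V := rev (?s3 Z) @ ?s3 V)"
      have b1: "halts ?g (Pop N) (st i) 1 ?s1" by (rule halts_Pop)
      have "halts ?g C2 ?s1 (poly p2 (sz [x, a i])) (?s1(Z := pair ([x, a i] ! 0) ([x, a i] ! 1)))"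
      proof (rule C2)
        show "\<forall>r\<le>M. ?s1 r = []" using low by (simp add: regs)
        show "\<forall>l<2. ?s1 (Suc M + l) = [x, a i] ! l" using args[of i] by (auto simp: regs less_2_cases_iff)
      qed (simp_all add: st_def regs)
      moreover have "poly p2 (sz [x, a i]) \<le> poly p2 (?S ?n)"
        using i by (intro poly_nat_mono) (simp add: a_len)
      ultimately have b2: "halts ?g C2 ?s1 (poly p2 (?S ?n)) ?s2" using halts_mono by fastforce
      have b3: "halts ?g (Query Z) ?s2 (Suc (Suc (2 * ?n + poly p ?n) + 1)) ?s3"
        by (rule haltsI[OF exec.Query]) (use i a_len[of i] in simp)
      have b4: "halts ?g (mv Z V) ?s3 5 ?s4"
        by (rule halts_mono[OF halts_mv]) (simp_all add: regs)
      have "?s4 = st (Suc i)"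
      proof
        fix r
        have V: "?s4 V = st (Suc i) V" by (simp add: st_def regs a_def A_def)
        have N: "?s4 N = st (Suc i) N" by (simp add: st_def regs)
        have Z: "?s4 Z = st (Suc i) Z" by (simp add: st_def regs)
        show "?s4 r = st (Suc i) r"
          using V N Z by (cases "r = V"; cases "r = N"; cases "r = Z") (simp_all add: st_def)
      qed
      with halts_Seq[OF b1 halts_Seq[OF b2 halts_Seq[OF b3 b4]]] show ?thesis by (simp only:)
    qed
    have 3: "halts ?g (Loop N ?body) (st 0) (poly p ?n * (?b ?n + 1) + 1) (st (poly p ?n))"
      by (rule halts_Loop) (use body in \<open>auto simp: st_def regs\<close>)
    let ?m = "poly p ?n"
    let ?s5 = "(st ?m)(Z := h x (a ?m))"
    have S: "sz [x, a ?m] = ?S ?n" by (simp add: a_len)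
    have "halts ?g C3 (st ?m) (poly p3 (sz [x, a ?m])) ((st ?m)(Z := h ([x, a ?m] ! 0) ([x, a ?m] ! 1)))"
      by (rule C3) (use low args[of ?m] in \<open>auto simp: st_def regs\<close>)
    then have 4: "halts ?g C3 (st ?m) (poly p3 (?S ?n)) ?s5" unfolding S by simp
    have len_h: "length (h x (a ?m)) \<le> poly r (?S ?n)" using r[of "[x, a ?m]"] S by simp
    have 5: "halts ?g (xfer M Z 0 1) ?s5 (1 * (10 * (?n + poly r (?S ?n)) + 3) + 1) (moved Z 0 1 ?s5)"
      by (rule halts_xfer) (use M(1) len_h in \<open>auto simp: st_def regs\<close>)
    have "halts ?g ?prog (load [x]) (?T ?n) (moved Z 0 1 ?s5)"
      by (rule halts_Seq[OF 1 halts_Seq[OF 2 halts_Seq[OF 3 halts_Seq[OF 4 5]]]])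
    then have "halts ?g ?prog (load [x]) (poly t ?n) (moved Z 0 1 ?s5)" using t halts_mono by blast
    then obtain u where u: "u \<le> poly t ?n" "exec ?g ?prog (load [x]) u (moved Z 0 1 ?s5)"
      unfolding halts_def by blast
    have "moved Z 0 1 ?s5 0 = f x" using h(2)[of x] B(2)[of x] by (simp add: a_def)
    moreover have "u \<le> poly t (sz [x])" using u(1) by simp
    ultimately show ?thesis unfolding runs_def using u(2) by blast
  qed
  then show ?thesis using A unfolding FP_rel_def by blast
qed


section \<open>From equivalence of the theories to solutions with an oracle\<close>

section \<open>From provability to solving search problems\<close>

definition FN :: "nat \<Rightarrow> (bool list \<Rightarrow> nat) set" where
  "FN j = {h. (\<lambda>x. bin (h x)) \<in> FS j}"

text \<open>Only finitely many elements of the assignment occur in the formula and its bound. Their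
  values at x serve as parameters of a binary search, and the bound makes the values sought
  polynomially short.\<close>

lemma FN_skolem:
  assumes "SigmaB (Suc i) \<phi>" "wf_fm \<phi>" "wf_tm t" "\<And>n. e n \<in> FN (Suc i)"
  shows "\<exists>h\<in>FN (Suc i). \<forall>x. (\<exists>n\<le>eval_tm (\<lambda>n. e n x) t. sat (case_nat n (\<lambda>n. e n x)) \<phi>) \<longrightarrow>
      h x \<le> eval_tm (\<lambda>n. e n x) t \<and> sat (case_nat (h x) (\<lambda>n. e n x)) \<phi>"
proof -
  obtain k where k: "fv_fm (BExists t \<phi>) \<subseteq> {..<k}" by (rule fv_bounded)
  then have kt: "fv_tm t \<subseteq> {..<k}" and kp: "fv_fm \<phi> \<subseteq> {..<Suc k}"
    by (auto simp: subset_iff less_Suc_eq_0_disj) (metis not0_implies_Suc)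
  let ?fs = "map (\<lambda>i x. bin (e i x)) [0..<k]"
  have fs: "length ?fs = k" "set ?fs \<subseteq> FS (Suc i)" using assms(4) unfolding FN_def by auto
  have vals: "map (\<lambda>f. f x) ?fs = args k (\<lambda>n. e n x)" for x by simp
  let ?B = "\<lambda>ys. val (ys ! 0) \<le> val (bin (eval_tm (env (tl ys)) t)) \<and> sat (env ys) \<phi>"
  note T = polytime_term[OF assms(3) kt]
  have "polytime_pred (Suc k) (\<lambda>ys. val (ys ! 0) \<le> val (bin (eval_tm (env (tl ys)) t)))"
    by (intro polytime_pred_val_le polytime_nth polytime_tl_args[OF T]) simp
  from Sig_pred(1)[OF Sig_formula(1)[OF assms(1,2) kp] this] have B: "Sig (Suc i) (Suc k) ?B" .
  have sem: "?B (z # args k (\<lambda>n. e n x)) \<longleftrightarrow>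
    val z \<le> eval_tm (\<lambda>n. e n x) t \<and> sat (case_nat (val z) (\<lambda>n. e n x)) \<phi>" for z x
  proof -
    have "eval_tm (env (args k (\<lambda>n. e n x))) t = eval_tm (\<lambda>n. e n x) t"
      by (rule eval_tm_cong) (use kt in auto)
    moreover have "fv_fm \<phi> \<subseteq> insert 0 (Suc ` {..<k})"
      using kp by (metis lessThan_Suc_eq_insert_0)
    ultimately show ?thesis using sat_args[of \<phi> k z "\<lambda>n. e n x"] by simp
  qed
  obtain r where r: "\<And>xs. length xs = k \<Longrightarrow> length (bin (eval_tm (env xs) t)) \<le> poly r (sz xs)"
    using polytime_length[OF T] by blast
  obtain s where s: "\<And>x. sz (map (\<lambda>f. f x) ?fs) \<le> poly s (length x)" using sz_FS[OF fs(2)] by blast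
  obtain g where g: "g \<in> FS (Suc i)"
    "\<And>x z. length z \<le> poly (pcompose r s) (length x) \<Longrightarrow> ?B (z # map (\<lambda>f. f x) ?fs) \<Longrightarrow> ?B (g x # map (\<lambda>f. f x) ?fs)"
    by (rule FS_search[OF B fs, where q = "pcompose r s"]) blast
  have "(\<lambda>x. (\<lambda>ys. bin (val (ys ! 0))) (map (\<lambda>f. f x) [g])) \<in> FS (Suc i)"
    by (rule FS_comp[where k = 1]) (use g(1) in \<open>auto intro!: pt\<close>)
  then have g_FN: "(\<lambda>x. val (g x)) \<in> FN (Suc i)" unfolding FN_def by simp
  have "val (g x) \<le> eval_tm (\<lambda>n. e n x) t \<and> sat (case_nat (val (g x)) (\<lambda>n. e n x)) \<phi>"
    if ex: "\<exists>n\<le>eval_tm (\<lambda>n. e n x) t. sat (case_nat n (\<lambda>n. e n x)) \<phi>" for x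
  proof -
    obtain n where n: "n \<le> eval_tm (\<lambda>n. e n x) t" "sat (case_nat n (\<lambda>n. e n x)) \<phi>" using ex by blast
    let ?xs = "args k (\<lambda>n. e n x)"
    have "eval_tm (env ?xs) t = eval_tm (\<lambda>n. e n x) t"
      by (rule eval_tm_cong) (use kt in auto)
    then have "length (bin n) \<le> poly r (sz ?xs)"
      using length_bin_mono[OF n(1)] r[of ?xs] by simp
    also have "\<dots> \<le> poly r (poly s (length x))"
      using s[of x] unfolding vals by (rule poly_nat_mono)
    finally have "length (bin n) \<le> poly (pcompose r s) (length x)" by (simp add: poly_pcompose)
    moreover have "?B (bin n # map (\<lambda>f. f x) ?fs)" unfolding vals sem using n by simp
    ultimately have "?B (g x # map (\<lambda>f. f x) ?fs)" by (rule g(2))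
    then show ?thesis unfolding vals sem .
  qed
  then show ?thesis by (intro bexI[OF _ g_FN] allI impI)
qed

lemma FN_ultrapower:
  assumes "ultrafilter U" shows "skolem_ultrapower U (FN j) j"
proof
  fix k f and hs :: "(bool list \<Rightarrow> nat) list"
  assume f: "PV_fun k f" "length hs = k" "set hs \<subseteq> FN j"
  have "polytime k (\<lambda>xs. bin (f (map (\<lambda>g. g xs) (map (\<lambda>i xs. val (xs ! i)) [0..<k]))))"
    by (rule polytime_PV_fun[OF f(1)]) (auto intro!: pt)
  then have F: "polytime k (\<lambda>xs. bin (f (map (\<lambda>i. val (xs ! i)) [0..<k])))" by (simp add: comp_def)
  have "(\<lambda>x. bin (f (map (\<lambda>i. val (map (\<lambda>g. g x) (map (\<lambda>h x. bin (h x)) hs) ! i)) [0..<k]))) \<in> FS j"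
    by (rule FS_comp[OF F]) (use f(2,3) in \<open>auto simp: FN_def\<close>)
  moreover have "map (\<lambda>i. val (map (\<lambda>g. g x) (map (\<lambda>h x. bin (h x)) hs) ! i)) [0..<k] = map (\<lambda>h. h x) hs" for x
    by (rule nth_equalityI) (use f(2) in auto)
  ultimately show "(\<lambda>x. f (map (\<lambda>h. h x) hs)) \<in> FN j" unfolding FN_def by simp
next
  show "(\<lambda>_. 0) \<in> FN j" "(\<lambda>_. 1) \<in> FN j" unfolding FN_def by (auto intro!: FS_polytime pt)
next
  fix \<phi> t and e :: "nat \<Rightarrow> bool list \<Rightarrow> nat"
  assume "0 < j" "SigmaB j \<phi>" "wf_fm \<phi>" "wf_tm t" "\<And>n. e n \<in> FN j"
  then show "\<exists>h\<in>FN j. \<forall>x. (\<exists>n\<le>eval_tm (\<lambda>n. e n x) t. sat (case_nat n (\<lambda>n. e n x)) \<phi>) \<longrightarrow>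
      h x \<le> eval_tm (\<lambda>n. e n x) t \<and> sat (case_nat (h x) (\<lambda>n. e n x)) \<phi>"
    using FN_skolem[of "j - 1" \<phi> t e] by simp
qed (rule assms)

lemma solvable_if_equiv:
  assumes eq: "T_PV (Suc j) \<equiv>\<^sub>T T_PV (Suc (Suc j))" and R: "R \<in> TFSigma (Suc j)"
  shows "\<exists>f\<in>FS j. \<forall>x. R x (f x)"
proof (rule ccontr)
  assume no: "\<not> (\<exists>f\<in>FS j. \<forall>x. R x (f x))"
  obtain p where PiP: "R \<in> PiP j" and total: "total_within p R" using R by auto
  let ?fail = "\<lambda>f. {x. \<not> R x (f x)}"
  obtain U where U: "ultrafilter U" "?fail ` FS j \<subseteq> U"
  proof (rule ex_ultrafilter[of "?fail ` FS j"])
    have "(\<lambda>x. x) \<in> FS j" by (rule FS_polytime) (intro pt, simp)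
    then show "?fail ` FS j \<noteq> {}" by blast
    show "{} \<notin> ?fail ` FS j" using no by auto
    fix X Y assume "X \<in> ?fail ` FS j" "Y \<in> ?fail ` FS j"
    then obtain f1 f2 where f: "f1 \<in> FS j" "X = ?fail f1" "f2 \<in> FS j" "Y = ?fail f2" by blast
    obtain f where "f \<in> FS j" "\<forall>x. R x (f1 x) \<or> R x (f2 x) \<longrightarrow> R x (f x)"
      using FS_choose[OF PiP f(1,3)] by blast
    then show "\<exists>Z\<in>?fail ` FS j. Z \<subseteq> X \<inter> Y" using f(2,4) by (intro bexI[of _ "?fail f"]) auto
  qed
  interpret skolem_ultrapower U "FN j" j by (rule FN_ultrapower[OF U(1)])
  \<comment> \<open>Variable 1 codes the input and variable 0 the candidate solution, in the de
    Bruijn order of a solution quantified inside an input.\<close>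
  have "Sig j 2 (\<lambda>xs. \<not> R (butlast (xs ! 1)) (butlast (xs ! 0)))"
    by (rule Sig_args2[of j "\<lambda>x y. \<not> R x y"]) (use PiP in \<open>auto simp: PiP_iff_Sig intro!: pt\<close>)
  from formula_Sig[OF this] obtain \<psi> where \<psi>: "SigmaB j \<psi>" "wf_fm \<psi>" "fv_fm \<psi> \<subseteq> {..<2}"
    "\<And>e. sat e \<psi> \<longleftrightarrow> \<not> R (butlast (bin (e 1))) (butlast (bin (e 0)))"
    by auto
  let ?t = "pv_term 1 (\<lambda>xs. True # replicate (poly p (length (butlast (xs ! 0)))) True)"
  let ?\<phi> = "BExists ?t (Neg \<psi>)"
  have "(Forall ^^ 1) ?\<phi> \<in> T_PV (Suc (Suc j))"
  proof (rule T_PV_closure)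
    show "SigmaB (Suc j) ?\<phi>"
      using \<psi>(1) by (intro SigmaB_PiB.SigmaB_BExists SigmaB_PiB.SigmaB_PiB SigmaB_PiB.PiB_Neg)
    have "polytime 1 (\<lambda>xs. True # replicate (poly p (length (butlast (xs ! 0)))) True)" by (intro pt) simp
    then show "wf_fm ?\<phi>" using \<psi>(2) by simp
    show "fv_fm ?\<phi> \<subseteq> {..<1}" using \<psi>(3) by auto
    fix e :: "nat \<Rightarrow> nat"
    let ?x = "butlast (bin (e 0))"
    obtain y where y: "length y \<le> poly p (length ?x)" "R ?x y" using total unfolding total_within_def by blast
    have "val (y @ [True]) \<le> eval_tm e ?t"
      using le_val_trues[of "val (y @ [True])" "Suc (poly p (length ?x))"] y(1) by simp
    moreover have "sat (case_nat (val (y @ [True])) e) (Neg \<psi>)" using \<psi>(4) y(2) by simp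
    ultimately show "sat e ?\<phi>" unfolding sat_BExists by blast
  qed
  then have in_T: "Forall ?\<phi> \<in> T_PV (Suc (Suc j))" by simp
  then have sent: "sentence (Forall ?\<phi>)" unfolding T_PV_def by auto
  then have "T_PV (Suc (Suc j)) \<turnstile> Forall ?\<phi>" using in_T proves.Hyp unfolding sentence_def by blast
  then have "T_PV (Suc j) \<turnstile> Forall ?\<phi>" using eq sent unfolding equiv_theories_def by blast
  moreover have zero: "(\<lambda>_. 0) \<in> FN j" by (rule constants)
  ultimately have "usat U (FN j) (\<lambda>_ _. 0) (Forall ?\<phi>)" by (rule usat_provable)
  \<comment> \<open>The identity function in coded form, the generic input of the
    ultrapower.\<close>
  moreover have c: "(\<lambda>x. val (x @ [True])) \<in> FN j"
    unfolding FN_def by (auto intro!: FS_polytime pt)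
  ultimately have "usat U (FN j) (case_nat (\<lambda>x. val (x @ [True])) (\<lambda>_ _. 0)) ?\<phi>" by simp
  then obtain h where h: "h \<in> FN j"
    "\<not> usat U (FN j) (case_nat h (case_nat (\<lambda>x. val (x @ [True])) (\<lambda>_ _. 0))) \<psi>"
    by (auto simp: BExists_def)
  let ?e = "case_nat h (case_nat (\<lambda>x. val (x @ [True])) (\<lambda>_ _. 0))"
  have "\<And>n. ?e n \<in> FN j" using h(1) c zero by (auto split: nat.split)
  from usat_SigmaB(1)[where e = ?e, OF \<psi>(1) order_refl \<psi>(2) this] h(2)
  have "{x. sat (\<lambda>n. ?e n x) \<psi>} \<notin> U" by blast
  moreover have "{x. sat (\<lambda>n. ?e n x) \<psi>} = ?fail (\<lambda>x. butlast (bin (h x)))"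
    using \<psi>(4) by simp
  \<comment> \<open>The decoded witness is a function with a Sigma_j oracle, so its set of failures
    was put into \<open>U\<close>, while the witness solves \<open>R\<close> almost
    everywhere.\<close>
  moreover have "(\<lambda>x. (\<lambda>ys. butlast (ys ! 0)) (map (\<lambda>f. f x) [\<lambda>x. bin (h x)])) \<in> FS j"
    by (rule FS_comp[where k = 1]) (use h(1) in \<open>auto simp: FN_def intro!: pt\<close>)
  then have "?fail (\<lambda>x. butlast (bin (h x))) \<in> U" using U(2) by auto
  ultimately show False by simp
qed

theorem FP_SigmaP_if_equiv:
  assumes "T_PV (Suc j) \<equiv>\<^sub>T T_PV (Suc (Suc j))" shows "TFSigma (Suc j) \<subseteq> FP_SigmaP j"
proof
  fix R assume "R \<in> TFSigma (Suc j)"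
  then obtain f where "f \<in> FS j" "\<forall>x. R x (f x)" using solvable_if_equiv[OF assms] by blast
  then show "R \<in> FP_SigmaP j" using FS_FP_rel unfolding FP_SigmaP_def solvable_def by blast
qed

text \<open>At level 0 the oracle is a polynomial-time predicate and can be eliminated.\<close>

lemma FP_SigmaP_0: "FP_SigmaP 0 \<subseteq> solvable FP"
proof
  fix R assume "R \<in> FP_SigmaP 0"
  then obtain A f where A: "A \<in> SigmaP 0" and f: "f \<in> FP_rel (\<lambda>q. [q \<in> A])" "\<forall>x. R x (f x)"
    unfolding FP_SigmaP_def solvable_def by blast
  obtain P where P: "polytime_pred 1 P" "\<And>x. x \<in> A \<longleftrightarrow> P [x]" using A unfolding SigmaP_def by auto
  have "(\<lambda>q. [q \<in> A]) \<in> FP"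
    unfolding FP_def mem_Collect_eq
    by (rule polytime_cong[THEN iffD1, OF _ polytime_pred_polytime[OF P(1)]])
      (auto simp: P(2) length_Suc_conv)
  then have "f \<in> FP" using f(1) oracle_elimination unfolding FP_rel_def by blast
  then show "R \<in> solvable FP" using f(2) unfolding solvable_def by blast
qed

text \<open>The program asks no query, so any oracle problem will do; the graph of the identity is
  chosen.\<close>

lemma solvable_FP_subset: "solvable FP \<subseteq> FP_TFSigma 0"
proof
  fix R assume "R \<in> solvable FP"
  then obtain f where f: "f \<in> FP" "\<And>x. R x (f x)" unfolding solvable_def by blast
  have id: "(\<lambda>x. x) \<in> FP" unfolding FP_def by (auto intro: pt)
  obtain c p where c: "query_free c" "\<forall>xs. length xs = 1 \<longrightarrow> runs (\<lambda>_. []) c p xs (f (xs ! 0))"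
    using f(1) unfolding FP_def polytime_def by blast
  have "runs g c p [x] (f x)" for g x
  proof -
    have "runs (\<lambda>_. []) c p [x] (f ([x] ! 0))" by (rule c(2)[rule_format]) simp
    then show ?thesis using exec_query_free[OF _ c(1)] unfolding runs_def nth_Cons_0 by blast
  qed
  moreover have "total_within [:0, 1:] (graph_of (\<lambda>x. x))"
    unfolding total_within_def graph_of_def by auto
  moreover have "graph_of (\<lambda>x. x) \<in> TFSigma 0" using id by simp
  ultimately show "R \<in> FP_TFSigma 0" unfolding FP_TFSigma_def using f(2) by blast
qed

lemma graph_of_TFNP: "graph_of ` FP \<subseteq> TFNP"
proof
  fix R assume "R \<in> graph_of ` FP"
  then obtain f where f: "polytime 1 (\<lambda>xs. f (xs ! 0))" "R = graph_of f" unfolding FP_def by auto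
  have "polytime_pred 2 (\<lambda>xs. \<not> xs ! 1 = f (xs ! 0))"
    by (intro polytime_pred_not polytime_pred_eq polytime_comp1[OF f(1)] polytime_nth) auto
  then have "R \<in> PiP 0" unfolding PiP_iff_Sig f(2) graph_of_def by simp
  moreover obtain p where "\<And>xs. length xs = 1 \<Longrightarrow> length (f (xs ! 0)) \<le> poly p (sz xs)"
    using polytime_length[OF f(1)] by blast
  then have "length (f x) \<le> poly p (length x)" for x by (metis One_nat_def add_0_right length_Cons list.map list.size(3) nth_Cons_0 sum_list.Cons sum_list.Nil)
  then have "total_within p R" unfolding total_within_def f(2) graph_of_def by auto
  ultimately show "R \<in> TFNP" by auto
qed

theorem theoremA8:
  shows "(\<forall>i\<ge>1.
      (TFSigma i \<subseteq> FP_TFSigma (i - 1) \<longrightarrow> T_PV i \<equiv>\<^sub>T T_PV (i + 1)) \<and>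
      (T_PV i \<equiv>\<^sub>T T_PV (i + 1) \<longrightarrow> TFSigma i \<subseteq> FP_SigmaP (i - 1))) \<and>
    ((TFNP \<subseteq> solvable FP \<and> graph_of ` FP \<subseteq> TFNP) \<longleftrightarrow> T_PV 1 \<equiv>\<^sub>T T_PV 2)"
proof -
  have levels: "(TFSigma i \<subseteq> FP_TFSigma (i - 1) \<longrightarrow> T_PV i \<equiv>\<^sub>T T_PV (i + 1)) \<and>
      (T_PV i \<equiv>\<^sub>T T_PV (i + 1) \<longrightarrow> TFSigma i \<subseteq> FP_SigmaP (i - 1))" if "1 \<le> i" for i
  proof -
    obtain j where "i = Suc j" using \<open>1 \<le> i\<close> by (cases i) auto
    then show ?thesis using equiv_if_solvable[of j] FP_SigmaP_if_equiv[of j] by (simp del: TFSigma.simps)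
  qed
  \<comment> \<open>At the lowest level the hypothesis of the first part follows from solvability in
    FP, and the conclusion of the second part implies it.\<close>
  from levels[of 1] solvable_FP_subset FP_SigmaP_0
  have "TFNP \<subseteq> solvable FP \<longleftrightarrow> T_PV 1 \<equiv>\<^sub>T T_PV 2"
    by (simp only: one_add_one order_refl diff_self_eq_0 simp_thms) blast
  with levels graph_of_TFNP show ?thesis by blast
qed

end
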